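(* Let $\mathcal V$ be an extensive category with finite limits. For each natural number $n$, the free strict $n$-dimensional $\mathcal V$-category monad $\mathsf T^{(n)}$ on $\mathcal V\text{-}\mathbf{Gph}^{(n)}$ is cartesian.
   Context: Sizes: universes $\mathcal U_1\in\mathcal U_2$ are fixed; "small"/"large" means being an element of $\mathcal U_1$/$\mathcal U_2$. A large category $\mathcal V$ is extensive if it has all small coproducts and for every small set $I$ and family $(X_i)_{i\in I}$ of objects the functor $\prod_{i\in I}(\mathcal V/X_i)\to\mathcal V/\coprod_{i}X_i$, $(f_i)_i\mapsto\coprod_i f_i$, is an equivalence. A small $\mathcal V$-graph $G$ consists of a small set $\mathrm{ob}(G)$ and objects $G(x,y)\in\mathcal V$ for $x,y\in\mathrm{ob}(G)$; a morphism $G\to G'$ is a function $f\colon\mathrm{ob}(G)\to\mathrm{ob}(G')$ with morphisms $f_{x,y}\colon G(x,y)\to G'(fx,fy)$. These form $\mathcal V\text{-}\mathbf{Gph}$, and $(-)\text{-}\mathbf{Gph}$ is a 2-functor on large categories (a functor $H$ acts by applying $H$ to all $G(x,y)$). $\mathcal V\text{-}\mathbf{Cat}$ is the category of small $\mathcal V$-categories for the cartesian structure. Put $\mathcal V\text{-}\mathbf{Gph}^{(0)}=\mathcal V=\mathcal V\text{-}\mathbf{Cat}^{(0)}$, $\mathcal V\text{-}\mathbf{Gph}^{(n+1)}=(\mathcal V\text{-}\mathbf{Gph}^{(n)})\text{-}\mathbf{Gph}$, $\mathcal V\text{-}\mathbf{Cat}^{(n+1)}=(\mathcal V\text{-}\mathbf{Cat}^{(n)})\text{-}\mathbf{Cat}$.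 When $\mathcal W$ is extensive with finite products, the forgetful functor $U\colon\mathcal W\text{-}\mathbf{Cat}\to\mathcal W\text{-}\mathbf{Gph}$ has a left adjoint $F$, where $FG$ has the same objects as $G$ and $(FG)(x,y)=\coprod_{n\in\mathbb N}\coprod_{w_0=x,w_1,\dots,w_n=y}G(w_{n-1},w_n)\times\dots\times G(w_0,w_1)$. All $\mathcal V\text{-}\mathbf{Cat}^{(n)}$ and $\mathcal V\text{-}\mathbf{Gph}^{(n)}$ are again extensive with finite limits. Define adjunctions $F^{(n)}\dashv U^{(n)}\colon\mathcal V\text{-}\mathbf{Cat}^{(n)}\to\mathcal V\text{-}\mathbf{Gph}^{(n)}$ by $F^{(0)}=U^{(0)}=\mathrm{id}_{\mathcal V}$, and $F^{(n+1)}\dashv U^{(n+1)}$ the composite of $F^{(n)}\text{-}\mathbf{Gph}\dashv U^{(n)}\text{-}\mathbf{Gph}$ (between $(\mathcal V\text{-}\mathbf{Gph}^{(n)})\text{-}\mathbf{Gph}$ and $(\mathcal V\text{-}\mathbf{Cat}^{(n)})\text{-}\mathbf{Gph}$) with $F\dashv U$ for $\mathcal W=\mathcal V\text{-}\mathbf{Cat}^{(n)}$. $\mathsf T^{(n)}$ is the monad on $\mathcal V\text{-}\mathbf{Gph}^{(n)}$ generated by $F^{(n)}\dashv U^{(n)}$. A natural transformation is cartesian if all its naturality squares are pullbacks. A monad on a category with pullbacks is cartesian if its functor part preserves pullbacks and its unit and multiplication are cartesian. *)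

theory Defs
  imports "HOL-Library.FuncSet"
begin

section \<open>Universes\<close>

text \<open>
  The universe of small sets is a type \<open>'u\<close> whose elements are sets via \<open>elts\<close>, subject to the
  axioms of a Grothendieck universe that contains an infinite set. A set \<open>A\<close> of elements
  of \<open>'u\<close> is small if it is itself an element of the universe. No bound is put on the collections of
  objects and arrows of a category (large categories); they may live in any type.
\<close>

definition grothendieck_universe :: "('u \<Rightarrow> 'u set) \<Rightarrow> bool" where
  "grothendieck_universe elts \<longleftrightarrow>
     inj elts \<and>
     wf {(x, y). x \<in> elts y} \<and>
     (\<forall>x y. \<exists>z. elts z = {x, y}) \<and>
     (\<forall>x. \<exists>z. elts ` elts z = Pow (elts x)) \<and>
     (\<forall>x f. \<exists>z. elts z = (\<Union>i\<in>elts x. elts (f i))) \<and>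
     (\<exists>x. infinite (elts x))"

definition small :: "('u \<Rightarrow> 'u set) \<Rightarrow> 'u set \<Rightarrow> bool" where
  "small elts A \<longleftrightarrow> A \<in> range elts"


section \<open>Categories, functors, equivalences\<close>

record ('o, 'm) category =
  Obj :: "'o set"
  Arr :: "'m set"
  Dom :: "'m \<Rightarrow> 'o"
  Cod :: "'m \<Rightarrow> 'o"
  Ide :: "'o \<Rightarrow> 'm"
  Cmp :: "'m \<Rightarrow> 'm \<Rightarrow> 'm" (infixr "\<cdot>\<index>" 70)

definition hom :: "('o, 'm) category \<Rightarrow> 'o \<Rightarrow> 'o \<Rightarrow> 'm set" where
  "hom C a b = {f \<in> Arr C. Dom C f = a \<and> Cod C f = b}"

definition is_category :: "('o, 'm) category \<Rightarrow> bool" where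
  "is_category C \<longleftrightarrow>
     (\<forall>f\<in>Arr C. Dom C f \<in> Obj C \<and> Cod C f \<in> Obj C) \<and>
     (\<forall>a\<in>Obj C. Ide C a \<in> hom C a a) \<and>
     (\<forall>f\<in>Arr C. \<forall>g\<in>Arr C. Dom C g = Cod C f \<longrightarrow> g \<cdot>\<^bsub>C\<^esub> f \<in> hom C (Dom C f) (Cod C g)) \<and>
     (\<forall>f\<in>Arr C. f \<cdot>\<^bsub>C\<^esub> Ide C (Dom C f) = f \<and> Ide C (Cod C f) \<cdot>\<^bsub>C\<^esub> f = f) \<and>
     (\<forall>f\<in>Arr C. \<forall>g\<in>Arr C. \<forall>h\<in>Arr C. Dom C g = Cod C f \<and> Dom C h = Cod C g \<longrightarrow>
        h \<cdot>\<^bsub>C\<^esub> (g \<cdot>\<^bsub>C\<^esub> f) = (h \<cdot>\<^bsub>C\<^esub> g) \<cdot>\<^bsub>C\<^esub> f)"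

definition is_iso :: "('o, 'm) category \<Rightarrow> 'm \<Rightarrow> bool" where
  "is_iso C f \<longleftrightarrow> f \<in> Arr C \<and>
     (\<exists>g\<in>hom C (Cod C f) (Dom C f). g \<cdot>\<^bsub>C\<^esub> f = Ide C (Dom C f) \<and> f \<cdot>\<^bsub>C\<^esub> g = Ide C (Cod C f))"

record ('o, 'm, 'p, 'q) cfunctor =
  fob :: "'o \<Rightarrow> 'p"
  far :: "'m \<Rightarrow> 'q"

definition is_functor ::
    "('o, 'm) category \<Rightarrow> ('p, 'q) category \<Rightarrow> ('o, 'm, 'p, 'q) cfunctor \<Rightarrow> bool" where
  "is_functor C D F \<longleftrightarrow> is_category C \<and> is_category D \<and>
     (\<forall>a\<in>Obj C. fob F a \<in> Obj D) \<and>
     (\<forall>f\<in>Arr C. far F f \<in> hom D (fob F (Dom C f)) (fob F (Cod C f))) \<and>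
     (\<forall>a\<in>Obj C. far F (Ide C a) = Ide D (fob F a)) \<and>
     (\<forall>f\<in>Arr C. \<forall>g\<in>Arr C. Dom C g = Cod C f \<longrightarrow> far F (g \<cdot>\<^bsub>C\<^esub> f) = far F g \<cdot>\<^bsub>D\<^esub> far F f)"

definition id_functor :: "('o, 'm, 'o, 'm) cfunctor" where
  "id_functor = \<lparr>fob = \<lambda>a. a, far = \<lambda>f. f\<rparr>"

definition comp_functor ::
    "('p, 'q, 'r, 's) cfunctor \<Rightarrow> ('o, 'm, 'p, 'q) cfunctor \<Rightarrow> ('o, 'm, 'r, 's) cfunctor" where
  "comp_functor G F = \<lparr>fob = \<lambda>a. fob G (fob F a), far = \<lambda>f. far G (far F f)\<rparr>"

definition nat_trans ::
    "('o, 'm) category \<Rightarrow> ('p, 'q) category \<Rightarrow> ('o, 'm, 'p, 'q) cfunctor \<Rightarrow> ('o, 'm, 'p, 'q) cfunctor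
       \<Rightarrow> ('o \<Rightarrow> 'q) \<Rightarrow> bool" where
  "nat_trans C D F G \<alpha> \<longleftrightarrow> is_functor C D F \<and> is_functor C D G \<and>
     (\<forall>a\<in>Obj C. \<alpha> a \<in> hom D (fob F a) (fob G a)) \<and>
     (\<forall>f\<in>Arr C. far G f \<cdot>\<^bsub>D\<^esub> \<alpha> (Dom C f) = \<alpha> (Cod C f) \<cdot>\<^bsub>D\<^esub> far F f)"

definition nat_iso ::
    "('o, 'm) category \<Rightarrow> ('p, 'q) category \<Rightarrow> ('o, 'm, 'p, 'q) cfunctor \<Rightarrow> ('o, 'm, 'p, 'q) cfunctor
       \<Rightarrow> ('o \<Rightarrow> 'q) \<Rightarrow> bool" where
  "nat_iso C D F G \<alpha> \<longleftrightarrow> nat_trans C D F G \<alpha> \<and> (\<forall>a\<in>Obj C. is_iso D (\<alpha> a))"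

definition is_equivalence ::
    "('o, 'm) category \<Rightarrow> ('p, 'q) category \<Rightarrow> ('o, 'm, 'p, 'q) cfunctor \<Rightarrow> bool" where
  "is_equivalence C D F \<longleftrightarrow> is_functor C D F \<and>
     (\<exists>G \<alpha> \<beta>. is_functor D C G \<and>
        nat_iso C C id_functor (comp_functor G F) \<alpha> \<and>
        nat_iso D D (comp_functor F G) id_functor \<beta>)"

definition slice :: "('o, 'm) category \<Rightarrow> 'o \<Rightarrow> ('m, 'm \<times> 'm \<times> 'm) category" where
  "slice C X =
     \<lparr>Obj = {f \<in> Arr C. Cod C f = X},
      Arr = {(f, h, g). f \<in> Arr C \<and> Cod C f = X \<and> g \<in> Arr C \<and> Cod C g = X \<and>
               h \<in> hom C (Dom C f) (Dom C g) \<and> g \<cdot>\<^bsub>C\<^esub> h = f},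
      Dom = \<lambda>(f, h, g). f,
      Cod = \<lambda>(f, h, g). g,
      Ide = \<lambda>f. (f, Ide C (Dom C f), f),
      Cmp = \<lambda>(g, k, g') (f, h, f'). (f, k \<cdot>\<^bsub>C\<^esub> h, g')\<rparr>"

definition prod_category ::
    "'i set \<Rightarrow> ('i \<Rightarrow> ('o, 'm) category) \<Rightarrow> ('i \<Rightarrow> 'o, 'i \<Rightarrow> 'm) category" where
  "prod_category I Cs =
     \<lparr>Obj = (\<Pi>\<^sub>E i\<in>I. Obj (Cs i)),
      Arr = (\<Pi>\<^sub>E i\<in>I. Arr (Cs i)),
      Dom = \<lambda>f. \<lambda>i\<in>I. Dom (Cs i) (f i),
      Cod = \<lambda>f. \<lambda>i\<in>I. Cod (Cs i) (f i),
      Ide = \<lambda>a. \<lambda>i\<in>I. Ide (Cs i) (a i),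
      Cmp = \<lambda>g f. \<lambda>i\<in>I. g i \<cdot>\<^bsub>Cs i\<^esub> f i\<rparr>"


section \<open>Limits, products and coproducts\<close>

definition is_cone ::
    "('j, 'k) category \<Rightarrow> ('o, 'm) category \<Rightarrow> ('j, 'k, 'o, 'm) cfunctor \<Rightarrow> 'o \<Rightarrow> ('j \<Rightarrow> 'm) \<Rightarrow> bool" where
  "is_cone J C D c \<gamma> \<longleftrightarrow> c \<in> Obj C \<and>
     (\<forall>j\<in>Obj J. \<gamma> j \<in> hom C c (fob D j)) \<and>
     (\<forall>u\<in>Arr J. far D u \<cdot>\<^bsub>C\<^esub> \<gamma> (Dom J u) = \<gamma> (Cod J u))"

definition is_limit ::
    "('j, 'k) category \<Rightarrow> ('o, 'm) category \<Rightarrow> ('j, 'k, 'o, 'm) cfunctor \<Rightarrow> 'o \<Rightarrow> ('j \<Rightarrow> 'm) \<Rightarrow> bool" where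
  "is_limit J C D l \<pi> \<longleftrightarrow> is_cone J C D l \<pi> \<and>
     (\<forall>c \<gamma>. is_cone J C D c \<gamma> \<longrightarrow> (\<exists>!h. h \<in> hom C c l \<and> (\<forall>j\<in>Obj J. \<pi> j \<cdot>\<^bsub>C\<^esub> h = \<gamma> j)))"

text \<open>Every finite category is isomorphic to one whose objects and arrows are natural numbers.\<close>

definition has_finite_limits :: "('o, 'm) category \<Rightarrow> bool" where
  "has_finite_limits C \<longleftrightarrow> is_category C \<and>
     (\<forall>(J :: (nat, nat) category) D.
        finite (Obj J) \<and> finite (Arr J) \<and> is_functor J C D \<longrightarrow> (\<exists>l \<pi>. is_limit J C D l \<pi>))"

definition is_product ::
    "('o, 'm) category \<Rightarrow> 'i set \<Rightarrow> ('i \<Rightarrow> 'o) \<Rightarrow> 'o \<Rightarrow> ('i \<Rightarrow> 'm) \<Rightarrow> bool" where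
  "is_product C I X p \<pi> \<longleftrightarrow> p \<in> Obj C \<and> (\<forall>i\<in>I. \<pi> i \<in> hom C p (X i)) \<and>
     (\<forall>c\<in>Obj C. \<forall>f. (\<forall>i\<in>I. f i \<in> hom C c (X i)) \<longrightarrow>
        (\<exists>!h. h \<in> hom C c p \<and> (\<forall>i\<in>I. \<pi> i \<cdot>\<^bsub>C\<^esub> h = f i)))"

definition is_coproduct ::
    "('o, 'm) category \<Rightarrow> 'i set \<Rightarrow> ('i \<Rightarrow> 'o) \<Rightarrow> 'o \<Rightarrow> ('i \<Rightarrow> 'm) \<Rightarrow> bool" where
  "is_coproduct C I X s \<iota> \<longleftrightarrow> s \<in> Obj C \<and> (\<forall>i\<in>I. \<iota> i \<in> hom C (X i) s) \<and>
     (\<forall>c\<in>Obj C. \<forall>f. (\<forall>i\<in>I. f i \<in> hom C (X i) c) \<longrightarrow>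
        (\<exists>!h. h \<in> hom C s c \<and> (\<forall>i\<in>I. h \<cdot>\<^bsub>C\<^esub> \<iota> i = f i)))"

text \<open>
  Chosen products and coproducts. The choice depends only on the restriction of the family \<open>X\<close>
  to \<open>I\<close>, since the predicate under \<open>SOME\<close> does.
\<close>

definition Prod :: "('o, 'm) category \<Rightarrow> 'i set \<Rightarrow> ('i \<Rightarrow> 'o) \<Rightarrow> 'o" where
  "Prod C I X = fst (SOME (p, \<pi>). is_product C I X p \<pi>)"

definition proj :: "('o, 'm) category \<Rightarrow> 'i set \<Rightarrow> ('i \<Rightarrow> 'o) \<Rightarrow> 'i \<Rightarrow> 'm" where
  "proj C I X = snd (SOME (p, \<pi>). is_product C I X p \<pi>)"

definition Coprod :: "('o, 'm) category \<Rightarrow> 'i set \<Rightarrow> ('i \<Rightarrow> 'o) \<Rightarrow> 'o" where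
  "Coprod C I X = fst (SOME (s, \<iota>). is_coproduct C I X s \<iota>)"

definition coproj :: "('o, 'm) category \<Rightarrow> 'i set \<Rightarrow> ('i \<Rightarrow> 'o) \<Rightarrow> 'i \<Rightarrow> 'm" where
  "coproj C I X = snd (SOME (s, \<iota>). is_coproduct C I X s \<iota>)"

definition tuple :: "('o, 'm) category \<Rightarrow> 'i set \<Rightarrow> 'o \<Rightarrow> ('i \<Rightarrow> 'm) \<Rightarrow> 'm" where
  "tuple C I c f = (THE h. h \<in> hom C c (Prod C I (\<lambda>i. Cod C (f i))) \<and>
     (\<forall>i\<in>I. proj C I (\<lambda>i. Cod C (f i)) i \<cdot>\<^bsub>C\<^esub> h = f i))"

definition cotuple :: "('o, 'm) category \<Rightarrow> 'i set \<Rightarrow> 'o \<Rightarrow> ('i \<Rightarrow> 'm) \<Rightarrow> 'm" where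
  "cotuple C I c f = (THE h. h \<in> hom C (Coprod C I (\<lambda>i. Dom C (f i))) c \<and>
     (\<forall>i\<in>I. h \<cdot>\<^bsub>C\<^esub> coproj C I (\<lambda>i. Dom C (f i)) i = f i))"

definition coprod_arr :: "('o, 'm) category \<Rightarrow> 'i set \<Rightarrow> ('i \<Rightarrow> 'm) \<Rightarrow> 'm" where
  "coprod_arr C I f = cotuple C I (Coprod C I (\<lambda>i. Cod C (f i)))
     (\<lambda>i. coproj C I (\<lambda>i. Cod C (f i)) i \<cdot>\<^bsub>C\<^esub> f i)"

definition prod2 :: "('o, 'm) category \<Rightarrow> 'o \<Rightarrow> 'o \<Rightarrow> 'o" where
  "prod2 C a b = Prod C UNIV (case_bool a b)"

definition proj1 :: "('o, 'm) category \<Rightarrow> 'o \<Rightarrow> 'o \<Rightarrow> 'm" where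
  "proj1 C a b = proj C UNIV (case_bool a b) True"

definition proj2 :: "('o, 'm) category \<Rightarrow> 'o \<Rightarrow> 'o \<Rightarrow> 'm" where
  "proj2 C a b = proj C UNIV (case_bool a b) False"

definition pair :: "('o, 'm) category \<Rightarrow> 'm \<Rightarrow> 'm \<Rightarrow> 'm" where
  "pair C f g = tuple C UNIV (Dom C f) (case_bool f g)"

definition prod2_arr :: "('o, 'm) category \<Rightarrow> 'm \<Rightarrow> 'm \<Rightarrow> 'm" where
  "prod2_arr C f g =
     pair C (f \<cdot>\<^bsub>C\<^esub> proj1 C (Dom C f) (Dom C g)) (g \<cdot>\<^bsub>C\<^esub> proj2 C (Dom C f) (Dom C g))"

definition assoc :: "('o, 'm) category \<Rightarrow> 'o \<Rightarrow> 'o \<Rightarrow> 'o \<Rightarrow> 'm" where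
  "assoc C a b c =
     pair C (pair C (proj1 C a (prod2 C b c)) (proj1 C b c \<cdot>\<^bsub>C\<^esub> proj2 C a (prod2 C b c)))
       (proj2 C b c \<cdot>\<^bsub>C\<^esub> proj2 C a (prod2 C b c))"

definition terminal :: "('o, 'm) category \<Rightarrow> 'o" where
  "terminal C = (SOME t. t \<in> Obj C \<and> (\<forall>c\<in>Obj C. \<exists>!h. h \<in> hom C c t))"

definition bang :: "('o, 'm) category \<Rightarrow> 'o \<Rightarrow> 'm" where
  "bang C c = (THE h. h \<in> hom C c (terminal C))"

definition is_pullback :: "('o, 'm) category \<Rightarrow> 'm \<Rightarrow> 'm \<Rightarrow> 'm \<Rightarrow> 'm \<Rightarrow> bool" where
  "is_pullback C f g p q \<longleftrightarrow>
     f \<in> Arr C \<and> g \<in> Arr C \<and> p \<in> Arr C \<and> q \<in> Arr C \<and> Cod C f = Cod C g \<and>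
     Dom C p = Dom C q \<and> Cod C p = Dom C f \<and> Cod C q = Dom C g \<and> f \<cdot>\<^bsub>C\<^esub> p = g \<cdot>\<^bsub>C\<^esub> q \<and>
     (\<forall>c. \<forall>a\<in>hom C c (Dom C f). \<forall>b\<in>hom C c (Dom C g). f \<cdot>\<^bsub>C\<^esub> a = g \<cdot>\<^bsub>C\<^esub> b \<longrightarrow>
        (\<exists>!h. h \<in> hom C c (Dom C p) \<and> p \<cdot>\<^bsub>C\<^esub> h = a \<and> q \<cdot>\<^bsub>C\<^esub> h = b))"

definition has_pullbacks :: "('o, 'm) category \<Rightarrow> bool" where
  "has_pullbacks C \<longleftrightarrow> is_category C \<and>
     (\<forall>f\<in>Arr C. \<forall>g\<in>Arr C. Cod C f = Cod C g \<longrightarrow> (\<exists>p q. is_pullback C f g p q))"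


section \<open>Extensive categories\<close>

definition coprod_functor ::
    "('o, 'm) category \<Rightarrow> 'i set \<Rightarrow> ('i \<Rightarrow> 'm, 'i \<Rightarrow> 'm \<times> 'm \<times> 'm, 'm, 'm \<times> 'm \<times> 'm) cfunctor" where
  "coprod_functor C I =
     \<lparr>fob = \<lambda>f. coprod_arr C I f,
      far = \<lambda>t. (coprod_arr C I (\<lambda>i. fst (t i)), coprod_arr C I (\<lambda>i. fst (snd (t i))),
                 coprod_arr C I (\<lambda>i. snd (snd (t i))))\<rparr>"

definition extensive :: "('u \<Rightarrow> 'u set) \<Rightarrow> ('o, 'm) category \<Rightarrow> bool" where
  "extensive elts C \<longleftrightarrow> is_category C \<and>
     (\<forall>I X. small elts I \<and> X \<in> I \<rightarrow> Obj C \<longrightarrow>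
        (\<exists>s \<iota>. is_coproduct C I X s \<iota>) \<and>
        is_equivalence (prod_category I (\<lambda>i. slice C (X i))) (slice C (Coprod C I X))
          (coprod_functor C I))"


section \<open>Enriched graphs and enriched categories\<close>

text \<open>
  For a category with objects in \<open>'o\<close> and arrows in \<open>'m\<close>, the following types contain the objects
  and arrows of all iterated categories of enriched graphs and enriched categories, so that both
  constructions are endomaps of one type of categories. The constructors \<open>BaseOb\<close> and
  \<open>BaseAr\<close> embed the given category. A graph \<open>GphOb A h\<close> has object set \<open>A\<close> and
  hom-objects \<open>h (x, y)\<close>; an enriched category \<open>CatOb A h m j\<close> has in addition compositions
  \<open>m (x, y, z) : h (y, z) \<times> h (x, y) \<rightarrow> h (x, z)\<close> and identities \<open>j x : 1 \<rightarrow> h (x, x)\<close>.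
  All these families are extensional (\<open>undefined\<close> outside their index sets), so that
  equality of graphs, categories and their morphisms is the intended one.
\<close>

datatype ('u, 'o, 'm) ob =
    BaseOb (un_ob: 'o)
  | GphOb (obs: "'u set") (homob: "'u \<times> 'u \<Rightarrow> ('u, 'o, 'm) ob")
  | CatOb (obs: "'u set") (homob: "'u \<times> 'u \<Rightarrow> ('u, 'o, 'm) ob")
      (mult: "'u \<times> 'u \<times> 'u \<Rightarrow> ('u, 'o, 'm) ar") (idt: "'u \<Rightarrow> ('u, 'o, 'm) ar")
and ('u, 'o, 'm) ar =
    BaseAr (un_ar: 'm)
  | Mor (src: "('u, 'o, 'm) ob") (tgt: "('u, 'o, 'm) ob")
      (on_obs: "'u \<Rightarrow> 'u") (on_homs: "'u \<times> 'u \<Rightarrow> ('u, 'o, 'm) ar")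

type_synonym ('u, 'o, 'm) vcat = "(('u, 'o, 'm) ob, ('u, 'o, 'm) ar) category"
type_synonym ('u, 'o, 'm) vfun =
  "(('u, 'o, 'm) ob, ('u, 'o, 'm) ar, ('u, 'o, 'm) ob, ('u, 'o, 'm) ar) cfunctor"

definition base :: "('o, 'm) category \<Rightarrow> ('u, 'o, 'm) vcat" where
  "base V =
     \<lparr>Obj = BaseOb ` Obj V,
      Arr = BaseAr ` Arr V,
      Dom = \<lambda>f. BaseOb (Dom V (un_ar f)),
      Cod = \<lambda>f. BaseOb (Cod V (un_ar f)),
      Ide = \<lambda>a. BaseAr (Ide V (un_ob a)),
      Cmp = \<lambda>g f. BaseAr (un_ar g \<cdot>\<^bsub>V\<^esub> un_ar f)\<rparr>"

definition graph :: "('u \<Rightarrow> 'u set) \<Rightarrow> ('u, 'o, 'm) vcat \<Rightarrow> ('u, 'o, 'm) ob \<Rightarrow> bool" where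
  "graph elts W G \<longleftrightarrow> (\<exists>A h. G = GphOb A h \<and> small elts A \<and> h \<in> A \<times> A \<rightarrow>\<^sub>E Obj W)"

text \<open>The object and hom parts of a morphism, for graphs as well as for enriched categories.\<close>

definition graph_map ::
    "('u, 'o, 'm) vcat \<Rightarrow> ('u, 'o, 'm) ob \<Rightarrow> ('u, 'o, 'm) ob \<Rightarrow> ('u \<Rightarrow> 'u) \<Rightarrow>
       ('u \<times> 'u \<Rightarrow> ('u, 'o, 'm) ar) \<Rightarrow> bool" where
  "graph_map W G H f \<phi> \<longleftrightarrow> f \<in> obs G \<rightarrow>\<^sub>E obs H \<and>
     \<phi> \<in> (\<Pi>\<^sub>E (x, y)\<in>obs G \<times> obs G. hom W (homob G (x, y)) (homob H (f x, f y)))"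

definition mor_id :: "('u, 'o, 'm) vcat \<Rightarrow> ('u, 'o, 'm) ob \<Rightarrow> ('u, 'o, 'm) ar" where
  "mor_id W G = Mor G G (\<lambda>x\<in>obs G. x) (\<lambda>p\<in>obs G \<times> obs G. Ide W (homob G p))"

definition mor_comp ::
    "('u, 'o, 'm) vcat \<Rightarrow> ('u, 'o, 'm) ar \<Rightarrow> ('u, 'o, 'm) ar \<Rightarrow> ('u, 'o, 'm) ar" where
  "mor_comp W g f =
     Mor (src f) (tgt g) (\<lambda>x\<in>obs (src f). on_obs g (on_obs f x))
       (\<lambda>(x, y)\<in>obs (src f) \<times> obs (src f).
          on_homs g (on_obs f x, on_obs f y) \<cdot>\<^bsub>W\<^esub> on_homs f (x, y))"

definition Gph :: "('u \<Rightarrow> 'u set) \<Rightarrow> ('u, 'o, 'm) vcat \<Rightarrow> ('u, 'o, 'm) vcat" where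
  "Gph elts W =
     \<lparr>Obj = {G. graph elts W G},
      Arr = {Mor G H f \<phi> | G H f \<phi>. graph elts W G \<and> graph elts W H \<and> graph_map W G H f \<phi>},
      Dom = src, Cod = tgt, Ide = mor_id W, Cmp = mor_comp W\<rparr>"

definition enriched_category ::
    "('u \<Rightarrow> 'u set) \<Rightarrow> ('u, 'o, 'm) vcat \<Rightarrow> ('u, 'o, 'm) ob \<Rightarrow> bool" where
  "enriched_category elts W C \<longleftrightarrow> (\<exists>A h m j. C = CatOb A h m j \<and> small elts A \<and>
     h \<in> A \<times> A \<rightarrow>\<^sub>E Obj W \<and>
     m \<in> (\<Pi>\<^sub>E (x, y, z)\<in>A \<times> A \<times> A. hom W (prod2 W (h (y, z)) (h (x, y))) (h (x, z))) \<and>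
     j \<in> (\<Pi>\<^sub>E x\<in>A. hom W (terminal W) (h (x, x))) \<and>
     (\<forall>x\<in>A. \<forall>y\<in>A. \<forall>z\<in>A. \<forall>w\<in>A.
        m (x, z, w) \<cdot>\<^bsub>W\<^esub> prod2_arr W (Ide W (h (z, w))) (m (x, y, z)) =
        m (x, y, w) \<cdot>\<^bsub>W\<^esub> prod2_arr W (m (y, z, w)) (Ide W (h (x, y)))
          \<cdot>\<^bsub>W\<^esub> assoc W (h (z, w)) (h (y, z)) (h (x, y))) \<and>
     (\<forall>x\<in>A. \<forall>y\<in>A.
        m (x, y, y) \<cdot>\<^bsub>W\<^esub> pair W (j y \<cdot>\<^bsub>W\<^esub> bang W (h (x, y))) (Ide W (h (x, y))) = Ide W (h (x, y)) \<and>
        m (x, x, y) \<cdot>\<^bsub>W\<^esub> pair W (Ide W (h (x, y))) (j x \<cdot>\<^bsub>W\<^esub> bang W (h (x, y))) = Ide W (h (x, y))))"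

definition enriched_functor ::
    "('u, 'o, 'm) vcat \<Rightarrow> ('u, 'o, 'm) ob \<Rightarrow> ('u, 'o, 'm) ob \<Rightarrow> ('u \<Rightarrow> 'u) \<Rightarrow>
       ('u \<times> 'u \<Rightarrow> ('u, 'o, 'm) ar) \<Rightarrow> bool" where
  "enriched_functor W C D f \<phi> \<longleftrightarrow> graph_map W C D f \<phi> \<and>
     (\<forall>x\<in>obs C. \<forall>y\<in>obs C. \<forall>z\<in>obs C.
        \<phi> (x, z) \<cdot>\<^bsub>W\<^esub> mult C (x, y, z) =
        mult D (f x, f y, f z) \<cdot>\<^bsub>W\<^esub> prod2_arr W (\<phi> (y, z)) (\<phi> (x, y))) \<and>
     (\<forall>x\<in>obs C. \<phi> (x, x) \<cdot>\<^bsub>W\<^esub> idt C x = idt D (f x))"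

definition Cat :: "('u \<Rightarrow> 'u set) \<Rightarrow> ('u, 'o, 'm) vcat \<Rightarrow> ('u, 'o, 'm) vcat" where
  "Cat elts W =
     \<lparr>Obj = {C. enriched_category elts W C},
      Arr = {Mor C D f \<phi> | C D f \<phi>. enriched_category elts W C \<and> enriched_category elts W D \<and>
               enriched_functor W C D f \<phi>},
      Dom = src, Cod = tgt, Ide = mor_id W, Cmp = mor_comp W\<rparr>"

primrec Gph_iter :: "('u \<Rightarrow> 'u set) \<Rightarrow> ('o, 'm) category \<Rightarrow> nat \<Rightarrow> ('u, 'o, 'm) vcat" where
  "Gph_iter elts V 0 = base V"
| "Gph_iter elts V (Suc n) = Gph elts (Gph_iter elts V n)"

primrec Cat_iter :: "('u \<Rightarrow> 'u set) \<Rightarrow> ('o, 'm) category \<Rightarrow> nat \<Rightarrow> ('u, 'o, 'm) vcat" where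
  "Cat_iter elts V 0 = base V"
| "Cat_iter elts V (Suc n) = Cat elts (Cat_iter elts V n)"

text \<open>Action of \<open>(-)-Gph\<close> on functors and on natural transformations \<open>\<alpha> : H \<rightarrow> K\<close>.\<close>

definition Gph_ob :: "('u, 'o, 'm) vfun \<Rightarrow> ('u, 'o, 'm) ob \<Rightarrow> ('u, 'o, 'm) ob" where
  "Gph_ob H G = GphOb (obs G) (\<lambda>p\<in>obs G \<times> obs G. fob H (homob G p))"

definition Gph_fun :: "('u, 'o, 'm) vfun \<Rightarrow> ('u, 'o, 'm) vfun" where
  "Gph_fun H =
     \<lparr>fob = Gph_ob H,
      far = \<lambda>f. Mor (Gph_ob H (src f)) (Gph_ob H (tgt f)) (on_obs f)
                  (\<lambda>p\<in>obs (src f) \<times> obs (src f). far H (on_homs f p))\<rparr>"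

definition Gph_nat ::
    "('u, 'o, 'm) vfun \<Rightarrow> ('u, 'o, 'm) vfun \<Rightarrow> (('u, 'o, 'm) ob \<Rightarrow> ('u, 'o, 'm) ar) \<Rightarrow>
       ('u, 'o, 'm) ob \<Rightarrow> ('u, 'o, 'm) ar" where
  "Gph_nat H K \<alpha> G =
     Mor (Gph_ob H G) (Gph_ob K G) (\<lambda>x\<in>obs G. x) (\<lambda>p\<in>obs G \<times> obs G. \<alpha> (homob G p))"


section \<open>Adjunctions and monads\<close>

record ('o, 'm, 'p, 'q) adjunction =
  ladj :: "('o, 'm, 'p, 'q) cfunctor"
  radj :: "('p, 'q, 'o, 'm) cfunctor"
  unit :: "'o \<Rightarrow> 'm"
  counit :: "'p \<Rightarrow> 'q"

definition id_adj :: "('o, 'm) category \<Rightarrow> ('o, 'm, 'o, 'm) adjunction" where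
  "id_adj C = \<lparr>ladj = id_functor, radj = id_functor, unit = Ide C, counit = Ide C\<rparr>"

text \<open>Composite of \<open>a : C \<rightleftharpoons> D\<close> and \<open>b : D \<rightleftharpoons> E\<close>.\<close>

definition comp_adj ::
    "('o, 'm) category \<Rightarrow> ('r, 's) category \<Rightarrow>
       ('o, 'm, 'p, 'q) adjunction \<Rightarrow> ('p, 'q, 'r, 's) adjunction \<Rightarrow> ('o, 'm, 'r, 's) adjunction" where
  "comp_adj C E a b =
     \<lparr>ladj = comp_functor (ladj b) (ladj a),
      radj = comp_functor (radj a) (radj b),
      unit = \<lambda>c. far (radj a) (unit b (fob (ladj a) c)) \<cdot>\<^bsub>C\<^esub> unit a c,
      counit = \<lambda>e. counit b e \<cdot>\<^bsub>E\<^esub> far (ladj b) (counit a (fob (radj b) e))\<rparr>"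

definition Gph_adj ::
    "(('u, 'o, 'm) ob, ('u, 'o, 'm) ar, ('u, 'o, 'm) ob, ('u, 'o, 'm) ar) adjunction \<Rightarrow>
     (('u, 'o, 'm) ob, ('u, 'o, 'm) ar, ('u, 'o, 'm) ob, ('u, 'o, 'm) ar) adjunction" where
  "Gph_adj a =
     \<lparr>ladj = Gph_fun (ladj a),
      radj = Gph_fun (radj a),
      unit = Gph_nat id_functor (comp_functor (radj a) (ladj a)) (unit a),
      counit = Gph_nat (comp_functor (ladj a) (radj a)) id_functor (counit a)\<rparr>"

record ('o, 'm) monad =
  mfun :: "('o, 'm, 'o, 'm) cfunctor"
  munit :: "'o \<Rightarrow> 'm"
  mmult :: "'o \<Rightarrow> 'm"

definition is_monad :: "('o, 'm) category \<Rightarrow> ('o, 'm) monad \<Rightarrow> bool" where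
  "is_monad C T \<longleftrightarrow>
     is_functor C C (mfun T) \<and>
     nat_trans C C id_functor (mfun T) (munit T) \<and>
     nat_trans C C (comp_functor (mfun T) (mfun T)) (mfun T) (mmult T) \<and>
     (\<forall>c\<in>Obj C.
        mmult T c \<cdot>\<^bsub>C\<^esub> munit T (fob (mfun T) c) = Ide C (fob (mfun T) c) \<and>
        mmult T c \<cdot>\<^bsub>C\<^esub> far (mfun T) (munit T c) = Ide C (fob (mfun T) c) \<and>
        mmult T c \<cdot>\<^bsub>C\<^esub> mmult T (fob (mfun T) c) = mmult T c \<cdot>\<^bsub>C\<^esub> far (mfun T) (mmult T c))"

definition generated_monad :: "('o, 'm, 'p, 'q) adjunction \<Rightarrow> ('o, 'm) monad" where
  "generated_monad a =
     \<lparr>mfun = comp_functor (radj a) (ladj a),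
      munit = unit a,
      mmult = \<lambda>c. far (radj a) (counit a (fob (ladj a) c))\<rparr>"

definition preserves_pullbacks ::
    "('o, 'm) category \<Rightarrow> ('p, 'q) category \<Rightarrow> ('o, 'm, 'p, 'q) cfunctor \<Rightarrow> bool" where
  "preserves_pullbacks C D F \<longleftrightarrow>
     (\<forall>f g p q. is_pullback C f g p q \<longrightarrow> is_pullback D (far F f) (far F g) (far F p) (far F q))"

definition cartesian_nat_trans ::
    "('o, 'm) category \<Rightarrow> ('p, 'q) category \<Rightarrow> ('o, 'm, 'p, 'q) cfunctor \<Rightarrow> ('o, 'm, 'p, 'q) cfunctor
       \<Rightarrow> ('o \<Rightarrow> 'q) \<Rightarrow> bool" where
  "cartesian_nat_trans C D F G \<alpha> \<longleftrightarrow> nat_trans C D F G \<alpha> \<and>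
     (\<forall>f\<in>Arr C. is_pullback D (far G f) (\<alpha> (Cod C f)) (\<alpha> (Dom C f)) (far F f))"

definition cartesian_monad :: "('o, 'm) category \<Rightarrow> ('o, 'm) monad \<Rightarrow> bool" where
  "cartesian_monad C T \<longleftrightarrow> has_pullbacks C \<and> is_monad C T \<and>
     preserves_pullbacks C C (mfun T) \<and>
     cartesian_nat_trans C C id_functor (mfun T) (munit T) \<and>
     cartesian_nat_trans C C (comp_functor (mfun T) (mfun T)) (mfun T) (mmult T)"


section \<open>Free enriched categories\<close>

definition forget_ob :: "('u, 'o, 'm) ob \<Rightarrow> ('u, 'o, 'm) ob" where
  "forget_ob C = GphOb (obs C) (homob C)"

definition forget :: "('u, 'o, 'm) vfun" where
  "forget =
     \<lparr>fob = forget_ob,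
      far = \<lambda>f. Mor (forget_ob (src f)) (forget_ob (tgt f)) (on_obs f) (on_homs f)\<rparr>"

text \<open>A path \<open>x = w\<^sub>0, \<dots>, w\<^sub>n = y\<close> is the list of its \<open>n + 1\<close> vertices.\<close>

definition paths :: "('u, 'o, 'm) ob \<Rightarrow> 'u \<Rightarrow> 'u \<Rightarrow> nat \<Rightarrow> 'u list set" where
  "paths G x y n = {w. length w = Suc n \<and> set w \<subseteq> obs G \<and> w ! 0 = x \<and> w ! n = y}"

definition step :: "('u, 'o, 'm) ob \<Rightarrow> 'u list \<Rightarrow> nat \<Rightarrow> ('u, 'o, 'm) ob" where
  "step G w i = homob G (w ! i, w ! Suc i)"

definition path_ob :: "('u, 'o, 'm) vcat \<Rightarrow> ('u, 'o, 'm) ob \<Rightarrow> 'u list \<Rightarrow> ('u, 'o, 'm) ob" where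
  "path_ob W G w = Prod W {..<length w - 1} (step G w)"

definition path_proj ::
    "('u, 'o, 'm) vcat \<Rightarrow> ('u, 'o, 'm) ob \<Rightarrow> 'u list \<Rightarrow> nat \<Rightarrow> ('u, 'o, 'm) ar" where
  "path_proj W G w = proj W {..<length w - 1} (step G w)"

definition free_hom ::
    "('u, 'o, 'm) vcat \<Rightarrow> ('u, 'o, 'm) ob \<Rightarrow> 'u \<Rightarrow> 'u \<Rightarrow> ('u, 'o, 'm) ob" where
  "free_hom W G x y =
     Coprod W (UNIV :: nat set) (\<lambda>n. Coprod W (paths G x y n) (path_ob W G))"

text \<open>The coprojection at \<open>w\<close>, from \<open>path_ob W G w\<close> to \<open>free_hom W G (hd w) (last w)\<close>.\<close>

definition free_inj ::
    "('u, 'o, 'm) vcat \<Rightarrow> ('u, 'o, 'm) ob \<Rightarrow> 'u list \<Rightarrow> ('u, 'o, 'm) ar" where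
  "free_inj W G w = (let x = hd w; y = last w; n = length w - 1 in
     coproj W (UNIV :: nat set) (\<lambda>n. Coprod W (paths G x y n) (path_ob W G)) n
       \<cdot>\<^bsub>W\<^esub> coproj W (paths G x y n) (path_ob W G) w)"

text \<open>
  For \<open>v\<close> from \<open>x\<close> to \<open>y\<close> and \<open>w\<close> from \<open>y\<close> to \<open>z\<close>, the
  canonical isomorphism from \<open>path_ob W G w \<times> path_ob W G v\<close> to the object of the concatenated path,
  which is \<open>v @ tl w\<close>.
\<close>

definition concat_iso ::
    "('u, 'o, 'm) vcat \<Rightarrow> ('u, 'o, 'm) ob \<Rightarrow> 'u list \<Rightarrow> 'u list \<Rightarrow> ('u, 'o, 'm) ar" where
  "concat_iso W G w v = (let k = length v - 1; l = length w - 1 in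
     tuple W {..<k + l} (prod2 W (path_ob W G w) (path_ob W G v))
       (\<lambda>i. if i < k then path_proj W G v i \<cdot>\<^bsub>W\<^esub> proj2 W (path_ob W G w) (path_ob W G v)
             else path_proj W G w (i - k) \<cdot>\<^bsub>W\<^esub> proj1 W (path_ob W G w) (path_ob W G v)))"

text \<open>
  Composition in the free category is concatenation of paths. It is determined by its
  restrictions along pairs of coprojections because \<open>W\<close>, being extensive, is distributive.
\<close>

definition free_mult ::
    "('u, 'o, 'm) vcat \<Rightarrow> ('u, 'o, 'm) ob \<Rightarrow> 'u \<Rightarrow> 'u \<Rightarrow> 'u \<Rightarrow> ('u, 'o, 'm) ar" where
  "free_mult W G x y z =
     (THE c. c \<in> hom W (prod2 W (free_hom W G y z) (free_hom W G x y)) (free_hom W G x z) \<and>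
        (\<forall>k l. \<forall>v\<in>paths G x y k. \<forall>w\<in>paths G y z l.
           c \<cdot>\<^bsub>W\<^esub> prod2_arr W (free_inj W G w) (free_inj W G v) =
           free_inj W G (v @ tl w) \<cdot>\<^bsub>W\<^esub> concat_iso W G w v))"

text \<open>The family in the \<open>tuple\<close> is indexed by the empty set, so its value is irrelevant.\<close>

definition free_idt :: "('u, 'o, 'm) vcat \<Rightarrow> ('u, 'o, 'm) ob \<Rightarrow> 'u \<Rightarrow> ('u, 'o, 'm) ar" where
  "free_idt W G x = free_inj W G [x] \<cdot>\<^bsub>W\<^esub> tuple W ({} :: nat set) (terminal W) (\<lambda>_. undefined)"

definition free_ob :: "('u, 'o, 'm) vcat \<Rightarrow> ('u, 'o, 'm) ob \<Rightarrow> ('u, 'o, 'm) ob" where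
  "free_ob W G =
     CatOb (obs G)
       (\<lambda>(x, y)\<in>obs G \<times> obs G. free_hom W G x y)
       (\<lambda>(x, y, z)\<in>obs G \<times> obs G \<times> obs G. free_mult W G x y z)
       (\<lambda>x\<in>obs G. free_idt W G x)"

definition free_unit :: "('u, 'o, 'm) vcat \<Rightarrow> ('u, 'o, 'm) ob \<Rightarrow> ('u, 'o, 'm) ar" where
  "free_unit W G =
     Mor G (forget_ob (free_ob W G)) (\<lambda>x\<in>obs G. x)
       (\<lambda>(x, y)\<in>obs G \<times> obs G. free_inj W G [x, y]
          \<cdot>\<^bsub>W\<^esub> tuple W {..<1 :: nat} (homob G (x, y)) (\<lambda>i. Ide W (homob G (x, y))))"

text \<open>
  The arrow part of the left adjoint and the counit are those determined by the universal property of
  \<open>free_unit\<close>: a graph morphism \<open>f : G \<rightarrow> U C\<close> extends uniquely to \<open>free_ob W G \<rightarrow> C\<close>.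
\<close>

definition free_ext ::
    "('u \<Rightarrow> 'u set) \<Rightarrow> ('u, 'o, 'm) vcat \<Rightarrow> ('u, 'o, 'm) ob \<Rightarrow> ('u, 'o, 'm) ob \<Rightarrow> ('u, 'o, 'm) ar \<Rightarrow>
       ('u, 'o, 'm) ar" where
  "free_ext elts W G C f =
     (THE h. h \<in> hom (Cat elts W) (free_ob W G) C \<and> far forget h \<cdot>\<^bsub>Gph elts W\<^esub> free_unit W G = f)"

definition free_adj ::
    "('u \<Rightarrow> 'u set) \<Rightarrow> ('u, 'o, 'm) vcat \<Rightarrow>
     (('u, 'o, 'm) ob, ('u, 'o, 'm) ar, ('u, 'o, 'm) ob, ('u, 'o, 'm) ar) adjunction" where
  "free_adj elts W =
     \<lparr>ladj = \<lparr>fob = free_ob W,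
              far = \<lambda>f. free_ext elts W (src f) (free_ob W (tgt f))
                          (free_unit W (tgt f) \<cdot>\<^bsub>Gph elts W\<^esub> f)\<rparr>,
      radj = forget,
      unit = free_unit W,
      counit = \<lambda>C. free_ext elts W (forget_ob C) C (Ide (Gph elts W) (forget_ob C))\<rparr>"

text \<open>The adjunctions \<open>F\<^sup>(\<^sup>n\<^sup>) \<stileturn> U\<^sup>(\<^sup>n\<^sup>)\<close> and the monads they generate.\<close>

primrec free_adj_iter ::
    "('u \<Rightarrow> 'u set) \<Rightarrow> ('o, 'm) category \<Rightarrow> nat \<Rightarrow>
     (('u, 'o, 'm) ob, ('u, 'o, 'm) ar, ('u, 'o, 'm) ob, ('u, 'o, 'm) ar) adjunction" where
  "free_adj_iter elts V 0 = id_adj (base V)"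
| "free_adj_iter elts V (Suc n) =
     comp_adj (Gph_iter elts V (Suc n)) (Cat_iter elts V (Suc n))
       (Gph_adj (free_adj_iter elts V n)) (free_adj elts (Cat_iter elts V n))"

definition free_monad ::
    "('u \<Rightarrow> 'u set) \<Rightarrow> ('o, 'm) category \<Rightarrow> nat \<Rightarrow> (('u, 'o, 'm) ob, ('u, 'o, 'm) ar) monad" where
  "free_monad elts V n = generated_monad (free_adj_iter elts V n)"

end

theory Submission
  imports Defs
begin

text \<open>
  In an extensive category, statements about arrows out of \<open>d\<close> may be checked on the summands of a small
  coproduct decomposition of \<open>d\<close>, and an arrow into a coproduct factors, locally on its domain, through exactly
  one summand. Hence an arrow from \<open>d\<close> into a hom object of \<open>F G\<close> is locally a path in \<open>G\<close> together with arrows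
  from \<open>d\<close> into the hom objects along it, and cartesianness of the adjunction becomes combinatorics of lists.

  The counit of the \<open>n\<close>-fold composite adjunction is not cartesian, but its naturality squares at free arrows
  \<open>F\<^sup>n f\<close> are pullbacks, which is all that the multiplication of the monad needs. This passes from \<open>n\<close> to
  \<open>n + 1\<close> because the arrows with a pullback counit square are closed under products and coproducts: if all
  homs of \<open>g\<close> are such arrows, so are those of \<open>F g\<close>.
\<close>

section \<open>Categories, coproducts and pullbacks\<close>

text \<open>For enrichment in sets, the counit square at a functor is a pullback exactly when every
  factorization of the image of an arrow, the empty one included, lifts uniquely. Composition in a
  general category may merge factorizations, so this fails; a free functor \<open>F g\<close> keeps
  the number of edges, and to factor a path is to cut a list, so it holds there. The same argument
  is carried out on generalized elements, where two points need care. All elements of an object at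
  an initial stage coincide, so an element determines its path only at a noninitial stage. And a
  path exists only after a decomposition of the stage, whose summands may carry paths of different
  lengths.

  The induction has to control the hom arrows of \<open>F g\<close>, which are coproducts over paths
  of finite products of hom arrows of \<open>g\<close>. The coproduct step wants the endofunctor
  underlying the comonad of the lower adjunction to preserve small coproducts. Its left adjoint does
  so anyway; that the right adjoint does so too is therefore carried along in the induction.\<close>

lemma hom_iff [simp]: "f \<in> hom C a b \<longleftrightarrow> f \<in> Arr C \<and> Dom C f = a \<and> Cod C f = b"
  by (auto simp: hom_def)

lemma ex1_unique: "\<lbrakk>\<exists>!x. P x; P a; P b\<rbrakk> \<Longrightarrow> a = b"
  by blast

definition is_initial :: "('o, 'm) category \<Rightarrow> 'o \<Rightarrow> bool" where
  "is_initial C z \<longleftrightarrow> z \<in> Obj C \<and> (\<forall>c\<in>Obj C. \<exists>!h. h \<in> hom C z c)"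

definition is_terminal :: "('o, 'm) category \<Rightarrow> 'o \<Rightarrow> bool" where
  "is_terminal C t \<longleftrightarrow> t \<in> Obj C \<and> (\<forall>c\<in>Obj C. \<exists>!h. h \<in> hom C c t)"

locale cat =
  fixes C :: "('o, 'm) category" (structure)
  assumes is_cat: "is_category C"
begin

lemma Dom_Obj [simp]: "f \<in> Arr C \<Longrightarrow> Dom C f \<in> Obj C"
  and Cod_Obj [simp]: "f \<in> Arr C \<Longrightarrow> Cod C f \<in> Obj C"
  using is_cat by (auto simp: is_category_def)

lemma Ide_simps [simp]:
  "a \<in> Obj C \<Longrightarrow> Ide C a \<in> Arr C"
  "a \<in> Obj C \<Longrightarrow> Dom C (Ide C a) = a"
  "a \<in> Obj C \<Longrightarrow> Cod C (Ide C a) = a"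
  using is_cat by (auto simp: is_category_def)

lemma comp_simps [simp]:
  assumes "f \<in> Arr C" "g \<in> Arr C" "Dom C g = Cod C f"
  shows "g \<cdot> f \<in> Arr C" "Dom C (g \<cdot> f) = Dom C f" "Cod C (g \<cdot> f) = Cod C g"
  using is_cat assms by (auto simp: is_category_def)

lemma comp_Ide [simp]: "f \<in> Arr C \<Longrightarrow> Dom C f = a \<Longrightarrow> f \<cdot> Ide C a = f"
  and Ide_comp [simp]: "f \<in> Arr C \<Longrightarrow> Cod C f = b \<Longrightarrow> Ide C b \<cdot> f = f"
  using is_cat by (auto simp: is_category_def)

lemma comp_assoc [simp]:
  assumes "f \<in> Arr C" "g \<in> Arr C" "h \<in> Arr C" "Dom C g = Cod C f" "Dom C h = Cod C g"
  shows "(h \<cdot> g) \<cdot> f = h \<cdot> (g \<cdot> f)"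
  using is_cat assms unfolding is_category_def by simp

text \<open>Composites are normalized to the right, which hides \<open>g \<cdot> f\<close> inside a
  longer composite; this applies an equation for \<open>g \<cdot> f\<close> in that
  position.\<close>

lemma comp_eq:
  assumes "g \<cdot> f = k" "e \<in> Arr C" "f \<in> Arr C" "g \<in> Arr C" "Dom C g = Cod C f" "Dom C f = Cod C e"
  shows "g \<cdot> (f \<cdot> e) = k \<cdot> e"
  using comp_assoc[of e f g] assms by auto

section \<open>Initial objects and coproducts by their universal property\<close>

lemma initial_unique: "\<lbrakk>is_initial C z; u \<in> Arr C; v \<in> Arr C; Dom C u = z; Dom C v = z;
    Cod C u = Cod C v\<rbrakk> \<Longrightarrow> u = v"
  using ex1_unique[of "\<lambda>h. h \<in> hom C z (Cod C u)" u v] unfolding is_initial_def by auto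

lemma initial_Obj: "is_initial C z \<Longrightarrow> z \<in> Obj C"
  by (simp add: is_initial_def)

lemma initial_hom: "is_initial C z \<Longrightarrow> c \<in> Obj C \<Longrightarrow> \<exists>u. u \<in> hom C z c"
  unfolding is_initial_def by blast

lemma coproduct_simps:
  assumes "is_coproduct C I X s \<iota>"
  shows "s \<in> Obj C" "\<And>i. i \<in> I \<Longrightarrow> \<iota> i \<in> Arr C" "\<And>i. i \<in> I \<Longrightarrow> Dom C (\<iota> i) = X i"
    "\<And>i. i \<in> I \<Longrightarrow> Cod C (\<iota> i) = s" "\<And>i. i \<in> I \<Longrightarrow> X i \<in> Obj C"
proof -
  show 1: "s \<in> Obj C" "\<And>i. i \<in> I \<Longrightarrow> \<iota> i \<in> Arr C" "\<And>i. i \<in> I \<Longrightarrow> Dom C (\<iota> i) = X i"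
    "\<And>i. i \<in> I \<Longrightarrow> Cod C (\<iota> i) = s"
    using assms unfolding is_coproduct_def by (simp_all cong: ball_cong)
  show "\<And>i. i \<in> I \<Longrightarrow> X i \<in> Obj C" using 1 Dom_Obj by metis
qed

lemma coproduct_ext:
  assumes "is_coproduct C I X s \<iota>" "u \<in> Arr C" "v \<in> Arr C" "Dom C u = s" "Dom C v = s" "Cod C u = Cod C v"
    "\<And>i. i \<in> I \<Longrightarrow> u \<cdot> \<iota> i = v \<cdot> \<iota> i"
  shows "u = v"
proof -
  have *: "\<forall>c\<in>Obj C. \<forall>f. (\<forall>i\<in>I. f i \<in> hom C (X i) c) \<longrightarrow>
     (\<exists>!h. h \<in> hom C s c \<and> (\<forall>i\<in>I. h \<cdot> \<iota> i = f i))"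
    using assms(1) unfolding is_coproduct_def by blast
  have "\<forall>i\<in>I. u \<cdot> \<iota> i \<in> hom C (X i) (Cod C v)"
    using assms(2-6) coproduct_simps[OF assms(1)] by auto
  then have "\<exists>!h. h \<in> hom C s (Cod C v) \<and> (\<forall>i\<in>I. h \<cdot> \<iota> i = u \<cdot> \<iota> i)"
    using *[rule_format, of "Cod C v" "\<lambda>i. u \<cdot> \<iota> i"] assms(3) by simp
  then show ?thesis by (rule ex1_unique) (use assms(2-) in auto)
qed

lemma coproduct_copair:
  assumes "is_coproduct C I X s \<iota>" "c \<in> Obj C" "\<And>i. i \<in> I \<Longrightarrow> f i \<in> hom C (X i) c"
  obtains h where "h \<in> Arr C" "Dom C h = s" "Cod C h = c" "\<And>i. i \<in> I \<Longrightarrow> h \<cdot> \<iota> i = f i"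
proof -
  have "\<exists>!h. h \<in> hom C s c \<and> (\<forall>i\<in>I. h \<cdot> \<iota> i = f i)"
    using assms unfolding is_coproduct_def by blast
  then show ?thesis using that by auto
qed

lemma coproduct_unique:
  assumes s: "is_coproduct C I X s \<iota>" and s': "is_coproduct C I X s' \<iota>'"
  obtains k l where "k \<in> hom C s s'" "l \<in> hom C s' s" "l \<cdot> k = Ide C s" "k \<cdot> l = Ide C s'"
    "\<And>i. i \<in> I \<Longrightarrow> k \<cdot> \<iota> i = \<iota>' i" "\<And>i. i \<in> I \<Longrightarrow> l \<cdot> \<iota>' i = \<iota> i"
proof -
  note [simp] = coproduct_simps[OF s] coproduct_simps[OF s']
  obtain k where k: "k \<in> Arr C" "Dom C k = s" "Cod C k = s'" "\<And>i. i \<in> I \<Longrightarrow> k \<cdot> \<iota> i = \<iota>' i"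
    using coproduct_copair[OF s, of s' \<iota>'] by auto
  obtain l where l: "l \<in> Arr C" "Dom C l = s'" "Cod C l = s" "\<And>i. i \<in> I \<Longrightarrow> l \<cdot> \<iota>' i = \<iota> i"
    using coproduct_copair[OF s', of s \<iota>] by auto
  have "l \<cdot> k = Ide C s"
    by (rule coproduct_ext[OF s]) (use k l in auto)
  moreover have "k \<cdot> l = Ide C s'"
    by (rule coproduct_ext[OF s']) (use k l in auto)
  ultimately show ?thesis using that[of k l] k l by simp
qed

text \<open>Carries a cocone from one coproduct to any isomorphic object, for instance from the
  chosen coproduct to the domain of a given arrow.\<close>

lemma coproduct_iso:
  assumes s: "is_coproduct C I X s \<iota>" and k: "k \<in> hom C s s'" and l: "l \<in> hom C s' s"
    and lk: "l \<cdot> k = Ide C s" and kl: "k \<cdot> l = Ide C s'"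
  shows "is_coproduct C I X s' (\<lambda>i. k \<cdot> \<iota> i)"
  unfolding is_coproduct_def
proof (intro conjI ballI allI impI)
  note [simp] = coproduct_simps[OF s]
  show "s' \<in> Obj C" using k by auto
  show "k \<cdot> \<iota> i \<in> hom C (X i) s'" if "i \<in> I" for i using that k by auto
  fix c f assume c: "c \<in> Obj C" and f: "\<forall>i\<in>I. f i \<in> hom C (X i) c"
  obtain h where h: "h \<in> Arr C" "Dom C h = s" "Cod C h = c" "\<And>i. i \<in> I \<Longrightarrow> h \<cdot> \<iota> i = f i"
    using coproduct_copair[OF s c, of f] f by auto
  have lk': "l \<cdot> (k \<cdot> e) = e" if "e \<in> Arr C" "Cod C e = s" for e
    using comp_eq[OF lk, of e] k l that by simp
  have kl': "k \<cdot> (l \<cdot> e) = e" if "e \<in> Arr C" "Cod C e = s'" for e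
    using comp_eq[OF kl, of e] k l that by simp
  show "\<exists>!h. h \<in> hom C s' c \<and> (\<forall>i\<in>I. h \<cdot> (k \<cdot> \<iota> i) = f i)"
  proof (rule ex1I[of _ "h \<cdot> l"])
    show "h \<cdot> l \<in> hom C s' c \<and> (\<forall>i\<in>I. (h \<cdot> l) \<cdot> (k \<cdot> \<iota> i) = f i)"
      using h l k lk' by auto
    fix h' assume h': "h' \<in> hom C s' c \<and> (\<forall>i\<in>I. h' \<cdot> (k \<cdot> \<iota> i) = f i)"
    have "h' \<cdot> k = h" by (rule coproduct_ext[OF s]) (use h h' k in auto)
    then have "(h' \<cdot> k) \<cdot> l = h \<cdot> l" by simp
    then show "h' = h \<cdot> l" using h' k l kl by auto
  qed
qed

lemma initial_empty_coproduct: "is_coproduct C {} X z \<iota> \<longleftrightarrow> is_initial C z"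
  unfolding is_coproduct_def is_initial_def by auto

text \<open>Used in contraposed form: a noninitial object has a noninitial summand in each of its
  decompositions.\<close>

lemma initial_coproduct:
  assumes s: "is_coproduct C I X s \<iota>" and X: "\<And>i. i \<in> I \<Longrightarrow> is_initial C (X i)"
  shows "is_initial C s"
  unfolding is_initial_def
proof (intro conjI ballI)
  note [simp] = coproduct_simps[OF s]
  show "s \<in> Obj C" by simp
  fix c assume c: "c \<in> Obj C"
  have "\<forall>i\<in>I. \<exists>f. f \<in> hom C (X i) c" using initial_hom[OF X c] by blast
  then obtain f where "\<forall>i\<in>I. f i \<in> hom C (X i) c" by metis
  then obtain h where h: "h \<in> Arr C" "Dom C h = s" "Cod C h = c"
    using coproduct_copair[OF s c, of f] by auto
  show "\<exists>!h. h \<in> hom C s c"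
  proof (rule ex1I[of _ h])
    show "h \<in> hom C s c" using h by simp
    fix h' assume h': "h' \<in> hom C s c"
    show "h' = h" by (rule coproduct_ext[OF s]) (use h h' in "auto intro: initial_unique[OF X]")
  qed
qed

section \<open>Pullbacks: universal property, pasting, invariance under isomorphism\<close>

lemma pullback_lift:
  assumes "is_pullback C f g p q" "a \<in> Arr C" "b \<in> Arr C" "Dom C a = d" "Dom C b = d" "Cod C a = Dom C f"
    "Cod C b = Dom C g" "f \<cdot> a = g \<cdot> b"
  obtains h where "h \<in> Arr C" "Dom C h = d" "Cod C h = Dom C p" "p \<cdot> h = a" "q \<cdot> h = b"
proof -
  have "\<exists>!h. h \<in> hom C d (Dom C p) \<and> p \<cdot> h = a \<and> q \<cdot> h = b"
  proof -
    have "a \<in> hom C d (Dom C f)" "b \<in> hom C d (Dom C g)" using assms by auto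
    then show ?thesis using assms(1,8) unfolding is_pullback_def by blast
  qed
  then show ?thesis using that by auto
qed

lemma pullback_ext:
  assumes "is_pullback C f g p q" "h \<in> Arr C" "h' \<in> Arr C" "Dom C h = d" "Dom C h' = d" "Cod C h = Dom C p"
    "Cod C h' = Dom C p" "p \<cdot> h = p \<cdot> h'" "q \<cdot> h = q \<cdot> h'"
  shows "h = h'"
proof -
  have t: "p \<in> Arr C" "q \<in> Arr C" "Dom C q = Dom C p" "f \<in> Arr C" "g \<in> Arr C" "Cod C p = Dom C f"
    "Cod C q = Dom C g" "f \<cdot> p = g \<cdot> q"
    using assms(1) unfolding is_pullback_def by auto
  have "f \<cdot> (p \<cdot> h) = g \<cdot> (q \<cdot> h)" using comp_eq[OF t(8), of h] t assms(2-7) by simp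
  moreover have "p \<cdot> h \<in> hom C d (Dom C f)" "q \<cdot> h \<in> hom C d (Dom C g)"
    using t assms(2-7) by auto
  ultimately have "\<exists>!k. k \<in> hom C d (Dom C p) \<and> p \<cdot> k = p \<cdot> h \<and> q \<cdot> k = q \<cdot> h"
    using assms(1) unfolding is_pullback_def by blast
  then show ?thesis by (rule ex1_unique) (use assms(2-) in auto)
qed

lemma pullbackI:
  assumes "f \<in> Arr C" "g \<in> Arr C" "p \<in> Arr C" "q \<in> Arr C" "Cod C f = Cod C g"
    "Dom C p = Dom C q" "Cod C p = Dom C f" "Cod C q = Dom C g" "f \<cdot> p = g \<cdot> q"
    "\<And>d a b. \<lbrakk>a \<in> Arr C; b \<in> Arr C; Dom C a = d; Dom C b = d; Cod C a = Dom C f; Cod C b = Dom C g;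
      f \<cdot> a = g \<cdot> b\<rbrakk> \<Longrightarrow> \<exists>h. h \<in> hom C d (Dom C q) \<and> p \<cdot> h = a \<and> q \<cdot> h = b"
    "\<And>d h h'. \<lbrakk>h \<in> Arr C; h' \<in> Arr C; Dom C h = d; Dom C h' = d; Cod C h = Dom C q; Cod C h' = Dom C q;
      p \<cdot> h = p \<cdot> h'; q \<cdot> h = q \<cdot> h'\<rbrakk> \<Longrightarrow> h = h'"
  shows "is_pullback C f g p q"
  unfolding is_pullback_def
proof (intro conjI allI ballI impI)
  fix c a b assume a: "a \<in> hom C c (Dom C f)" and b: "b \<in> hom C c (Dom C g)" and e: "f \<cdot> a = g \<cdot> b"
  obtain h where "h \<in> hom C c (Dom C q) \<and> p \<cdot> h = a \<and> q \<cdot> h = b"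
    using assms(10)[of a b] a b e by auto
  then show "\<exists>!h. h \<in> hom C c (Dom C p) \<and> p \<cdot> h = a \<and> q \<cdot> h = b"
    using assms(6,11) a b by (intro ex1I[of _ h]) auto
qed (use assms in auto)

lemma pullback_simps:
  assumes "is_pullback C f g p q"
  shows "f \<in> Arr C" "g \<in> Arr C" "p \<in> Arr C" "q \<in> Arr C" "Cod C f = Cod C g"
    "Dom C p = Dom C q" "Cod C p = Dom C f" "Cod C q = Dom C g" "f \<cdot> p = g \<cdot> q"
  using assms unfolding is_pullback_def by auto

lemma pullback_swap:
  assumes pb: "is_pullback C f g p q"
  shows "is_pullback C g f q p"
proof -
  note [simp] = pullback_simps[OF pb]
  show ?thesis
  proof (rule pullbackI)
    fix d a b assume *: "a \<in> Arr C" "b \<in> Arr C" "Dom C a = d" "Dom C b = d" "Cod C a = Dom C g"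
      "Cod C b = Dom C f" "g \<cdot> a = f \<cdot> b"
    show "\<exists>h. h \<in> hom C d (Dom C p) \<and> q \<cdot> h = a \<and> p \<cdot> h = b"
      using pullback_lift[OF pb, of b a] * by auto
  next
    fix d h h' assume "h \<in> Arr C" "h' \<in> Arr C" "Dom C h = d" "Dom C h' = d" "Cod C h = Dom C p"
      "Cod C h' = Dom C p" "q \<cdot> h = q \<cdot> h'" "p \<cdot> h = p \<cdot> h'"
    then show "h = h'" using pullback_ext[OF pb, of h h'] by simp
  qed auto
qed

text \<open>The two squares share the edge \<open>q\<^sub>1\<close>. Read as naturality squares,
  they compose cartesian transformations: the components \<open>g\<close> and \<open>p\<close> are
  multiplied, while the opposite edges \<open>f\<close> and \<open>q\<^sub>2\<close> are the images
  of one arrow under the outer functors.\<close>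

lemma pullback_paste:
  assumes pb1: "is_pullback C f g\<^sub>1 p\<^sub>1 q\<^sub>1" and pb2: "is_pullback C q\<^sub>1 g\<^sub>2 p\<^sub>2 q\<^sub>2"
  shows "is_pullback C f (g\<^sub>1 \<cdot> g\<^sub>2) (p\<^sub>1 \<cdot> p\<^sub>2) q\<^sub>2"
proof -
  note [simp] = pullback_simps(1-4,6-8)[OF pb1] pullback_simps(1-4,6-7)[OF pb2]
  have [simp]: "Cod C g\<^sub>2 = Dom C g\<^sub>1" "Cod C q\<^sub>2 = Dom C g\<^sub>2" "Cod C g\<^sub>1 = Cod C f"
    using pullback_simps[OF pb1] pullback_simps[OF pb2] by auto
  have eq: "f \<cdot> p\<^sub>1 = g\<^sub>1 \<cdot> q\<^sub>1" "q\<^sub>1 \<cdot> p\<^sub>2 = g\<^sub>2 \<cdot> q\<^sub>2" using pullback_simps(9) pb1 pb2 by auto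
  show ?thesis
  proof (rule pullbackI)
    show "f \<cdot> (p\<^sub>1 \<cdot> p\<^sub>2) = (g\<^sub>1 \<cdot> g\<^sub>2) \<cdot> q\<^sub>2"
      using comp_eq[OF eq(1), of p\<^sub>2] comp_assoc[of q\<^sub>2 g\<^sub>2 g\<^sub>1] comp_assoc[of p\<^sub>2 q\<^sub>1 g\<^sub>1] eq(2) by simp
    fix d a b assume *: "a \<in> Arr C" "b \<in> Arr C" "Dom C a = d" "Dom C b = d" "Cod C a = Dom C f"
      "Cod C b = Dom C (g\<^sub>1 \<cdot> g\<^sub>2)" "f \<cdot> a = (g\<^sub>1 \<cdot> g\<^sub>2) \<cdot> b"
    obtain k where k: "k \<in> Arr C" "Dom C k = d" "Cod C k = Dom C p\<^sub>1" "p\<^sub>1 \<cdot> k = a" "q\<^sub>1 \<cdot> k = g\<^sub>2 \<cdot> b"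
      using pullback_lift[OF pb1, of a "g\<^sub>2 \<cdot> b"] * by auto
    obtain l where l: "l \<in> Arr C" "Dom C l = d" "Cod C l = Dom C p\<^sub>2" "p\<^sub>2 \<cdot> l = k" "q\<^sub>2 \<cdot> l = b"
      using pullback_lift[OF pb2, of k b] * k by auto
    then show "\<exists>h. h \<in> hom C d (Dom C q\<^sub>2) \<and> (p\<^sub>1 \<cdot> p\<^sub>2) \<cdot> h = a \<and> q\<^sub>2 \<cdot> h = b"
      using * k by (intro exI[of _ l]) auto
  next
    fix d h h' assume *: "h \<in> Arr C" "h' \<in> Arr C" "Dom C h = d" "Dom C h' = d" "Cod C h = Dom C q\<^sub>2"
      "Cod C h' = Dom C q\<^sub>2" "(p\<^sub>1 \<cdot> p\<^sub>2) \<cdot> h = (p\<^sub>1 \<cdot> p\<^sub>2) \<cdot> h'" "q\<^sub>2 \<cdot> h = q\<^sub>2 \<cdot> h'"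
    have "q\<^sub>1 \<cdot> (p\<^sub>2 \<cdot> h) = q\<^sub>1 \<cdot> (p\<^sub>2 \<cdot> h')"
      using *(1-7) comp_eq[OF eq(2), of h] comp_eq[OF eq(2), of h'] *(8) by simp
    note prev = this
    have "p\<^sub>2 \<cdot> h = p\<^sub>2 \<cdot> h'" by (rule pullback_ext[OF pb1, of _ _ d]) (use * prev in auto)
    note prev = this
    show "h = h'" by (rule pullback_ext[OF pb2, of _ _ d]) (use prev * in auto)
  qed auto
qed

text \<open>The other half of the pasting law. A competitor for the inner square becomes one for the
  rectangle after composing with \<open>p\<^sub>1\<close>, and the square \<open>pb1\<close> shows
  that the lift found there is right.\<close>

lemma pullback_cancel:
  assumes pb1: "is_pullback C f g\<^sub>1 p\<^sub>1 q\<^sub>1" and pb: "is_pullback C f (g\<^sub>1 \<cdot> g\<^sub>2) (p\<^sub>1 \<cdot> p\<^sub>2) q\<^sub>2"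
    and [simp]: "g\<^sub>2 \<in> Arr C" "p\<^sub>2 \<in> Arr C" "Cod C g\<^sub>2 = Dom C g\<^sub>1" "Cod C p\<^sub>2 = Dom C p\<^sub>1"
    and eq2: "q\<^sub>1 \<cdot> p\<^sub>2 = g\<^sub>2 \<cdot> q\<^sub>2"
  shows "is_pullback C q\<^sub>1 g\<^sub>2 p\<^sub>2 q\<^sub>2"
proof -
  note [simp] = pullback_simps(1-8)[OF pb1]
  note 1 = pullback_simps(1-8)[OF pb]
  have [simp]: "q\<^sub>2 \<in> Arr C" "Dom C q\<^sub>2 = Dom C p\<^sub>2" "Cod C q\<^sub>2 = Dom C g\<^sub>2" using 1 by auto
  have eq: "f \<cdot> p\<^sub>1 = g\<^sub>1 \<cdot> q\<^sub>1" using pullback_simps(9) pb1 by auto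
  show ?thesis
  proof (rule pullbackI)
    fix d a b assume *: "a \<in> Arr C" "b \<in> Arr C" "Dom C a = d" "Dom C b = d" "Cod C a = Dom C q\<^sub>1"
      "Cod C b = Dom C g\<^sub>2" "q\<^sub>1 \<cdot> a = g\<^sub>2 \<cdot> b"
    have "f \<cdot> (p\<^sub>1 \<cdot> a) = (g\<^sub>1 \<cdot> g\<^sub>2) \<cdot> b" using comp_eq[OF eq, of a] * by simp
    then obtain l where l: "l \<in> Arr C" "Dom C l = d" "Cod C l = Dom C p\<^sub>2"
        "(p\<^sub>1 \<cdot> p\<^sub>2) \<cdot> l = p\<^sub>1 \<cdot> a" "q\<^sub>2 \<cdot> l = b"
      using pullback_lift[OF pb, of "p\<^sub>1 \<cdot> a" b] * by auto
    have "p\<^sub>2 \<cdot> l = a" by (rule pullback_ext[OF pb1, of _ _ d]) (use l * comp_eq[OF eq2, of l] in auto)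
    then show "\<exists>h. h \<in> hom C d (Dom C q\<^sub>2) \<and> p\<^sub>2 \<cdot> h = a \<and> q\<^sub>2 \<cdot> h = b" using * l by (intro exI[of _ l]) auto
  next
    fix d h h' assume *: "h \<in> Arr C" "h' \<in> Arr C" "Dom C h = d" "Dom C h' = d" "Cod C h = Dom C q\<^sub>2"
      "Cod C h' = Dom C q\<^sub>2" "p\<^sub>2 \<cdot> h = p\<^sub>2 \<cdot> h'" "q\<^sub>2 \<cdot> h = q\<^sub>2 \<cdot> h'"
    show "h = h'" by (rule pullback_ext[OF pb, of _ _ d]) (use * in auto)
  qed (use eq2 in auto)
qed

lemma pullback_iso:
  assumes pb: "is_pullback C f g p q" and k: "k \<in> hom C r (Dom C p)" "l \<in> hom C (Dom C p) r"
    "k \<cdot> l = Ide C (Dom C p)" "l \<cdot> k = Ide C r"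
  shows "is_pullback C f g (p \<cdot> k) (q \<cdot> k)"
proof -
  note [simp] = pullback_simps(1-8)[OF pb]
  note eq = pullback_simps(9)[OF pb]
  show ?thesis
  proof (rule pullbackI)
    show "f \<cdot> (p \<cdot> k) = g \<cdot> (q \<cdot> k)" using k comp_eq[OF eq, of k] by simp
    fix d a b assume *: "a \<in> Arr C" "b \<in> Arr C" "Dom C a = d" "Dom C b = d" "Cod C a = Dom C f"
      "Cod C b = Dom C g" "f \<cdot> a = g \<cdot> b"
    obtain h where h: "h \<in> Arr C" "Dom C h = d" "Cod C h = Dom C p" "p \<cdot> h = a" "q \<cdot> h = b"
      using pullback_lift[OF pb, of a b] * by auto
    then have "k \<cdot> (l \<cdot> h) = h" using k comp_eq[OF k(3), of h] by simp
    then show "\<exists>h. h \<in> hom C d (Dom C (q \<cdot> k)) \<and> (p \<cdot> k) \<cdot> h = a \<and> (q \<cdot> k) \<cdot> h = b"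
      using * k h by (intro exI[of _ "l \<cdot> h"]) auto
  next
    fix d h h' assume *: "h \<in> Arr C" "h' \<in> Arr C" "Dom C h = d" "Dom C h' = d" "Cod C h = Dom C (q \<cdot> k)"
      "Cod C h' = Dom C (q \<cdot> k)" "(p \<cdot> k) \<cdot> h = (p \<cdot> k) \<cdot> h'" "(q \<cdot> k) \<cdot> h = (q \<cdot> k) \<cdot> h'"
    have "k \<cdot> h = k \<cdot> h'" by (rule pullback_ext[OF pb, of _ _ d]) (use * k in auto)
    then have "l \<cdot> (k \<cdot> h) = l \<cdot> (k \<cdot> h')" by simp
    then show "h = h'" using * k comp_eq[OF k(4)] by auto
  qed (use k in auto)
qed

lemma pullback_unique:
  assumes pb: "is_pullback C f g p q" and pb': "is_pullback C f g p' q'"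
  obtains k l where "k \<in> hom C (Dom C p') (Dom C p)" "l \<in> hom C (Dom C p) (Dom C p')"
    "k \<cdot> l = Ide C (Dom C p)" "l \<cdot> k = Ide C (Dom C p')" "p \<cdot> k = p'" "q \<cdot> k = q'"
proof -
  note [simp] = pullback_simps(1-8)[OF pb] pullback_simps(1-8)[OF pb']
  note eq = pullback_simps(9)[OF pb] pullback_simps(9)[OF pb']
  obtain k where k: "k \<in> Arr C" "Dom C k = Dom C p'" "Cod C k = Dom C p" "p \<cdot> k = p'" "q \<cdot> k = q'"
    using pullback_lift[OF pb, of p' q'] eq by auto
  obtain l where l: "l \<in> Arr C" "Dom C l = Dom C p" "Cod C l = Dom C p'" "p' \<cdot> l = p" "q' \<cdot> l = q"
    using pullback_lift[OF pb', of p q] eq by auto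
  have "k \<cdot> l = Ide C (Dom C p)"
    by (rule pullback_ext[OF pb]) (use k l comp_eq[OF k(4), of l] comp_eq[OF k(5), of l] in auto)
  moreover have "l \<cdot> k = Ide C (Dom C p')" by (rule pullback_ext[OF pb']) (use k l comp_eq[OF l(4), of k] comp_eq[OF l(5), of k] in auto)
  ultimately show ?thesis using that[of k l] k l by auto
qed

end

section \<open>Change of index set, and the chosen products and coproducts\<close>

lemma coproduct_cong:
  assumes "\<And>i. i \<in> I \<Longrightarrow> X i = X' i" "\<And>i. i \<in> I \<Longrightarrow> \<iota> i = \<iota>' i"
  shows "is_coproduct C I X s \<iota> \<longleftrightarrow> is_coproduct C I X' s \<iota>'"
  using assms unfolding is_coproduct_def by (simp cong: ball_cong)

text \<open>Smallness speaks of sets of elements of \<open>'u\<close> only, whereas paths and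
  natural numbers live in other types. Renaming indices along an injection carries coproducts
  between the two.\<close>

lemma coproduct_reindex:
  fixes C :: "('o, 'm) category" (structure) and \<sigma> :: "'i \<Rightarrow> 'j"
  assumes "inj_on \<sigma> I"
  shows "is_coproduct C (\<sigma> ` I) X s \<iota> \<longleftrightarrow> is_coproduct C I (\<lambda>i. X (\<sigma> i)) s (\<lambda>i. \<iota> (\<sigma> i))"
    (is "?L \<longleftrightarrow> ?R")
proof -
  \<comment> \<open>Every family on \<open>I\<close> agrees on \<open>I\<close> with one of the form
    \<open>f (\<sigma> i)\<close>, so quantifying over families on the image amounts to quantifying
    over families on \<open>I\<close>.\<close>
  have "(\<forall>f. P (\<lambda>i. f (\<sigma> i))) \<longleftrightarrow> (\<forall>f. P f)" if "\<And>f g. \<forall>i\<in>I. f i = g i \<Longrightarrow> P f \<Longrightarrow> P g" for P :: "('i \<Rightarrow> 'm) \<Rightarrow> bool"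
  proof (intro iffI allI)
    fix f assume "\<forall>f. P (\<lambda>i. f (\<sigma> i))"
    then have "P (\<lambda>i. f (inv_into I \<sigma> (\<sigma> i)))" by (rule allE[of _ "\<lambda>j. f (inv_into I \<sigma> j)"])
    moreover have "\<forall>i\<in>I. f (inv_into I \<sigma> (\<sigma> i)) = f i" using assms by simp
    ultimately show "P f" using that[of "\<lambda>i. f (inv_into I \<sigma> (\<sigma> i))" f] by simp
  qed simp
  from this[of "\<lambda>f. (\<forall>i\<in>I. f i \<in> hom C (X (\<sigma> i)) c) \<longrightarrow>
        (\<exists>!h. h \<in> hom C s c \<and> (\<forall>i\<in>I. h \<cdot> \<iota> (\<sigma> i) = f i))" for c]
  have "(\<forall>f. (\<forall>i\<in>I. f (\<sigma> i) \<in> hom C (X (\<sigma> i)) c) \<longrightarrow>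
        (\<exists>!h. h \<in> hom C s c \<and> (\<forall>i\<in>I. h \<cdot> \<iota> (\<sigma> i) = f (\<sigma> i)))) \<longleftrightarrow>
     (\<forall>f. (\<forall>i\<in>I. f i \<in> hom C (X (\<sigma> i)) c) \<longrightarrow>
        (\<exists>!h. h \<in> hom C s c \<and> (\<forall>i\<in>I. h \<cdot> \<iota> (\<sigma> i) = f i)))" for c
    by (simp cong: ball_cong)
  then show ?thesis unfolding is_coproduct_def ball_simps(9) by (simp only: bex_simps ball_simps)
qed

text \<open>The form for a family that is given on \<open>I\<close> and has to be spread over the
  image.\<close>

lemma coproduct_reindex_inv:
  assumes "inj_on \<sigma> I"
  shows "is_coproduct C (\<sigma> ` I) (\<lambda>j. X (inv_into I \<sigma> j)) s (\<lambda>j. \<iota> (inv_into I \<sigma> j)) \<longleftrightarrow> is_coproduct C I X s \<iota>"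
  unfolding coproduct_reindex[OF assms] by (rule coproduct_cong) (use assms in auto)

lemma Coprod_is_coproduct:
  "is_coproduct C I X s \<iota> \<Longrightarrow> is_coproduct C I X (Coprod C I X) (coproj C I X)"
  unfolding Coprod_def coproj_def
  by (rule someI2[of "\<lambda>(s, \<iota>). is_coproduct C I X s \<iota>" "(s, \<iota>)"]) auto

lemma Prod_is_product:
  "is_product C I X p \<pi> \<Longrightarrow> is_product C I X (Prod C I X) (proj C I X)"
  unfolding Prod_def proj_def
  by (rule someI2[of "\<lambda>(s, \<iota>). is_product C I X s \<iota>" "(p, \<pi>)"]) auto

lemma Coprod_cong:
  assumes "\<And>i. i \<in> I \<Longrightarrow> X i = Y i"
  shows "Coprod C I X = Coprod C I Y" "coproj C I X = coproj C I Y"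
proof -
  have "is_coproduct C I X = is_coproduct C I Y" by (intro ext coproduct_cong assms) auto
  then show "Coprod C I X = Coprod C I Y" "coproj C I X = coproj C I Y"
    by (auto simp: Coprod_def coproj_def)
qed

lemma Prod_cong:
  assumes "\<And>i. i \<in> I \<Longrightarrow> X i = Y i"
  shows "Prod C I X = Prod C I Y" "proj C I X = proj C I Y"
proof -
  have "is_product C I X = is_product C I Y"
    using assms by (intro ext) (simp add: is_product_def cong: ball_cong)
  then show "Prod C I X = Prod C I Y" "proj C I X = proj C I Y"
    by (auto simp: Prod_def proj_def)
qed

section \<open>Functors and adjunctions\<close>

lemma functor_cat: assumes "is_functor C D F" shows "cat C" "cat D"
  using assms by (auto simp: is_functor_def cat_def)

lemma functor_simps:
  assumes "is_functor C D F"
  shows "\<And>a. a \<in> Obj C \<Longrightarrow> fob F a \<in> Obj D"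
    "\<And>f. f \<in> Arr C \<Longrightarrow> far F f \<in> Arr D"
    "\<And>f. f \<in> Arr C \<Longrightarrow> Dom D (far F f) = fob F (Dom C f)"
    "\<And>f. f \<in> Arr C \<Longrightarrow> Cod D (far F f) = fob F (Cod C f)"
    "\<And>a. a \<in> Obj C \<Longrightarrow> far F (Ide C a) = Ide D (fob F a)"
    "\<And>f g. \<lbrakk>f \<in> Arr C; g \<in> Arr C; Dom C g = Cod C f\<rbrakk> \<Longrightarrow> far F (g \<cdot>\<^bsub>C\<^esub> f) = far F g \<cdot>\<^bsub>D\<^esub> far F f"
  using assms by (auto simp: is_functor_def)

lemma id_functor_simps [simp]: "fob id_functor a = a" "far id_functor f = f"
  by (auto simp: id_functor_def)

lemma comp_functor_simps [simp]:
  "fob (comp_functor G F) a = fob G (fob F a)" "far (comp_functor G F) f = far G (far F f)"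
  by (auto simp: comp_functor_def)

lemma id_functor_is: "cat C \<Longrightarrow> is_functor C C id_functor"
  using cat.comp_simps[of C] cat.Dom_Obj[of C] cat.Cod_Obj[of C] by (auto simp: is_functor_def cat_def)

lemma comp_functor_is:
  assumes "is_functor C D F" "is_functor D E G"
  shows "is_functor C E (comp_functor G F)"
proof -
  interpret C: cat C using functor_cat assms by blast
  show ?thesis
    using assms functor_simps[OF assms(1)] functor_simps[OF assms(2)]
    unfolding is_functor_def by simp
qed

lemma nat_trans_simps:
  assumes "nat_trans C D F G \<alpha>"
  shows "\<And>a. a \<in> Obj C \<Longrightarrow> \<alpha> a \<in> Arr D" "\<And>a. a \<in> Obj C \<Longrightarrow> Dom D (\<alpha> a) = fob F a"
    "\<And>a. a \<in> Obj C \<Longrightarrow> Cod D (\<alpha> a) = fob G a"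
  using assms by (auto simp: nat_trans_def)

lemma nat_trans_nat:
  assumes "nat_trans C D F G \<alpha>" "f \<in> Arr C"
  shows "far G f \<cdot>\<^bsub>D\<^esub> \<alpha> (Dom C f) = \<alpha> (Cod C f) \<cdot>\<^bsub>D\<^esub> far F f"
  using assms by (auto simp: nat_trans_def)

text \<open>Unit, counit and triangle identities are taken as primitive, because
  \<open>comp_adj\<close> and \<open>Gph_adj\<close> are given by exactly these data.\<close>

definition is_adjunction ::
    "('o, 'm) category \<Rightarrow> ('p, 'q) category \<Rightarrow> ('o, 'm, 'p, 'q) adjunction \<Rightarrow> bool" where
  "is_adjunction C D a \<longleftrightarrow> is_functor C D (ladj a) \<and> is_functor D C (radj a) \<and>
     nat_trans C C id_functor (comp_functor (radj a) (ladj a)) (unit a) \<and>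
     nat_trans D D (comp_functor (ladj a) (radj a)) id_functor (counit a) \<and>
     (\<forall>c\<in>Obj C. counit a (fob (ladj a) c) \<cdot>\<^bsub>D\<^esub> far (ladj a) (unit a c) = Ide D (fob (ladj a) c)) \<and>
     (\<forall>d\<in>Obj D. far (radj a) (counit a d) \<cdot>\<^bsub>C\<^esub> unit a (fob (radj a) d) = Ide C (fob (radj a) d))"

locale adj =
  fixes C :: "('o, 'm) category" (structure) and D :: "('p, 'q) category" and a :: "('o, 'm, 'p, 'q) adjunction"
  assumes adj: "is_adjunction C D a"
begin

abbreviation "L \<equiv> ladj a"
abbreviation "R \<equiv> radj a"
abbreviation "\<eta> \<equiv> unit a"
abbreviation "\<epsilon> \<equiv> counit a"

lemma L_functor: "is_functor C D L" and R_functor: "is_functor D C R"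
  and unit_nat: "nat_trans C C id_functor (comp_functor R L) \<eta>"
  and counit_nat: "nat_trans D D (comp_functor L R) id_functor \<epsilon>"
  and triangle_L: "c \<in> Obj C \<Longrightarrow> \<epsilon> (fob L c) \<cdot>\<^bsub>D\<^esub> far L (\<eta> c) = Ide D (fob L c)"
  and triangle_R: "d \<in> Obj D \<Longrightarrow> far R (\<epsilon> d) \<cdot> \<eta> (fob R d) = Ide C (fob R d)"
  using adj by (auto simp: is_adjunction_def)

sublocale C: cat C + D: cat D
  using functor_cat L_functor by blast+

lemmas L_simps [simp] = functor_simps[OF L_functor]
lemmas R_simps [simp] = functor_simps[OF R_functor]
lemmas unit_simps [simp] = nat_trans_simps[OF unit_nat, simplified]
lemmas counit_simps [simp] = nat_trans_simps[OF counit_nat, simplified]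

lemma unit_natural: "f \<in> Arr C \<Longrightarrow> far R (far L f) \<cdot> \<eta> (Dom C f) = \<eta> (Cod C f) \<cdot> f"
  using nat_trans_nat[OF unit_nat] by simp

lemma counit_natural: "f \<in> Arr D \<Longrightarrow> f \<cdot>\<^bsub>D\<^esub> \<epsilon> (Dom D f) = \<epsilon> (Cod D f) \<cdot>\<^bsub>D\<^esub> far L (far R f)"
  using nat_trans_nat[OF counit_nat] by simp

text \<open>The two transposes of the adjunction: \<phi> turns an arrow out of
  \<open>fob L c\<close> into one out of \<open>c\<close>, and \<psi> goes back.\<close>

definition "\<phi> c h = far R h \<cdot> \<eta> c"
definition "\<psi> d f = \<epsilon> d \<cdot>\<^bsub>D\<^esub> far L f"

lemma psi_simps [simp]:
  "\<lbrakk>f \<in> Arr C; d \<in> Obj D; Cod C f = fob R d\<rbrakk> \<Longrightarrow> \<psi> d f \<in> Arr D"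
  "\<lbrakk>f \<in> Arr C; d \<in> Obj D; Cod C f = fob R d\<rbrakk> \<Longrightarrow> Dom D (\<psi> d f) = fob L (Dom C f)"
  "\<lbrakk>f \<in> Arr C; d \<in> Obj D; Cod C f = fob R d\<rbrakk> \<Longrightarrow> Cod D (\<psi> d f) = d"
  by (auto simp: \<psi>_def)

lemma phi_simps [simp]:
  "\<lbrakk>h \<in> Arr D; c \<in> Obj C; Dom D h = fob L c\<rbrakk> \<Longrightarrow> \<phi> c h \<in> Arr C"
  "\<lbrakk>h \<in> Arr D; c \<in> Obj C; Dom D h = fob L c\<rbrakk> \<Longrightarrow> Dom C (\<phi> c h) = c"
  "\<lbrakk>h \<in> Arr D; c \<in> Obj C; Dom D h = fob L c\<rbrakk> \<Longrightarrow> Cod C (\<phi> c h) = fob R (Cod D h)"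
  by (auto simp: \<phi>_def)

lemma phi_psi:
  assumes "f \<in> Arr C" "d \<in> Obj D" "Cod C f = fob R d"
  shows "\<phi> (Dom C f) (\<psi> d f) = f"
proof -
  have "\<phi> (Dom C f) (\<psi> d f) = far R (\<epsilon> d) \<cdot> (far R (far L f) \<cdot> \<eta> (Dom C f))"
    using assms by (simp add: \<phi>_def \<psi>_def)
  also have "\<dots> = far R (\<epsilon> d) \<cdot> (\<eta> (fob R d) \<cdot> f)"
    using assms unit_natural[of f] by simp
  also have "\<dots> = f" using assms C.comp_eq[OF triangle_R, of d f] by simp
  finally show ?thesis .
qed

lemma psi_phi:
  assumes "h \<in> Arr D" "c \<in> Obj C" "Dom D h = fob L c"
  shows "\<psi> (Cod D h) (\<phi> c h) = h"
proof -
  have "\<psi> (Cod D h) (\<phi> c h) = (\<epsilon> (Cod D h) \<cdot>\<^bsub>D\<^esub> far L (far R h)) \<cdot>\<^bsub>D\<^esub> far L (\<eta> c)"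
    using assms by (simp add: \<phi>_def \<psi>_def)
  also have "\<dots> = (h \<cdot>\<^bsub>D\<^esub> \<epsilon> (fob L c)) \<cdot>\<^bsub>D\<^esub> far L (\<eta> c)"
    using assms counit_natural[of h] by simp
  also have "\<dots> = h" using assms triangle_L[of c] by simp
  finally show ?thesis .
qed

lemma psi_comp:
  assumes "f \<in> Arr C" "d \<in> Obj D" "Cod C f = fob R d" "e \<in> Arr C" "Cod C e = Dom C f"
  shows "\<psi> d (f \<cdot> e) = \<psi> d f \<cdot>\<^bsub>D\<^esub> far L e"
  using assms by (simp add: \<psi>_def)

lemma phi_comp:
  assumes "h \<in> Arr D" "c \<in> Obj C" "Dom D h = fob L c" "k \<in> Arr D" "Dom D k = Cod D h"
  shows "\<phi> c (k \<cdot>\<^bsub>D\<^esub> h) = far R k \<cdot> \<phi> c h"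
  using assms by (simp add: \<phi>_def)

lemma psi_far:
  assumes "f \<in> Arr C" "k \<in> Arr D" "Cod C f = fob R (Dom D k)"
  shows "\<psi> (Cod D k) (far R k \<cdot> f) = k \<cdot>\<^bsub>D\<^esub> \<psi> (Dom D k) f"
  using assms D.comp_eq[OF counit_natural[of k], of "far L f"] by (simp add: \<psi>_def)

lemma phi_far:
  assumes "h \<in> Arr D" "e \<in> Arr C" "Dom D h = fob L (Cod C e)"
  shows "\<phi> (Dom C e) (h \<cdot>\<^bsub>D\<^esub> far L e) = \<phi> (Cod C e) h \<cdot> e"
  using assms unit_natural[of e] by (simp add: \<phi>_def)

text \<open>Transposing by \<psi> turns a cone over the image of a cospan into a cone over the
  cospan itself, where the universal property is at hand.\<close>

lemma radj_preserves_pullbacks: "preserves_pullbacks D C R"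
  unfolding preserves_pullbacks_def
proof (intro allI impI)
  fix f g p q assume pb: "is_pullback D f g p q"
  note [simp] = D.pullback_simps(1-8)[OF pb]
  note eq = D.pullback_simps(9)[OF pb]
  show "is_pullback C (far R f) (far R g) (far R p) (far R q)"
  proof (rule C.pullbackI)
    show "far R f \<cdot> far R p = far R g \<cdot> far R q"
      using R_simps(6)[of p f] R_simps(6)[of q g] eq by simp
    fix d u v assume *: "u \<in> Arr C" "v \<in> Arr C" "Dom C u = d" "Dom C v = d" "Cod C u = Dom C (far R f)"
      "Cod C v = Dom C (far R g)" "far R f \<cdot> u = far R g \<cdot> v"
    have "f \<cdot>\<^bsub>D\<^esub> \<psi> (Dom D f) u = g \<cdot>\<^bsub>D\<^esub> \<psi> (Dom D g) v"
      using psi_far[of u f] psi_far[of v g] * by simp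
    then obtain h where h: "h \<in> Arr D" "Dom D h = fob L d" "Cod D h = Dom D p"
       "p \<cdot>\<^bsub>D\<^esub> h = \<psi> (Dom D f) u" "q \<cdot>\<^bsub>D\<^esub> h = \<psi> (Dom D g) v"
      using D.pullback_lift[OF pb, of "\<psi> (Dom D f) u" "\<psi> (Dom D g) v"] * by auto
    show "\<exists>h. h \<in> hom C d (Dom C (far R q)) \<and> far R p \<cdot> h = u \<and> far R q \<cdot> h = v"
      using h phi_comp[of h d p] phi_comp[of h d q] * phi_psi[of u "Dom D f"] phi_psi[of v "Dom D g"]
      by (intro exI[of _ "\<phi> d h"]) auto
  next
    fix d h h' assume *: "h \<in> Arr C" "h' \<in> Arr C" "Dom C h = d" "Dom C h' = d" "Cod C h = Dom C (far R q)"
      "Cod C h' = Dom C (far R q)" "far R p \<cdot> h = far R p \<cdot> h'" "far R q \<cdot> h = far R q \<cdot> h'"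
    have "\<psi> (Dom D p) h = \<psi> (Dom D p) h'"
      by (rule D.pullback_ext[OF pb, of _ _ "fob L d"]) (use * psi_far[of h p] psi_far[of h' p] psi_far[of h q] psi_far[of h' q] in auto)
    then show "h = h'" using * phi_psi[of h "Dom D p"] phi_psi[of h' "Dom D p"] by simp
  qed auto
qed

text \<open>Dual to the argument for pullbacks: cocones are transposed by \<phi>.\<close>

lemma ladj_preserves_coproducts:
  assumes s: "is_coproduct C I X s \<iota>"
  shows "is_coproduct D I (\<lambda>i. fob L (X i)) (fob L s) (\<lambda>i. far L (\<iota> i))"
  unfolding is_coproduct_def
proof (intro conjI ballI allI impI)
  note [simp] = C.coproduct_simps[OF s]
  show "fob L s \<in> Obj D" by simp
  show "far L (\<iota> i) \<in> hom D (fob L (X i)) (fob L s)" if "i \<in> I" for i using that by simp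
  fix d f assume d: "d \<in> Obj D" and f: "\<forall>i\<in>I. f i \<in> hom D (fob L (X i)) d"
  obtain h where h: "h \<in> Arr C" "Dom C h = s" "Cod C h = fob R d" "\<And>i. i \<in> I \<Longrightarrow> h \<cdot> \<iota> i = \<phi> (X i) (f i)"
    using C.coproduct_copair[OF s, of "fob R d" "\<lambda>i. \<phi> (X i) (f i)"] d f by auto
  have 1: "\<psi> d h \<cdot>\<^bsub>D\<^esub> far L (\<iota> i) = f i" if "i \<in> I" for i
    using psi_comp[of h d "\<iota> i"] h d f that psi_phi[of "f i" "X i"] by simp
  show "\<exists>!h. h \<in> hom D (fob L s) d \<and> (\<forall>i\<in>I. h \<cdot>\<^bsub>D\<^esub> far L (\<iota> i) = f i)"
  proof (rule ex1I[of _ "\<psi> d h"])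
    show "\<psi> d h \<in> hom D (fob L s) d \<and> (\<forall>i\<in>I. \<psi> d h \<cdot>\<^bsub>D\<^esub> far L (\<iota> i) = f i)"
      using 1 h d by simp
    fix h' assume h': "h' \<in> hom D (fob L s) d \<and> (\<forall>i\<in>I. h' \<cdot>\<^bsub>D\<^esub> far L (\<iota> i) = f i)"
    have "\<phi> s h' = h"
    proof (rule C.coproduct_ext[OF s])
      fix i assume i: "i \<in> I"
      then show "\<phi> s h' \<cdot> \<iota> i = h \<cdot> \<iota> i" using h h' phi_far[of h' "\<iota> i"] by simp
    qed (use h h' in auto)
    then show "h' = \<psi> d h" using h' psi_phi[of h' s] by auto
  qed
qed

lemma generated_monad_is_monad: "is_monad C (generated_monad a)"
proof -
  have T: "is_functor C C (comp_functor R L)" using L_functor R_functor by (rule comp_functor_is)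
  have TT: "is_functor C C (comp_functor (comp_functor R L) (comp_functor R L))" using T T by (rule comp_functor_is)
  have "nat_trans C C (comp_functor (comp_functor R L) (comp_functor R L)) (comp_functor R L)
     (\<lambda>c. far R (\<epsilon> (fob L c)))"
    unfolding nat_trans_def
  proof (intro conjI ballI T TT)
    fix f assume f: "f \<in> Arr C"
    have "far R (far L f \<cdot>\<^bsub>D\<^esub> \<epsilon> (fob L (Dom C f))) = far R (\<epsilon> (fob L (Cod C f)) \<cdot>\<^bsub>D\<^esub> far L (far R (far L f)))"
      using counit_natural[of "far L f"] f by simp
    then show "far (comp_functor R L) f \<cdot> far R (\<epsilon> (fob L (Dom C f))) =
      far R (\<epsilon> (fob L (Cod C f))) \<cdot> far (comp_functor (comp_functor R L) (comp_functor R L)) f"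
      using f by simp
  qed auto
  moreover have "far R (\<epsilon> (fob L c)) \<cdot> far R (far L (\<eta> c)) = Ide C (fob R (fob L c))" if "c \<in> Obj C" for c
    using R_simps(6)[of "far L (\<eta> c)" "\<epsilon> (fob L c)"] triangle_L[OF that] that by simp
  moreover have "far R (\<epsilon> (fob L c)) \<cdot> far R (\<epsilon> (fob L (fob R (fob L c)))) =
       far R (\<epsilon> (fob L c)) \<cdot> far R (far L (far R (\<epsilon> (fob L c))))" if "c \<in> Obj C" for c
    using arg_cong[where f="far R", OF counit_natural[of "\<epsilon> (fob L c)"]] that by simp
  ultimately show ?thesis
    unfolding is_monad_def generated_monad_def using T unit_nat triangle_R by simp
qed

end

lemma id_adj_is_adjunction:
  assumes "cat C" shows "is_adjunction C C (id_adj C)"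
proof -
  interpret cat C by fact
  show ?thesis
    using id_functor_is[OF assms] comp_functor_is[OF id_functor_is[OF assms] id_functor_is[OF assms]]
    unfolding is_adjunction_def id_adj_def nat_trans_def by simp
qed

lemma comp_adj_is_adjunction:
  fixes E (structure)
  assumes "is_adjunction C D a" "is_adjunction D E b"
  shows "is_adjunction C E (comp_adj C E a b)"
proof -
  interpret a: adj C D a by unfold_locales fact
  interpret b: adj D E b by unfold_locales fact
  note LF = comp_functor_is[OF a.L_functor b.L_functor] and RF = comp_functor_is[OF b.R_functor a.R_functor]
  show ?thesis
    unfolding is_adjunction_def comp_adj_def nat_trans_def adjunction.simps
  proof (intro conjI ballI LF RF comp_functor_is[OF LF RF] comp_functor_is[OF RF LF] id_functor_is a.C.cat_axioms b.D.cat_axioms)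
    fix f assume f: "f \<in> Arr C"
    have 1: "far a.R (far b.R (far b.L (far a.L f)) \<cdot>\<^bsub>D\<^esub> b.\<eta> (fob a.L (Dom C f))) =
       far a.R (b.\<eta> (fob a.L (Cod C f)) \<cdot>\<^bsub>D\<^esub> far a.L f)"
      using b.unit_natural[of "far a.L f"] f by simp
    have "far a.R (far b.R (far b.L (far a.L f))) \<cdot>\<^bsub>C\<^esub> (far a.R (b.\<eta> (fob a.L (Dom C f))) \<cdot>\<^bsub>C\<^esub> a.\<eta> (Dom C f)) =
       (far a.R (b.\<eta> (fob a.L (Cod C f))) \<cdot>\<^bsub>C\<^esub> far a.R (far a.L f)) \<cdot>\<^bsub>C\<^esub> a.\<eta> (Dom C f)"
      using 1 f a.C.comp_assoc[of "a.\<eta> (Dom C f)" "far a.R (b.\<eta> (fob a.L (Dom C f)))" "far a.R (far b.R (far b.L (far a.L f)))", symmetric] by simp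
    then show "far (comp_functor (comp_functor a.R b.R) (comp_functor b.L a.L)) f \<cdot>\<^bsub>C\<^esub>
         (far a.R (b.\<eta> (fob a.L (Dom C f))) \<cdot>\<^bsub>C\<^esub> a.\<eta> (Dom C f)) =
         (far a.R (b.\<eta> (fob a.L (Cod C f))) \<cdot>\<^bsub>C\<^esub> a.\<eta> (Cod C f)) \<cdot>\<^bsub>C\<^esub> far id_functor f"
      using f a.unit_natural[of f] by simp
  next
    fix f assume f: "f \<in> Arr E"
    have 1: "far b.L (far b.R f \<cdot>\<^bsub>D\<^esub> a.\<epsilon> (fob b.R (Dom E f))) =
       far b.L (a.\<epsilon> (fob b.R (Cod E f)) \<cdot>\<^bsub>D\<^esub> far a.L (far a.R (far b.R f)))"
      using a.counit_natural[of "far b.R f"] f by simp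
    have "f \<cdot> (b.\<epsilon> (Dom E f) \<cdot> far b.L (a.\<epsilon> (fob b.R (Dom E f)))) =
      b.\<epsilon> (Cod E f) \<cdot> (far b.L (far b.R f) \<cdot> far b.L (a.\<epsilon> (fob b.R (Dom E f))))"
      using b.D.comp_eq[OF b.counit_natural[of f], of "far b.L (a.\<epsilon> (fob b.R (Dom E f)))"] f by simp
    also have "\<dots> = b.\<epsilon> (Cod E f) \<cdot> (far b.L (a.\<epsilon> (fob b.R (Cod E f))) \<cdot> far b.L (far a.L (far a.R (far b.R f))))"
      using 1 f by simp
    finally show "far id_functor f \<cdot> (b.\<epsilon> (Dom E f) \<cdot> far b.L (a.\<epsilon> (fob b.R (Dom E f)))) =
      (b.\<epsilon> (Cod E f) \<cdot> far b.L (a.\<epsilon> (fob b.R (Cod E f)))) \<cdot>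
        far (comp_functor (comp_functor b.L a.L) (comp_functor a.R b.R)) f"
      using f by simp
  next
    fix c assume c: "c \<in> Obj C"
    let ?x = "fob a.L c"
    \<comment> \<open>Naturality of the counit of \<open>a\<close> at \<open>b.\<eta> ?x\<close>
      rearranges the middle of the composite; after that the two triangle identities apply one after
      the other.\<close>
    have 1: "far b.L (a.\<epsilon> (fob b.R (fob b.L ?x)) \<cdot>\<^bsub>D\<^esub> far a.L (far a.R (b.\<eta> ?x))) = far b.L (b.\<eta> ?x \<cdot>\<^bsub>D\<^esub> a.\<epsilon> ?x)"
      using a.counit_natural[of "b.\<eta> ?x"] c by simp
    have 2: "far b.L (a.\<epsilon> ?x \<cdot>\<^bsub>D\<^esub> far a.L (a.\<eta> c)) = Ide E (fob b.L ?x)"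
      using a.triangle_L[OF c] c by simp
    have "(b.\<epsilon> (fob b.L ?x) \<cdot> far b.L (a.\<epsilon> (fob b.R (fob b.L ?x)))) \<cdot>
         far b.L (far a.L (far a.R (b.\<eta> ?x) \<cdot>\<^bsub>C\<^esub> a.\<eta> c)) =
      b.\<epsilon> (fob b.L ?x) \<cdot> ((far b.L (a.\<epsilon> (fob b.R (fob b.L ?x))) \<cdot>
         far b.L (far a.L (far a.R (b.\<eta> ?x)))) \<cdot> far b.L (far a.L (a.\<eta> c)))" using c by simp
    also have "\<dots> = b.\<epsilon> (fob b.L ?x) \<cdot> (far b.L (b.\<eta> ?x) \<cdot> (far b.L (a.\<epsilon> ?x) \<cdot> far b.L (far a.L (a.\<eta> c))))"
      using 1 c by simp
    also have "\<dots> = Ide E (fob b.L ?x)" using 2 c b.triangle_L[of ?x] by simp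
    finally show "(b.\<epsilon> (fob (comp_functor b.L a.L) c) \<cdot> far b.L (a.\<epsilon> (fob b.R (fob (comp_functor b.L a.L) c)))) \<cdot>
         far (comp_functor b.L a.L) (far a.R (b.\<eta> (fob a.L c)) \<cdot>\<^bsub>C\<^esub> a.\<eta> c) =
         Ide E (fob (comp_functor b.L a.L) c)" by simp
  next
    fix e assume e: "e \<in> Obj E"
    let ?x = "fob b.R e"
    have 1: "far a.R (far b.R (far b.L (a.\<epsilon> ?x)) \<cdot>\<^bsub>D\<^esub> b.\<eta> (fob a.L (fob a.R ?x))) = far a.R (b.\<eta> ?x \<cdot>\<^bsub>D\<^esub> a.\<epsilon> ?x)"
      using b.unit_natural[of "a.\<epsilon> ?x"] e by simp
    have 2: "far a.R (far b.R (b.\<epsilon> e) \<cdot>\<^bsub>D\<^esub> b.\<eta> ?x) = Ide C (fob a.R ?x)"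
      using b.triangle_R[OF e] e by simp
    have "far a.R (far b.R (b.\<epsilon> e \<cdot> far b.L (a.\<epsilon> ?x))) \<cdot>\<^bsub>C\<^esub> (far a.R (b.\<eta> (fob a.L (fob a.R ?x))) \<cdot>\<^bsub>C\<^esub> a.\<eta> (fob a.R ?x))
      = far a.R (far b.R (b.\<epsilon> e)) \<cdot>\<^bsub>C\<^esub> ((far a.R (far b.R (far b.L (a.\<epsilon> ?x))) \<cdot>\<^bsub>C\<^esub> far a.R (b.\<eta> (fob a.L (fob a.R ?x)))) \<cdot>\<^bsub>C\<^esub> a.\<eta> (fob a.R ?x))"
      using e by simp
    also have "\<dots> = (far a.R (far b.R (b.\<epsilon> e)) \<cdot>\<^bsub>C\<^esub> far a.R (b.\<eta> ?x)) \<cdot>\<^bsub>C\<^esub> (far a.R (a.\<epsilon> ?x) \<cdot>\<^bsub>C\<^esub> a.\<eta> (fob a.R ?x))"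
      using 1 e by simp
    also have "\<dots> = Ide C (fob a.R ?x)" using 2 e a.triangle_R[of ?x] by simp
    finally show "far (comp_functor a.R b.R) (b.\<epsilon> e \<cdot> far b.L (a.\<epsilon> (fob b.R e))) \<cdot>\<^bsub>C\<^esub>
         (far a.R (b.\<eta> (fob a.L (fob (comp_functor a.R b.R) e))) \<cdot>\<^bsub>C\<^esub> a.\<eta> (fob (comp_functor a.R b.R) e)) =
         Ide C (fob (comp_functor a.R b.R) e)" by simp
  qed auto
qed

text \<open>The free functor on arrows and the counit are defined as solutions of a universal
  problem, so what is known of them is an equation after precomposition with the unit.
  Functoriality, naturality of the counit and the triangle identity on the left adjoint follow by
  uniqueness, as both sides have the same transpose.\<close>

lemma adjunction_universal:
  fixes C (structure)
  assumes "cat C" and R: "is_functor D C (radj a)"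
    and Lob: "\<And>c. c \<in> Obj C \<Longrightarrow> fob (ladj a) c \<in> Obj D"
    and eta: "\<And>c. c \<in> Obj C \<Longrightarrow> unit a c \<in> hom C c (fob (radj a) (fob (ladj a) c))"
    and uni: "\<And>c h h'. \<lbrakk>c \<in> Obj C; h \<in> Arr D; h' \<in> Arr D; Dom D h = fob (ladj a) c;
       Dom D h' = fob (ladj a) c; Cod D h = Cod D h';
       far (radj a) h \<cdot> unit a c = far (radj a) h' \<cdot> unit a c\<rbrakk> \<Longrightarrow> h = h'"
    and Lar: "\<And>f. f \<in> Arr C \<Longrightarrow> far (ladj a) f \<in> hom D (fob (ladj a) (Dom C f)) (fob (ladj a) (Cod C f))"
    and Leta: "\<And>f. f \<in> Arr C \<Longrightarrow> far (radj a) (far (ladj a) f) \<cdot> unit a (Dom C f) = unit a (Cod C f) \<cdot> f"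
    and eps: "\<And>d. d \<in> Obj D \<Longrightarrow> counit a d \<in> hom D (fob (ladj a) (fob (radj a) d)) d"
    and eps_eta: "\<And>d. d \<in> Obj D \<Longrightarrow> far (radj a) (counit a d) \<cdot> unit a (fob (radj a) d) = Ide C (fob (radj a) d)"
  shows "is_adjunction C D a"
proof -
  interpret C: cat C by fact
  interpret D: cat D using functor_cat R by blast
  note [simp] = functor_simps[OF R] Lob eta[simplified] Lar[simplified] eps[simplified]
  have L: "is_functor C D (ladj a)"
    unfolding is_functor_def
  proof (intro conjI ballI impI C.is_cat D.is_cat Lob Lar)
    fix c assume c: "c \<in> Obj C"
    show "far (ladj a) (Ide C c) = Ide D (fob (ladj a) c)"
      by (rule uni[OF c]) (use c Leta[of "Ide C c"] in auto)
  next
    fix f g assume *: "f \<in> Arr C" "g \<in> Arr C" "Dom C g = Cod C f"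
    have "far (radj a) (far (ladj a) g) \<cdot> (far (radj a) (far (ladj a) f) \<cdot> unit a (Dom C f)) =
       unit a (Cod C g) \<cdot> (g \<cdot> f)"
      using * Leta[of f] C.comp_eq[OF Leta[of g], of f] by simp
    note 1 = this
    show "far (ladj a) (g \<cdot> f) = far (ladj a) g \<cdot>\<^bsub>D\<^esub> far (ladj a) f"
      by (rule uni[of "Dom C f"]) (use 1 * Leta[of "g \<cdot> f"] in auto)
  qed
  show ?thesis
    unfolding is_adjunction_def nat_trans_def
  proof (intro conjI ballI L R id_functor_is comp_functor_is[OF L R] comp_functor_is[OF R L] C.cat_axioms D.cat_axioms)
    fix f assume f: "f \<in> Arr D"
    have 1: "far (radj a) f \<cdot> (far (radj a) (counit a (Dom D f)) \<cdot> unit a (fob (radj a) (Dom D f))) =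
      (far (radj a) (counit a (Cod D f)) \<cdot> unit a (fob (radj a) (Cod D f))) \<cdot> far (radj a) f"
      using f eps_eta[of "Dom D f"] eps_eta[of "Cod D f"] by (simp del: C.comp_assoc)
    show "far id_functor f \<cdot>\<^bsub>D\<^esub> counit a (Dom D f) = counit a (Cod D f) \<cdot>\<^bsub>D\<^esub> far (comp_functor (ladj a) (radj a)) f"
      by (rule uni[of "fob (radj a) (Dom D f)"]) (use f 1 Leta[of "far (radj a) f"] in auto)
  next
    fix c assume c: "c \<in> Obj C"
    have "far (radj a) (counit a (fob (ladj a) c)) \<cdot> (far (radj a) (far (ladj a) (unit a c)) \<cdot> unit a c) = unit a c"
      using c Leta[of "unit a c"] C.comp_eq[OF eps_eta[of "fob (ladj a) c"], of "unit a c"] by simp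
    note 1 = this
    show "counit a (fob (ladj a) c) \<cdot>\<^bsub>D\<^esub> far (ladj a) (unit a c) = Ide D (fob (ladj a) c)"
      by (rule uni[OF c]) (use c 1 in auto)
  qed (use Leta eps_eta in auto)
qed

text \<open>Preservation need only be checked on one coproduct of the family. For enriched
  categories this will be the explicit disjoint union.\<close>

lemma preserves_coproduct_transfer:
  fixes C (structure)
  assumes F: "is_functor C D F" and s: "is_coproduct C I X s \<iota>" and t: "is_coproduct C I X t \<kappa>"
    and Fs: "is_coproduct D I (\<lambda>i. fob F (X i)) (fob F s) (\<lambda>i. far F (\<iota> i))"
  shows "is_coproduct D I (\<lambda>i. fob F (X i)) (fob F t) (\<lambda>i. far F (\<kappa> i))"
proof -
  interpret C: cat C using functor_cat F by blast
  interpret D: cat D using functor_cat F by blast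
  note [simp] = functor_simps[OF F] C.coproduct_simps[OF s] C.coproduct_simps[OF t]
  obtain k l where kl: "k \<in> hom C s t" "l \<in> hom C t s" "l \<cdot> k = Ide C s" "k \<cdot> l = Ide C t"
    "\<And>i. i \<in> I \<Longrightarrow> k \<cdot> \<iota> i = \<kappa> i"
    using C.coproduct_unique[OF s t] by metis
  have "is_coproduct D I (\<lambda>i. fob F (X i)) (fob F t) (\<lambda>i. far F k \<cdot>\<^bsub>D\<^esub> far F (\<iota> i))"
    by (rule D.coproduct_iso[OF Fs, of _ _ "far F l"])
      (use kl functor_simps(6)[OF F, of k l] functor_simps(6)[OF F, of l k] in auto)
  moreover have "far F k \<cdot>\<^bsub>D\<^esub> far F (\<iota> i) = far F (\<kappa> i)" if "i \<in> I" for i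
    using functor_simps(6)[OF F, of "\<iota> i" k] kl that by simp
  ultimately show ?thesis by (simp cong: coproduct_cong)
qed

section \<open>Smallness\<close>

text \<open>The version up to bijection of \<open>small\<close>, for index sets of any type; lists
  of vertices and natural numbers index the coproducts in a free category.\<close>

definition essentially_small :: "('u \<Rightarrow> 'u set) \<Rightarrow> 'a set \<Rightarrow> bool" where
  "essentially_small elts A \<longleftrightarrow> (\<exists>\<sigma>. inj_on \<sigma> A \<and> small elts (\<sigma> ` A))"

locale universe =
  fixes elts :: "'u \<Rightarrow> 'u set"
  assumes universe: "grothendieck_universe elts"
begin

lemma elts_inj: "inj elts"
  and upair_ex: "\<exists>z. elts z = {x, y}"
  and power_ex: "\<exists>z. elts ` elts z = Pow (elts x)"
  and UN_ex: "\<exists>z. elts z = (\<Union>i\<in>elts x. elts (f i))"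
  and infinite_ex: "\<exists>x. infinite (elts x)"
  using universe by (auto simp: grothendieck_universe_def)

lemma small_subset: assumes "small elts A" "B \<subseteq> A" shows "small elts B"
proof -
  obtain x where x: "A = elts x" using assms by (auto simp: small_def)
  obtain z where z: "elts ` elts z = Pow (elts x)" using power_ex by blast
  have "B \<in> elts ` elts z" using z x assms by simp
  then show ?thesis unfolding small_def by blast
qed

lemma small_UN: assumes "small elts A" "\<And>i. i \<in> A \<Longrightarrow> small elts (B i)" shows "small elts (\<Union>i\<in>A. B i)"
proof -
  obtain x where x: "A = elts x" using assms by (auto simp: small_def)
  have "\<forall>i\<in>A. \<exists>z. B i = elts z" using assms by (auto simp: small_def)
  then obtain f where f: "\<forall>i\<in>A. B i = elts (f i)" by metis
  obtain z where "elts z = (\<Union>i\<in>elts x. elts (f i))" using UN_ex by blast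
  then have "(\<Union>i\<in>A. B i) = elts z" using f x by simp
  then show ?thesis by (auto simp: small_def)
qed

lemma small_singleton: "small elts {x}"
  using upair_ex[of x x] by (auto simp: small_def)

lemma small_image: assumes "small elts A" shows "small elts (f ` A)"
proof -
  have "f ` A = (\<Union>i\<in>A. {f i})" by auto
  then show ?thesis using small_UN[OF assms small_singleton] by simp
qed

definition upair :: "'u \<Rightarrow> 'u \<Rightarrow> 'u" where "upair x y = (SOME z. elts z = {x, y})"

lemma elts_upair: "elts (upair x y) = {x, y}"
  unfolding upair_def by (rule someI_ex) (rule upair_ex)

text \<open>Kuratowski pairs inside the universe. The object set of a graph consists of elements of
  \<open>'u\<close>, so products and disjoint unions of such sets have to be coded.\<close>

definition code :: "'u \<times> 'u \<Rightarrow> 'u" where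
  "code p = upair (upair (fst p) (fst p)) (upair (fst p) (snd p))"

lemma upair_eq: "upair a b = upair c d \<longleftrightarrow> {a, b} = {c, d}"
  using elts_upair elts_inj by (metis injD)

lemma code_eq [simp]: "code p = code q \<longleftrightarrow> p = q"
proof
  assume "code p = code q"
  then have "{upair (fst p) (fst p), upair (fst p) (snd p)} = {upair (fst q) (fst q), upair (fst q) (snd q)}"
    by (simp add: code_def upair_eq)
  then show "p = q" by (auto simp: doubleton_eq_iff upair_eq prod_eq_iff)
qed simp

definition decode :: "'u \<Rightarrow> 'u \<times> 'u" where "decode = inv code"

lemma decode_code [simp]: "decode (code p) = p"
  unfolding decode_def by (rule inv_f_f) (simp add: inj_def)

lemma small_Sigma: assumes "small elts A" "\<And>x. x \<in> A \<Longrightarrow> small elts (B x)" shows "small elts (code ` Sigma A B)"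
proof -
  have "code ` Sigma A B = (\<Union>x\<in>A. (\<lambda>y. code (x, y)) ` B x)" by auto
  then show ?thesis using assms small_UN small_image by simp
qed

lemma essentially_small: "small elts A \<Longrightarrow> essentially_small elts A"
  unfolding essentially_small_def by (rule exI[of _ "\<lambda>x. x"]) simp

lemma essentially_small_image: assumes "essentially_small elts A" shows "essentially_small elts (f ` A)"
proof -
  obtain \<sigma> where \<sigma>: "inj_on \<sigma> A" "small elts (\<sigma> ` A)" using assms by (auto simp: essentially_small_def)
  \<comment> \<open>A section of \<open>f\<close> embeds the image back into \<open>A\<close>, where
    \<sigma> is available.\<close>
  let ?g = "inv_into A f"
  have "inj_on (\<sigma> \<circ> ?g) (f ` A)"
    by (intro comp_inj_on inj_on_inv_into) (use \<sigma> in "auto intro: inj_on_subset inv_into_into")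
  moreover have "small elts ((\<sigma> \<circ> ?g) ` f ` A)"
    by (rule small_subset[OF \<sigma>(2)]) (auto intro!: imageI inv_into_into)
  ultimately show ?thesis unfolding essentially_small_def by blast
qed

lemma essentially_small_subset: assumes "essentially_small elts A" "B \<subseteq> A" shows "essentially_small elts B"
  using assms unfolding essentially_small_def by (meson image_mono inj_on_subset small_subset)

lemma essentially_small_Sigma:
  assumes "essentially_small elts A" "\<And>x. x \<in> A \<Longrightarrow> essentially_small elts (B x)"
  shows "essentially_small elts (Sigma A B)"
proof -
  obtain \<sigma> where \<sigma>: "inj_on \<sigma> A" "small elts (\<sigma> ` A)" using assms by (auto simp: essentially_small_def)
  have "\<forall>x\<in>A. \<exists>\<tau>. inj_on \<tau> (B x) \<and> small elts (\<tau> ` B x)" using assms by (auto simp: essentially_small_def)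
  then obtain \<tau> where \<tau>: "\<And>x. x \<in> A \<Longrightarrow> inj_on (\<tau> x) (B x) \<and> small elts (\<tau> x ` B x)" by metis
  let ?\<rho> = "\<lambda>(x, y). code (\<sigma> x, \<tau> x y)"
  have "inj_on ?\<rho> (Sigma A B)" using \<sigma> \<tau> by (auto simp: inj_on_def)
  moreover have "?\<rho> ` Sigma A B \<subseteq> code ` Sigma (\<sigma> ` A) (\<lambda>z. \<tau> (inv_into A \<sigma> z) ` B (inv_into A \<sigma> z))"
  proof
    fix p assume "p \<in> ?\<rho> ` Sigma A B"
    then obtain x y where xy: "x \<in> A" "y \<in> B x" "p = code (\<sigma> x, \<tau> x y)" by auto
    then show "p \<in> code ` Sigma (\<sigma> ` A) (\<lambda>z. \<tau> (inv_into A \<sigma> z) ` B (inv_into A \<sigma> z))"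
      using \<sigma>(1) by (intro image_eqI[of _ _ "(\<sigma> x, \<tau> x y)"]) auto
  qed
  moreover have "small elts (code ` Sigma (\<sigma> ` A) (\<lambda>z. \<tau> (inv_into A \<sigma> z) ` B (inv_into A \<sigma> z)))"
    by (rule small_Sigma) (use \<sigma> \<tau> in "auto simp: inv_into_into")
  ultimately show ?thesis unfolding essentially_small_def using small_subset by blast
qed

text \<open>Here the infinite element of the universe enters: path lengths are unbounded and index a
  coproduct.\<close>

lemma essentially_small_nat: "essentially_small elts (UNIV :: nat set)"
proof -
  obtain x where "infinite (elts x)" using infinite_ex by blast
  then obtain f :: "nat \<Rightarrow> 'u" where f: "inj f" "range f \<subseteq> elts x" using infinite_countable_subset by blast
  moreover have "small elts (elts x)" by (auto simp: small_def)
  ultimately show ?thesis unfolding essentially_small_def using small_subset by blast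
qed

lemma essentially_small_lists:
  assumes "essentially_small elts A"
  shows "essentially_small elts {w. length w = n \<and> set w \<subseteq> A}"
proof (induction n)
  case 0
  have "{w. length w = 0 \<and> set w \<subseteq> A} = (\<lambda>_. []) ` {undefined :: 'u}" by auto
  then show ?case using essentially_small_image[OF essentially_small[OF small_singleton]] by simp
next
  case (Suc n)
  have "{w. length w = Suc n \<and> set w \<subseteq> A} = (\<lambda>(x, xs). x # xs) ` (A \<times> {w. length w = n \<and> set w \<subseteq> A})"
    by (auto simp: length_Suc_conv image_def)
  then show ?case using essentially_small_image[OF essentially_small_Sigma[OF assms Suc]] by simp
qed

lemma small_empty: "small elts {}"
  by (rule small_subset[OF small_singleton]) simp

end

section \<open>Finite products\<close>

text \<open>Just what enrichment over \<open>C\<close> uses. Pullbacks, wanted for the categories of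
  graphs, are kept in the separate locale \<open>pb_cat\<close>.\<close>

locale fp_cat = cat C for C :: "('o, 'm) category" (structure) +
  assumes terminal_ex: "\<exists>t. is_terminal C t"
    and products_ex: "a \<in> Obj C \<Longrightarrow> b \<in> Obj C \<Longrightarrow> \<exists>p \<pi>. is_product C UNIV (case_bool a b) p \<pi>"
begin

abbreviation "\<T> \<equiv> terminal C"

lemma terminal_is: "is_terminal C \<T>"
  unfolding terminal_def is_terminal_def using terminal_ex unfolding is_terminal_def by (rule someI_ex)

lemma terminal_Obj [simp]: "\<T> \<in> Obj C"
  using terminal_is by (simp add: is_terminal_def)

lemma bang_simps [simp]:
  assumes "a \<in> Obj C" shows "bang C a \<in> Arr C" "Dom C (bang C a) = a" "Cod C (bang C a) = \<T>"
proof -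
  have "\<exists>!h. h \<in> hom C a \<T>" using terminal_is assms by (simp add: is_terminal_def)
  then have "bang C a \<in> hom C a \<T>" unfolding bang_def by (rule theI')
  then show "bang C a \<in> Arr C" "Dom C (bang C a) = a" "Cod C (bang C a) = \<T>" by auto
qed

lemma terminal_unique:
  assumes "f \<in> Arr C" "Cod C f = \<T>" shows "f = bang C (Dom C f)"
proof -
  have "\<exists>!h. h \<in> hom C (Dom C f) \<T>" using terminal_is assms by (simp add: is_terminal_def)
  then show ?thesis by (rule ex1_unique) (use assms in auto)
qed

lemma bang_comp [simp]: "\<lbrakk>a \<in> Obj C; e \<in> Arr C; Cod C e = a\<rbrakk> \<Longrightarrow> bang C a \<cdot> e = bang C (Dom C e)"
  using terminal_unique[of "bang C a \<cdot> e"] by simp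

lemma prod2_is: "a \<in> Obj C \<Longrightarrow> b \<in> Obj C \<Longrightarrow>
    is_product C UNIV (case_bool a b) (prod2 C a b) (case_bool (proj1 C a b) (proj2 C a b))"
proof -
  assume "a \<in> Obj C" "b \<in> Obj C"
  moreover have "proj C UNIV (case_bool a b) = case_bool (proj1 C a b) (proj2 C a b)"
    by (auto simp: proj1_def proj2_def split: bool.split)
  ultimately show ?thesis using products_ex[of a b] Prod_is_product[of C UNIV "case_bool a b"]
    unfolding prod2_def by metis
qed

lemma prod2_simps [simp]:
  assumes "a \<in> Obj C" "b \<in> Obj C"
  shows "prod2 C a b \<in> Obj C"
    "proj1 C a b \<in> Arr C" "Dom C (proj1 C a b) = prod2 C a b" "Cod C (proj1 C a b) = a"
    "proj2 C a b \<in> Arr C" "Dom C (proj2 C a b) = prod2 C a b" "Cod C (proj2 C a b) = b"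
  using prod2_is[OF assms] unfolding is_product_def by (auto split: bool.splits)

lemma prod2_uni:
  assumes "f \<in> Arr C" "g \<in> Arr C" "Dom C f = d" "Dom C g = d" "Cod C f = a" "Cod C g = b"
  shows "\<exists>!h. h \<in> hom C d (prod2 C a b) \<and> proj1 C a b \<cdot> h = f \<and> proj2 C a b \<cdot> h = g"
proof -
  have o: "a \<in> Obj C" "b \<in> Obj C" "d \<in> Obj C" using assms by auto
  have "\<exists>!h. h \<in> hom C d (prod2 C a b) \<and> (\<forall>i\<in>UNIV. case_bool (proj1 C a b) (proj2 C a b) i \<cdot> h = case_bool f g i)"
    using prod2_is[OF o(1,2)] o(3) assms unfolding is_product_def
    by (elim conjE) (drule bspec[of _ _ d], assumption, drule spec[of _ "case_bool f g"], auto split: bool.splits)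
  then show ?thesis by (simp add: all_bool_eq conj_commute)
qed

lemma pair_is:
  assumes "f \<in> Arr C" "g \<in> Arr C" "Dom C g = Dom C f" "Cod C f = a" "Cod C g = b"
  shows "pair C f g \<in> hom C (Dom C f) (prod2 C a b) \<and> proj1 C a b \<cdot> pair C f g = f \<and> proj2 C a b \<cdot> pair C f g = g"
proof -
  have *: "(\<lambda>i. Cod C (case_bool f g i)) = case_bool a b" using assms by (auto split: bool.splits)
  have "pair C f g = (THE h. h \<in> hom C (Dom C f) (prod2 C a b) \<and> proj1 C a b \<cdot> h = f \<and> proj2 C a b \<cdot> h = g)"
    unfolding pair_def tuple_def * prod2_def[symmetric] proj1_def proj2_def
    by (rule arg_cong[where f=The]) (auto simp: all_bool_eq split: bool.splits)
  also have "\<dots> \<in> hom C (Dom C f) (prod2 C a b) \<and> proj1 C a b \<cdot> \<dots> = f \<and> proj2 C a b \<cdot> \<dots> = g"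
    by (rule theI'[OF prod2_uni]) (use assms in auto)
  finally show ?thesis by simp
qed

lemma pair_simps [simp]:
  assumes "f \<in> Arr C" "g \<in> Arr C" "Dom C g = Dom C f"
  shows "pair C f g \<in> Arr C" "Dom C (pair C f g) = Dom C f" "Cod C (pair C f g) = prod2 C (Cod C f) (Cod C g)"
  using pair_is[OF assms refl refl] by auto

lemma proj_pair [simp]:
  assumes "f \<in> Arr C" "g \<in> Arr C" "Dom C g = Dom C f" "Cod C f = a" "Cod C g = b"
  shows "proj1 C a b \<cdot> pair C f g = f" "proj2 C a b \<cdot> pair C f g = g"
  using pair_is[OF assms] by auto

lemma pair_ext:
  assumes "u \<in> Arr C" "v \<in> Arr C" "Dom C u = Dom C v" "Cod C u = prod2 C a b" "Cod C v = prod2 C a b"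
    "a \<in> Obj C" "b \<in> Obj C"
    "proj1 C a b \<cdot> u = proj1 C a b \<cdot> v" "proj2 C a b \<cdot> u = proj2 C a b \<cdot> v"
  shows "u = v"
proof -
  have "\<exists>!h. h \<in> hom C (Dom C v) (prod2 C a b) \<and> proj1 C a b \<cdot> h = proj1 C a b \<cdot> v \<and> proj2 C a b \<cdot> h = proj2 C a b \<cdot> v"
    by (rule prod2_uni) (use assms(2-7) in auto)
  then show ?thesis by (rule ex1_unique) (use assms in simp_all)
qed

text \<open>Together with \<open>prod2_arr_pair\<close> and \<open>assoc_pair\<close> this makes the
  simplifier evaluate diagrams between products on generalized elements.\<close>

lemma pair_comp [simp]:
  assumes "f \<in> Arr C" "g \<in> Arr C" "e \<in> Arr C" "Dom C g = Dom C f" "Dom C f = Cod C e"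
  shows "pair C f g \<cdot> e = pair C (f \<cdot> e) (g \<cdot> e)"
proof (rule pair_ext[of _ _ "Cod C f" "Cod C g"])
  show "proj1 C (Cod C f) (Cod C g) \<cdot> pair C f g \<cdot> e = proj1 C (Cod C f) (Cod C g) \<cdot> pair C (f \<cdot> e) (g \<cdot> e)"
    using assms comp_eq[of "proj1 C (Cod C f) (Cod C g)" "pair C f g" f e] by simp
  show "proj2 C (Cod C f) (Cod C g) \<cdot> pair C f g \<cdot> e = proj2 C (Cod C f) (Cod C g) \<cdot> pair C (f \<cdot> e) (g \<cdot> e)"
    using assms comp_eq[of "proj2 C (Cod C f) (Cod C g)" "pair C f g" g e] by simp
qed (use assms in simp_all)

lemma pair_proj:
  assumes "u \<in> Arr C" "Cod C u = prod2 C a b" "a \<in> Obj C" "b \<in> Obj C"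
  shows "pair C (proj1 C a b \<cdot> u) (proj2 C a b \<cdot> u) = u"
  by (rule pair_ext[of _ _ a b]) (use assms in simp_all)

lemma pair_eq_iff:
  assumes "f \<in> Arr C" "g \<in> Arr C" "Dom C g = Dom C f" "f' \<in> Arr C" "g' \<in> Arr C" "Dom C g' = Dom C f'"
    "Cod C f = Cod C f'" "Cod C g = Cod C g'"
  shows "pair C f g = pair C f' g' \<longleftrightarrow> f = f' \<and> g = g'"
  using proj_pair[OF assms(1-3) refl refl] proj_pair[OF assms(4-6) refl refl] assms by metis

lemma prod2_arr_simps [simp]:
  assumes "f \<in> Arr C" "g \<in> Arr C"
  shows "prod2_arr C f g \<in> Arr C" "Dom C (prod2_arr C f g) = prod2 C (Dom C f) (Dom C g)"
    "Cod C (prod2_arr C f g) = prod2 C (Cod C f) (Cod C g)"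
  using assms unfolding prod2_arr_def by simp_all

lemma prod2_arr_pair [simp]:
  assumes "f \<in> Arr C" "g \<in> Arr C" "a \<in> Arr C" "b \<in> Arr C" "Dom C b = Dom C a" "Cod C a = Dom C f" "Cod C b = Dom C g"
  shows "prod2_arr C f g \<cdot> pair C a b = pair C (f \<cdot> a) (g \<cdot> b)"
  using assms unfolding prod2_arr_def by simp

lemma assoc_pair [simp]:
  assumes "x \<in> Arr C" "y \<in> Arr C" "z \<in> Arr C" "Dom C y = Dom C x" "Dom C z = Dom C x"
    "Cod C x = a" "Cod C y = b" "Cod C z = c"
  shows "assoc C a b c \<cdot> pair C x (pair C y z) = pair C (pair C x y) z"
proof -
  have [simp]: "a \<in> Obj C" "b \<in> Obj C" "c \<in> Obj C" using assms by auto
  show ?thesis using assms unfolding assoc_def by simp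
qed

lemma assoc_simps [simp]:
  assumes "a \<in> Obj C" "b \<in> Obj C" "c \<in> Obj C"
  shows "assoc C a b c \<in> Arr C" "Dom C (assoc C a b c) = prod2 C a (prod2 C b c)"
    "Cod C (assoc C a b c) = prod2 C (prod2 C a b) c"
  using assms unfolding assoc_def by simp_all

text \<open>The empty product is a terminal object, and each further factor is adjoined on the right
  by a binary product.\<close>

lemma nproduct_ex:
  assumes "\<And>i. i < n \<Longrightarrow> X i \<in> Obj C"
  shows "\<exists>p \<pi>. is_product C {..<n :: nat} X p \<pi>"
  using assms
proof (induction n)
  case 0
  have "is_product C {..<0 :: nat} X \<T> (\<lambda>_. undefined)"
    using terminal_is unfolding is_product_def is_terminal_def by auto
  then show ?case by blast
next
  case (Suc n)
  then obtain p \<pi> where p: "is_product C {..<n} X p \<pi>" by auto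
  have p': "p \<in> Obj C" "\<And>i. i < n \<Longrightarrow> \<pi> i \<in> hom C p (X i)" using p unfolding is_product_def by auto
  have Xn [simp]: "X n \<in> Obj C" using Suc by simp
  let ?r = "\<lambda>i. if i < n then \<pi> i \<cdot> proj1 C p (X n) else proj2 C p (X n)"
  have "is_product C {..<Suc n} X (prod2 C p (X n)) ?r"
    unfolding is_product_def
  proof (intro conjI ballI allI impI)
    show "prod2 C p (X n) \<in> Obj C" using p' by simp
    show "?r i \<in> hom C (prod2 C p (X n)) (X i)" if "i \<in> {..<Suc n}" for i
      using that p' by (auto simp: less_Suc_eq)
    fix c f assume c: "c \<in> Obj C" and f: "\<forall>i\<in>{..<Suc n}. f i \<in> hom C c (X i)"
    have uni: "\<exists>!h. h \<in> hom C c p \<and> (\<forall>i\<in>{..<n}. \<pi> i \<cdot> h = f i)"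
      using p c f unfolding is_product_def by (simp add: less_Suc_eq)
    then obtain h where h: "h \<in> hom C c p" "\<forall>i\<in>{..<n}. \<pi> i \<cdot> h = f i" by blast
    show "\<exists>!h. h \<in> hom C c (prod2 C p (X n)) \<and> (\<forall>i\<in>{..<Suc n}. ?r i \<cdot> h = f i)"
    proof (rule ex1I[of _ "pair C h (f n)"])
      show "pair C h (f n) \<in> hom C c (prod2 C p (X n)) \<and> (\<forall>i\<in>{..<Suc n}. ?r i \<cdot> pair C h (f n) = f i)"
        using h f p' by (auto simp: less_Suc_eq)
      fix k assume k: "k \<in> hom C c (prod2 C p (X n)) \<and> (\<forall>i\<in>{..<Suc n}. ?r i \<cdot> k = f i)"
      have 1: "proj1 C p (X n) \<cdot> k = h"
      proof (rule ex1_unique[OF uni])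
        have "\<pi> i \<cdot> proj1 C p (X n) \<cdot> k = f i" if "i < n" for i
        proof -
          have "\<forall>i\<in>{..<Suc n}. ?r i \<cdot> k = f i" using k by blast
          from bspec[OF this, of i] show ?thesis using k p' that by simp
        qed
        then show "proj1 C p (X n) \<cdot> k \<in> hom C c p \<and> (\<forall>i\<in>{..<n}. \<pi> i \<cdot> proj1 C p (X n) \<cdot> k = f i)"
          using k p' by auto
      qed (use h in simp)
      have "?r n \<cdot> k = f n" using k by blast
      then have "proj2 C p (X n) \<cdot> k = f n" by simp
      then show "k = pair C h (f n)" using pair_proj[of k p "X n"] k p' 1 by simp
    qed
  qed
  then show ?case by blast
qed

lemma nprod_is:
  assumes "\<And>i. i < n \<Longrightarrow> X i \<in> Obj C"
  shows "is_product C {..<n :: nat} X (Prod C {..<n} X) (proj C {..<n} X)"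
proof -
  obtain p \<pi> where "is_product C {..<n} X p \<pi>" using nproduct_ex[of n X] assms by auto
  then show ?thesis by (rule Prod_is_product)
qed

lemma nprod_uni:
  assumes "d \<in> Obj C" "\<And>i. i < n \<Longrightarrow> f i \<in> hom C d (X i)"
  shows "\<exists>!h. h \<in> hom C d (Prod C {..<n :: nat} X) \<and> (\<forall>i\<in>{..<n}. proj C {..<n} X i \<cdot> h = f i)"
proof -
  have "X i \<in> Obj C" if "i < n" for i using assms(2)[OF that] Cod_Obj[of "f i"] by simp
  then have "is_product C {..<n} X (Prod C {..<n} X) (proj C {..<n} X)" by (rule nprod_is)
  moreover have "\<forall>i\<in>{..<n}. f i \<in> hom C d (X i)" using assms(2) by simp
  ultimately show ?thesis using assms(1) unfolding is_product_def by blast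
qed

lemma nprod_simps [simp]:
  assumes "\<And>i. i < n \<Longrightarrow> X i \<in> Obj C"
  shows "Prod C {..<n :: nat} X \<in> Obj C" "i < n \<Longrightarrow> proj C {..<n} X i \<in> Arr C"
    "i < n \<Longrightarrow> Dom C (proj C {..<n} X i) = Prod C {..<n} X" "i < n \<Longrightarrow> Cod C (proj C {..<n} X i) = X i"
  using nprod_is[of n X] assms unfolding is_product_def by auto

lemma tuple_is:
  assumes "d \<in> Obj C" "\<And>i. i < n \<Longrightarrow> f i \<in> Arr C" "\<And>i. i < n \<Longrightarrow> Dom C (f i) = d" "\<And>i. i < n \<Longrightarrow> Cod C (f i) = X i"
  shows "tuple C {..<n :: nat} d f \<in> hom C d (Prod C {..<n} X)
    \<and> (\<forall>i\<in>{..<n}. proj C {..<n} X i \<cdot> tuple C {..<n} d f = f i)"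
proof -
  have X: "\<And>i. i < n \<Longrightarrow> X i \<in> Obj C" using assms(2,4) Cod_Obj by metis
  have *: "Prod C {..<n} (\<lambda>i. Cod C (f i)) = Prod C {..<n} X" "proj C {..<n} (\<lambda>i. Cod C (f i)) = proj C {..<n} X"
    by (rule Prod_cong, use assms in simp)+
  have "\<exists>!h. h \<in> hom C d (Prod C {..<n} X) \<and> (\<forall>i\<in>{..<n}. proj C {..<n} X i \<cdot> h = f i)"
    by (rule nprod_uni) (use assms in auto)
  then show ?thesis unfolding tuple_def * by (rule theI')
qed

lemma tuple_simps [simp]:
  assumes "d \<in> Obj C" "\<And>i. i < n \<Longrightarrow> f i \<in> Arr C" "\<And>i. i < n \<Longrightarrow> Dom C (f i) = d"
  shows "tuple C {..<n :: nat} d f \<in> Arr C" "Dom C (tuple C {..<n} d f) = d"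
  using tuple_is[OF assms refl] by auto

lemma Cod_tuple:
  assumes "d \<in> Obj C" "\<And>i. i < n \<Longrightarrow> f i \<in> Arr C" "\<And>i. i < n \<Longrightarrow> Dom C (f i) = d" "\<And>i. i < n \<Longrightarrow> Cod C (f i) = X i"
  shows "Cod C (tuple C {..<n :: nat} d f) = Prod C {..<n} X"
  using tuple_is[of d n f X] assms by auto

lemma proj_tuple:
  assumes "d \<in> Obj C" "\<And>i. i < n \<Longrightarrow> f i \<in> Arr C" "\<And>i. i < n \<Longrightarrow> Dom C (f i) = d" "\<And>i. i < n \<Longrightarrow> Cod C (f i) = X i"
    "i < n"
  shows "proj C {..<n :: nat} X i \<cdot> tuple C {..<n} d f = f i"
  using tuple_is[of d n f X] assms by auto

lemma tuple_ext:
  assumes "u \<in> Arr C" "v \<in> Arr C" "Dom C u = Dom C v" "Cod C u = Prod C {..<n :: nat} X" "Cod C v = Prod C {..<n} X"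
    "\<And>i. i < n \<Longrightarrow> X i \<in> Obj C"
    "\<And>i. i < n \<Longrightarrow> proj C {..<n} X i \<cdot> u = proj C {..<n} X i \<cdot> v"
  shows "u = v"
proof -
  have "\<exists>!h. h \<in> hom C (Dom C v) (Prod C {..<n} X) \<and> (\<forall>i\<in>{..<n}. proj C {..<n} X i \<cdot> h = proj C {..<n} X i \<cdot> v)"
    by (rule nprod_uni) (use assms(2,5,6) in auto)
  then show ?thesis by (rule ex1_unique) (use assms in auto)
qed

lemma tuple_comp:
  assumes "d \<in> Obj C" "\<And>i. i < n \<Longrightarrow> f i \<in> Arr C" "\<And>i. i < n \<Longrightarrow> Dom C (f i) = d" "e \<in> Arr C" "Cod C e = d"
  shows "tuple C {..<n :: nat} d f \<cdot> e = tuple C {..<n} (Dom C e) (\<lambda>i. f i \<cdot> e)"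
proof (rule tuple_ext[of _ _ n "\<lambda>i. Cod C (f i)"])
  show "Cod C (tuple C {..<n} d f \<cdot> e) = Prod C {..<n} (\<lambda>i. Cod C (f i))"
    using assms Cod_tuple[of d n f "\<lambda>i. Cod C (f i)"] by simp
  show "Cod C (tuple C {..<n} (Dom C e) (\<lambda>i. f i \<cdot> e)) = Prod C {..<n} (\<lambda>i. Cod C (f i))"
    by (rule Cod_tuple) (use assms in auto)
  fix i assume i: "i < n"
  have "proj C {..<n} (\<lambda>i. Cod C (f i)) i \<cdot> tuple C {..<n} d f \<cdot> e = f i \<cdot> e"
    by (rule comp_eq[OF proj_tuple]) (use i assms Cod_tuple[of d n f "\<lambda>i. Cod C (f i)"] in auto)
  moreover have "proj C {..<n} (\<lambda>i. Cod C (f i)) i \<cdot> tuple C {..<n} (Dom C e) (\<lambda>i. f i \<cdot> e) = f i \<cdot> e"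
    by (rule proj_tuple) (use i assms in auto)
  ultimately show "proj C {..<n} (\<lambda>i. Cod C (f i)) i \<cdot> tuple C {..<n} d f \<cdot> e =
     proj C {..<n} (\<lambda>i. Cod C (f i)) i \<cdot> tuple C {..<n} (Dom C e) (\<lambda>i. f i \<cdot> e)" by simp
qed (use assms in auto)

lemma tuple_cong:
  assumes "\<And>i. i < n \<Longrightarrow> f i = g i" shows "tuple C {..<n :: nat} d f = tuple C {..<n} d g"
proof -
  have "Prod C {..<n} (\<lambda>i. Cod C (f i)) = Prod C {..<n} (\<lambda>i. Cod C (g i))"
    "proj C {..<n} (\<lambda>i. Cod C (f i)) = proj C {..<n} (\<lambda>i. Cod C (g i))"
    by (rule Prod_cong, use assms in simp)+
  then show ?thesis using assms unfolding tuple_def by (intro arg_cong[where f=The] ext) auto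
qed

end

text \<open>Binary products are pullbacks over a terminal object. In this form the lemma serves the
  base category as well as the category of enriched categories.\<close>

lemma (in cat) fp_catI:
  assumes t: "is_terminal C t"
    and pb: "\<And>f g. \<lbrakk>f \<in> Arr C; g \<in> Arr C; Cod C f = t; Cod C g = t\<rbrakk> \<Longrightarrow> \<exists>p q. is_pullback C f g p q"
  shows "fp_cat C"
proof
  show "\<exists>t. is_terminal C t" using t by blast
  fix a b assume ab: "a \<in> Obj C" "b \<in> Obj C"
  have "\<exists>f. f \<in> hom C a t" "\<exists>g. g \<in> hom C b t" using t ab unfolding is_terminal_def by blast+
  then obtain f g where f: "f \<in> hom C a t" "g \<in> hom C b t" by blast
  have tu: "u = v" if "u \<in> hom C c t" "v \<in> hom C c t" for u v c
  proof -
    have "c \<in> Obj C" using that by auto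
    then have "\<exists>!h. h \<in> hom C c t" using t unfolding is_terminal_def by blast
    then show ?thesis using that by (rule ex1_unique)
  qed
  obtain p q where pb: "is_pullback C f g p q" using pb[of f g] f by auto
  note [simp] = pullback_simps(1-4,6-8)[OF pb]
  have "is_product C UNIV (case_bool a b) (Dom C q) (case_bool p q)"
    unfolding is_product_def
  proof (intro conjI ballI allI impI)
    show "Dom C q \<in> Obj C" by simp
    show "case_bool p q i \<in> hom C (Dom C q) (case_bool a b i)" for i using f by (auto split: bool.splits)
    fix c h assume c: "c \<in> Obj C" and h: "\<forall>i\<in>UNIV. h i \<in> hom C c (case_bool a b i)"
    have h': "h True \<in> hom C c a" "h False \<in> hom C c b" using h by (auto split: bool.splits simp: all_bool_eq)
    have "f \<cdot> h True = g \<cdot> h False" by (rule tu[of _ c]) (use h' f in auto)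
    then obtain k where k: "k \<in> Arr C" "Dom C k = c" "Cod C k = Dom C p" "p \<cdot> k = h True" "q \<cdot> k = h False"
      using pullback_lift[OF pb, of "h True" "h False" c] h' f by auto
    show "\<exists>!k. k \<in> hom C c (Dom C q) \<and> (\<forall>i\<in>UNIV. case_bool p q i \<cdot> k = h i)"
    proof (rule ex1I[of _ k])
      show "k \<in> hom C c (Dom C q) \<and> (\<forall>i\<in>UNIV. case_bool p q i \<cdot> k = h i)"
        using k by (auto split: bool.splits)
      fix k' assume "k' \<in> hom C c (Dom C q) \<and> (\<forall>i\<in>UNIV. case_bool p q i \<cdot> k' = h i)"
      then have k': "k' \<in> hom C c (Dom C q)" "p \<cdot> k' = h True" "q \<cdot> k' = h False" by (auto simp: all_bool_eq)
      show "k' = k" by (rule pullback_ext[OF pb, of _ _ c]) (use k k' in auto)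
    qed
  qed
  then show "\<exists>p \<pi>. is_product C UNIV (case_bool a b) p \<pi>" by blast
qed

section \<open>Extensive categories and local reasoning\<close>

text \<open>The content of the slice equivalence in terms of arrows. An arrow into the coproduct
  splits its domain (essential surjectivity), and coprojections are monic and disjoint (fullness).
  The latter is asserted at noninitial domains only, because all arrows from an initial object to
  \<open>s\<close> agree, whatever summand they pass through.\<close>

definition extensive_coproduct ::
    "('o, 'm) category \<Rightarrow> 'i set \<Rightarrow> ('i \<Rightarrow> 'o) \<Rightarrow> 'o \<Rightarrow> ('i \<Rightarrow> 'm) \<Rightarrow> bool" where
  "extensive_coproduct C I X s \<iota> \<longleftrightarrow> is_coproduct C I X s \<iota> \<and>
     (\<forall>u\<in>Arr C. Cod C u = s \<longrightarrow> (\<exists>D e a. is_coproduct C I D (Dom C u) e \<and>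
        (\<forall>i\<in>I. a i \<in> hom C (D i) (X i) \<and> u \<cdot>\<^bsub>C\<^esub> e i = \<iota> i \<cdot>\<^bsub>C\<^esub> a i))) \<and>
     (\<forall>i\<in>I. \<forall>j\<in>I. \<forall>a\<in>Arr C. \<forall>b\<in>Arr C. Dom C b = Dom C a \<longrightarrow> Cod C a = X i \<longrightarrow> Cod C b = X j \<longrightarrow>
        \<not> is_initial C (Dom C a) \<longrightarrow> \<iota> i \<cdot>\<^bsub>C\<^esub> a = \<iota> j \<cdot>\<^bsub>C\<^esub> b \<longrightarrow> i = j \<and> a = b)"

locale lextensive = universe elts + fp_cat C
  for elts :: "'u \<Rightarrow> 'u set" and C :: "('o, 'm) category" (structure) +
  assumes extensive_coproduct_ex: "small elts I \<Longrightarrow> (\<And>i. i \<in> I \<Longrightarrow> X i \<in> Obj C) \<Longrightarrow> \<exists>s \<iota>. extensive_coproduct C I X s \<iota>"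
begin

lemma small_coproduct_ex: "small elts I \<Longrightarrow> (\<And>i. i \<in> I \<Longrightarrow> X i \<in> Obj C) \<Longrightarrow> \<exists>s \<iota>. is_coproduct C I X s \<iota>"
  using extensive_coproduct_ex[of I X] unfolding extensive_coproduct_def by blast

text \<open>Independence of the coproduct taken: the comparison isomorphisms \<open>k\<close> and
  \<open>l\<close> carry decompositions and disjointness across.\<close>

lemma small_coproduct_extensive:
  assumes I: "small elts I" and s': "is_coproduct C I X s' \<iota>'"
  shows "extensive_coproduct C I X s' \<iota>'"
proof -
  have X: "\<And>i. i \<in> I \<Longrightarrow> X i \<in> Obj C" using coproduct_simps(5)[OF s'] .
  obtain s \<iota> where "extensive_coproduct C I X s \<iota>" using extensive_coproduct_ex[OF I, of X, OF X] by blast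
  then have s: "is_coproduct C I X s \<iota>"
    and L1: "\<And>u. u \<in> Arr C \<Longrightarrow> Cod C u = s \<Longrightarrow>
        \<exists>D e a. is_coproduct C I D (Dom C u) e \<and> (\<forall>i\<in>I. a i \<in> hom C (D i) (X i) \<and> u \<cdot> e i = \<iota> i \<cdot> a i)"
    and L2: "\<And>i j a b. \<lbrakk>i \<in> I; j \<in> I; a \<in> Arr C; b \<in> Arr C; Dom C b = Dom C a; Cod C a = X i; Cod C b = X j;
        \<not> is_initial C (Dom C a); \<iota> i \<cdot> a = \<iota> j \<cdot> b\<rbrakk> \<Longrightarrow> i = j \<and> a = b"
    unfolding extensive_coproduct_def by blast+
  note [simp] = coproduct_simps[OF s] coproduct_simps[OF s']
  obtain k l where kl: "k \<in> Arr C" "Dom C k = s" "Cod C k = s'" "l \<in> Arr C" "Dom C l = s'" "Cod C l = s" "l \<cdot> k = Ide C s" "k \<cdot> l = Ide C s'"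
    "\<And>i. i \<in> I \<Longrightarrow> k \<cdot> \<iota> i = \<iota>' i" "\<And>i. i \<in> I \<Longrightarrow> l \<cdot> \<iota>' i = \<iota> i"
    by (rule coproduct_unique[OF s s'], rule that) auto
  have 1: "\<exists>D e a. is_coproduct C I D (Dom C u) e \<and> (\<forall>i\<in>I. a i \<in> hom C (D i) (X i) \<and> u \<cdot> e i = \<iota>' i \<cdot> a i)"
    if u: "u \<in> Arr C" "Cod C u = s'" for u
  proof -
    obtain D e a where *: "is_coproduct C I D (Dom C (l \<cdot> u)) e" "\<forall>i\<in>I. a i \<in> hom C (D i) (X i) \<and> (l \<cdot> u) \<cdot> e i = \<iota> i \<cdot> a i"
      using L1[of "l \<cdot> u"] u kl by auto
    have D: "is_coproduct C I D (Dom C u) e" using * u kl by simp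
    have "a i \<in> hom C (D i) (X i) \<and> u \<cdot> e i = \<iota>' i \<cdot> a i" if i: "i \<in> I" for i
    proof -
      have a: "a i \<in> hom C (D i) (X i)" and e: "(l \<cdot> u) \<cdot> e i = \<iota> i \<cdot> a i" using * i by auto
      have "k \<cdot> ((l \<cdot> u) \<cdot> e i) = k \<cdot> (\<iota> i \<cdot> a i)" using e by simp
      then show ?thesis using a i kl u coproduct_simps[OF D] comp_eq[OF kl(8), of "u \<cdot> e i"] comp_eq[OF kl(9)[OF i], of "a i"] by simp
    qed
    then show ?thesis using D by blast
  qed
  have 2: "i = j \<and> a = b" if "i \<in> I" "j \<in> I" "a \<in> Arr C" "b \<in> Arr C" "Dom C b = Dom C a" "Cod C a = X i" "Cod C b = X j"
     "\<not> is_initial C (Dom C a)" "\<iota>' i \<cdot> a = \<iota>' j \<cdot> b" for i j a b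
  proof (rule L2)
    have "l \<cdot> (\<iota>' i \<cdot> a) = l \<cdot> (\<iota>' j \<cdot> b)" using that by simp
    then show "\<iota> i \<cdot> a = \<iota> j \<cdot> b"
      using that kl comp_eq[OF kl(10)[OF that(1)], of a] comp_eq[OF kl(10)[OF that(2)], of b] by simp
  qed (use that in auto)
  show ?thesis unfolding extensive_coproduct_def using s' 1 2 by blast
qed

lemma small_decomp: "\<lbrakk>small elts I; is_coproduct C I X s \<iota>; u \<in> Arr C; Cod C u = s\<rbrakk> \<Longrightarrow>
    \<exists>D e a. is_coproduct C I D (Dom C u) e \<and> (\<forall>i\<in>I. a i \<in> hom C (D i) (X i) \<and> u \<cdot> e i = \<iota> i \<cdot> a i)"
  using small_coproduct_extensive[of I X s \<iota>] unfolding extensive_coproduct_def by blast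

lemma small_disjoint:
  assumes "small elts I" "is_coproduct C I X s \<iota>" "i \<in> I" "j \<in> I" "a \<in> Arr C" "b \<in> Arr C" "Dom C b = Dom C a"
    "Cod C a = X i" "Cod C b = X j" "\<not> is_initial C (Dom C a)" "\<iota> i \<cdot> a = \<iota> j \<cdot> b"
  shows "i = j \<and> a = b"
  using small_coproduct_extensive[OF assms(1,2)] assms(3-) unfolding extensive_coproduct_def by blast

lemma coproduct_ex:
  assumes "essentially_small elts I" "\<And>i. i \<in> I \<Longrightarrow> X i \<in> Obj C"
  shows "\<exists>s \<iota>. is_coproduct C I X s \<iota>"
proof -
  obtain \<sigma> where \<sigma>: "inj_on \<sigma> I" "small elts (\<sigma> ` I)" using assms by (auto simp: essentially_small_def)
  obtain s \<iota> where "is_coproduct C (\<sigma> ` I) (\<lambda>j. X (inv_into I \<sigma> j)) s \<iota>"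
    using small_coproduct_ex[OF \<sigma>(2), of "\<lambda>j. X (inv_into I \<sigma> j)"] assms(2) inv_into_into[of _ \<sigma> I] by auto
  then have "is_coproduct C I (\<lambda>i. X (inv_into I \<sigma> (\<sigma> i))) s (\<lambda>i. \<iota> (\<sigma> i))" by (simp only: coproduct_reindex[OF \<sigma>(1)])
  moreover have "X (inv_into I \<sigma> (\<sigma> i)) = X i" if "i \<in> I" for i using that \<sigma> by simp
  ultimately show ?thesis by (metis (no_types, lifting) coproduct_cong)
qed

lemma Coprod_is:
  "essentially_small elts I \<Longrightarrow> (\<And>i. i \<in> I \<Longrightarrow> X i \<in> Obj C) \<Longrightarrow> is_coproduct C I X (Coprod C I X) (coproj C I X)"
  using coproduct_ex Coprod_is_coproduct by metis

lemma initial_ex: "\<exists>z. is_initial C z"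
proof -
  obtain z \<iota> where "is_coproduct C ({} :: 'u set) (\<lambda>_. undefined) z \<iota>" using small_coproduct_ex[OF small_empty, of "\<lambda>_. undefined"] by auto
  then show ?thesis using initial_empty_coproduct by blast
qed

text \<open>An initial object is a coproduct of the empty family, and an arrow into it decomposes
  its domain accordingly.\<close>

lemma initial_strict:
  assumes "u \<in> Arr C" "is_initial C (Cod C u)" shows "is_initial C (Dom C u)"
proof -
  have "is_coproduct C {} (\<lambda>_. undefined) (Cod C u) (\<lambda>_. undefined)" using assms initial_empty_coproduct by blast
  from small_decomp[OF small_empty this assms(1) refl] show ?thesis using initial_empty_coproduct by blast
qed

text \<open>
  \<open>locally d P\<close>: the predicate \<open>P\<close> on arrows into \<open>d\<close> holds on all summands of some iterated small
  coproduct decomposition of \<open>d\<close>.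
\<close>

inductive locally :: "'o \<Rightarrow> ('m \<Rightarrow> bool) \<Rightarrow> bool" where
  here: "d \<in> Obj C \<Longrightarrow> P (Ide C d) \<Longrightarrow> locally d P"
| step: "\<lbrakk>small elts I; is_coproduct C I D d e; (\<And>i. i \<in> I \<Longrightarrow> locally (D i) (\<lambda>f. P (e i \<cdot> f)))\<rbrakk> \<Longrightarrow> locally d P"

text \<open>The empty decomposition covers an initial object, so there is nothing to check.\<close>

lemma locally_initial: "is_initial C d \<Longrightarrow> locally d P"
  by (rule step[OF small_empty, where D="\<lambda>_. undefined" and e="\<lambda>_. undefined"]) (use initial_empty_coproduct in auto)

lemma locally_weaken:
  assumes "locally d P" "\<And>f. \<lbrakk>f \<in> Arr C; Cod C f = d; P f\<rbrakk> \<Longrightarrow> Q f"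
  shows "locally d Q"
  using assms
proof (induction arbitrary: Q)
  case (here d R) then show ?case by (intro locally.here) auto
next
  case (step I D d e R)
  note [simp] = coproduct_simps[OF step(2)]
  show ?case by (rule locally.step[OF step(1,2)]) (use step in auto)
qed

text \<open>Decompositions compose, by grafting a cover of each leaf. Initial leaves get the empty
  cover, which is why the second premise may assume a noninitial stage.\<close>

lemma locally_trans:
  assumes "locally d P"
    "\<And>e. \<lbrakk>e \<in> Arr C; Cod C e = d; \<not> is_initial C (Dom C e); P e\<rbrakk> \<Longrightarrow> locally (Dom C e) (\<lambda>f. Q (e \<cdot> f))"
  shows "locally d Q"
  using assms
proof (induction arbitrary: Q)
  case (here d P)
  show ?case
  proof (cases "is_initial C d")
    case True then show ?thesis by (rule locally_initial)
  next
    case False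
    then have "locally d (\<lambda>f. Q (Ide C d \<cdot> f))" using here(3)[of "Ide C d"] here(1,2) by simp
    then show ?thesis by (rule locally_weaken) simp
  qed
next
  case (step I D d e P)
  note [simp] = coproduct_simps[OF step(2)]
  show ?case
  proof (rule locally.step[OF step(1,2)], rule step(4))
    fix i f assume f: "i \<in> I" "f \<in> Arr C" "Cod C f = D i" "\<not> is_initial C (Dom C f)" "P (e i \<cdot> f)"
    have "locally (Dom C f) (\<lambda>g. Q ((e i \<cdot> f) \<cdot> g))" using step(5)[of "e i \<cdot> f"] f by simp
    then show "locally (Dom C f) (\<lambda>g. Q (e i \<cdot> f \<cdot> g))" by (rule locally_weaken) (use f in simp)
  qed
qed

text \<open>Stronger than \<open>locally_weaken\<close>, since the implication is only asked for at
  noninitial stages, where elements of coproducts determine their summand.\<close>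

lemma locally_mono:
  assumes "locally d P" "\<And>e. \<lbrakk>e \<in> Arr C; Cod C e = d; \<not> is_initial C (Dom C e); P e\<rbrakk> \<Longrightarrow> Q e"
  shows "locally d Q"
  using assms(1)
  by (rule locally_trans) (use assms(2) in "auto intro!: here")

text \<open>Covers pull back: a decomposition of \<open>d\<close> induces one of the domain of
  \<open>f\<close>. The new summands merely map to the old ones, so \<open>P\<close> has to be
  stable under precomposition.\<close>

lemma locally_restrict:
  assumes "locally d P" "f \<in> Arr C" "Cod C f = d"
    "\<And>e g. \<lbrakk>e \<in> Arr C; Cod C e = d; P e; g \<in> Arr C; Cod C g = Dom C e\<rbrakk> \<Longrightarrow> P (e \<cdot> g)"
  shows "locally (Dom C f) (\<lambda>e. P (f \<cdot> e))"
  using assms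
proof (induction arbitrary: f)
  case (here d P)
  have "P (Ide C d \<cdot> f)" by (rule here(5)) (use here in auto)
  then show ?case using here by (intro locally.here) auto
next
  case (step I D d e P)
  note [simp] = coproduct_simps[OF step(2)]
  obtain D' e' a where *: "is_coproduct C I D' (Dom C f) e'" "\<forall>i\<in>I. a i \<in> hom C (D' i) (D i) \<and> f \<cdot> e' i = e i \<cdot> a i"
    using small_decomp[OF step(1,2,5,6)] by blast
  note [simp] = coproduct_simps[OF *(1)]
  show ?case
  proof (rule locally.step[OF step(1) *(1)])
    fix i assume i: "i \<in> I"
    have eq: "f \<cdot> e' i = e i \<cdot> a i" and a: "a i \<in> Arr C" "Dom C (a i) = D' i" "Cod C (a i) = D i" using * i by auto
    have "locally (Dom C (a i)) (\<lambda>g. P (e i \<cdot> (a i \<cdot> g)))"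
    proof (rule step(4)[OF i a(1,3)])
      show "P (e i \<cdot> g \<cdot> g')" if "g \<in> Arr C" "Cod C g = D i" "P (e i \<cdot> g)" "g' \<in> Arr C" "Cod C g' = Dom C g" for g g'
        using step(7)[of "e i \<cdot> g" g'] that i by simp
    qed
    then show "locally (D' i) (\<lambda>g. P (f \<cdot> (e' i \<cdot> g)))"
      unfolding a(2)
    proof (rule locally_weaken)
      fix g assume g: "g \<in> Arr C" "Cod C g = D' i" "P (e i \<cdot> (a i \<cdot> g))"
      have "f \<cdot> (e' i \<cdot> g) = e i \<cdot> (a i \<cdot> g)"
        using comp_eq[OF eq, of g] g i step(5,6) a by simp
      then show "P (f \<cdot> (e' i \<cdot> g))" using g by simp
    qed
  qed
qed

text \<open>Coprojections are jointly epic, level by level of the iterated decomposition.\<close>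

lemma locally_eq:
  assumes "locally d (\<lambda>e. u \<cdot> e = v \<cdot> e)" "u \<in> Arr C" "v \<in> Arr C" "Dom C u = d" "Dom C v = d" "Cod C u = Cod C v"
  shows "u = v"
proof -
  \<comment> \<open>Generalized for the induction: on passing to a summand, \<open>u\<close> and
    \<open>v\<close> become \<open>u \<cdot> e i\<close> and \<open>v \<cdot> e i\<close>, so the
    predicate must not be tied to one pair.\<close>
  have "u = v" if "locally d P" "\<And>e. \<lbrakk>e \<in> Arr C; Cod C e = d; P e\<rbrakk> \<Longrightarrow> u \<cdot> e = v \<cdot> e"
    "u \<in> Arr C" "v \<in> Arr C" "Dom C u = d" "Dom C v = d" "Cod C u = Cod C v" for P u v
    using that
  proof (induction arbitrary: u v)
    case (here d P)
    then show ?case using here(3)[of "Ide C d"] by simp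
  next
    case (step I D d e P)
    note [simp] = coproduct_simps[OF step(2)]
    show "u = v"
    proof (rule coproduct_ext[OF step(2)])
      fix i assume i: "i \<in> I"
      have "(u \<cdot> e i) \<cdot> f = (v \<cdot> e i) \<cdot> f" if "f \<in> Arr C" "Cod C f = D i" "P (e i \<cdot> f)" for f
        using step(5)[of "e i \<cdot> f"] that i step(6-) by simp
      then show "u \<cdot> e i = v \<cdot> e i" by (rule step(4)[OF i]) (use i step(6-) in auto)
    qed (use step in auto)
  qed
  from this[OF assms(1)] show ?thesis using assms(2-) by blast
qed

text \<open>A sheaf condition without compatibility requirement: the cover consists of coproduct
  summands, so arrows chosen on them can simply be copaired.\<close>

lemma locally_glue:
  assumes "locally d (\<lambda>e. \<exists>y. y \<in> hom C (Dom C e) Y \<and> Q e y)" "Y \<in> Obj C"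
  shows "\<exists>y. y \<in> hom C d Y \<and> locally d (\<lambda>e. Q e (y \<cdot> e))"
proof -
  have "\<exists>y. y \<in> hom C d Y \<and> locally d (\<lambda>e. Q e (y \<cdot> e))" if "locally d P"
    "\<And>e. \<lbrakk>e \<in> Arr C; Cod C e = d; P e\<rbrakk> \<Longrightarrow> \<exists>y. y \<in> hom C (Dom C e) Y \<and> Q e y" for P Q
    using that
  proof (induction arbitrary: Q)
    case (here d P)
    then obtain y where y: "y \<in> hom C d Y" "Q (Ide C d) y" using here(3)[of "Ide C d"] by auto
    then show ?case using here by (intro exI[of _ y]) (auto intro!: locally.here)
  next
    case (step I D d e P)
    note [simp] = coproduct_simps[OF step(2)]
    have "\<exists>y. y \<in> hom C (D i) Y \<and> locally (D i) (\<lambda>f. Q (e i \<cdot> f) (y \<cdot> f))" if i: "i \<in> I" for i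
    proof (rule step(4)[OF i])
      fix f assume "f \<in> Arr C" "Cod C f = D i" "P (e i \<cdot> f)"
      then show "\<exists>y. y \<in> hom C (Dom C f) Y \<and> Q (e i \<cdot> f) y" using step(5)[of "e i \<cdot> f"] i by simp
    qed
    then obtain y where y: "\<And>i. i \<in> I \<Longrightarrow> y i \<in> hom C (D i) Y" "\<And>i. i \<in> I \<Longrightarrow> locally (D i) (\<lambda>f. Q (e i \<cdot> f) (y i \<cdot> f))"
      by metis
    obtain h where h: "h \<in> Arr C" "Dom C h = d" "Cod C h = Y" "\<And>i. i \<in> I \<Longrightarrow> h \<cdot> e i = y i"
      using coproduct_copair[OF step(2) assms(2) y(1)] by auto
    have "locally d (\<lambda>e. Q e (h \<cdot> e))"
    proof (rule locally.step[OF step(1,2)])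
      fix i assume i: "i \<in> I"
      show "locally (D i) (\<lambda>f. Q (e i \<cdot> f) (h \<cdot> e i \<cdot> f))"
      proof (rule locally_weaken[OF y(2)[OF i]])
        fix f assume f: "f \<in> Arr C" "Cod C f = D i" "Q (e i \<cdot> f) (y i \<cdot> f)"
        then show "Q (e i \<cdot> f) (h \<cdot> e i \<cdot> f)" using comp_eq[OF h(4)[OF i], of f] h i by simp
      qed
    qed
    then show ?case using h by auto
  qed
  from this[OF assms(1)] show ?thesis by blast
qed

text \<open>A noninitial object keeps a noninitial piece in every decomposition, so a statement that
  does not mention the stage may be read off there.\<close>

lemma locally_const:
  assumes "locally d P" "\<And>e. \<lbrakk>e \<in> Arr C; Cod C e = d; \<not> is_initial C (Dom C e); P e\<rbrakk> \<Longrightarrow> Q"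
    "\<not> is_initial C d"
  shows Q
  using assms
proof induction
  case (here d P) then show ?case using here(3)[of "Ide C d"] by simp
next
  case (step I D d e P)
  note [simp] = coproduct_simps[OF step(2)]
  obtain i where i: "i \<in> I" "\<not> is_initial C (D i)" using initial_coproduct[OF step(2)] step(6) by blast
  show ?case
  proof (rule step(4)[OF i(1) _ i(2)])
    fix f assume "f \<in> Arr C" "Cod C f = D i" "\<not> is_initial C (Dom C f)" "P (e i \<cdot> f)"
    then show Q using step(5)[of "e i \<cdot> f"] i by simp
  qed
qed

text \<open>The decomposition of the domain into preimages of the summands, one per index, read as a
  cover.\<close>

lemma coproduct_decomp:
  assumes I: "essentially_small elts I" and s: "is_coproduct C I X s \<iota>" and u: "u \<in> Arr C" "Cod C u = s"
  shows "locally (Dom C u) (\<lambda>e. \<exists>i a. i \<in> I \<and> a \<in> hom C (Dom C e) (X i) \<and> u \<cdot> e = \<iota> i \<cdot> a)"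
proof -
  obtain \<sigma> where \<sigma>: "inj_on \<sigma> I" "small elts (\<sigma> ` I)" using I by (auto simp: essentially_small_def)
  have s': "is_coproduct C (\<sigma> ` I) (\<lambda>j. X (inv_into I \<sigma> j)) s (\<lambda>j. \<iota> (inv_into I \<sigma> j))"
    using s by (simp only: coproduct_reindex_inv[OF \<sigma>(1)])
  note [simp] = coproduct_simps[OF s]
  obtain D e a where *: "is_coproduct C (\<sigma> ` I) D (Dom C u) e"
     "\<forall>j\<in>\<sigma> ` I. a j \<in> hom C (D j) (X (inv_into I \<sigma> j)) \<and> u \<cdot> e j = \<iota> (inv_into I \<sigma> j) \<cdot> a j"
    using small_decomp[OF \<sigma>(2) s' u] by blast
  note [simp] = coproduct_simps[OF *(1)]
  show ?thesis
  proof (rule step[OF \<sigma>(2) *(1)], rule here)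
    fix j assume j: "j \<in> \<sigma> ` I"
    then show "D j \<in> Obj C" by simp
    show "\<exists>i b. i \<in> I \<and> b \<in> hom C (Dom C (e j \<cdot> Ide C (D j))) (X i) \<and> u \<cdot> e j \<cdot> Ide C (D j) = \<iota> i \<cdot> b"
      using j bspec[OF *(2) j] inv_into_into[OF j] u by (intro exI[of _ "inv_into I \<sigma> j"] exI[of _ "a j"]) simp
  qed
qed

lemma coproduct_disjoint:
  assumes I: "essentially_small elts I" and s: "is_coproduct C I X s \<iota>" and "i \<in> I" "j \<in> I"
    "a \<in> Arr C" "b \<in> Arr C" "Dom C b = Dom C a" "Cod C a = X i" "Cod C b = X j"
    "\<not> is_initial C (Dom C a)" "\<iota> i \<cdot> a = \<iota> j \<cdot> b"
  shows "i = j \<and> a = b"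
proof -
  obtain \<sigma> where \<sigma>: "inj_on \<sigma> I" "small elts (\<sigma> ` I)" using I by (auto simp: essentially_small_def)
  have s': "is_coproduct C (\<sigma> ` I) (\<lambda>j. X (inv_into I \<sigma> j)) s (\<lambda>j. \<iota> (inv_into I \<sigma> j))"
    using s by (simp only: coproduct_reindex_inv[OF \<sigma>(1)])
  have "\<sigma> i = \<sigma> j \<and> a = b"
    by (rule small_disjoint[OF \<sigma>(2) s']) (use assms \<sigma> in auto)
  then show ?thesis using \<sigma> assms by (auto dest: inj_onD)
qed

text \<open>Local lifts can be glued and local equality is equality, so both halves of the universal
  property may be verified on a cover of a noninitial stage.\<close>

lemma locally_pullbackI:
  assumes "f \<in> Arr C" "g \<in> Arr C" "p \<in> Arr C" "q \<in> Arr C" "Cod C f = Cod C g"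
    "Dom C p = Dom C q" "Cod C p = Dom C f" "Cod C q = Dom C g" "f \<cdot> p = g \<cdot> q"
    "\<And>d a b. \<lbrakk>a \<in> Arr C; b \<in> Arr C; Dom C a = d; Dom C b = d; Cod C a = Dom C f; Cod C b = Dom C g;
      \<not> is_initial C d; f \<cdot> a = g \<cdot> b\<rbrakk> \<Longrightarrow>
      locally d (\<lambda>e. \<exists>h. h \<in> hom C (Dom C e) (Dom C q) \<and> p \<cdot> h = a \<cdot> e \<and> q \<cdot> h = b \<cdot> e)"
    "\<And>d h h'. \<lbrakk>h \<in> Arr C; h' \<in> Arr C; Dom C h = d; Dom C h' = d; Cod C h = Dom C q; Cod C h' = Dom C q;
      \<not> is_initial C d; p \<cdot> h = p \<cdot> h'; q \<cdot> h = q \<cdot> h'\<rbrakk> \<Longrightarrow> locally d (\<lambda>e. h \<cdot> e = h' \<cdot> e)"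
  shows "is_pullback C f g p q"
proof (rule pullbackI)
  fix d a b assume ab: "a \<in> Arr C" "b \<in> Arr C" "Dom C a = d" "Dom C b = d" "Cod C a = Dom C f" "Cod C b = Dom C g" "f \<cdot> a = g \<cdot> b"
  have "locally d (\<lambda>e. \<exists>h. h \<in> hom C (Dom C e) (Dom C q) \<and> p \<cdot> h = a \<cdot> e \<and> q \<cdot> h = b \<cdot> e)"
    using assms(10)[of a b d] ab locally_initial by blast
  then have "\<exists>h. h \<in> hom C d (Dom C q) \<and> locally d (\<lambda>e. p \<cdot> (h \<cdot> e) = a \<cdot> e \<and> q \<cdot> (h \<cdot> e) = b \<cdot> e)"
    by (rule locally_glue) (use assms(4) in auto)
  then obtain h where h: "h \<in> hom C d (Dom C q)" "locally d (\<lambda>e. p \<cdot> (h \<cdot> e) = a \<cdot> e \<and> q \<cdot> (h \<cdot> e) = b \<cdot> e)" by blast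
  have "p \<cdot> h = a"
    by (rule locally_eq[OF locally_weaken[OF h(2)]]) (use h(1) ab assms(1-9) in auto)
  moreover have "q \<cdot> h = b"
    by (rule locally_eq[OF locally_weaken[OF h(2)]]) (use h(1) ab assms(1-9) in auto)
  ultimately show "\<exists>h. h \<in> hom C d (Dom C q) \<and> p \<cdot> h = a \<and> q \<cdot> h = b" using h(1) by blast
next
  fix d h h' assume *: "h \<in> Arr C" "h' \<in> Arr C" "Dom C h = d" "Dom C h' = d" "Cod C h = Dom C q" "Cod C h' = Dom C q"
    "p \<cdot> h = p \<cdot> h'" "q \<cdot> h = q \<cdot> h'"
  have "locally d (\<lambda>e. h \<cdot> e = h' \<cdot> e)" using assms(11)[of h h' d] * locally_initial by blast
  then show "h = h'" by (rule locally_eq) (use * in auto)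
qed (use assms in auto)

text \<open>By Yoneda, a family of maps on generalized elements that is natural in the stage is an
  arrow. Here the family is a relation, single-valued at noninitial stages and defined only locally,
  which is how prescriptions on path elements arise.\<close>

lemma locally_define:
  assumes "X \<in> Obj C" "Y \<in> Obj C"
    and typed: "\<And>x y. R x y \<Longrightarrow> x \<in> Arr C \<and> Cod C x = X \<and> y \<in> hom C (Dom C x) Y"
    and stable: "\<And>x y e. \<lbrakk>R x y; e \<in> Arr C; Cod C e = Dom C x\<rbrakk> \<Longrightarrow> R (x \<cdot> e) (y \<cdot> e)"
    and funct: "\<And>x y y'. \<lbrakk>R x y; R x y'; \<not> is_initial C (Dom C x)\<rbrakk> \<Longrightarrow> y = y'"
    and total: "\<And>x. x \<in> Arr C \<Longrightarrow> Cod C x = X \<Longrightarrow> locally (Dom C x) (\<lambda>e. \<exists>y. R (x \<cdot> e) y)"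
  obtains c where "c \<in> Arr C" "Dom C c = X" "Cod C c = Y" "\<And>x y. R x y \<Longrightarrow> c \<cdot> x = y"
proof -
  \<comment> \<open>\<open>Ide C X\<close> is the generic element of \<open>X\<close>; its value,
    glued from a cover, is the arrow sought.\<close>
  have "locally X (\<lambda>e. \<exists>y. R (Ide C X \<cdot> e) y)" using total[of "Ide C X"] assms(1) by simp
  then have 1: "locally X (\<lambda>e. \<exists>y. y \<in> hom C (Dom C e) Y \<and> R e y)"
  proof (rule locally_weaken)
    fix e assume e: "e \<in> Arr C" "Cod C e = X" "\<exists>y. R (Ide C X \<cdot> e) y"
    then obtain y where "R e y" by auto
    then show "\<exists>y. y \<in> hom C (Dom C e) Y \<and> R e y" using typed by blast
  qed
  obtain c where c: "c \<in> hom C X Y" "locally X (\<lambda>e. R e (c \<cdot> e))" using locally_glue[OF 1 assms(2)] by blast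
  have "c \<cdot> x = y" if xy: "R x y" for x y
  proof (rule locally_eq)
    note t = typed[OF xy]
    have "locally (Dom C x) (\<lambda>e. R (x \<cdot> e) (c \<cdot> (x \<cdot> e)))"
      by (rule locally_restrict[OF c(2)]) (use t c(1) stable in fastforce)+
    then show "locally (Dom C x) (\<lambda>e. (c \<cdot> x) \<cdot> e = y \<cdot> e)"
    proof (rule locally_mono)
      fix e assume e: "e \<in> Arr C" "Cod C e = Dom C x" "\<not> is_initial C (Dom C e)" "R (x \<cdot> e) (c \<cdot> (x \<cdot> e))"
      have "c \<cdot> (x \<cdot> e) = y \<cdot> e" using funct[OF e(4) stable[OF xy e(1,2)]] e t by simp
      then show "(c \<cdot> x) \<cdot> e = y \<cdot> e" using e t c(1) by simp
    qed
  qed (use typed[OF xy] c in auto)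
  then show ?thesis using that c(1) by auto
qed

end

section \<open>Enriched graphs\<close>

text \<open>The selectors of \<open>ar\<close> are total and say nothing sensible on
  \<open>BaseAr\<close>; this singles out the arrows that are determined by their four
  components.\<close>

definition is_Mor :: "('u, 'o, 'm) ar \<Rightarrow> bool" where
  "is_Mor f \<longleftrightarrow> f = Mor (src f) (tgt f) (on_obs f) (on_homs f)"

lemma is_Mor_Mor [simp]: "is_Mor (Mor G H o' h)"
  by (simp add: is_Mor_def)

text \<open>Restricting both components to \<open>obs G\<close> supplies the extensionality that
  equality of arrows relies on.\<close>

definition mk_mor where
  "mk_mor G H o' h = Mor G H (\<lambda>x\<in>obs G. o' x) (\<lambda>p\<in>obs G \<times> obs G. h p)"

lemma mk_mor_simps [simp]:
  "src (mk_mor G H o' h) = G" "tgt (mk_mor G H o' h) = H" "is_Mor (mk_mor G H o' h)"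
  "x \<in> obs G \<Longrightarrow> on_obs (mk_mor G H o' h) x = o' x"
  "x \<in> obs G \<Longrightarrow> y \<in> obs G \<Longrightarrow> on_homs (mk_mor G H o' h) (x, y) = h (x, y)"
  by (auto simp: mk_mor_def)

lemma mor_comp_simps [simp]:
  "src (mor_comp W g f) = src f" "tgt (mor_comp W g f) = tgt g" "is_Mor (mor_comp W g f)"
  "x \<in> obs (src f) \<Longrightarrow> on_obs (mor_comp W g f) x = on_obs g (on_obs f x)"
  "x \<in> obs (src f) \<Longrightarrow> y \<in> obs (src f) \<Longrightarrow>
     on_homs (mor_comp W g f) (x, y) = on_homs g (on_obs f x, on_obs f y) \<cdot>\<^bsub>W\<^esub> on_homs f (x, y)"
  by (auto simp: mor_comp_def)

lemma mor_id_simps [simp]: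
  "src (mor_id W G) = G" "tgt (mor_id W G) = G" "is_Mor (mor_id W G)"
  "x \<in> obs G \<Longrightarrow> on_obs (mor_id W G) x = x"
  "x \<in> obs G \<Longrightarrow> y \<in> obs G \<Longrightarrow> on_homs (mor_id W G) (x, y) = Ide W (homob G (x, y))"
  by (auto simp: mor_id_def)

text \<open>Of source and target only objects and homs matter, so that graphs and enriched
  categories share it; an enriched functor is a \<open>gmor\<close> with further properties.\<close>

definition gmor where
  "gmor W f \<longleftrightarrow> is_Mor f \<and> graph_map W (src f) (tgt f) (on_obs f) (on_homs f)"

lemma gmor_simps [simp]:
  assumes "gmor W f"
  shows "x \<in> obs (src f) \<Longrightarrow> on_obs f x \<in> obs (tgt f)"
    "x \<in> obs (src f) \<Longrightarrow> y \<in> obs (src f) \<Longrightarrow> on_homs f (x, y) \<in> Arr W"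
    "x \<in> obs (src f) \<Longrightarrow> y \<in> obs (src f) \<Longrightarrow> Dom W (on_homs f (x, y)) = homob (src f) (x, y)"
    "x \<in> obs (src f) \<Longrightarrow> y \<in> obs (src f) \<Longrightarrow> Cod W (on_homs f (x, y)) = homob (tgt f) (on_obs f x, on_obs f y)"
  using assms unfolding gmor_def graph_map_def by (auto simp: PiE_iff)

lemma gmor_obs [simp]: "\<lbrakk>gmor W f; tgt f = H; x \<in> obs (src f)\<rbrakk> \<Longrightarrow> on_obs f x \<in> obs H"
  by auto

lemma gmor_mk [simp]:
  assumes "\<And>x. x \<in> obs G \<Longrightarrow> o' x \<in> obs H"
    "\<And>x y. x \<in> obs G \<Longrightarrow> y \<in> obs G \<Longrightarrow> h (x, y) \<in> hom W (homob G (x, y)) (homob H (o' x, o' y))"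
  shows "gmor W (mk_mor G H o' h)"
  using assms by (auto simp: gmor_def graph_map_def mk_mor_def)

lemma gmor_eqI:
  assumes "gmor W f" "gmor W g" "src f = src g" "tgt f = tgt g"
    "\<And>x. x \<in> obs (src g) \<Longrightarrow> on_obs f x = on_obs g x"
    "\<And>x y. x \<in> obs (src g) \<Longrightarrow> y \<in> obs (src g) \<Longrightarrow> on_homs f (x, y) = on_homs g (x, y)"
  shows "f = g"
proof -
  have "on_obs f \<in> extensional (obs (src g))" "on_obs g \<in> extensional (obs (src g))"
    "on_homs f \<in> extensional (obs (src g) \<times> obs (src g))" "on_homs g \<in> extensional (obs (src g) \<times> obs (src g))"
    using assms(1-3) unfolding gmor_def graph_map_def by (auto simp: PiE_iff)
  then have "on_obs f = on_obs g" "on_homs f = on_homs g"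
    using assms(5,6) by (auto intro: extensionalityI)
  then show ?thesis using assms(1-4) unfolding gmor_def is_Mor_def by metis
qed

lemma graph_simps:
  assumes "graph elts W G"
  shows "small elts (obs G)" "x \<in> obs G \<Longrightarrow> y \<in> obs G \<Longrightarrow> homob G (x, y) \<in> Obj W"
  using assms by (auto simp: graph_def)

lemma graph_GphI [simp]:
  assumes "small elts A" "\<And>x y. x \<in> A \<Longrightarrow> y \<in> A \<Longrightarrow> h (x, y) \<in> Obj W"
  shows "graph elts W (GphOb A (restrict h (A \<times> A)))"
  using assms unfolding graph_def by auto

lemma Gph_simps [simp]:
  "Dom (Gph elts W) = src" "Cod (Gph elts W) = tgt" "Ide (Gph elts W) = mor_id W"
  "Cmp (Gph elts W) = mor_comp W" "G \<in> Obj (Gph elts W) \<longleftrightarrow> graph elts W G"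
  by (auto simp: Gph_def)

lemma Gph_Arr: "f \<in> Arr (Gph elts W) \<longleftrightarrow> graph elts W (src f) \<and> graph elts W (tgt f) \<and> gmor W f"
proof
  assume "graph elts W (src f) \<and> graph elts W (tgt f) \<and> gmor W f"
  then show "f \<in> Arr (Gph elts W)" unfolding Gph_def gmor_def
    by (auto simp: is_Mor_def)
qed (auto simp: Gph_def gmor_def)

text \<open>A pullback taken componentwise: of sets on objects, in \<open>W\<close> on homs. It is
  stated for bare maps, because the same squares serve as pullbacks of graphs and of enriched
  categories.\<close>

definition cpb where
  "cpb W f g p q \<longleftrightarrow> gmor W f \<and> gmor W g \<and> gmor W p \<and> gmor W q \<and>
     tgt f = tgt g \<and> src p = src q \<and> tgt p = src f \<and> tgt q = src g \<and>
     (\<forall>z\<in>obs (src q). on_obs f (on_obs p z) = on_obs g (on_obs q z)) \<and>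
     (\<forall>x\<in>obs (src f). \<forall>y\<in>obs (src g). on_obs f x = on_obs g y \<longrightarrow>
        (\<exists>!z. z \<in> obs (src q) \<and> on_obs p z = x \<and> on_obs q z = y)) \<and>
     (\<forall>z\<in>obs (src q). \<forall>z'\<in>obs (src q). is_pullback W
        (on_homs f (on_obs p z, on_obs p z')) (on_homs g (on_obs q z, on_obs q z'))
        (on_homs p (z, z')) (on_homs q (z, z')))"

section \<open>Componentwise pullbacks of graphs\<close>

locale vcat = cat C for C :: "('u, 'o, 'm) vcat" (structure)
begin

lemma gmor_comp [simp]: "\<lbrakk>gmor C f; gmor C g; tgt f = src g\<rbrakk> \<Longrightarrow> gmor C (mor_comp C g f)"
  unfolding mor_comp_def using gmor_mk[of "src f" "\<lambda>x. on_obs g (on_obs f x)" "tgt g"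
    "\<lambda>(x, y). on_homs g (on_obs f x, on_obs f y) \<cdot> on_homs f (x, y)" C]
  unfolding mk_mor_def by (auto simp: hom_iff)

lemma gmor_id [simp]: "(\<And>x y. x \<in> obs G \<Longrightarrow> y \<in> obs G \<Longrightarrow> homob G (x, y) \<in> Obj C) \<Longrightarrow> gmor C (mor_id C G)"
  unfolding mor_id_def using gmor_mk[of G "\<lambda>x. x" G "\<lambda>p. Ide C (homob G p)" C]
  unfolding mk_mor_def by auto

lemma gmor_id_graph [simp]: "graph elts C G \<Longrightarrow> gmor C (mor_id C G)"
  by (rule gmor_id) (rule graph_simps)

lemma mor_comp_assoc:
  "\<lbrakk>gmor C f; gmor C g; gmor C h; tgt f = src g; tgt g = src h\<rbrakk> \<Longrightarrow>
    mor_comp C h (mor_comp C g f) = mor_comp C (mor_comp C h g) f"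
  by (rule gmor_eqI[of C]) auto

lemma mor_comp_id_right: "gmor C f \<Longrightarrow> mor_comp C f (mor_id C (src f)) = f"
proof (rule gmor_eqI[of C])
  assume f: "gmor C f"
  have "homob (src f) (x, y) \<in> Obj C" if "x \<in> obs (src f)" "y \<in> obs (src f)" for x y
    using gmor_simps[OF f] that Dom_Obj by metis
  then show "gmor C (mor_comp C f (mor_id C (src f)))" using f by simp
qed auto

lemma mor_comp_id_left: "gmor C f \<Longrightarrow> (\<And>x y. x \<in> obs (tgt f) \<Longrightarrow> y \<in> obs (tgt f) \<Longrightarrow> homob (tgt f) (x, y) \<in> Obj C)
    \<Longrightarrow> mor_comp C (mor_id C (tgt f)) f = f"
  by (rule gmor_eqI[of C]) auto

lemma cpb_lift:
  assumes pb: "cpb C f g p q" and a: "gmor C a" "tgt a = src f" and b: "gmor C b" "tgt b = src g" "src a = src b"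
    and eq: "mor_comp C f a = mor_comp C g b"
  obtains h where "gmor C h" "src h = src b" "tgt h = src q" "mor_comp C p h = a" "mor_comp C q h = b"
proof -
  have [simp]: "gmor C f" "gmor C g" "gmor C p" "gmor C q" "tgt f = tgt g" "src p = src q" "tgt p = src f" "tgt q = src g"
    using pb by (auto simp: cpb_def)
  note [simp] = a b
  let ?K = "src b"
  have eqo: "on_obs f (on_obs a k) = on_obs g (on_obs b k)" if "k \<in> obs ?K" for k
    using arg_cong[OF eq, of "\<lambda>m. on_obs m k"] that by simp
  have eqh: "on_homs f (on_obs a k, on_obs a l) \<cdot> on_homs a (k, l) = on_homs g (on_obs b k, on_obs b l) \<cdot> on_homs b (k, l)"
    if "k \<in> obs ?K" "l \<in> obs ?K" for k l
    using arg_cong[OF eq, of "\<lambda>m. on_homs m (k, l)"] that by simp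
  have "\<exists>z. z \<in> obs (src q) \<and> on_obs p z = on_obs a k \<and> on_obs q z = on_obs b k" if k: "k \<in> obs ?K" for k
  proof -
    have "on_obs a k \<in> obs (src f)" "on_obs b k \<in> obs (src g)"
      using gmor_simps(1)[OF a(1), of k] gmor_simps(1)[OF b(1), of k] k by auto
    then show ?thesis using pb eqo[OF k] unfolding cpb_def by blast
  qed
  then obtain \<zeta> where z: "\<And>k. k \<in> obs ?K \<Longrightarrow> \<zeta> k \<in> obs (src q)"
     "\<And>k. k \<in> obs ?K \<Longrightarrow> on_obs p (\<zeta> k) = on_obs a k" "\<And>k. k \<in> obs ?K \<Longrightarrow> on_obs q (\<zeta> k) = on_obs b k" by metis
  have "\<exists>h. h \<in> hom C (homob ?K (k, l)) (homob (src q) (\<zeta> k, \<zeta> l)) \<and> on_homs p (\<zeta> k, \<zeta> l) \<cdot> h = on_homs a (k, l) \<and>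
      on_homs q (\<zeta> k, \<zeta> l) \<cdot> h = on_homs b (k, l)" if k: "k \<in> obs ?K" "l \<in> obs ?K" for k l
  proof -
    have pb': "is_pullback C (on_homs f (on_obs a k, on_obs a l)) (on_homs g (on_obs b k, on_obs b l))
        (on_homs p (\<zeta> k, \<zeta> l)) (on_homs q (\<zeta> k, \<zeta> l))"
      using pb z k unfolding cpb_def by metis
    note 1 = gmor_simps(1)[OF a(1), of k] gmor_simps(1)[OF b(1), of k] gmor_simps(1)[OF a(1), of l] gmor_simps(1)[OF b(1), of l]
    show ?thesis
      by (rule pullback_lift[OF pb', of "on_homs a (k, l)" "on_homs b (k, l)" "homob ?K (k, l)"])
        (use k z eqh 1 in auto)
  qed
  then obtain \<theta>' where "\<And>k l. k \<in> obs ?K \<Longrightarrow> l \<in> obs ?K \<Longrightarrow> \<theta>' k l \<in> hom C (homob ?K (k, l)) (homob (src q) (\<zeta> k, \<zeta> l)) \<and>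
      on_homs p (\<zeta> k, \<zeta> l) \<cdot> \<theta>' k l = on_homs a (k, l) \<and> on_homs q (\<zeta> k, \<zeta> l) \<cdot> \<theta>' k l = on_homs b (k, l)"
    by metis
  then have t: "\<And>k l. k \<in> obs ?K \<Longrightarrow> l \<in> obs ?K \<Longrightarrow> (\<lambda>(k, l). \<theta>' k l) (k, l) \<in> hom C (homob ?K (k, l)) (homob (src q) (\<zeta> k, \<zeta> l)) \<and>
      on_homs p (\<zeta> k, \<zeta> l) \<cdot> \<theta>' k l = on_homs a (k, l) \<and> on_homs q (\<zeta> k, \<zeta> l) \<cdot> \<theta>' k l = on_homs b (k, l)"
    by simp
  let ?h = "mk_mor ?K (src q) \<zeta> (\<lambda>(k, l). \<theta>' k l)"
  have h: "gmor C ?h" using z t by (intro gmor_mk) blast+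
  moreover have "mor_comp C p ?h = a" by (rule gmor_eqI[of C]) (use h z t in auto)
  moreover have "mor_comp C q ?h = b" by (rule gmor_eqI[of C]) (use h z t in auto)
  ultimately show ?thesis using that by simp
qed

lemma cpb_ext:
  assumes pb: "cpb C f g p q" and h: "gmor C h" "gmor C h'" "src h = src h'" "tgt h = src q" "tgt h' = src q"
    and eq: "mor_comp C p h = mor_comp C p h'" "mor_comp C q h = mor_comp C q h'"
  shows "h = h'"
proof -
  have [simp]: "gmor C f" "gmor C g" "gmor C p" "gmor C q" "tgt f = tgt g" "src p = src q" "tgt p = src f" "tgt q = src g"
    using pb by (auto simp: cpb_def)
  note [simp] = h
  have o1: "on_obs h x \<in> obs (src q)" "on_obs h' x \<in> obs (src q)" if "x \<in> obs (src h')" for x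
    using gmor_simps(1)[OF h(1), of x] gmor_simps(1)[OF h(2), of x] that by auto
  have o: "on_obs h x = on_obs h' x" if x: "x \<in> obs (src h')" for x
  proof -
    have 1: "on_obs p (on_obs h x) = on_obs p (on_obs h' x)" "on_obs q (on_obs h x) = on_obs q (on_obs h' x)"
      using arg_cong[OF eq(1), of "\<lambda>m. on_obs m x"] arg_cong[OF eq(2), of "\<lambda>m. on_obs m x"] x by auto
    have "on_obs f (on_obs p (on_obs h' x)) = on_obs g (on_obs q (on_obs h' x))"
      using pb o1[OF x] by (auto simp: cpb_def)
    moreover have "on_obs p (on_obs h' x) \<in> obs (src f)" "on_obs q (on_obs h' x) \<in> obs (src g)"
      using gmor_simps(1)[of C p "on_obs h' x"] gmor_simps(1)[of C q "on_obs h' x"] o1[OF x] by auto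
    ultimately have "\<exists>!z. z \<in> obs (src q) \<and> on_obs p z = on_obs p (on_obs h' x) \<and> on_obs q z = on_obs q (on_obs h' x)"
      using pb unfolding cpb_def by blast
    then show ?thesis by (rule ex1_unique) (use 1 o1[OF x] in auto)
  qed
  show ?thesis
  proof (rule gmor_eqI[of C])
    fix x y assume xy: "x \<in> obs (src h')" "y \<in> obs (src h')"
    have pb': "is_pullback C (on_homs f (on_obs p (on_obs h' x), on_obs p (on_obs h' y)))
       (on_homs g (on_obs q (on_obs h' x), on_obs q (on_obs h' y)))
        (on_homs p (on_obs h' x, on_obs h' y)) (on_homs q (on_obs h' x, on_obs h' y))"
      using pb o1 xy unfolding cpb_def by blast
    have 1: "on_homs p (on_obs h' x, on_obs h' y) \<cdot> on_homs h (x, y) = on_homs p (on_obs h' x, on_obs h' y) \<cdot> on_homs h' (x, y)"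
      "on_homs q (on_obs h' x, on_obs h' y) \<cdot> on_homs h (x, y) = on_homs q (on_obs h' x, on_obs h' y) \<cdot> on_homs h' (x, y)"
      using arg_cong[OF eq(1), of "\<lambda>m. on_homs m (x, y)"] arg_cong[OF eq(2), of "\<lambda>m. on_homs m (x, y)"] xy o by auto
    show "on_homs h (x, y) = on_homs h' (x, y)"
      by (rule pullback_ext[OF pb', of _ _ "homob (src h') (x, y)"]) (use 1 xy o o1 in auto)
  qed (use o in auto)
qed

text \<open>Moves a componentwise pullback from the constructed vertex to any isomorphic
  one.\<close>

lemma cpb_iso:
  assumes pb: "cpb C f g p q" and k: "gmor C k" "gmor C l" "tgt k = src q" "src k = tgt l" "src l = src q"
    and kl: "mor_comp C k l = mor_id C (src q)" and lk: "mor_comp C l k = mor_id C (tgt l)"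
  shows "cpb C f g (mor_comp C p k) (mor_comp C q k)"
proof -
  have [simp]: "gmor C f" "gmor C g" "gmor C p" "gmor C q" "tgt f = tgt g" "src p = src q" "tgt p = src f" "tgt q = src g"
    using pb by (auto simp: cpb_def)
  note [simp] = k
  let ?r = "tgt l"
  have ko: "on_obs k x \<in> obs (src q)" if "x \<in> obs ?r" for x using gmor_simps(1)[OF k(1), of x] that by simp
  have lo: "on_obs l x \<in> obs ?r" if "x \<in> obs (src q)" for x using gmor_simps(1)[OF k(2), of x] that by simp
  have klo: "on_obs k (on_obs l x) = x" if "x \<in> obs (src q)" for x
    using arg_cong[OF kl, of "\<lambda>m. on_obs m x"] that by simp
  have lko: "on_obs l (on_obs k x) = x" if "x \<in> obs ?r" for x
    using arg_cong[OF lk, of "\<lambda>m. on_obs m x"] that by simp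
  have klh: "on_homs k (on_obs l x, on_obs l y) \<cdot> on_homs l (x, y) = Ide C (homob (src q) (x, y))"
    if "x \<in> obs (src q)" "y \<in> obs (src q)" for x y
    using arg_cong[OF kl, of "\<lambda>m. on_homs m (x, y)"] that by simp
  have lkh: "on_homs l (on_obs k x, on_obs k y) \<cdot> on_homs k (x, y) = Ide C (homob ?r (x, y))"
    if "x \<in> obs ?r" "y \<in> obs ?r" for x y
    using arg_cong[OF lk, of "\<lambda>m. on_homs m (x, y)"] that by simp
  show ?thesis
    unfolding cpb_def
  proof (intro conjI ballI impI)
    fix z assume "z \<in> obs (src (mor_comp C q k))"
    then show "on_obs f (on_obs (mor_comp C p k) z) = on_obs g (on_obs (mor_comp C q k) z)"
      using pb ko by (auto simp: cpb_def)
  next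
    fix x y assume xy: "x \<in> obs (src f)" "y \<in> obs (src g)" "on_obs f x = on_obs g y"
    then have ex1: "\<exists>!z. z \<in> obs (src q) \<and> on_obs p z = x \<and> on_obs q z = y" using pb by (auto simp: cpb_def)
    then obtain z where z: "z \<in> obs (src q)" "on_obs p z = x" "on_obs q z = y" by blast
    show "\<exists>!z. z \<in> obs (src (mor_comp C q k)) \<and> on_obs (mor_comp C p k) z = x \<and> on_obs (mor_comp C q k) z = y"
    proof (rule ex1I[of _ "on_obs l z"])
      show "on_obs l z \<in> obs (src (mor_comp C q k)) \<and> on_obs (mor_comp C p k) (on_obs l z) = x \<and>
          on_obs (mor_comp C q k) (on_obs l z) = y" using z lo klo by simp
      fix z' assume z': "z' \<in> obs (src (mor_comp C q k)) \<and> on_obs (mor_comp C p k) z' = x \<and> on_obs (mor_comp C q k) z' = y"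
      have "on_obs k z' = z" by (rule ex1_unique[OF ex1]) (use z z' ko in auto)
      then show "z' = on_obs l z" using lko z' by auto
    qed
  next
    fix z z' assume zz: "z \<in> obs (src (mor_comp C q k))" "z' \<in> obs (src (mor_comp C q k))"
    let ?kz = "on_obs k z" and ?kz' = "on_obs k z'"
    have pb': "is_pullback C (on_homs f (on_obs p ?kz, on_obs p ?kz')) (on_homs g (on_obs q ?kz, on_obs q ?kz'))
        (on_homs p (?kz, ?kz')) (on_homs q (?kz, ?kz'))"
      using pb ko zz by (auto simp: cpb_def)
    have "is_pullback C (on_homs f (on_obs p ?kz, on_obs p ?kz')) (on_homs g (on_obs q ?kz, on_obs q ?kz'))
        (on_homs p (?kz, ?kz') \<cdot> on_homs k (z, z')) (on_homs q (?kz, ?kz') \<cdot> on_homs k (z, z'))"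
      by (rule pullback_iso[OF pb', of _ "homob ?r (z, z')" "on_homs l (?kz, ?kz')"])
        (use zz ko lko klh[of ?kz ?kz'] lkh in auto)
    then show "is_pullback C (on_homs f (on_obs (mor_comp C p k) z, on_obs (mor_comp C p k) z'))
        (on_homs g (on_obs (mor_comp C q k) z, on_obs (mor_comp C q k) z'))
        (on_homs (mor_comp C p k) (z, z')) (on_homs (mor_comp C q k) (z, z'))"
      using zz by simp
  qed auto
qed

lemma cpb_comp: "cpb C f g p q \<Longrightarrow> mor_comp C f p = mor_comp C g q"
proof (rule gmor_eqI[of C])
  assume pb: "cpb C f g p q"
  then have [simp]: "gmor C f" "gmor C g" "gmor C p" "gmor C q" "tgt f = tgt g" "src p = src q" "tgt p = src f" "tgt q = src g"
    by (auto simp: cpb_def)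
  show "gmor C (mor_comp C f p)" "gmor C (mor_comp C g q)" by auto
  fix x y assume xy: "x \<in> obs (src (mor_comp C g q))" "y \<in> obs (src (mor_comp C g q))"
  then have "is_pullback C (on_homs f (on_obs p x, on_obs p y)) (on_homs g (on_obs q x, on_obs q y))
     (on_homs p (x, y)) (on_homs q (x, y))"
    using pb by (auto simp: cpb_def)
  from pullback_simps(9)[OF this] show "on_homs (mor_comp C f p) (x, y) = on_homs (mor_comp C g q) (x, y)"
    using xy by simp
qed (auto simp: cpb_def)

lemma Gph_cat: "cat (Gph elts C)"
  unfolding cat_def is_category_def
  by (auto simp: Gph_Arr mor_comp_assoc mor_comp_id_right intro!: mor_comp_id_left dest: graph_simps)

lemma cpb_Gph_pullback:
  assumes pb: "cpb C f g p q" and "f \<in> Arr (Gph elts C)" "g \<in> Arr (Gph elts C)" "p \<in> Arr (Gph elts C)" "q \<in> Arr (Gph elts C)"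
  shows "is_pullback (Gph elts C) f g p q"
proof -
  let ?G = "Gph elts C"
  interpret G: cat ?G by (rule Gph_cat)
  have [simp]: "gmor C f" "gmor C g" "gmor C p" "gmor C q" "tgt f = tgt g" "src p = src q" "tgt p = src f" "tgt q = src g"
    using pb by (auto simp: cpb_def)
  show ?thesis
  proof (rule G.pullbackI)
    show "f \<cdot>\<^bsub>?G\<^esub> p = g \<cdot>\<^bsub>?G\<^esub> q" using cpb_comp[OF pb] by simp
    fix d a b assume *: "a \<in> Arr ?G" "b \<in> Arr ?G" "Dom ?G a = d" "Dom ?G b = d"
       "Cod ?G a = Dom ?G f" "Cod ?G b = Dom ?G g"
       "f \<cdot>\<^bsub>?G\<^esub> a = g \<cdot>\<^bsub>?G\<^esub> b"
    have "gmor C a" "gmor C b" using * by (auto simp: Gph_Arr)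
    then obtain h where h: "gmor C h" "src h = src b" "tgt h = src q" "mor_comp C p h = a" "mor_comp C q h = b"
      using cpb_lift[OF pb, of a b] * by auto
    then show "\<exists>h. h \<in> hom ?G d (Dom ?G q) \<and> p \<cdot>\<^bsub>?G\<^esub> h = a \<and> q \<cdot>\<^bsub>?G\<^esub> h = b"
      using * assms(5) by (intro exI[of _ h]) (auto simp: Gph_Arr)
  next
    fix d h h' assume "h \<in> Arr ?G" "h' \<in> Arr ?G" "Dom ?G h = d" "Dom ?G h' = d"
      "Cod ?G h = Dom ?G q" "Cod ?G h' = Dom ?G q"
      "p \<cdot>\<^bsub>?G\<^esub> h = p \<cdot>\<^bsub>?G\<^esub> h'" "q \<cdot>\<^bsub>?G\<^esub> h = q \<cdot>\<^bsub>?G\<^esub> h'"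
    then show "h = h'" using cpb_ext[OF pb, of h h'] by (simp add: Gph_Arr)
  qed (use assms in auto)
qed

end

locale pb_cat = universe elts + vcat C for elts :: "'u \<Rightarrow> 'u set" and C :: "('u, 'o, 'm) vcat" (structure) +
  assumes pullback_ex: "\<lbrakk>f \<in> Arr C; g \<in> Arr C; Cod C f = Cod C g\<rbrakk> \<Longrightarrow> \<exists>p q. is_pullback C f g p q"
begin

text \<open>The vertex graph has the coded pairs of objects with equal images as objects and
  pullbacks in \<open>C\<close> as homs.\<close>

lemma cpb_ex:
  assumes f: "gmor C f" and g: "gmor C g" and t: "tgt f = tgt g" and sm: "small elts (obs (src f))" "small elts (obs (src g))"
  obtains p q where "cpb C f g p q" "graph elts C (src q)"
proof -
  note [simp] = f g t
  define A where "A = code ` Sigma (obs (src f)) (\<lambda>x. {y \<in> obs (src g). on_obs f x = on_obs g y})"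
  define P Q where "P z = fst (decode z)" and "Q z = snd (decode z)" for z
  have A: "z \<in> A \<longleftrightarrow> (\<exists>x y. z = code (x, y) \<and> x \<in> obs (src f) \<and> y \<in> obs (src g) \<and> on_obs f x = on_obs g y)" for z
    by (auto simp: A_def)
  have PQ: "P z \<in> obs (src f)" "Q z \<in> obs (src g)" "on_obs f (P z) = on_obs g (Q z)" if "z \<in> A" for z
    using that by (auto simp: A P_def Q_def)
  have "\<exists>r. is_pullback C (on_homs f (P z, P z')) (on_homs g (Q z, Q z')) (fst r) (snd r)" if "z \<in> A" "z' \<in> A" for z z'
    using pullback_ex[of "on_homs f (P z, P z')" "on_homs g (Q z, Q z')"] PQ[OF that(1)] PQ[OF that(2)] f g t by simp
  then obtain r where "\<And>z z'. z \<in> A \<Longrightarrow> z' \<in> A \<Longrightarrow>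
      is_pullback C (on_homs f (P z, P z')) (on_homs g (Q z, Q z')) (fst (r z z')) (snd (r z z'))" by metis
  then obtain p' q' where "\<And>z z'. z \<in> A \<Longrightarrow> z' \<in> A \<Longrightarrow>
      is_pullback C (on_homs f (P z, P z')) (on_homs g (Q z, Q z')) (p' z z') (q' z z')"
    by (rule that[of "\<lambda>z z'. fst (r z z')" "\<lambda>z z'. snd (r z z')"])
  then have pb: "is_pullback C (on_homs f (P z, P z')) (on_homs g (Q z, Q z')) ((\<lambda>(x, y). p' x y) (z, z')) ((\<lambda>(x, y). q' x y) (z, z'))"
    if "z \<in> A" "z' \<in> A" for z z' using that by simp
  let ?S = "GphOb A (\<lambda>(x, y)\<in>A \<times> A. Dom C (q' x y))"
  have S: "graph elts C ?S"
  proof (rule graph_GphI)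
    show "small elts A" unfolding A_def by (rule small_Sigma) (use sm in "auto intro: small_subset")
    fix x y assume xy: "x \<in> A" "y \<in> A"
    show "(\<lambda>(x, y). Dom C (q' x y)) (x, y) \<in> Obj C" using pullback_simps(4)[OF pb[OF xy]] by simp
  qed
  let ?p = "mk_mor ?S (src f) P (\<lambda>(x, y). p' x y)" and ?q = "mk_mor ?S (src g) Q (\<lambda>(x, y). q' x y)"
  have [simp]: "gmor C ?p"
  proof (rule gmor_mk)
    fix x y assume xy: "x \<in> obs ?S" "y \<in> obs ?S"
    then have xy: "x \<in> A" "y \<in> A" by simp_all
    show "(\<lambda>(x, y). p' x y) (x, y) \<in> hom C (homob ?S (x, y)) (homob (src f) (P x, P y))"
      using pullback_simps(3,6,7)[OF pb[OF xy]] PQ[OF xy(1)] PQ[OF xy(2)] xy by simp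
  qed (use PQ in simp)
  have [simp]: "gmor C ?q"
  proof (rule gmor_mk)
    fix x y assume xy: "x \<in> obs ?S" "y \<in> obs ?S"
    then have xy: "x \<in> A" "y \<in> A" by simp_all
    show "(\<lambda>(x, y). q' x y) (x, y) \<in> hom C (homob ?S (x, y)) (homob (src g) (Q x, Q y))"
      using pullback_simps(4,8)[OF pb[OF xy]] PQ[OF xy(1)] PQ[OF xy(2)] xy by simp
  qed (use PQ in simp)
  have "cpb C f g ?p ?q"
    unfolding cpb_def
  proof (intro conjI ballI impI)
    fix z assume "z \<in> obs (src ?q)"
    then have z: "z \<in> A" by simp
    then show "on_obs f (on_obs ?p z) = on_obs g (on_obs ?q z)" using PQ(3)[OF z] by simp
  next
    fix x y assume xy: "x \<in> obs (src f)" "y \<in> obs (src g)" "on_obs f x = on_obs g y"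
    have c: "code (x, y) \<in> A" using xy A by blast
    show "\<exists>!z. z \<in> obs (src ?q) \<and> on_obs ?p z = x \<and> on_obs ?q z = y"
    proof (rule ex1I[of _ "code (x, y)"])
      show "code (x, y) \<in> obs (src ?q) \<and> on_obs ?p (code (x, y)) = x \<and> on_obs ?q (code (x, y)) = y"
        using c by (simp add: P_def Q_def)
      fix z assume "z \<in> obs (src ?q) \<and> on_obs ?p z = x \<and> on_obs ?q z = y"
      then have "z \<in> A" "P z = x" "Q z = y" by auto
      then show "z = code (x, y)" using A by (auto simp: P_def Q_def)
    qed
  next
    fix z z' assume "z \<in> obs (src ?q)" "z' \<in> obs (src ?q)"
    then have z: "z \<in> A" "z' \<in> A" by simp_all
    show "is_pullback C (on_homs f (on_obs ?p z, on_obs ?p z')) (on_homs g (on_obs ?q z, on_obs ?q z'))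
        (on_homs ?p (z, z')) (on_homs ?q (z, z'))"
      using pb[OF z] z by simp
  qed auto
  then show ?thesis using that[of ?p ?q] S by simp
qed

text \<open>An arbitrary pullback of graphs is isomorphic to the componentwise one. From left to
  right, this is what allows preservation of pullbacks to be proved hom by hom.\<close>

lemma Gph_pullback_iff:
  "is_pullback (Gph elts C) f g p q \<longleftrightarrow> cpb C f g p q \<and> f \<in> Arr (Gph elts C) \<and> g \<in> Arr (Gph elts C) \<and>
     p \<in> Arr (Gph elts C) \<and> q \<in> Arr (Gph elts C)"
proof
  let ?G = "Gph elts C"
  assume pb: "is_pullback ?G f g p q"
  interpret G: cat ?G by (rule Gph_cat)
  note t = G.pullback_simps[OF pb]
  have "gmor C f" "gmor C g" "tgt f = tgt g" "small elts (obs (src f))" "small elts (obs (src g))"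
    using t graph_simps(1) by (auto simp: Gph_Arr)
  then obtain p' q' where c: "cpb C f g p' q'" "graph elts C (src q')" using cpb_ex by blast
  have c': "p' \<in> Arr ?G" "q' \<in> Arr ?G" using c t by (auto simp: Gph_Arr cpb_def)
  have pb': "is_pullback ?G f g p' q'" by (rule cpb_Gph_pullback[OF c(1)]) (use t c' in auto)
  obtain k l where kl: "k \<in> hom ?G (src p) (src p')" "l \<in> hom ?G (src p') (src p)"
    "mor_comp C k l = mor_id C (src p')" "mor_comp C l k = mor_id C (src p)" "mor_comp C p' k = p" "mor_comp C q' k = q"
    using G.pullback_unique[OF pb' pb] by auto
  have "cpb C f g (mor_comp C p' k) (mor_comp C q' k)"
    by (rule cpb_iso[OF c(1), of k l]) (use kl c(1) in "auto simp: Gph_Arr cpb_def")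
  then show "cpb C f g p q \<and> f \<in> Arr ?G \<and> g \<in> Arr ?G \<and>
     p \<in> Arr ?G \<and> q \<in> Arr ?G" using kl t by simp
qed (use cpb_Gph_pullback in blast)

lemma Gph_pb_cat: "pb_cat elts (Gph elts C)"
proof (intro pb_cat.intro universe_axioms vcat.intro Gph_cat pb_cat_axioms.intro)
  let ?G = "Gph elts C"
  fix f g assume *: "f \<in> Arr ?G" "g \<in> Arr ?G" "Cod ?G f = Cod ?G g"
  then have "gmor C f" "gmor C g" "tgt f = tgt g" "small elts (obs (src f))" "small elts (obs (src g))"
    using graph_simps(1) by (auto simp: Gph_Arr)
  then obtain p q where c: "cpb C f g p q" "graph elts C (src q)" using cpb_ex by blast
  have "p \<in> Arr ?G" "q \<in> Arr ?G" using c * by (auto simp: Gph_Arr cpb_def)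
  then show "\<exists>p q. is_pullback ?G f g p q" using c * Gph_pullback_iff by blast
qed

end

section \<open>The action of Gph on functors and adjunctions\<close>

lemma Gph_ob_simps [simp]:
  "obs (Gph_ob H G) = obs G" "x \<in> obs G \<Longrightarrow> y \<in> obs G \<Longrightarrow> homob (Gph_ob H G) (x, y) = fob H (homob G (x, y))"
  by (auto simp: Gph_ob_def)

lemma Gph_fun_simps [simp]:
  "fob (Gph_fun H) G = Gph_ob H G" "src (far (Gph_fun H) f) = Gph_ob H (src f)" "tgt (far (Gph_fun H) f) = Gph_ob H (tgt f)"
  "is_Mor (far (Gph_fun H) f)" "on_obs (far (Gph_fun H) f) = on_obs f"
  "x \<in> obs (src f) \<Longrightarrow> y \<in> obs (src f) \<Longrightarrow> on_homs (far (Gph_fun H) f) (x, y) = far H (on_homs f (x, y))"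
  by (auto simp: Gph_fun_def)

lemma Gph_nat_simps [simp]:
  "src (Gph_nat H K \<alpha> G) = Gph_ob H G" "tgt (Gph_nat H K \<alpha> G) = Gph_ob K G"
  "is_Mor (Gph_nat H K \<alpha> G)" "x \<in> obs G \<Longrightarrow> on_obs (Gph_nat H K \<alpha> G) x = x"
  "x \<in> obs G \<Longrightarrow> y \<in> obs G \<Longrightarrow> on_homs (Gph_nat H K \<alpha> G) (x, y) = \<alpha> (homob G (x, y))"
  by (auto simp: Gph_nat_def)

lemma Gph_ob_comp [simp]: "Gph_ob (comp_functor K H) G = Gph_ob K (Gph_ob H G)"
  unfolding Gph_ob_def by (auto intro!: ext)

text \<open>The identity functor acts as the identity because a graph is built by
  \<open>GphOb\<close> from an extensional hom family.\<close>

lemma Gph_ob_id [simp]: "graph elts W G \<Longrightarrow> Gph_ob id_functor G = G"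
  unfolding Gph_ob_def graph_def by auto

lemma Gph_ob_graph:
  assumes "is_functor A B H" "graph elts A G" shows "graph elts B (Gph_ob H G)"
  unfolding Gph_ob_def by (rule graph_GphI) (use graph_simps[OF assms(2)] functor_simps[OF assms(1)] in auto)

lemma Gph_fun_gmor:
  assumes H: "is_functor A B H" and f: "gmor A f"
  shows "gmor B (far (Gph_fun H) f)"
proof -
  have "on_obs f \<in> obs (src f) \<rightarrow>\<^sub>E obs (tgt f)" using f unfolding gmor_def graph_map_def by auto
  moreover have "on_homs (far (Gph_fun H) f) \<in> extensional (obs (src f) \<times> obs (src f))" by (auto simp: Gph_fun_def)
  ultimately show ?thesis
    unfolding gmor_def graph_map_def using f functor_simps[OF H] by (auto simp: PiE_iff)
qed

lemma Gph_fun_is_functor: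
  assumes H: "is_functor A B H"
  shows "is_functor (Gph elts A) (Gph elts B) (Gph_fun H)"
proof -
  interpret A: vcat A using functor_cat H by (simp add: vcat_def)
  interpret B: vcat B using functor_cat H by (simp add: vcat_def)
  interpret GA: cat "Gph elts A" by (rule A.Gph_cat)
  interpret GB: cat "Gph elts B" by (rule B.Gph_cat)
  note [simp] = functor_simps[OF H] Gph_fun_gmor[OF H] Gph_ob_graph[OF H]
  have 1: "far (Gph_fun H) f \<in> Arr (Gph elts B)" if "f \<in> Arr (Gph elts A)" for f
    using that by (auto simp: Gph_Arr)
  show ?thesis
    unfolding is_functor_def
  proof (intro conjI ballI impI GA.is_cat GB.is_cat)
    fix G assume "G \<in> Obj (Gph elts A)"
    then have G: "graph elts A G" by simp
    note [simp] = graph_simps[OF G]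
    have "graph elts B (Gph_ob H G)" using G by simp
    then have 2: "gmor B (mor_id B (Gph_ob H G))" by (rule B.gmor_id_graph)
    show "far (Gph_fun H) (Ide (Gph elts A) G) = Ide (Gph elts B) (fob (Gph_fun H) G)"
      by (rule gmor_eqI[of B]) (use 2 in auto)
  next
    fix f g assume *: "f \<in> Arr (Gph elts A)" "g \<in> Arr (Gph elts A)" "Dom (Gph elts A) g = Cod (Gph elts A) f"
    then have [simp]: "gmor A f" "gmor A g" "src g = tgt f" by (auto simp: Gph_Arr)
    have o: "on_obs f x \<in> obs (tgt f)" if "x \<in> obs (src f)" for x using gmor_simps(1)[of A f x] that by simp
    show "far (Gph_fun H) (g \<cdot>\<^bsub>Gph elts A\<^esub> f) = far (Gph_fun H) g \<cdot>\<^bsub>Gph elts B\<^esub> far (Gph_fun H) f"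
      by (rule gmor_eqI[of B]) (use o in auto)
  qed (use 1 in auto)
qed

lemma Gph_nat_gmor:
  assumes "\<And>x y. x \<in> obs G \<Longrightarrow> y \<in> obs G \<Longrightarrow> \<alpha> (homob G (x, y)) \<in> hom B (fob H (homob G (x, y))) (fob K (homob G (x, y)))"
  shows "gmor B (Gph_nat H K \<alpha> G)"
  unfolding gmor_def graph_map_def Gph_nat_def using assms by (auto simp: Gph_ob_def)

text \<open>Objects are untouched, and on homs every equation is one for \<open>a\<close> at the hom
  objects.\<close>

lemma Gph_adj_is_adjunction:
  assumes adj: "is_adjunction A B a"
  shows "is_adjunction (Gph elts A) (Gph elts B) (Gph_adj a)"
proof -
  interpret adj A B a by unfold_locales fact
  interpret A: vcat A by (simp add: vcat_def C.cat_axioms)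
  interpret B: vcat B by (simp add: vcat_def D.cat_axioms)
  interpret GA: cat "Gph elts A" by (rule A.Gph_cat)
  interpret GB: cat "Gph elts B" by (rule B.Gph_cat)
  note LF = Gph_fun_is_functor[OF L_functor, of elts] and RF = Gph_fun_is_functor[OF R_functor, of elts]
  note [simp] = Gph_fun_gmor[OF L_functor] Gph_ob_graph[OF L_functor] Gph_fun_gmor[OF R_functor] Gph_ob_graph[OF R_functor]
  have u: "gmor A (Gph_nat id_functor (comp_functor R L) \<eta> G)" if "graph elts A G" for G
    by (rule Gph_nat_gmor) (use graph_simps[OF that] in auto)
  have c: "gmor B (Gph_nat (comp_functor L R) id_functor \<epsilon> G)" if "graph elts B G" for G
    by (rule Gph_nat_gmor) (use graph_simps[OF that] in auto)
  show ?thesis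
    unfolding is_adjunction_def Gph_adj_def nat_trans_def adjunction.simps
  proof (intro conjI ballI LF RF comp_functor_is[OF LF RF] comp_functor_is[OF RF LF] id_functor_is GA.cat_axioms GB.cat_axioms)
    fix G assume "G \<in> Obj (Gph elts A)"
    then have G: "graph elts A G" by simp
    show "Gph_nat id_functor (comp_functor R L) \<eta> G \<in> hom (Gph elts A) (fob id_functor G) (fob (comp_functor (Gph_fun R) (Gph_fun L)) G)"
      using u[OF G] G by (auto simp: Gph_Arr)
    note [simp] = u[OF G] c[OF Gph_ob_graph[OF L_functor G]] graph_simps[OF G]
    have l: "graph elts B (Gph_ob L G)" using G by simp
    note * = Gph_ob_id[OF G] Gph_ob_id[OF l]
    show "Gph_nat (comp_functor L R) id_functor \<epsilon> (fob (Gph_fun L) G) \<cdot>\<^bsub>Gph elts B\<^esub>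
         far (Gph_fun L) (Gph_nat id_functor (comp_functor R L) \<eta> G) = Ide (Gph elts B) (fob (Gph_fun L) G)"
      by (rule gmor_eqI[of B]) (use * l B.gmor_id_graph[OF l] triangle_L in auto)
  next
    fix G assume "G \<in> Obj (Gph elts B)"
    then have G: "graph elts B G" by simp
    show "Gph_nat (comp_functor L R) id_functor \<epsilon> G \<in> hom (Gph elts B) (fob (comp_functor (Gph_fun L) (Gph_fun R)) G) (fob id_functor G)"
      using c[OF G] G by (auto simp: Gph_Arr)
    note [simp] = c[OF G] u[OF Gph_ob_graph[OF R_functor G]] graph_simps[OF G]
    have l: "graph elts A (Gph_ob R G)" using G by simp
    note * = Gph_ob_id[OF G] Gph_ob_id[OF l]
    show "far (Gph_fun R) (Gph_nat (comp_functor L R) id_functor \<epsilon> G) \<cdot>\<^bsub>Gph elts A\<^esub>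
         Gph_nat id_functor (comp_functor R L) \<eta> (fob (Gph_fun R) G) = Ide (Gph elts A) (fob (Gph_fun R) G)"
      by (rule gmor_eqI[of A]) (use * l A.gmor_id_graph[OF l] triangle_R in auto)
  next
    fix f assume "f \<in> Arr (Gph elts A)"
    then have f: "graph elts A (src f)" "graph elts A (tgt f)" "gmor A f" by (auto simp: Gph_Arr)
    note [simp] = f(3) gmor_obs[OF f(3) refl] u[OF f(1)] u[OF f(2)] graph_simps[OF f(1)] graph_simps[OF f(2)]
    have *: "Gph_ob id_functor (src f) = src f" "Gph_ob id_functor (tgt f) = tgt f" using f by auto
    have **: "\<eta> (homob (tgt f) (on_obs f x, on_obs f y)) \<cdot>\<^bsub>A\<^esub> on_homs f (x, y) =
       far R (far L (on_homs f (x, y))) \<cdot>\<^bsub>A\<^esub> \<eta> (homob (src f) (x, y))" if "x \<in> obs (src f)" "y \<in> obs (src f)" for x y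
      using unit_natural[of "on_homs f (x, y)"] that by simp
    show "far (comp_functor (Gph_fun R) (Gph_fun L)) f \<cdot>\<^bsub>Gph elts A\<^esub> Gph_nat id_functor (comp_functor R L) \<eta> (Dom (Gph elts A) f) =
         Gph_nat id_functor (comp_functor R L) \<eta> (Cod (Gph elts A) f) \<cdot>\<^bsub>Gph elts A\<^esub> far id_functor f"
      by (rule gmor_eqI[of A]) (use * ** in auto)
  next
    fix f assume "f \<in> Arr (Gph elts B)"
    then have f: "graph elts B (src f)" "graph elts B (tgt f)" "gmor B f" by (auto simp: Gph_Arr)
    note [simp] = f(3) gmor_obs[OF f(3) refl] c[OF f(1)] c[OF f(2)] graph_simps[OF f(1)] graph_simps[OF f(2)]
    have *: "Gph_ob id_functor (src f) = src f" "Gph_ob id_functor (tgt f) = tgt f" using f by auto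
    have **: "\<epsilon> (homob (tgt f) (on_obs f x, on_obs f y)) \<cdot>\<^bsub>B\<^esub> far L (far R (on_homs f (x, y))) =
       on_homs f (x, y) \<cdot>\<^bsub>B\<^esub> \<epsilon> (homob (src f) (x, y))" if "x \<in> obs (src f)" "y \<in> obs (src f)" for x y
      using counit_natural[of "on_homs f (x, y)"] that by simp
    show "far id_functor f \<cdot>\<^bsub>Gph elts B\<^esub> Gph_nat (comp_functor L R) id_functor \<epsilon> (Dom (Gph elts B) f) =
         Gph_nat (comp_functor L R) id_functor \<epsilon> (Cod (Gph elts B) f) \<cdot>\<^bsub>Gph elts B\<^esub> far (comp_functor (Gph_fun L) (Gph_fun R)) f"
      by (rule gmor_eqI[of B]) (use * ** in auto)
  qed
qed

text \<open>The pullback of object sets is unchanged; only the hom squares are moved by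
  \<open>H\<close>.\<close>

lemma cpb_Gph_fun:
  assumes H: "is_functor A B H" and pres: "preserves_pullbacks A B H" and pb: "cpb A f g p q"
  shows "cpb B (far (Gph_fun H) f) (far (Gph_fun H) g) (far (Gph_fun H) p) (far (Gph_fun H) q)"
proof -
  have [simp]: "gmor A f" "gmor A g" "gmor A p" "gmor A q" "tgt f = tgt g" "src p = src q" "tgt p = src f" "tgt q = src g"
    using pb by (auto simp: cpb_def)
  have o: "on_obs p z \<in> obs (src f)" "on_obs q z \<in> obs (src g)" if "z \<in> obs (src q)" for z
    using gmor_simps(1)[of A p z] gmor_simps(1)[of A q z] that by auto
  show ?thesis using pb pres o unfolding cpb_def preserves_pullbacks_def by (auto simp: Gph_fun_gmor[OF H])
qed

section \<open>Enriched categories through generalized elements\<close>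

text \<open>Yoneda for arrows out of a product: the pair of projections is the generic
  element.\<close>

lemma (in fp_cat) prod2_arr_ext:
  assumes "X \<in> Arr C" "Y \<in> Arr C" "Dom C X = prod2 C a b" "Dom C Y = prod2 C a b" "a \<in> Obj C" "b \<in> Obj C"
    "\<And>d x y. \<lbrakk>d \<in> Obj C; x \<in> hom C d a; y \<in> hom C d b\<rbrakk> \<Longrightarrow> X \<cdot> pair C x y = Y \<cdot> pair C x y"
  shows "X = Y"
proof -
  have "X \<cdot> pair C (proj1 C a b) (proj2 C a b) = Y \<cdot> pair C (proj1 C a b) (proj2 C a b)"
    by (rule assms(7)[of "prod2 C a b"]) (use assms in auto)
  moreover have "pair C (proj1 C a b) (proj2 C a b) = Ide C (prod2 C a b)"
    using pair_proj[of "Ide C (prod2 C a b)" a b] assms by simp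
  ultimately show ?thesis using assms by simp
qed

locale venr = universe elts + fp_cat W + vcat W
  for elts :: "'u \<Rightarrow> 'u set" and W :: "('u, 'o, 'm) vcat" (structure)
begin

abbreviation "CAT \<equiv> Cat elts W"
abbreviation "GPH \<equiv> Gph elts W"
abbreviation "enr \<equiv> enriched_category elts W"

text \<open>Composition of generalized elements, with \<open>b\<close> after \<open>a\<close> as in
  the composition arrow. In these terms the axioms of an enriched category are the equations of an
  ordinary one, natural in the stage.\<close>

definition ecomp where "ecomp A x y z b a = mult A (x, y, z) \<cdot> pair W b a"
definition eid where "eid A x d = idt A x \<cdot> bang W d"

lemma enr_simps [simp]:
  assumes "enr A"
  shows "small elts (obs A)"
    "x \<in> obs A \<Longrightarrow> y \<in> obs A \<Longrightarrow> homob A (x, y) \<in> Obj W"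
    "\<lbrakk>x \<in> obs A; y \<in> obs A; z \<in> obs A\<rbrakk> \<Longrightarrow> mult A (x, y, z) \<in> Arr W"
    "\<lbrakk>x \<in> obs A; y \<in> obs A; z \<in> obs A\<rbrakk> \<Longrightarrow> Dom W (mult A (x, y, z)) = prod2 W (homob A (y, z)) (homob A (x, y))"
    "\<lbrakk>x \<in> obs A; y \<in> obs A; z \<in> obs A\<rbrakk> \<Longrightarrow> Cod W (mult A (x, y, z)) = homob A (x, z)"
    "x \<in> obs A \<Longrightarrow> idt A x \<in> Arr W" "x \<in> obs A \<Longrightarrow> Dom W (idt A x) = \<T>" "x \<in> obs A \<Longrightarrow> Cod W (idt A x) = homob A (x, x)"
proof -
  obtain O' h m j where A: "A = CatOb O' h m j" and "small elts O'" and h: "h \<in> O' \<times> O' \<rightarrow>\<^sub>E Obj W"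
    and m: "m \<in> (\<Pi>\<^sub>E (x, y, z)\<in>O' \<times> O' \<times> O'. hom W (prod2 W (h (y, z)) (h (x, y))) (h (x, z)))"
    and j: "j \<in> (\<Pi>\<^sub>E x\<in>O'. hom W \<T> (h (x, x)))"
    using assms unfolding enriched_category_def by blast
  then show "small elts (obs A)" by simp
  show "x \<in> obs A \<Longrightarrow> y \<in> obs A \<Longrightarrow> homob A (x, y) \<in> Obj W" using h by (auto simp: A)
  show "\<lbrakk>x \<in> obs A; y \<in> obs A; z \<in> obs A\<rbrakk> \<Longrightarrow> mult A (x, y, z) \<in> Arr W"
    "\<lbrakk>x \<in> obs A; y \<in> obs A; z \<in> obs A\<rbrakk> \<Longrightarrow> Dom W (mult A (x, y, z)) = prod2 W (homob A (y, z)) (homob A (x, y))"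
    "\<lbrakk>x \<in> obs A; y \<in> obs A; z \<in> obs A\<rbrakk> \<Longrightarrow> Cod W (mult A (x, y, z)) = homob A (x, z)"
    using PiE_mem[OF m, of "(x, y, z)"] by (auto simp: A)
  show "x \<in> obs A \<Longrightarrow> idt A x \<in> Arr W" "x \<in> obs A \<Longrightarrow> Dom W (idt A x) = \<T>" "x \<in> obs A \<Longrightarrow> Cod W (idt A x) = homob A (x, x)"
    using PiE_mem[OF j, of x] by (auto simp: A)
qed

lemma ecomp_simps [simp]:
  assumes "enr A" "x \<in> obs A" "y \<in> obs A" "z \<in> obs A" "a \<in> Arr W" "b \<in> Arr W" "Dom W b = Dom W a"
    "Cod W b = homob A (y, z)" "Cod W a = homob A (x, y)"
  shows "ecomp A x y z b a \<in> Arr W" "Dom W (ecomp A x y z b a) = Dom W a" "Cod W (ecomp A x y z b a) = homob A (x, z)"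
  using assms unfolding ecomp_def by auto

lemma ecomp_restrict [simp]:
  assumes "enr A" "x \<in> obs A" "y \<in> obs A" "z \<in> obs A" "a \<in> Arr W" "b \<in> Arr W" "Dom W b = Dom W a"
    "Cod W b = homob A (y, z)" "Cod W a = homob A (x, y)" "e \<in> Arr W" "Cod W e = Dom W a"
  shows "ecomp A x y z b a \<cdot> e = ecomp A x y z (b \<cdot> e) (a \<cdot> e)"
  using assms unfolding ecomp_def by auto

lemma eid_simps [simp]:
  assumes "enr A" "x \<in> obs A" "d \<in> Obj W"
  shows "eid A x d \<in> Arr W" "Dom W (eid A x d) = d" "Cod W (eid A x d) = homob A (x, x)"
  using assms unfolding eid_def by auto

lemma eid_restrict [simp]:
  assumes "enr A" "x \<in> obs A" "e \<in> Arr W" "Cod W e = d"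
  shows "eid A x d \<cdot> e = eid A x (Dom W e)"
  using assms unfolding eid_def by auto

lemma ecomp_assoc:
  assumes "enr A" "x \<in> obs A" "y \<in> obs A" "z \<in> obs A" "w \<in> obs A"
    "a \<in> Arr W" "b \<in> Arr W" "c \<in> Arr W" "Dom W b = Dom W a" "Dom W c = Dom W a"
    "Cod W a = homob A (x, y)" "Cod W b = homob A (y, z)" "Cod W c = homob A (z, w)"
  shows "ecomp A x z w c (ecomp A x y z b a) = ecomp A x y w (ecomp A y z w c b) a"
proof -
  obtain O' h m j where A: "A = CatOb O' h m j"
    and ass: "\<forall>x\<in>O'. \<forall>y\<in>O'. \<forall>z\<in>O'. \<forall>w\<in>O'.
        m (x, z, w) \<cdot> prod2_arr W (Ide W (h (z, w))) (m (x, y, z)) =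
        m (x, y, w) \<cdot> prod2_arr W (m (y, z, w)) (Ide W (h (x, y))) \<cdot> assoc W (h (z, w)) (h (y, z)) (h (x, y))"
    using assms(1) unfolding enriched_category_def by blast
  have "mult A (x, z, w) \<cdot> prod2_arr W (Ide W (homob A (z, w))) (mult A (x, y, z)) =
      mult A (x, y, w) \<cdot> prod2_arr W (mult A (y, z, w)) (Ide W (homob A (x, y)))
       \<cdot> assoc W (homob A (z, w)) (homob A (y, z)) (homob A (x, y))"
    using ass assms(2-5) unfolding A by simp
  then have "(mult A (x, z, w) \<cdot> prod2_arr W (Ide W (homob A (z, w))) (mult A (x, y, z))) \<cdot> pair W c (pair W b a) =
      (mult A (x, y, w) \<cdot> prod2_arr W (mult A (y, z, w)) (Ide W (homob A (x, y)))
       \<cdot> assoc W (homob A (z, w)) (homob A (y, z)) (homob A (x, y))) \<cdot> pair W c (pair W b a)" by simp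
  then show ?thesis using assms unfolding ecomp_def by simp
qed

lemma ecomp_eid [simp]:
  assumes "enr A" "x \<in> obs A" "y \<in> obs A" "a \<in> Arr W" "Dom W a = d" "Cod W a = homob A (x, y)"
  shows "ecomp A x y y (eid A y d) a = a" "ecomp A x x y a (eid A x d) = a"
proof -
  obtain O' h m j where A: "A = CatOb O' h m j"
    and un: "\<forall>x\<in>O'. \<forall>y\<in>O'.
        m (x, y, y) \<cdot> pair W (j y \<cdot> bang W (h (x, y))) (Ide W (h (x, y))) = Ide W (h (x, y)) \<and>
        m (x, x, y) \<cdot> pair W (Ide W (h (x, y))) (j x \<cdot> bang W (h (x, y))) = Ide W (h (x, y))"
    using assms(1) unfolding enriched_category_def by blast
  have 1: "mult A (x, y, y) \<cdot> pair W (idt A y \<cdot> bang W (homob A (x, y))) (Ide W (homob A (x, y))) = Ide W (homob A (x, y))"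
    "mult A (x, x, y) \<cdot> pair W (Ide W (homob A (x, y))) (idt A x \<cdot> bang W (homob A (x, y))) = Ide W (homob A (x, y))"
    using un assms(2,3) unfolding A by simp_all
  have "(mult A (x, y, y) \<cdot> pair W (idt A y \<cdot> bang W (homob A (x, y))) (Ide W (homob A (x, y)))) \<cdot> a = a"
    unfolding 1 using assms by simp
  then show "ecomp A x y y (eid A y d) a = a" using assms unfolding ecomp_def eid_def by simp
  have "(mult A (x, x, y) \<cdot> pair W (Ide W (homob A (x, y))) (idt A x \<cdot> bang W (homob A (x, y)))) \<cdot> a = a"
    unfolding 1 using assms by simp
  then show "ecomp A x x y a (eid A x d) = a" using assms unfolding ecomp_def eid_def by simp
qed

definition mk_cat where
  "mk_cat O' h m j = CatOb O' (restrict h (O' \<times> O')) (restrict m (O' \<times> O' \<times> O')) (restrict j O')"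

lemma mk_cat_simps [simp]:
  "obs (mk_cat O' h m j) = O'"
  "x \<in> O' \<Longrightarrow> y \<in> O' \<Longrightarrow> homob (mk_cat O' h m j) (x, y) = h (x, y)"
  "\<lbrakk>x \<in> O'; y \<in> O'; z \<in> O'\<rbrakk> \<Longrightarrow> mult (mk_cat O' h m j) (x, y, z) = m (x, y, z)"
  "x \<in> O' \<Longrightarrow> idt (mk_cat O' h m j) x = j x"
  by (auto simp: mk_cat_def)

text \<open>The diagrammatic axioms follow from their versions on generalized elements: the unit
  laws at the identity of the hom, associativity at arbitrary triples.\<close>

lemma enr_mk_cat:
  assumes sm: "small elts O'"
    and h: "\<And>x y. x \<in> O' \<Longrightarrow> y \<in> O' \<Longrightarrow> h (x, y) \<in> Obj W"
    and m: "\<And>x y z. \<lbrakk>x \<in> O'; y \<in> O'; z \<in> O'\<rbrakk> \<Longrightarrow> m (x, y, z) \<in> hom W (prod2 W (h (y, z)) (h (x, y))) (h (x, z))"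
    and j: "\<And>x. x \<in> O' \<Longrightarrow> j x \<in> hom W \<T> (h (x, x))"
    and ass: "\<And>x y z w d a b c. \<lbrakk>x \<in> O'; y \<in> O'; z \<in> O'; w \<in> O'; d \<in> Obj W; a \<in> hom W d (h (x, y));
       b \<in> hom W d (h (y, z)); c \<in> hom W d (h (z, w))\<rbrakk> \<Longrightarrow>
       m (x, z, w) \<cdot> pair W c (m (x, y, z) \<cdot> pair W b a) = m (x, y, w) \<cdot> pair W (m (y, z, w) \<cdot> pair W c b) a"
    and unl: "\<And>x y d a. \<lbrakk>x \<in> O'; y \<in> O'; d \<in> Obj W; a \<in> hom W d (h (x, y))\<rbrakk> \<Longrightarrow> m (x, y, y) \<cdot> pair W (j y \<cdot> bang W d) a = a"
    and unr: "\<And>x y d a. \<lbrakk>x \<in> O'; y \<in> O'; d \<in> Obj W; a \<in> hom W d (h (x, y))\<rbrakk> \<Longrightarrow> m (x, x, y) \<cdot> pair W a (j x \<cdot> bang W d) = a"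
  shows "enr (mk_cat O' h m j)"
  unfolding enriched_category_def mk_cat_def
proof (intro exI conjI ballI)
  show "restrict h (O' \<times> O') \<in> O' \<times> O' \<rightarrow>\<^sub>E Obj W" using h by auto
  show "restrict m (O' \<times> O' \<times> O') \<in> (\<Pi>\<^sub>E (x, y, z)\<in>O' \<times> O' \<times> O'. hom W (prod2 W (restrict h (O' \<times> O') (y, z))
      (restrict h (O' \<times> O') (x, y))) (restrict h (O' \<times> O') (x, z)))" using m by auto
  show "restrict j O' \<in> (\<Pi>\<^sub>E x\<in>O'. hom W \<T> (restrict h (O' \<times> O') (x, x)))" using j by auto
  fix x y assume xy: "x \<in> O'" "y \<in> O'"
  show "restrict m (O' \<times> O' \<times> O') (x, y, y) \<cdot> pair W (restrict j O' y \<cdot> bang W (restrict h (O' \<times> O') (x, y)))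
      (Ide W (restrict h (O' \<times> O') (x, y))) = Ide W (restrict h (O' \<times> O') (x, y))"
    using unl[of x y "h (x, y)" "Ide W (h (x, y))"] h xy by simp
  show "restrict m (O' \<times> O' \<times> O') (x, x, y) \<cdot> pair W (Ide W (restrict h (O' \<times> O') (x, y)))
      (restrict j O' x \<cdot> bang W (restrict h (O' \<times> O') (x, y))) = Ide W (restrict h (O' \<times> O') (x, y))"
    using unr[of x y "h (x, y)" "Ide W (h (x, y))"] h xy by simp
  fix z w assume zw: "z \<in> O'" "w \<in> O'"
  note [simp] = xy zw
  note [simp] = h[OF xy] h[OF xy(2) zw(1)] h[OF zw] h[OF xy(1) zw(1)] h[OF xy(2) zw(2)] h[OF xy(1) zw(2)]
     m[OF xy zw(1), simplified] m[OF xy zw(2), simplified] m[OF xy(2) zw, simplified] m[OF xy(1) zw, simplified]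
  have "m (x, z, w) \<cdot> prod2_arr W (Ide W (h (z, w))) (m (x, y, z)) =
        m (x, y, w) \<cdot> prod2_arr W (m (y, z, w)) (Ide W (h (x, y))) \<cdot> assoc W (h (z, w)) (h (y, z)) (h (x, y))"
  proof (rule prod2_arr_ext[of _ _ "h (z, w)" "prod2 W (h (y, z)) (h (x, y))"])
    fix d c ba assume c: "d \<in> Obj W" "c \<in> hom W d (h (z, w))" and ba: "ba \<in> hom W d (prod2 W (h (y, z)) (h (x, y)))"
    \<comment> \<open>An element of the inner product is a pair, so both sides need only be compared
      on triples.\<close>
    define b a where "b = proj1 W (h (y, z)) (h (x, y)) \<cdot> ba" and "a = proj2 W (h (y, z)) (h (x, y)) \<cdot> ba"
    have eq: "ba = pair W b a" using pair_proj[of ba "h (y, z)" "h (x, y)"] ba by (simp add: a_def b_def)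
    have t: "b \<in> hom W d (h (y, z))" "a \<in> hom W d (h (x, y))" using ba by (auto simp: a_def b_def)
    show "(m (x, z, w) \<cdot> prod2_arr W (Ide W (h (z, w))) (m (x, y, z))) \<cdot> pair W c ba =
        (m (x, y, w) \<cdot> prod2_arr W (m (y, z, w)) (Ide W (h (x, y))) \<cdot> assoc W (h (z, w)) (h (y, z)) (h (x, y))) \<cdot> pair W c ba"
      using ass[OF xy zw c(1) t(2,1) c(2)] t c unfolding eq by simp
  qed auto
  then show "restrict m (O' \<times> O' \<times> O') (x, z, w) \<cdot> prod2_arr W (Ide W (restrict h (O' \<times> O') (z, w))) (restrict m (O' \<times> O' \<times> O') (x, y, z)) =
        restrict m (O' \<times> O' \<times> O') (x, y, w) \<cdot> prod2_arr W (restrict m (O' \<times> O' \<times> O') (y, z, w)) (Ide W (restrict h (O' \<times> O') (x, y)))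
       \<cdot> assoc W (restrict h (O' \<times> O') (z, w)) (restrict h (O' \<times> O') (y, z)) (restrict h (O' \<times> O') (x, y))"
    by simp
qed (use sm in auto)

text \<open>Functoriality tested on generalized elements. That source and target are enriched
  categories is stated separately, in \<open>Cat_Arr\<close>.\<close>

definition emor where
  "emor f \<longleftrightarrow> gmor W f \<and>
     (\<forall>x\<in>obs (src f). \<forall>y\<in>obs (src f). \<forall>z\<in>obs (src f). \<forall>a\<in>Arr W. \<forall>b\<in>Arr W. Dom W b = Dom W a \<longrightarrow>
       Cod W a = homob (src f) (x, y) \<longrightarrow> Cod W b = homob (src f) (y, z) \<longrightarrow>
       on_homs f (x, z) \<cdot> ecomp (src f) x y z b a =
       ecomp (tgt f) (on_obs f x) (on_obs f y) (on_obs f z) (on_homs f (y, z) \<cdot> b) (on_homs f (x, y) \<cdot> a)) \<and>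
     (\<forall>x\<in>obs (src f). \<forall>d\<in>Obj W. on_homs f (x, x) \<cdot> eid (src f) x d = eid (tgt f) (on_obs f x) d)"

lemma emor_gmor: "emor f \<Longrightarrow> gmor W f"
  by (simp add: emor_def)

lemma emor_comp:
  assumes "emor f" "x \<in> obs (src f)" "y \<in> obs (src f)" "z \<in> obs (src f)" "a \<in> Arr W" "b \<in> Arr W" "Dom W b = Dom W a"
    "Cod W a = homob (src f) (x, y)" "Cod W b = homob (src f) (y, z)"
  shows "on_homs f (x, z) \<cdot> ecomp (src f) x y z b a =
    ecomp (tgt f) (on_obs f x) (on_obs f y) (on_obs f z) (on_homs f (y, z) \<cdot> b) (on_homs f (x, y) \<cdot> a)"
  using assms unfolding emor_def by blast

lemma emor_id:
  assumes "emor f" "x \<in> obs (src f)" "d \<in> Obj W"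
  shows "on_homs f (x, x) \<cdot> eid (src f) x d = eid (tgt f) (on_obs f x) d"
  using assms unfolding emor_def by blast

lemma enriched_functor_iff:
  assumes A: "enr (src f)" and B: "enr (tgt f)" and M: "is_Mor f"
  shows "enriched_functor W (src f) (tgt f) (on_obs f) (on_homs f) \<longleftrightarrow> emor f"
proof
  assume ef: "enriched_functor W (src f) (tgt f) (on_obs f) (on_homs f)"
  then have g: "gmor W f" using M by (auto simp: gmor_def enriched_functor_def)
  note [simp] = gmor_simps[OF g] A B
  show "emor f"
    unfolding emor_def
  proof (intro conjI ballI impI g)
    fix x y z a b assume *: "x \<in> obs (src f)" "y \<in> obs (src f)" "z \<in> obs (src f)" "a \<in> Arr W" "b \<in> Arr W" "Dom W b = Dom W a"
      "Cod W a = homob (src f) (x, y)" "Cod W b = homob (src f) (y, z)"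
    have "on_homs f (x, z) \<cdot> mult (src f) (x, y, z) = mult (tgt f) (on_obs f x, on_obs f y, on_obs f z) \<cdot>
        prod2_arr W (on_homs f (y, z)) (on_homs f (x, y))"
      using ef * unfolding enriched_functor_def by blast
    then have "(on_homs f (x, z) \<cdot> mult (src f) (x, y, z)) \<cdot> pair W b a = (mult (tgt f) (on_obs f x, on_obs f y, on_obs f z) \<cdot>
        prod2_arr W (on_homs f (y, z)) (on_homs f (x, y))) \<cdot> pair W b a" by simp
    then show "on_homs f (x, z) \<cdot> ecomp (src f) x y z b a =
       ecomp (tgt f) (on_obs f x) (on_obs f y) (on_obs f z) (on_homs f (y, z) \<cdot> b) (on_homs f (x, y) \<cdot> a)"
      using * unfolding ecomp_def by simp
  next
    fix x d assume *: "x \<in> obs (src f)" "d \<in> Obj W"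
    have "on_homs f (x, x) \<cdot> idt (src f) x = idt (tgt f) (on_obs f x)"
      using ef * unfolding enriched_functor_def by blast
    from comp_eq[OF this, of "bang W d"] show "on_homs f (x, x) \<cdot> eid (src f) x d = eid (tgt f) (on_obs f x) d"
      using * unfolding eid_def by simp
  qed
next
  assume e: "emor f"
  then have g: "gmor W f" by (rule emor_gmor)
  note [simp] = gmor_simps[OF g] A B
  show "enriched_functor W (src f) (tgt f) (on_obs f) (on_homs f)"
    unfolding enriched_functor_def
  proof (intro conjI ballI)
    show "graph_map W (src f) (tgt f) (on_obs f) (on_homs f)" using g by (simp add: gmor_def)
    fix x assume x: "x \<in> obs (src f)"
    \<comment> \<open>At the terminal stage \<open>eid\<close> is the arrow \<open>idt\<close>
      itself.\<close>
    have "bang W \<T> = Ide W \<T>" using terminal_unique[of "Ide W \<T>"] by simp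
    then show "on_homs f (x, x) \<cdot> idt (src f) x = idt (tgt f) (on_obs f x)"
      using emor_id[OF e x, of \<T>] x unfolding eid_def by simp
    fix y z assume *: "y \<in> obs (src f)" "z \<in> obs (src f)"
    show "on_homs f (x, z) \<cdot> mult (src f) (x, y, z) = mult (tgt f) (on_obs f x, on_obs f y, on_obs f z) \<cdot>
        prod2_arr W (on_homs f (y, z)) (on_homs f (x, y))"
    proof (rule prod2_arr_ext[of _ _ "homob (src f) (y, z)" "homob (src f) (x, y)"])
      fix d b a assume "d \<in> Obj W" "b \<in> hom W d (homob (src f) (y, z))" "a \<in> hom W d (homob (src f) (x, y))"
      then show "(on_homs f (x, z) \<cdot> mult (src f) (x, y, z)) \<cdot> pair W b a =
        (mult (tgt f) (on_obs f x, on_obs f y, on_obs f z) \<cdot> prod2_arr W (on_homs f (y, z)) (on_homs f (x, y))) \<cdot> pair W b a"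
        using emor_comp[OF e x *, of a b] x * unfolding ecomp_def by simp
    qed (use x * in auto)
  qed
qed

lemma Cat_simps [simp]:
  "Dom CAT = src" "Cod CAT = tgt" "Ide CAT = mor_id W"
  "Cmp CAT = mor_comp W" "A \<in> Obj CAT \<longleftrightarrow> enr A"
  by (auto simp: Cat_def)

lemma Cat_Arr: "f \<in> Arr CAT \<longleftrightarrow> enr (src f) \<and> enr (tgt f) \<and> emor f"
proof
  assume "enr (src f) \<and> enr (tgt f) \<and> emor f"
  then have 1: "enr (src f)" "enr (tgt f)" "emor f" "is_Mor f" by (auto simp: emor_def gmor_def)
  have "enriched_functor W (src f) (tgt f) (on_obs f) (on_homs f)" using enriched_functor_iff[OF 1(1,2,4)] 1 by simp
  then show "f \<in> Arr CAT" using 1 unfolding Cat_def is_Mor_def by auto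
next
  assume "f \<in> Arr CAT"
  then obtain A B o' h where f: "f = Mor A B o' h" "enr A" "enr B" "enriched_functor W A B o' h"
    unfolding Cat_def by auto
  then show "enr (src f) \<and> enr (tgt f) \<and> emor f" using enriched_functor_iff[of f] by simp
qed

lemma emor_mor_id [simp]: assumes "enr A" shows "emor (mor_id W A)"
proof -
  have "gmor W (mor_id W A)" by (rule gmor_id) (use assms in auto)
  then show ?thesis unfolding emor_def using assms by simp
qed

lemma emor_mor_comp [simp]:
  assumes f: "emor f" and g: "emor g" and t: "tgt f = src g" and e: "enr (src f)" "enr (src g)" "enr (tgt g)"
  shows "emor (mor_comp W g f)"
  unfolding emor_def
proof (intro conjI ballI impI)
  note gm = emor_gmor[OF f] emor_gmor[OF g]
  note [simp] = gmor_simps[OF gm(1)] gmor_simps[OF gm(2)] t e gmor_obs[OF gm(1)] gmor_obs[OF gm(2)]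
  show "gmor W (mor_comp W g f)" using gm t by simp
  fix x assume x: "x \<in> obs (src (mor_comp W g f))"
  then have x': "x \<in> obs (src f)" by simp
  show "on_homs (mor_comp W g f) (x, x) \<cdot> eid (src (mor_comp W g f)) x d =
      eid (tgt (mor_comp W g f)) (on_obs (mor_comp W g f) x) d" if d: "d \<in> Obj W" for d
    using x' d emor_id[OF f x' d] emor_id[OF g, of "on_obs f x" d] by simp
  fix y z a b assume *: "y \<in> obs (src (mor_comp W g f))" "z \<in> obs (src (mor_comp W g f))" "a \<in> Arr W" "b \<in> Arr W" "Dom W b = Dom W a"
      "Cod W a = homob (src (mor_comp W g f)) (x, y)" "Cod W b = homob (src (mor_comp W g f)) (y, z)"
  then have *: "y \<in> obs (src f)" "z \<in> obs (src f)" "a \<in> Arr W" "b \<in> Arr W" "Dom W b = Dom W a"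
      "Cod W a = homob (src f) (x, y)" "Cod W b = homob (src f) (y, z)" by simp_all
  show "on_homs (mor_comp W g f) (x, z) \<cdot> ecomp (src (mor_comp W g f)) x y z b a =
       ecomp (tgt (mor_comp W g f)) (on_obs (mor_comp W g f) x) (on_obs (mor_comp W g f) y) (on_obs (mor_comp W g f) z)
        (on_homs (mor_comp W g f) (y, z) \<cdot> b) (on_homs (mor_comp W g f) (x, y) \<cdot> a)"
    using x' * emor_comp[OF f x' *] emor_comp[OF g, of "on_obs f x" "on_obs f y" "on_obs f z"
      "on_homs f (x, y) \<cdot> a" "on_homs f (y, z) \<cdot> b"] by simp
qed

lemma Cat_cat: "cat CAT"
  unfolding cat_def is_category_def
  by (auto simp: Cat_Arr emor_gmor mor_comp_assoc mor_comp_id_right intro!: mor_comp_id_left)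

sublocale CC: cat "CAT" by (rule Cat_cat)

section \<open>Pullbacks and finite products of enriched categories\<close>

lemma cpb_hom_ext:
  assumes "cpb W f g p q" "x \<in> obs (src q)" "y \<in> obs (src q)" "u \<in> Arr W" "v \<in> Arr W" "Dom W u = Dom W v"
    "Cod W u = homob (src q) (x, y)" "Cod W v = homob (src q) (x, y)"
    "on_homs p (x, y) \<cdot> u = on_homs p (x, y) \<cdot> v" "on_homs q (x, y) \<cdot> u = on_homs q (x, y) \<cdot> v"
  shows "u = v"
proof -
  have [simp]: "gmor W p" "gmor W q" "src p = src q" using assms by (auto simp: cpb_def)
  have pb': "is_pullback W (on_homs f (on_obs p x, on_obs p y)) (on_homs g (on_obs q x, on_obs q y)) (on_homs p (x, y)) (on_homs q (x, y))"
    using assms(1-3) by (auto simp: cpb_def)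
  show ?thesis by (rule pullback_ext[OF pb', of _ _ "Dom W v"]) (use assms in auto)
qed

text \<open>The componentwise lift is a functor: \<open>p\<close> and \<open>q\<close> are jointly
  monic on homs, and after composing with either of them the functor laws become those of the given
  cone.\<close>

lemma cpb_Cat_pullback:
  assumes pb: "cpb W f g p q" and ar: "f \<in> Arr CAT" "g \<in> Arr CAT" "p \<in> Arr CAT" "q \<in> Arr CAT"
  shows "is_pullback CAT f g p q"
proof -
  have [simp]: "gmor W f" "gmor W g" "gmor W p" "gmor W q" "tgt f = tgt g" "src p = src q" "tgt p = src f" "tgt q = src g"
    using pb by (auto simp: cpb_def)
  have [simp]: "enr (src f)" "enr (src g)" "enr (src q)" "enr (tgt g)" and e: "emor p" "emor q"
    using ar by (auto simp: Cat_Arr)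
  show ?thesis
  proof (rule CC.pullbackI)
    show "f \<cdot>\<^bsub>CAT\<^esub> p = g \<cdot>\<^bsub>CAT\<^esub> q" using cpb_comp[OF pb] by simp
    fix d a b assume *: "a \<in> Arr CAT" "b \<in> Arr CAT" "Dom CAT a = d" "Dom CAT b = d"
       "Cod CAT a = Dom CAT f" "Cod CAT b = Dom CAT g"
       "f \<cdot>\<^bsub>CAT\<^esub> a = g \<cdot>\<^bsub>CAT\<^esub> b"
    have ab [simp]: "gmor W a" "gmor W b" "enr (src b)" "src a = src b" "tgt a = src f" "tgt b = src g" and ea: "emor a" "emor b"
      using * by (auto simp: Cat_Arr emor_gmor)
    then obtain h where h: "gmor W h" "src h = src b" "tgt h = src q" and ph: "mor_comp W p h = a" and qh: "mor_comp W q h = b"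
      using cpb_lift[OF pb, of a b] * by auto
    note [simp] = h gmor_obs[OF h(1) h(3)] gmor_obs[OF \<open>gmor W p\<close>] gmor_obs[OF \<open>gmor W q\<close>]
    have ho [simp]: "on_obs h x \<in> obs (src q)" if "x \<in> obs (src b)" for x using gmor_obs[OF h(1) h(3), of x] that by simp
    have po: "on_obs p (on_obs h x) = on_obs a x" "on_obs q (on_obs h x) = on_obs b x" if "x \<in> obs (src b)" for x
      using arg_cong[OF ph, of "\<lambda>m. on_obs m x"] arg_cong[OF qh, of "\<lambda>m. on_obs m x"] that by auto
    have pm: "on_homs p (on_obs h x, on_obs h y) \<cdot> on_homs h (x, y) = on_homs a (x, y)"
       "on_homs q (on_obs h x, on_obs h y) \<cdot> on_homs h (x, y) = on_homs b (x, y)" if "x \<in> obs (src b)" "y \<in> obs (src b)" for x y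
      using arg_cong[OF ph, of "\<lambda>m. on_homs m (x, y)"] arg_cong[OF qh, of "\<lambda>m. on_homs m (x, y)"] that by auto
    have pe: "on_homs p (on_obs h x, on_obs h y) \<cdot> (on_homs h (x, y) \<cdot> u) = on_homs a (x, y) \<cdot> u"
       "on_homs q (on_obs h x, on_obs h y) \<cdot> (on_homs h (x, y) \<cdot> u) = on_homs b (x, y) \<cdot> u"
      if "x \<in> obs (src b)" "y \<in> obs (src b)" "u \<in> Arr W" "Cod W u = homob (src b) (x, y)" for x y u
      using comp_eq[OF pm(1)[OF that(1,2)], of u] comp_eq[OF pm(2)[OF that(1,2)], of u] that by auto
    have "emor h"
      unfolding emor_def
    proof (intro conjI ballI impI h(1))
      fix x y z v u assume "x \<in> obs (src h)" "y \<in> obs (src h)" "z \<in> obs (src h)" "v \<in> Arr W" "u \<in> Arr W" "Dom W u = Dom W v"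
        "Cod W v = homob (src h) (x, y)" "Cod W u = homob (src h) (y, z)"
      then have x: "x \<in> obs (src b)" "y \<in> obs (src b)" "z \<in> obs (src b)" "v \<in> Arr W" "u \<in> Arr W" "Dom W u = Dom W v"
        "Cod W v = homob (src b) (x, y)" "Cod W u = homob (src b) (y, z)" by simp_all
      have 1: "on_homs p (on_obs h x, on_obs h z) \<cdot> ecomp (src q) (on_obs h x) (on_obs h y) (on_obs h z) (on_homs h (y, z) \<cdot> u) (on_homs h (x, y) \<cdot> v)
         = on_homs a (x, z) \<cdot> ecomp (src b) x y z u v"
        using emor_comp[OF e(1), of "on_obs h x" "on_obs h y" "on_obs h z" "on_homs h (x, y) \<cdot> v" "on_homs h (y, z) \<cdot> u"]
          emor_comp[OF ea(1), of x y z v u] x by (simp add: po pe)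
      have 2: "on_homs q (on_obs h x, on_obs h z) \<cdot> ecomp (src q) (on_obs h x) (on_obs h y) (on_obs h z) (on_homs h (y, z) \<cdot> u) (on_homs h (x, y) \<cdot> v)
         = on_homs b (x, z) \<cdot> ecomp (src b) x y z u v"
        using emor_comp[OF e(2), of "on_obs h x" "on_obs h y" "on_obs h z" "on_homs h (x, y) \<cdot> v" "on_homs h (y, z) \<cdot> u"]
          emor_comp[OF ea(2), of x y z v u] x by (simp add: po pe)
      have "on_homs h (x, z) \<cdot> ecomp (src b) x y z u v =
        ecomp (src q) (on_obs h x) (on_obs h y) (on_obs h z) (on_homs h (y, z) \<cdot> u) (on_homs h (x, y) \<cdot> v)"
        by (rule cpb_hom_ext[OF pb, of "on_obs h x" "on_obs h z"]) (use x 1 2 in "simp_all add: pe")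
      then show "on_homs h (x, z) \<cdot> ecomp (src h) x y z u v =
        ecomp (tgt h) (on_obs h x) (on_obs h y) (on_obs h z) (on_homs h (y, z) \<cdot> u) (on_homs h (x, y) \<cdot> v)" by simp
    next
      fix x c assume "x \<in> obs (src h)" and c: "c \<in> Obj W"
      then have x: "x \<in> obs (src b)" by simp
      have "on_homs h (x, x) \<cdot> eid (src b) x c = eid (src q) (on_obs h x) c"
        by (rule cpb_hom_ext[OF pb, of "on_obs h x" "on_obs h x"])
          (use x c emor_id[OF e(1), of "on_obs h x" c] emor_id[OF e(2), of "on_obs h x" c] emor_id[OF ea(1), of x c] emor_id[OF ea(2), of x c]
            in "simp_all add: pe po")
      then show "on_homs h (x, x) \<cdot> eid (src h) x c = eid (tgt h) (on_obs h x) c" by simp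
    qed
    have d: "src b = d" using * by simp
    have "enr d" using ab(3) unfolding d .
    then have "h \<in> hom CAT d (Dom CAT q)" using \<open>emor h\<close> d by (simp add: Cat_Arr)
    then show "\<exists>h. h \<in> hom CAT d (Dom CAT q) \<and> p \<cdot>\<^bsub>CAT\<^esub> h = a \<and> q \<cdot>\<^bsub>CAT\<^esub> h = b"
      by (intro exI[of _ h]) (simp add: ph qh)
  next
    fix d h h' assume *: "h \<in> Arr CAT" "h' \<in> Arr CAT" "Dom CAT h = d" "Dom CAT h' = d"
      "Cod CAT h = Dom CAT q" "Cod CAT h' = Dom CAT q"
      "p \<cdot>\<^bsub>CAT\<^esub> h = p \<cdot>\<^bsub>CAT\<^esub> h'" "q \<cdot>\<^bsub>CAT\<^esub> h = q \<cdot>\<^bsub>CAT\<^esub> h'"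
    have "gmor W h" "gmor W h'" using * by (auto simp: Cat_Arr emor_gmor)
    then show "h = h'" using cpb_ext[OF pb, of h h'] * by simp
  qed (use ar in auto)
qed

lemma Cat_terminal:
  obtains T where "is_terminal CAT T" "obs T = {undefined}" "homob T (undefined, undefined) = \<T>"
proof -
  let ?u = "undefined :: 'u"
  let ?T = "mk_cat {?u} (\<lambda>_. \<T>) (\<lambda>_. bang W (prod2 W \<T> \<T>)) (\<lambda>_. Ide W \<T>)"
  have T: "enr ?T"
  proof (rule enr_mk_cat)
    fix d a assume "a \<in> hom W d \<T>"
    then show "bang W (prod2 W \<T> \<T>) \<cdot> pair W (Ide W \<T> \<cdot> bang W d) a = a"
       "bang W (prod2 W \<T> \<T>) \<cdot> pair W a (Ide W \<T> \<cdot> bang W d) = a"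
      using terminal_unique[of a] by auto
  qed (auto simp: small_singleton)
  have uni: "\<exists>!h. h \<in> hom CAT A ?T" if A: "enr A" for A
  proof (rule ex1I)
    let ?h = "mk_mor A ?T (\<lambda>_. ?u) (\<lambda>p. bang W (homob A p))"
    have gh: "gmor W ?h" by (rule gmor_mk) (use A in auto)
    have tu: "u = v" if "u \<in> Arr W" "v \<in> Arr W" "Dom W u = Dom W v" "Cod W u = \<T>" "Cod W v = \<T>" for u v
      using terminal_unique[of u] terminal_unique[of v] that by simp
    have "emor ?h" unfolding emor_def
      by (intro conjI ballI impI gh tu) (use A T gmor_simps[OF gh] in auto)
    then show "?h \<in> hom CAT A ?T" using A T by (auto simp: Cat_Arr)
    fix h assume "h \<in> hom CAT A ?T"
    then have h: "gmor W h" "src h = A" "tgt h = ?T" by (auto simp: Cat_Arr emor_gmor)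
    have o: "on_obs h x = ?u" if "x \<in> obs A" for x using gmor_obs[OF h(1,3), of x] that h by simp
    show "h = ?h"
    proof (rule gmor_eqI[OF h(1) gh])
      fix x y assume xy: "x \<in> obs (src ?h)" "y \<in> obs (src ?h)"
      then have xy: "x \<in> obs A" "y \<in> obs A" by simp_all
      have "on_homs h (x, y) = bang W (homob A (x, y))"
        using gmor_simps(2-)[OF h(1), of x y] xy o h terminal_unique[of "on_homs h (x, y)"] by simp
      then show "on_homs h (x, y) = on_homs ?h (x, y)" using xy by simp
    qed (use h o in auto)
  qed
  have "is_terminal CAT ?T"
    unfolding is_terminal_def
  proof (intro conjI ballI)
    show "?T \<in> Obj CAT" using T by (simp only: Cat_simps)
    show "\<exists>!h. h \<in> hom CAT A ?T" if "A \<in> Obj CAT" for A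
      by (rule uni) (use that in "simp only: Cat_simps")
  qed
  then show ?thesis using that[of ?T] by simp
qed

lemma terminal_pullback:
  assumes "f \<in> Arr W" "Cod W f = \<T>" "g \<in> Arr W" "Cod W g = \<T>"
  shows "is_pullback W f g (proj1 W (Dom W f) (Dom W g)) (proj2 W (Dom W f) (Dom W g))"
proof (rule pullbackI)
  have tu: "u = v" if "u \<in> Arr W" "v \<in> Arr W" "Dom W u = Dom W v" "Cod W u = \<T>" "Cod W v = \<T>" for u v
    using terminal_unique[of u] terminal_unique[of v] that by simp
  show "f \<cdot> proj1 W (Dom W f) (Dom W g) = g \<cdot> proj2 W (Dom W f) (Dom W g)" by (rule tu) (use assms in auto)
  show "\<exists>h. h \<in> hom W d (Dom W (proj2 W (Dom W f) (Dom W g))) \<and> proj1 W (Dom W f) (Dom W g) \<cdot> h = a \<and> proj2 W (Dom W f) (Dom W g) \<cdot> h = b"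
    if "a \<in> Arr W" "b \<in> Arr W" "Dom W a = d" "Dom W b = d" "Cod W a = Dom W f" "Cod W b = Dom W g" for d a b
    using that assms by (intro exI[of _ "pair W a b"]) simp
  show "h = h'" if "h \<in> Arr W" "h' \<in> Arr W" "Dom W h = d" "Dom W h' = d" "Cod W h = Dom W (proj2 W (Dom W f) (Dom W g))"
    "Cod W h' = Dom W (proj2 W (Dom W f) (Dom W g))" "proj1 W (Dom W f) (Dom W g) \<cdot> h = proj1 W (Dom W f) (Dom W g) \<cdot> h'"
    "proj2 W (Dom W f) (Dom W g) \<cdot> h = proj2 W (Dom W f) (Dom W g) \<cdot> h'" for d h h'
    by (rule pair_ext) (use that assms in auto)
qed (use assms in auto)

text \<open>Products are produced as componentwise pullbacks over the one-object category
  \<open>T\<close>. Its only hom is terminal, so the pullbacks on homs are binary products, which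
  \<open>W\<close> has.\<close>

lemma Cat_fp: "fp_cat CAT"
proof -
  obtain T where T: "is_terminal CAT T" "obs T = {undefined}" "homob T (undefined, undefined) = \<T>" by (rule Cat_terminal)
  show ?thesis
  proof (rule CC.fp_catI[OF T(1)])
    fix f g assume f: "f \<in> Arr CAT" "Cod CAT f = T" and g: "g \<in> Arr CAT" "Cod CAT g = T"
    define A B where "A = src f" and "B = src g"
    have fg [simp]: "gmor W f" "gmor W g" "enr A" "enr B" using f g by (auto simp: Cat_Arr emor_gmor A_def B_def)
    have st [simp]: "src f = A" "src g = B" "tgt f = T" "tgt g = T" using f g by (auto simp: A_def B_def)
    define l r where "l z = fst (decode z)" and "r z = snd (decode z)" for z
    define S where "S = code ` (obs A \<times> obs B)"
    have lr [simp]: "l (code (x, y)) = x" "r (code (x, y)) = y" for x y by (auto simp: l_def r_def)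
    have S [simp]: "l z \<in> obs A" "r z \<in> obs B" "code (l z, r z) = z" if "z \<in> S" for z using that by (auto simp: S_def)
    define h where "h = (\<lambda>(x, y). prod2 W (homob A (l x, l y)) (homob B (r x, r y)))"
    define p where "p = (\<lambda>(x, y). proj1 W (homob A (l x, l y)) (homob B (r x, r y)))"
    define q where "q = (\<lambda>(x, y). proj2 W (homob A (l x, l y)) (homob B (r x, r y)))"
    \<comment> \<open>Composition acts in each factor separately; \<open>p\<close> and
      \<open>q\<close> extract the factors of a hom, and \<open>mp\<close> is the resulting rule on
      elements.\<close>
    define m where "m = (\<lambda>(x, y, z). pair W
      (ecomp A (l x) (l y) (l z) (p (y, z) \<cdot> proj1 W (h (y, z)) (h (x, y))) (p (x, y) \<cdot> proj2 W (h (y, z)) (h (x, y))))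
      (ecomp B (r x) (r y) (r z) (q (y, z) \<cdot> proj1 W (h (y, z)) (h (x, y))) (q (x, y) \<cdot> proj2 W (h (y, z)) (h (x, y)))))"
    define j where "j x = pair W (eid A (l x) \<T>) (eid B (r x) \<T>)" for x
    have hpq [simp]: "h (x, y) \<in> Obj W" "p (x, y) \<in> Arr W" "Dom W (p (x, y)) = h (x, y)" "Cod W (p (x, y)) = homob A (l x, l y)"
      "q (x, y) \<in> Arr W" "Dom W (q (x, y)) = h (x, y)" "Cod W (q (x, y)) = homob B (r x, r y)" if "x \<in> S" "y \<in> S" for x y
      using that by (auto simp: h_def p_def q_def)
    have ext: "u = v" if "x \<in> S" "y \<in> S" "u \<in> Arr W" "v \<in> Arr W" "Dom W u = Dom W v" "Cod W u = h (x, y)" "Cod W v = h (x, y)"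
      "p (x, y) \<cdot> u = p (x, y) \<cdot> v" "q (x, y) \<cdot> u = q (x, y) \<cdot> v" for x y u v
      by (rule pair_ext[of u v "homob A (l x, l y)" "homob B (r x, r y)"]) (use that in "auto simp: h_def p_def q_def")
    have m [simp]: "m (x, y, z) \<in> Arr W" "Dom W (m (x, y, z)) = prod2 W (h (y, z)) (h (x, y))" "Cod W (m (x, y, z)) = h (x, z)"
      "p (x, z) \<cdot> m (x, y, z) = ecomp A (l x) (l y) (l z) (p (y, z) \<cdot> proj1 W (h (y, z)) (h (x, y))) (p (x, y) \<cdot> proj2 W (h (y, z)) (h (x, y)))"
      "q (x, z) \<cdot> m (x, y, z) = ecomp B (r x) (r y) (r z) (q (y, z) \<cdot> proj1 W (h (y, z)) (h (x, y))) (q (x, y) \<cdot> proj2 W (h (y, z)) (h (x, y)))"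
      if "x \<in> S" "y \<in> S" "z \<in> S" for x y z
      using that by (simp_all add: m_def h_def p_def q_def)
    have mp: "p (x, z) \<cdot> (m (x, y, z) \<cdot> pair W b a) = ecomp A (l x) (l y) (l z) (p (y, z) \<cdot> b) (p (x, y) \<cdot> a)"
      "q (x, z) \<cdot> (m (x, y, z) \<cdot> pair W b a) = ecomp B (r x) (r y) (r z) (q (y, z) \<cdot> b) (q (x, y) \<cdot> a)"
      if "x \<in> S" "y \<in> S" "z \<in> S" "a \<in> Arr W" "b \<in> Arr W" "Dom W b = Dom W a" "Cod W a = h (x, y)" "Cod W b = h (y, z)" for x y z a b
      using comp_eq[OF m(4)[OF that(1-3)], of "pair W b a"] comp_eq[OF m(5)[OF that(1-3)], of "pair W b a"] that by simp_all
    have j [simp]: "j x \<in> Arr W" "Dom W (j x) = \<T>" "Cod W (j x) = h (x, x)"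
      "p (x, x) \<cdot> j x = eid A (l x) \<T>" "q (x, x) \<cdot> j x = eid B (r x) \<T>" if "x \<in> S" for x
      using that by (auto simp: j_def h_def p_def q_def)
    have jp: "p (x, x) \<cdot> (j x \<cdot> bang W d) = eid A (l x) d" "q (x, x) \<cdot> (j x \<cdot> bang W d) = eid B (r x) d" if "x \<in> S" "d \<in> Obj W" for x d
      using comp_eq[OF j(4)[OF that(1)], of "bang W d"] comp_eq[OF j(5)[OF that(1)], of "bang W d"] that by simp_all
    let ?P = "mk_cat S h m j"
    have P: "enr ?P"
    proof (rule enr_mk_cat)
      show "small elts S" unfolding S_def by (rule small_Sigma) simp_all
      fix x y assume xy: "x \<in> S" "y \<in> S"
      show "h (x, y) \<in> Obj W" using xy by simp
      fix d a assume d: "d \<in> Obj W" "a \<in> hom W d (h (x, y))"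
      show "m (x, y, y) \<cdot> pair W (j y \<cdot> bang W d) a = a" by (rule ext[OF xy]) (use d xy in "simp_all add: mp jp")
      show "m (x, x, y) \<cdot> pair W a (j x \<cdot> bang W d) = a" by (rule ext[OF xy]) (use d xy in "simp_all add: mp jp")
      fix z w b c assume z: "z \<in> S" "w \<in> S" and bc: "b \<in> hom W d (h (y, z))" "c \<in> hom W d (h (z, w))"
      show "m (x, z, w) \<cdot> pair W c (m (x, y, z) \<cdot> pair W b a) = m (x, y, w) \<cdot> pair W (m (y, z, w) \<cdot> pair W c b) a"
        by (rule ext[OF xy(1) z(2)]) (use d xy z bc in "simp_all add: mp ecomp_assoc")
    qed auto
    let ?p = "mk_mor ?P A l p" and ?q = "mk_mor ?P B r q"
    have gp: "gmor W ?p" "gmor W ?q" by (rule gmor_mk; simp)+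
    have ep: "emor ?p" "emor ?q" unfolding emor_def using gp P by (auto simp: mp jp ecomp_def[of ?P] eid_def[of ?P])
    have o: "x \<in> obs A \<Longrightarrow> on_obs f x = undefined" "x \<in> obs B \<Longrightarrow> on_obs g x = undefined" for x
      using gmor_obs[OF fg(1) st(3), of x] gmor_obs[OF fg(2) st(4), of x] T(2) by simp_all
    have "cpb W f g ?p ?q" unfolding cpb_def
    proof (intro conjI ballI impI gp)
      fix x y assume "x \<in> obs (src f)" "y \<in> obs (src g)"
      then show "\<exists>!z. z \<in> obs (src ?q) \<and> on_obs ?p z = x \<and> on_obs ?q z = y"
        by (intro ex1I[of _ "code (x, y)"]) (auto simp: S_def)
    next
      fix z z' assume "z \<in> obs (src ?q)" "z' \<in> obs (src ?q)"
      then have z: "z \<in> S" "z' \<in> S" by simp_all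
      show "is_pullback W (on_homs f (on_obs ?p z, on_obs ?p z')) (on_homs g (on_obs ?q z, on_obs ?q z')) (on_homs ?p (z, z')) (on_homs ?q (z, z'))"
        using terminal_pullback[of "on_homs f (l z, l z')" "on_homs g (r z, r z')"] z gmor_simps(2-)[OF fg(1), of "l z" "l z'"]
          gmor_simps(2-)[OF fg(2), of "r z" "r z'"] o T(3) by (simp add: p_def q_def)
    qed (use o in auto)
    then have "is_pullback CAT f g ?p ?q"
      by (rule cpb_Cat_pullback) (use f g P ep in "auto simp: Cat_Arr")
    then show "\<exists>p q. is_pullback CAT f g p q" by blast
  qed
qed

end

section \<open>Coproducts of enriched graphs and categories\<close>

text \<open>\<open>\<kappa>\<close> names the summand that contains a given object of \<open>S\<close>.\<close>

definition gcop where
  "gcop W I X S \<iota> \<kappa> \<longleftrightarrow>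
     (\<forall>i\<in>I. gmor W (\<iota> i) \<and> src (\<iota> i) = X i \<and> tgt (\<iota> i) = S \<and>
        bij_betw (on_obs (\<iota> i)) (obs (X i)) {p \<in> obs S. \<kappa> p = i} \<and>
        (\<forall>x\<in>obs (X i). \<forall>y\<in>obs (X i).
           homob S (on_obs (\<iota> i) x, on_obs (\<iota> i) y) = homob (X i) (x, y) \<and>
           on_homs (\<iota> i) (x, y) = Ide W (homob (X i) (x, y)))) \<and>
     (\<forall>p\<in>obs S. \<kappa> p \<in> I) \<and>
     (\<forall>p\<in>obs S. \<forall>q\<in>obs S. \<kappa> p \<noteq> \<kappa> q \<longrightarrow> is_initial W (homob S (p, q)))"

section \<open>The universal property of disjoint unions of graphs\<close>

context vcat
begin

lemma gcop_simps:
  assumes "gcop C I X S \<iota> \<kappa>"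
  shows "\<And>i. i \<in> I \<Longrightarrow> gmor C (\<iota> i)" "\<And>i. i \<in> I \<Longrightarrow> src (\<iota> i) = X i" "\<And>i. i \<in> I \<Longrightarrow> tgt (\<iota> i) = S"
    "\<And>i x. i \<in> I \<Longrightarrow> x \<in> obs (X i) \<Longrightarrow> on_obs (\<iota> i) x \<in> obs S"
    "\<And>i x. i \<in> I \<Longrightarrow> x \<in> obs (X i) \<Longrightarrow> \<kappa> (on_obs (\<iota> i) x) = i"
    "\<And>i x y. \<lbrakk>i \<in> I; x \<in> obs (X i); y \<in> obs (X i)\<rbrakk> \<Longrightarrow> homob S (on_obs (\<iota> i) x, on_obs (\<iota> i) y) = homob (X i) (x, y)"
    "\<And>i x y. \<lbrakk>i \<in> I; x \<in> obs (X i); y \<in> obs (X i)\<rbrakk> \<Longrightarrow> on_homs (\<iota> i) (x, y) = Ide C (homob (X i) (x, y))"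
    "\<And>i x y. \<lbrakk>i \<in> I; x \<in> obs (X i); y \<in> obs (X i)\<rbrakk> \<Longrightarrow> on_obs (\<iota> i) x = on_obs (\<iota> i) y \<longleftrightarrow> x = y"
    "\<And>p. p \<in> obs S \<Longrightarrow> \<kappa> p \<in> I"
    "\<And>p q. \<lbrakk>p \<in> obs S; q \<in> obs S; \<kappa> p \<noteq> \<kappa> q\<rbrakk> \<Longrightarrow> is_initial C (homob S (p, q))"
  using assms unfolding gcop_def by (auto simp: bij_betw_def inj_on_def)

lemma gcop_obs:
  assumes "gcop C I X S \<iota> \<kappa>" "p \<in> obs S"
  obtains x where "x \<in> obs (X (\<kappa> p))" "on_obs (\<iota> (\<kappa> p)) x = p"
proof -
  have "\<kappa> p \<in> I" using assms by (auto simp: gcop_def)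
  then have "on_obs (\<iota> (\<kappa> p)) ` obs (X (\<kappa> p)) = {p' \<in> obs S. \<kappa> p' = \<kappa> p}"
    using assms unfolding gcop_def bij_betw_def by blast
  then have "p \<in> on_obs (\<iota> (\<kappa> p)) ` obs (X (\<kappa> p))" using assms(2) by simp
  then obtain x where "x \<in> obs (X (\<kappa> p))" "p = on_obs (\<iota> (\<kappa> p)) x" by (elim imageE)
  then show ?thesis using that by metis
qed

text \<open>Inside a summand the values are dictated by the family \<open>t\<close>; between
  summands the hom is initial and leaves exactly one choice.\<close>

lemma gcop_copair:
  assumes gc: "gcop C I X S \<iota> \<kappa>" and t: "\<And>i. i \<in> I \<Longrightarrow> gmor C (t i)" "\<And>i. i \<in> I \<Longrightarrow> src (t i) = X i" "\<And>i. i \<in> I \<Longrightarrow> tgt (t i) = T"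
    and T: "\<And>x y. x \<in> obs T \<Longrightarrow> y \<in> obs T \<Longrightarrow> homob T (x, y) \<in> Obj C"
  obtains h where "gmor C h" "src h = S" "tgt h = T" "\<And>i. i \<in> I \<Longrightarrow> mor_comp C h (\<iota> i) = t i"
proof -
  note [simp] = gcop_simps(1-9)[OF gc] t
  define r where "r p = (SOME x. x \<in> obs (X (\<kappa> p)) \<and> on_obs (\<iota> (\<kappa> p)) x = p)" for p
  have r: "r p \<in> obs (X (\<kappa> p))" "on_obs (\<iota> (\<kappa> p)) (r p) = p" if "p \<in> obs S" for p
  proof -
    have "\<exists>x. x \<in> obs (X (\<kappa> p)) \<and> on_obs (\<iota> (\<kappa> p)) x = p" using gcop_obs[OF gc that] by blast
    from someI_ex[OF this] show "r p \<in> obs (X (\<kappa> p))" "on_obs (\<iota> (\<kappa> p)) (r p) = p" by (auto simp: r_def)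
  qed
  have ri: "r (on_obs (\<iota> i) x) = x" if "i \<in> I" "x \<in> obs (X i)" for i x
    using r[of "on_obs (\<iota> i) x"] that by simp
  define ho where "ho p = on_obs (t (\<kappa> p)) (r p)" for p
  have ho: "ho p \<in> obs T" if "p \<in> obs S" for p
    using gmor_obs[OF t(1,3), of "\<kappa> p" "r p"] r that by (simp add: ho_def)
  have hr: "homob (X (\<kappa> q)) (r p, r q) = homob S (p, q)" if "p \<in> obs S" "q \<in> obs S" "\<kappa> p = \<kappa> q" for p q
    using gcop_simps(6)[OF gc, of "\<kappa> q" "r p" "r q"] r[of p] r[of q] that by simp
  define hh where "hh = (\<lambda>(p, q). if \<kappa> p = \<kappa> q then on_homs (t (\<kappa> p)) (r p, r q)
      else (SOME u. u \<in> hom C (homob S (p, q)) (homob T (ho p, ho q))))"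
  have hh: "hh (p, q) \<in> hom C (homob S (p, q)) (homob T (ho p, ho q))" if pq: "p \<in> obs S" "q \<in> obs S" for p q
  proof (cases "\<kappa> p = \<kappa> q")
    case True
    then show ?thesis using pq r[of p] r[of q] hr[OF pq] by (simp add: hh_def ho_def)
  next
    case False
    have "\<exists>u. u \<in> hom C (homob S (p, q)) (homob T (ho p, ho q))"
      by (rule initial_hom[OF gcop_simps(10)[OF gc pq False]]) (use pq ho T in auto)
    from someI_ex[OF this] False show ?thesis by (simp add: hh_def)
  qed
  have g: "gmor C (mk_mor S T ho hh)" by (rule gmor_mk) (use ho hh in auto)
  have "mor_comp C (mk_mor S T ho hh) (\<iota> i) = t i" if i: "i \<in> I" for i
  proof (rule gmor_eqI[of C])
    show "gmor C (mor_comp C (mk_mor S T ho hh) (\<iota> i))" using g i by simp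
    fix x assume "x \<in> obs (src (t i))"
    then have x: "x \<in> obs (X i)" using i by simp
    then show "on_obs (mor_comp C (mk_mor S T ho hh) (\<iota> i)) x = on_obs (t i) x" using ri i by (simp add: ho_def)
    fix y assume "y \<in> obs (src (t i))"
    then have y: "y \<in> obs (X i)" using i by simp
    show "on_homs (mor_comp C (mk_mor S T ho hh) (\<iota> i)) (x, y) = on_homs (t i) (x, y)"
      using i x y ri by (simp add: hh_def)
  qed (use i in auto)
  then show ?thesis using that[OF g] by simp
qed

lemma gcop_ext:
  assumes gc: "gcop C I X S \<iota> \<kappa>" and h: "gmor C h" "gmor C h'" "src h = S" "src h' = S" "tgt h = tgt h'"
    and eq: "\<And>i. i \<in> I \<Longrightarrow> mor_comp C h (\<iota> i) = mor_comp C h' (\<iota> i)"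
  shows "h = h'"
proof (rule gmor_eqI[OF h(1,2)])
  note [simp] = gcop_simps(1-9)[OF gc] h gmor_simps(2-)[OF h(1)] gmor_simps(2-)[OF h(2)]
  have o: "on_obs h p = on_obs h' p" if p: "p \<in> obs S" for p
  proof -
    obtain x where x: "x \<in> obs (X (\<kappa> p))" "on_obs (\<iota> (\<kappa> p)) x = p" by (rule gcop_obs[OF gc p])
    show ?thesis using arg_cong[OF eq, of "\<kappa> p" "\<lambda>m. on_obs m x"] x p by simp
  qed
  then show "\<And>x. x \<in> obs (src h') \<Longrightarrow> on_obs h x = on_obs h' x" by simp
  fix p q assume "p \<in> obs (src h')" "q \<in> obs (src h')"
  then have pq: "p \<in> obs S" "q \<in> obs S" by simp_all
  show "on_homs h (p, q) = on_homs h' (p, q)"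
  proof (cases "\<kappa> p = \<kappa> q")
    case True
    obtain x where x: "x \<in> obs (X (\<kappa> q))" "on_obs (\<iota> (\<kappa> q)) x = p" using gcop_obs[OF gc pq(1)] True by metis
    obtain y where y: "y \<in> obs (X (\<kappa> q))" "on_obs (\<iota> (\<kappa> q)) y = q" using gcop_obs[OF gc pq(2)] by metis
    have "homob (X (\<kappa> q)) (x, y) = homob S (p, q)" using gcop_simps(6)[OF gc _ x(1) y(1)] x y pq by simp
    then show ?thesis using arg_cong[OF eq, of "\<kappa> q" "\<lambda>m. on_homs m (x, y)"] x y pq by simp
  next
    case False
    show ?thesis by (rule initial_unique[OF gcop_simps(10)[OF gc pq False]]) (use pq o in auto)
  qed
qed (use h in auto)

text \<open>On the graph side this recognizes the image of a disjoint union of enriched categories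
  under a right adjoint.\<close>

lemma gcop_Gph:
  assumes gc: "gcop C I X S \<iota> \<kappa>" and X: "\<And>i. i \<in> I \<Longrightarrow> graph elts C (X i)" and S: "graph elts C S"
  shows "is_coproduct (Gph elts C) I X S \<iota>"
  unfolding is_coproduct_def
proof (intro conjI ballI allI impI)
  let ?G = "Gph elts C"
  note [simp] = gcop_simps(1-9)[OF gc]
  show "S \<in> Obj ?G" using S by simp
  show "\<iota> i \<in> hom ?G (X i) S" if "i \<in> I" for i using that X S by (simp add: Gph_Arr)
  fix T t assume T: "T \<in> Obj ?G" and t: "\<forall>i\<in>I. t i \<in> hom ?G (X i) T"
  obtain h where h: "gmor C h" "src h = S" "tgt h = T" "\<And>i. i \<in> I \<Longrightarrow> mor_comp C h (\<iota> i) = t i"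
    by (rule gcop_copair[OF gc, of t T]) (use T t in "auto simp: Gph_Arr dest: graph_simps")
  show "\<exists>!h. h \<in> hom ?G S T \<and> (\<forall>i\<in>I. h \<cdot>\<^bsub>?G\<^esub> \<iota> i = t i)"
  proof (rule ex1I[of _ h])
    show "h \<in> hom ?G S T \<and> (\<forall>i\<in>I. h \<cdot>\<^bsub>?G\<^esub> \<iota> i = t i)" using h S T by (simp add: Gph_Arr)
    fix h' assume h': "h' \<in> hom ?G S T \<and> (\<forall>i\<in>I. h' \<cdot>\<^bsub>?G\<^esub> \<iota> i = t i)"
    show "h' = h" by (rule gcop_ext[OF gc]) (use h h' in "auto simp: Gph_Arr")
  qed
qed

end

section \<open>Extensivity of the category of enriched categories\<close>

locale lexv = lextensive elts W + vcat W for elts :: "'u \<Rightarrow> 'u set" and W :: "('u, 'o, 'm) vcat" (structure)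
begin

sublocale venr elts W
  by (intro venr.intro universe_axioms fp_cat_axioms vcat_axioms)

text \<open>Functoriality of the copairing has two cases. Composable elements inside one summand are
  handled by the given functors. Elements that cross summands pass through an initial hom, so their
  stage is initial by strictness and both sides agree.\<close>

lemma gcop_Cat:
  assumes gc: "gcop W I X S \<iota> \<kappa>" and S: "enr S" and \<iota>: "\<And>i. i \<in> I \<Longrightarrow> \<iota> i \<in> Arr CAT"
  shows "is_coproduct CAT I X S \<iota>"
  unfolding is_coproduct_def
proof (intro conjI ballI allI impI)
  note g = gcop_simps[OF gc]
  note [simp] = g(1-9) S
  have ei: "emor (\<iota> i)" "enr (X i)" if "i \<in> I" for i using \<iota>[OF that] that by (auto simp: Cat_Arr)
  show "S \<in> Obj CAT" using S by simp
  show "\<iota> i \<in> hom CAT (X i) S" if "i \<in> I" for i using that \<iota> by simp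
  fix T t assume T: "T \<in> Obj CAT" and t: "\<forall>i\<in>I. t i \<in> hom CAT (X i) T"
  have et: "emor (t i)" "src (t i) = X i" "tgt (t i) = T" if "i \<in> I" for i using t that by (auto simp: Cat_Arr)
  have T' [simp]: "enr T" using T by simp
  obtain h where h: "gmor W h" "src h = S" "tgt h = T" and hi: "\<And>i. i \<in> I \<Longrightarrow> mor_comp W h (\<iota> i) = t i"
    by (rule gcop_copair[OF gc, of t T]) (use T et in "auto simp: emor_gmor")
  note [simp] = h gmor_simps(2-)[OF h(1)]
  have ho [simp]: "on_obs h p \<in> obs T" if "p \<in> obs S" for p by (rule gmor_obs[OF h(1,3)]) (use h that in simp)
  have hio: "on_obs h (on_obs (\<iota> i) x) = on_obs (t i) x" if "i \<in> I" "x \<in> obs (X i)" for i x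
    using arg_cong[OF hi[OF that(1)], of "\<lambda>m. on_obs m x"] that by simp
  have hih: "on_homs h (on_obs (\<iota> i) x, on_obs (\<iota> i) y) = on_homs (t i) (x, y)" if "i \<in> I" "x \<in> obs (X i)" "y \<in> obs (X i)" for i x y
    using arg_cong[OF hi[OF that(1)], of "\<lambda>m. on_homs m (x, y)"] that by simp
  have "emor h"
    unfolding emor_def
  proof (intro conjI ballI impI h(1))
    fix p d assume "p \<in> obs (src h)" and d: "d \<in> Obj W"
    then have p: "p \<in> obs S" by simp
    obtain x where x: "x \<in> obs (X (\<kappa> p))" "on_obs (\<iota> (\<kappa> p)) x = p" by (rule gcop_obs[OF gc p])
    have i: "\<kappa> p \<in> I" using p by simp
    have "eid S p d = eid (X (\<kappa> p)) x d" using emor_id[OF ei(1)[OF i], of x d] x d p ei(2)[OF i] by simp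
    moreover have "on_homs h (p, p) = on_homs (t (\<kappa> p)) (x, x)" "on_obs h p = on_obs (t (\<kappa> p)) x"
      using hih[OF i x(1) x(1)] hio[OF i x(1)] x by simp_all
    ultimately show "on_homs h (p, p) \<cdot> eid (src h) p d = eid (tgt h) (on_obs h p) d"
      using emor_id[OF et(1)[OF i], of x d] x d i et by simp
  next
    fix p q r a b assume "p \<in> obs (src h)" "q \<in> obs (src h)" "r \<in> obs (src h)" "a \<in> Arr W" "b \<in> Arr W" "Dom W b = Dom W a"
      "Cod W a = homob (src h) (p, q)" "Cod W b = homob (src h) (q, r)"
    then have *: "p \<in> obs S" "q \<in> obs S" "r \<in> obs S" "a \<in> Arr W" "b \<in> Arr W" "Dom W b = Dom W a"
      "Cod W a = homob S (p, q)" "Cod W b = homob S (q, r)" by simp_all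
    have "on_homs h (p, r) \<cdot> ecomp S p q r b a = ecomp T (on_obs h p) (on_obs h q) (on_obs h r) (on_homs h (q, r) \<cdot> b) (on_homs h (p, q) \<cdot> a)"
    proof (cases "\<kappa> p = \<kappa> q \<and> \<kappa> q = \<kappa> r")
      case True
      define i where "i = \<kappa> q"
      have i: "i \<in> I" "\<kappa> p = i" "\<kappa> q = i" "\<kappa> r = i" using * True by (auto simp: i_def)
      obtain x where x: "x \<in> obs (X i)" "on_obs (\<iota> i) x = p" using gcop_obs[OF gc *(1)] i by metis
      obtain y where y: "y \<in> obs (X i)" "on_obs (\<iota> i) y = q" using gcop_obs[OF gc *(2)] i by metis
      obtain z where z: "z \<in> obs (X i)" "on_obs (\<iota> i) z = r" using gcop_obs[OF gc *(3)] i by metis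
      have hS: "homob S (p, q) = homob (X i) (x, y)" "homob S (q, r) = homob (X i) (y, z)" "homob S (p, r) = homob (X i) (x, z)"
        using g(6)[OF i(1) x(1) y(1)] g(6)[OF i(1) y(1) z(1)] g(6)[OF i(1) x(1) z(1)] x y z by auto
      have "ecomp S p q r b a = ecomp (X i) x y z b a"
        using emor_comp[OF ei(1)[OF i(1)], of x y z a b] x y z * i(1) ei(2)[OF i(1)] hS by simp
      moreover have "on_homs h (p, r) = on_homs (t i) (x, z)" "on_homs h (q, r) = on_homs (t i) (y, z)" "on_homs h (p, q) = on_homs (t i) (x, y)"
        using hih[OF i(1) x(1) z(1)] hih[OF i(1) y(1) z(1)] hih[OF i(1) x(1) y(1)] x y z by simp_all
      moreover have "on_obs h p = on_obs (t i) x" "on_obs h q = on_obs (t i) y" "on_obs h r = on_obs (t i) z"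
        using hio[OF i(1) x(1)] hio[OF i(1) y(1)] hio[OF i(1) z(1)] x y z by simp_all
      ultimately show ?thesis using emor_comp[OF et(1)[OF i(1)], of x y z a b] x y z * i(1) et hS by simp
    next
      case False
      have "is_initial W (Cod W a) \<or> is_initial W (Cod W b)" using False * g(10) by metis
      then have "is_initial W (Dom W a)" using initial_strict[of a] initial_strict[of b] * by auto
      then show ?thesis by (rule initial_unique) (use * in auto)
    qed
    then show "on_homs h (p, r) \<cdot> ecomp (src h) p q r b a = ecomp (tgt h) (on_obs h p) (on_obs h q) (on_obs h r) (on_homs h (q, r) \<cdot> b) (on_homs h (p, q) \<cdot> a)"
      by simp
  qed
  show "\<exists>!h. h \<in> hom CAT S T \<and> (\<forall>i\<in>I. h \<cdot>\<^bsub>CAT\<^esub> \<iota> i = t i)"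
  proof (rule ex1I[of _ h])
    show "h \<in> hom CAT S T \<and> (\<forall>i\<in>I. h \<cdot>\<^bsub>CAT\<^esub> \<iota> i = t i)" using \<open>emor h\<close> hi by (simp add: Cat_Arr)
    fix h' assume h': "h' \<in> hom CAT S T \<and> (\<forall>i\<in>I. h' \<cdot>\<^bsub>CAT\<^esub> \<iota> i = t i)"
    show "h' = h" by (rule gcop_ext[OF gc]) (use h' hi in "auto simp: Cat_Arr emor_gmor")
  qed
qed

text \<open>The disjoint union, with coded objects \<open>(i, x)\<close> and an initial hom between
  different summands. Each axiom holds inside a summand by assumption, and elsewhere because the
  stage maps to an initial object and is therefore initial.\<close>

lemma gcop_ex:
  assumes I: "small elts I" and X: "\<And>i. i \<in> I \<Longrightarrow> enr (X i)"
  obtains S \<iota> \<kappa> where "gcop W I X S \<iota> \<kappa>" "enr S" "\<And>i. i \<in> I \<Longrightarrow> \<iota> i \<in> Arr CAT"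
proof -
  obtain z where z: "is_initial W z" using initial_ex by blast
  define A where "A = code ` Sigma I (\<lambda>i. obs (X i))"
  define K V where "K p = fst (decode p)" and "V p = snd (decode p)" for p
  have KV [simp]: "K (code (i, x)) = i" "V (code (i, x)) = x" for i x by (auto simp: K_def V_def)
  have A: "p \<in> A \<longleftrightarrow> (\<exists>i x. p = code (i, x) \<and> i \<in> I \<and> x \<in> obs (X i))" for p by (auto simp: A_def)
  have AK [simp]: "K p \<in> I" "V p \<in> obs (X (K p))" "enr (X (K p))" if "p \<in> A" for p using that A X by auto
  define h where "h = (\<lambda>(p, q). if K p = K q then homob (X (K p)) (V p, V q) else z)"
  have h_same: "h (p, q) = homob (X (K q)) (V p, V q)" if "K p = K q" for p q using that by (simp add: h_def)
  have h_diff: "h (p, q) = z" if "K p \<noteq> K q" for p q using that by (simp add: h_def)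
  have h [simp]: "h (p, q) \<in> Obj W" if "p \<in> A" "q \<in> A" for p q
    using that z initial_Obj AK(2)[of p] AK(3)[of q] AK(2)[of q] by (cases "K p = K q") (simp_all add: h_same h_diff)
  define m where "m = (\<lambda>(p, q, r). if K p = K q \<and> K q = K r then mult (X (K p)) (V p, V q, V r)
     else (SOME u. u \<in> hom W (prod2 W (h (q, r)) (h (p, q))) (h (p, r))))"
  have d_init: "is_initial W (Dom W a)" if "a \<in> Arr W" "Cod W a = h (p, q)" "K p \<noteq> K q" for a p q
    using initial_strict[of a] that z h_diff by simp
  have m_same: "m (p, q, r) = mult (X (K r)) (V p, V q, V r)" if "K p = K r" "K q = K r" for p q r using that by (simp add: m_def)
  have m [simp]: "m (p, q, r) \<in> Arr W" "Dom W (m (p, q, r)) = prod2 W (h (q, r)) (h (p, q))" "Cod W (m (p, q, r)) = h (p, r)"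
    if pqr: "p \<in> A" "q \<in> A" "r \<in> A" for p q r
  proof -
    have "m (p, q, r) \<in> hom W (prod2 W (h (q, r)) (h (p, q))) (h (p, r))"
    proof (cases "K p = K r \<and> K q = K r")
      case True
      then show ?thesis using AK(2,3)[OF pqr(1)] AK(2)[OF pqr(2)] AK(2)[OF pqr(3)] by (simp add: m_same h_same)
    next
      case False
      then have "K q \<noteq> K r \<or> K p \<noteq> K q" by auto
      \<comment> \<open>One of the two projections ends in an initial object, so the product is
        initial by strictness and the composition arrow is forced.\<close>
      then have "is_initial W (prod2 W (h (q, r)) (h (p, q)))"
        using d_init[of "proj1 W (h (q, r)) (h (p, q))" q r] d_init[of "proj2 W (h (q, r)) (h (p, q))" p q] pqr by (elim disjE) auto
      from initial_hom[OF this] have "\<exists>u. u \<in> hom W (prod2 W (h (q, r)) (h (p, q))) (h (p, r))" using pqr by simp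
      from someI_ex[OF this] show ?thesis using False by (auto simp: m_def)
    qed
    then show "m (p, q, r) \<in> Arr W" "Dom W (m (p, q, r)) = prod2 W (h (q, r)) (h (p, q))" "Cod W (m (p, q, r)) = h (p, r)" by auto
  qed
  define j where "j p = idt (X (K p)) (V p)" for p
  have j [simp]: "j p \<in> Arr W" "Dom W (j p) = \<T>" "Cod W (j p) = h (p, p)" if "p \<in> A" for p
    using AK[OF that] by (auto simp: j_def h_same)
  let ?S = "mk_cat A h m j"
  have S: "enr ?S"
  proof (rule enr_mk_cat)
    show "small elts A" unfolding A_def by (rule small_Sigma) (use I X in auto)
    fix p q assume pq: "p \<in> A" "q \<in> A"
    fix d a assume d: "d \<in> Obj W" and a: "a \<in> hom W d (h (p, q))"
    show "m (p, q, q) \<cdot> pair W (j q \<cdot> bang W d) a = a"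
    proof (cases "K p = K q")
      case True
      then show ?thesis using ecomp_eid(1)[OF AK(3)[OF pq(2)], of "V p" "V q" a d] AK[OF pq(1)] AK[OF pq(2)] a
        by (simp add: m_same ecomp_def eid_def j_def h_same)
    next
      case False
      have "is_initial W d" using d_init[of a p q] a False by auto
      then show ?thesis by (rule initial_unique) (use a pq d in auto)
    qed
    show "m (p, p, q) \<cdot> pair W a (j p \<cdot> bang W d) = a"
    proof (cases "K p = K q")
      case True
      then show ?thesis using ecomp_eid(2)[OF AK(3)[OF pq(2)], of "V p" "V q" a d] AK[OF pq(1)] AK[OF pq(2)] a
        by (simp add: m_same ecomp_def eid_def j_def h_same)
    next
      case False
      have "is_initial W d" using d_init[of a p q] a False by auto
      then show ?thesis by (rule initial_unique) (use a pq d in auto)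
    qed
    fix r s b c assume rs: "r \<in> A" "s \<in> A" and bc: "b \<in> hom W d (h (q, r))" "c \<in> hom W d (h (r, s))"
    show "m (p, r, s) \<cdot> pair W c (m (p, q, r) \<cdot> pair W b a) = m (p, q, s) \<cdot> pair W (m (q, r, s) \<cdot> pair W c b) a"
    proof (cases "K p = K s \<and> K q = K s \<and> K r = K s")
      case True
      then show ?thesis
        using ecomp_assoc[OF AK(3)[OF rs(2)], of "V p" "V q" "V r" "V s" a b c] AK[OF pq(1)] AK[OF pq(2)] AK[OF rs(1)] AK[OF rs(2)] a bc
        by (simp add: m_same ecomp_def h_same)
    next
      case False
      then have "K p \<noteq> K q \<or> K q \<noteq> K r \<or> K r \<noteq> K s" by auto
      then have "is_initial W d" using d_init[of a p q] d_init[of b q r] d_init[of c r s] a bc by (elim disjE) auto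
      then show ?thesis by (rule initial_unique) (use a bc pq rs d in auto)
    qed
  qed auto
  let ?\<iota> = "\<lambda>i. mk_mor (X i) ?S (\<lambda>x. code (i, x)) (\<lambda>p. Ide W (homob (X i) p))"
  have cA [simp]: "code (i, x) \<in> A" if "i \<in> I" "x \<in> obs (X i)" for i x using A that by blast
  have g\<iota>: "gmor W (?\<iota> i)" if i: "i \<in> I" for i
    by (rule gmor_mk) (use X[OF i] i in "auto simp: h_same")
  have e\<iota>: "emor (?\<iota> i)" if i: "i \<in> I" for i
    unfolding emor_def using g\<iota>[OF i] i X[OF i] by (auto simp: ecomp_def[of ?S] eid_def[of ?S] m_same h_same j_def ecomp_def[of "X i"] eid_def[of "X i"])
  have "gcop W I X ?S ?\<iota> K"
    unfolding gcop_def
  proof (intro conjI ballI impI g\<iota>)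
    fix i assume i: "i \<in> I"
    show "bij_betw (on_obs (?\<iota> i)) (obs (X i)) {p \<in> obs ?S. K p = i}"
      unfolding bij_betw_def
    proof
      show "inj_on (on_obs (?\<iota> i)) (obs (X i))" by (auto simp: inj_on_def)
      have "on_obs (?\<iota> i) ` obs (X i) = (\<lambda>x. code (i, x)) ` obs (X i)" by (rule image_cong) auto
      also have "\<dots> = {p \<in> obs ?S. K p = i}" using i A by auto
      finally show "on_obs (?\<iota> i) ` obs (X i) = {p \<in> obs ?S. K p = i}" .
    qed
  next
    fix p q assume "p \<in> obs ?S" "q \<in> obs ?S" "K p \<noteq> K q"
    then show "is_initial W (homob ?S (p, q))" using z by (simp add: h_diff)
  qed (auto simp: h_same)
  then show ?thesis using that[of ?S ?\<iota> K] S e\<iota> X by (simp add: Cat_Arr)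
qed

text \<open>The piece \<open>D i\<close> is the full subcategory on the objects that
  \<open>u\<close> sends into the summand \<open>i\<close>. A hom between different pieces maps to
  an initial hom, hence is initial by strictness.\<close>

lemma gcop_decomp:
  assumes gc: "gcop W I X S \<iota> \<kappa>" and \<iota>: "\<And>i. i \<in> I \<Longrightarrow> \<iota> i \<in> Arr CAT"
    and u: "u \<in> Arr CAT" "tgt u = S"
  obtains D e a \<kappa>' where "gcop W I D (src u) e \<kappa>'" "\<And>i. i \<in> I \<Longrightarrow> e i \<in> Arr CAT"
    "\<And>i. i \<in> I \<Longrightarrow> a i \<in> hom CAT (D i) (X i)" "\<And>i. i \<in> I \<Longrightarrow> mor_comp W u (e i) = mor_comp W (\<iota> i) (a i)"
proof -
  note g = gcop_simps[OF gc]
  define B where "B = src u"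
  have B [simp]: "enr B" "src u = B" and eu: "emor u" and gu: "gmor W u" and S: "enr S" using u by (auto simp: Cat_Arr B_def emor_gmor)
  note [simp] = g(1-9) u(2) S
  have uo [simp]: "on_obs u x \<in> obs S" if "x \<in> obs B" for x by (rule gmor_obs[OF gu u(2)]) (use that in simp)
  have uh [simp]: "on_homs u (x, y) \<in> Arr W" "Dom W (on_homs u (x, y)) = homob B (x, y)" "Cod W (on_homs u (x, y)) = homob S (on_obs u x, on_obs u y)"
    if "x \<in> obs B" "y \<in> obs B" for x y using gmor_simps(2-)[OF gu, of x y] that by auto
  have ei: "emor (\<iota> i)" "enr (X i)" if "i \<in> I" for i using \<iota>[OF that] that by (auto simp: Cat_Arr)
  define O' where "O' i = {x \<in> obs B. \<kappa> (on_obs u x) = i}" for i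
  have O': "x \<in> O' i \<longleftrightarrow> x \<in> obs B \<and> \<kappa> (on_obs u x) = i" for x i by (auto simp: O'_def)
  define D where "D i = mk_cat (O' i) (homob B) (mult B) (idt B)" for i
  have D [simp]: "obs (D i) = O' i" "x \<in> O' i \<Longrightarrow> y \<in> O' i \<Longrightarrow> homob (D i) (x, y) = homob B (x, y)"
    "\<lbrakk>x \<in> O' i; y \<in> O' i; z \<in> O' i\<rbrakk> \<Longrightarrow> ecomp (D i) x y z b a = ecomp B x y z b a"
    "x \<in> O' i \<Longrightarrow> eid (D i) x d = eid B x d" for i x y z a b d
    by (auto simp: D_def ecomp_def eid_def)
  have enrD [simp]: "enr (D i)" for i
    unfolding D_def
  proof (rule enr_mk_cat)
    show "small elts (O' i)" by (rule small_subset[of "obs B"]) (auto simp: O')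
    fix x y assume xy: "x \<in> O' i" "y \<in> O' i"
    fix d a assume d: "d \<in> Obj W" "a \<in> hom W d (homob B (x, y))"
    show "mult B (x, y, y) \<cdot> pair W (idt B y \<cdot> bang W d) a = a" "mult B (x, x, y) \<cdot> pair W a (idt B x \<cdot> bang W d) = a"
      using ecomp_eid[OF B(1), of x y a d] xy d O' by (auto simp: ecomp_def eid_def)
    fix z w b c assume "z \<in> O' i" "w \<in> O' i" "b \<in> hom W d (homob B (y, z))" "c \<in> hom W d (homob B (z, w))"
    then show "mult B (x, z, w) \<cdot> pair W c (mult B (x, y, z) \<cdot> pair W b a) = mult B (x, y, w) \<cdot> pair W (mult B (y, z, w) \<cdot> pair W c b) a"
      using ecomp_assoc[OF B(1), of x y z w a b c] xy d O' by (auto simp: ecomp_def)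
  qed (auto simp: O')
  define e where "e i = mk_mor (D i) B (\<lambda>x. x) (\<lambda>p. Ide W (homob B p))" for i
  have ge: "gmor W (e i)" for i unfolding e_def by (rule gmor_mk) (auto simp: O')
  have e [simp]: "src (e i) = D i" "tgt (e i) = B" "x \<in> O' i \<Longrightarrow> on_obs (e i) x = x"
    "x \<in> O' i \<Longrightarrow> y \<in> O' i \<Longrightarrow> on_homs (e i) (x, y) = Ide W (homob B (x, y))" for i x y by (auto simp: e_def)
  have ee: "emor (e i)" for i unfolding emor_def using ge O' by auto
  define r where "r i x = (SOME y. y \<in> obs (X i) \<and> on_obs (\<iota> i) y = on_obs u x)" for i x
  have r [simp]: "r i x \<in> obs (X i)" "on_obs (\<iota> i) (r i x) = on_obs u x" if "i \<in> I" "x \<in> O' i" for i x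
  proof -
    have "on_obs u x \<in> obs S" "\<kappa> (on_obs u x) = i" using that O' by auto
    then have "\<exists>y. y \<in> obs (X i) \<and> on_obs (\<iota> i) y = on_obs u x" using gcop_obs[OF gc] by metis
    from someI_ex[OF this] show "r i x \<in> obs (X i)" "on_obs (\<iota> i) (r i x) = on_obs u x" by (auto simp: r_def)
  qed
  have hX: "homob S (on_obs u x, on_obs u y) = homob (X i) (r i x, r i y)" if "i \<in> I" "x \<in> O' i" "y \<in> O' i" for i x y
    using g(6)[OF that(1), of "r i x" "r i y"] that by simp
  define a where "a i = mk_mor (D i) (X i) (r i) (on_homs u)" for i
  have a [simp]: "src (a i) = D i" "tgt (a i) = X i" "x \<in> O' i \<Longrightarrow> on_obs (a i) x = r i x"
    "x \<in> O' i \<Longrightarrow> y \<in> O' i \<Longrightarrow> on_homs (a i) (x, y) = on_homs u (x, y)" for i x y by (auto simp: a_def)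
  have ga: "gmor W (a i)" if i: "i \<in> I" for i unfolding a_def by (rule gmor_mk) (use O' hX i in auto)
  have ea: "emor (a i)" if i: "i \<in> I" for i
    unfolding emor_def
  proof (intro conjI ballI impI ga[OF i])
    fix x d assume "x \<in> obs (src (a i))" and d: "d \<in> Obj W"
    then have x: "x \<in> O' i" by simp
    have "eid S (on_obs u x) d = eid (X i) (r i x) d"
      using emor_id[OF ei(1)[OF i], of "r i x" d] x d i ei(2)[OF i] hX by simp
    then show "on_homs (a i) (x, x) \<cdot> eid (src (a i)) x d = eid (tgt (a i)) (on_obs (a i) x) d"
      using emor_id[OF eu, of x d] x d O' by simp
  next
    fix x y z v w assume *: "x \<in> obs (src (a i))" "y \<in> obs (src (a i))" "z \<in> obs (src (a i))" "v \<in> Arr W" "w \<in> Arr W" "Dom W w = Dom W v"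
      "Cod W v = homob (src (a i)) (x, y)" "Cod W w = homob (src (a i)) (y, z)"
    then have *: "x \<in> O' i" "y \<in> O' i" "z \<in> O' i" "v \<in> Arr W" "w \<in> Arr W" "Dom W w = Dom W v"
      "Cod W v = homob B (x, y)" "Cod W w = homob B (y, z)" by simp_all
    have **: "x \<in> obs B" "y \<in> obs B" "z \<in> obs B" using * O' by auto
    have "ecomp S (on_obs u x) (on_obs u y) (on_obs u z) (on_homs u (y, z) \<cdot> w) (on_homs u (x, y) \<cdot> v) =
       ecomp (X i) (r i x) (r i y) (r i z) (on_homs u (y, z) \<cdot> w) (on_homs u (x, y) \<cdot> v)"
      using emor_comp[OF ei(1)[OF i], of "r i x" "r i y" "r i z" "on_homs u (x, y) \<cdot> v" "on_homs u (y, z) \<cdot> w"] * ** i ei(2)[OF i] hX by simp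
    then show "on_homs (a i) (x, z) \<cdot> ecomp (src (a i)) x y z w v =
       ecomp (tgt (a i)) (on_obs (a i) x) (on_obs (a i) y) (on_obs (a i) z) (on_homs (a i) (y, z) \<cdot> w) (on_homs (a i) (x, y) \<cdot> v)"
      using emor_comp[OF eu, of x y z v w] * ** by simp
  qed
  have "gcop W I D B e (\<lambda>x. \<kappa> (on_obs u x))"
    unfolding gcop_def
  proof (intro conjI ballI impI ge)
    fix i assume i: "i \<in> I"
    have "on_obs (e i) ` O' i = (\<lambda>x. x) ` O' i" by (rule image_cong) auto
    then show "bij_betw (on_obs (e i)) (obs (D i)) {p \<in> obs B. \<kappa> (on_obs u p) = i}"
      unfolding bij_betw_def by (auto simp: inj_on_def O'_def)
  next
    fix p q assume pq: "p \<in> obs B" "q \<in> obs B" "\<kappa> (on_obs u p) \<noteq> \<kappa> (on_obs u q)"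
    have "is_initial W (homob S (on_obs u p, on_obs u q))" by (rule g(10)) (use pq in auto)
    then show "is_initial W (homob B (p, q))" using initial_strict[of "on_homs u (p, q)"] pq by simp
  qed auto
  moreover have "mor_comp W u (e i) = mor_comp W (\<iota> i) (a i)" if i: "i \<in> I" for i
  proof (rule gmor_eqI[of W])
    show "gmor W (mor_comp W u (e i))" "gmor W (mor_comp W (\<iota> i) (a i))" using gu ge ga i by auto
  qed (use i O' hX in auto)
  ultimately show ?thesis using that[of D e "\<lambda>x. \<kappa> (on_obs u x)" a] ee ea ei(2) by (simp add: Cat_Arr)
qed

lemma Cat_initial:
  assumes A: "enr A" and "obs A = {}" shows "is_initial CAT A"
  unfolding is_initial_def
proof (intro conjI ballI)
  show "A \<in> Obj CAT" using A by simp
  fix B assume B: "B \<in> Obj CAT"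
  let ?h = "mk_mor A B (\<lambda>x. x) (\<lambda>p. undefined)"
  have g: "gmor W ?h" by (rule gmor_mk) (use assms in auto)
  show "\<exists>!h. h \<in> hom CAT A B"
  proof (rule ex1I[of _ ?h])
    show "?h \<in> hom CAT A B" using g A B assms by (auto simp: Cat_Arr emor_def)
    fix h assume "h \<in> hom CAT A B"
    then show "h = ?h" using g assms gmor_eqI[of W h ?h] by (auto simp: Cat_Arr emor_gmor)
  qed
qed

text \<open>A noninitial enriched category has an object, and the image of that object names the
  summand. On homs the coprojections are identities, so nothing is lost.\<close>

lemma gcop_disjoint:
  assumes gc: "gcop W I X S \<iota> \<kappa>" and ij: "i \<in> I" "j \<in> I"
    and a: "a \<in> Arr CAT" "tgt a = X i" and b: "b \<in> Arr CAT" "tgt b = X j" "src b = src a"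
    and eq: "mor_comp W (\<iota> i) a = mor_comp W (\<iota> j) b" and ni: "\<not> is_initial CAT (src a)"
  shows "i = j \<and> a = b"
proof -
  note g = gcop_simps[OF gc]
  have ab: "enr (src a)" "gmor W a" "gmor W b" using a b by (auto simp: Cat_Arr emor_gmor)
  have o [simp]: "on_obs a x \<in> obs (X i)" "on_obs b x \<in> obs (X j)" if "x \<in> obs (src a)" for x
    using gmor_obs[OF ab(2) a(2)] gmor_obs[OF ab(3) b(2)] that b(3) by auto
  have eo: "on_obs (\<iota> i) (on_obs a x) = on_obs (\<iota> j) (on_obs b x)" if "x \<in> obs (src a)" for x
    using arg_cong[OF eq, of "\<lambda>m. on_obs m x"] that b(3) by simp
  obtain x where x: "x \<in> obs (src a)" using Cat_initial ab(1) ni by blast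
  have ij': "i = j" using g(5)[OF ij(1) o(1)[OF x]] g(5)[OF ij(2) o(2)[OF x]] eo[OF x] by simp
  have oe: "on_obs a x = on_obs b x" if "x \<in> obs (src a)" for x
    using eo[OF that] g(8)[OF ij(2) o(1)[OF that, unfolded ij'] o(2)[OF that]] ij' by simp
  have "a = b"
  proof (rule gmor_eqI[OF ab(2,3)])
    fix x y assume "x \<in> obs (src b)" "y \<in> obs (src b)"
    then have xy: "x \<in> obs (src a)" "y \<in> obs (src a)" using b by auto
    show "on_homs a (x, y) = on_homs b (x, y)"
      using arg_cong[OF eq, of "\<lambda>m. on_homs m (x, y)"] xy b(3) g(7)[OF ij(1)] g(7)[OF ij(2)] o
        gmor_simps(2-)[OF ab(2), of x y] gmor_simps(2-)[OF ab(3), of x y] a(2) b(2) by simp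
  qed (use a b oe ij' in auto)
  then show ?thesis using ij' by simp
qed

end

text \<open>Reproduces one level up the hypothesis on \<open>W\<close>, so that the free category
  construction can be iterated.\<close>

lemma (in lexv) Cat_lextensive: "lextensive elts CAT"
proof (intro lextensive.intro universe_axioms Cat_fp lextensive_axioms.intro)
  fix I :: "'u set" and X assume I: "small elts I" and X: "\<And>i. i \<in> I \<Longrightarrow> X i \<in> Obj CAT"
  obtain S \<iota> \<kappa> where S: "gcop W I X S \<iota> \<kappa>" "enr S" "\<And>i. i \<in> I \<Longrightarrow> \<iota> i \<in> Arr CAT"
    by (rule gcop_ex[OF I, of X]) (use X in auto)
  show "\<exists>S \<iota>. extensive_coproduct CAT I X S \<iota>"
    unfolding extensive_coproduct_def
  proof (intro exI[of _ S] exI[of _ \<iota>] conjI allI impI ballI)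
    show "is_coproduct CAT I X S \<iota>" by (rule gcop_Cat[OF S])
    fix u assume u: "u \<in> Arr CAT" "Cod CAT u = S"
    obtain D e a \<kappa>' where D: "gcop W I D (src u) e \<kappa>'" "\<And>i. i \<in> I \<Longrightarrow> e i \<in> Arr CAT"
       and a: "\<And>i. i \<in> I \<Longrightarrow> a i \<in> hom CAT (D i) (X i)" "\<And>i. i \<in> I \<Longrightarrow> mor_comp W u (e i) = mor_comp W (\<iota> i) (a i)"
      by (rule gcop_decomp[OF S(1,3), of u]) (use u in auto)
    have "enr (src u)" using u by (simp add: Cat_Arr)
    then have "is_coproduct CAT I D (src u) e" using gcop_Cat[OF D(1) _ D(2)] by blast
    then show "\<exists>D e a. is_coproduct CAT I D (Dom CAT u) e \<and>
           (\<forall>i\<in>I. a i \<in> hom CAT (D i) (X i) \<and> u \<cdot>\<^bsub>CAT\<^esub> e i = \<iota> i \<cdot>\<^bsub>CAT\<^esub> a i)"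
      using a by (intro exI[of _ D] exI[of _ e] exI[of _ a]) auto
  next
    fix i j a b assume "i \<in> I" "j \<in> I" "a \<in> Arr CAT" "b \<in> Arr CAT" "Dom CAT b = Dom CAT a"
         "Cod CAT a = X i" "Cod CAT b = X j" "\<not> is_initial CAT (Dom CAT a)"
         "\<iota> i \<cdot>\<^bsub>CAT\<^esub> a = \<iota> j \<cdot>\<^bsub>CAT\<^esub> b"
    then have "i = j \<and> a = b" by (intro gcop_disjoint[OF S(1)]) simp_all
    then show "i = j" "a = b" by auto
  qed
qed

section \<open>Free enriched categories\<close>

text \<open>A coproduct of coproducts is a coproduct over the union of the index sets. They are kept
  disjoint by \<nu>, which will be the number of edges of a path.\<close>

lemma (in cat) coproduct_nested:
  assumes s: "is_coproduct C N S s \<kappa>" and \<iota>: "\<And>n. n \<in> N \<Longrightarrow> is_coproduct C (P n) X (S n) (\<iota> n)"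
    and nw: "\<And>n w. n \<in> N \<Longrightarrow> w \<in> P n \<Longrightarrow> \<nu> w = n"
  shows "is_coproduct C (\<Union>n\<in>N. P n) X s (\<lambda>w. \<kappa> (\<nu> w) \<cdot> \<iota> (\<nu> w) w)"
  unfolding is_coproduct_def
proof (intro conjI ballI allI impI)
  note [simp] = coproduct_simps[OF s] coproduct_simps[OF \<iota>]
  show "s \<in> Obj C" by simp
  show "\<kappa> (\<nu> w) \<cdot> \<iota> (\<nu> w) w \<in> hom C (X w) s" if "w \<in> (\<Union>n\<in>N. P n)" for w using that nw by auto
  fix c f assume c: "c \<in> Obj C" and f: "\<forall>w\<in>\<Union>n\<in>N. P n. f w \<in> hom C (X w) c"
  have "\<exists>h. h \<in> hom C (S n) c \<and> (\<forall>w\<in>P n. h \<cdot> \<iota> n w = f w)" if n: "n \<in> N" for n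
    by (rule coproduct_copair[OF \<iota>[OF n] c, of f]) (use f n in auto)
  then obtain h where h: "\<And>n. n \<in> N \<Longrightarrow> h n \<in> hom C (S n) c \<and> (\<forall>w\<in>P n. h n \<cdot> \<iota> n w = f w)" by metis
  obtain k where k: "k \<in> Arr C" "Dom C k = s" "Cod C k = c" "\<And>n. n \<in> N \<Longrightarrow> k \<cdot> \<kappa> n = h n"
    by (rule coproduct_copair[OF s c, of h]) (use h in auto)
  show "\<exists>!k. k \<in> hom C s c \<and> (\<forall>w\<in>\<Union>n\<in>N. P n. k \<cdot> \<kappa> (\<nu> w) \<cdot> \<iota> (\<nu> w) w = f w)"
  proof (rule ex1I[of _ k])
    have "k \<cdot> \<kappa> (\<nu> w) \<cdot> \<iota> (\<nu> w) w = f w" if "n \<in> N" "w \<in> P n" for n w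
      using comp_eq[OF k(4)[OF that(1)], of "\<iota> n w"] that nw h k by simp
    then show "k \<in> hom C s c \<and> (\<forall>w\<in>\<Union>n\<in>N. P n. k \<cdot> \<kappa> (\<nu> w) \<cdot> \<iota> (\<nu> w) w = f w)" using k by auto
    fix k' assume k': "k' \<in> hom C s c \<and> (\<forall>w\<in>\<Union>n\<in>N. P n. k' \<cdot> \<kappa> (\<nu> w) \<cdot> \<iota> (\<nu> w) w = f w)"
    show "k' = k"
    proof (rule coproduct_ext[OF s])
      fix n assume n: "n \<in> N"
      show "k' \<cdot> \<kappa> n = k \<cdot> \<kappa> n"
      proof (rule coproduct_ext[OF \<iota>[OF n]])
        fix w assume w: "w \<in> P n"
        then have "k' \<cdot> \<kappa> n \<cdot> \<iota> n w = f w" using k' n nw by auto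
        then show "(k' \<cdot> \<kappa> n) \<cdot> \<iota> n w = (k \<cdot> \<kappa> n) \<cdot> \<iota> n w" using k k' n w h by simp
      qed (use k k' n h[OF n] in auto)
    qed (use k k' in auto)
  qed
qed

lemma forget_ob_simps [simp]: "obs (forget_ob A) = obs A" "homob (forget_ob A) = homob A"
  by (auto simp: forget_ob_def)

lemma forget_simps [simp]:
  "fob forget = forget_ob" "src (far forget f) = forget_ob (src f)" "tgt (far forget f) = forget_ob (tgt f)"
  "on_obs (far forget f) = on_obs f" "on_homs (far forget f) = on_homs f" "is_Mor (far forget f)"
  by (auto simp: forget_def)

lemma gmor_forget [simp]: "gmor W f \<Longrightarrow> gmor W (far forget f)"
  unfolding gmor_def graph_map_def by simp

text \<open>All lengths together. Nonemptiness takes the place of the length condition, a path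
  having at least one vertex.\<close>

definition Paths where
  "Paths G x y = {w. w \<noteq> [] \<and> set w \<subseteq> obs G \<and> hd w = x \<and> last w = y}"

lemma paths_eq: "paths G x y n = {w \<in> Paths G x y. length w = Suc n}"
proof (rule set_eqI)
  fix w show "w \<in> paths G x y n \<longleftrightarrow> w \<in> {w \<in> Paths G x y. length w = Suc n}"
    by (cases "w = []") (auto simp: paths_def Paths_def hd_conv_nth last_conv_nth)
qed

text \<open>The stage \<open>d\<close> is an argument of its own because an empty list of elements
  does not reveal it.\<close>

definition (in vcat) ptup where "ptup d as = tuple C {..<length as} d (\<lambda>i. as ! i)"

text \<open>The element of a free hom named by the path \<open>w\<close> with the elements
  \<open>as\<close> on its edges. Locally every element has this form, and at a noninitial stage in
  one way only.\<close>

definition (in vcat) fin where "fin G d w as = free_inj C G w \<cdot> ptup d as"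

text \<open>\<open>as\<close> is a sequence of generalized elements at stage \<open>d\<close> of the hom objects along the path \<open>w\<close>.\<close>

definition (in vcat) pel where
  "pel G d x y w as \<longleftrightarrow> d \<in> Obj C \<and> w \<in> Paths G x y \<and> length w = Suc (length as) \<and>
     (\<forall>i<length as. as ! i \<in> hom C d (homob G (w ! i, w ! Suc i)))"

text \<open>The vertices \<open>w\<close> are passed beside the elements since
  \<open>on_homs f\<close> is indexed by the end points of each edge.\<close>

definition hmap where
  "hmap W f w as = map (\<lambda>i. on_homs f (w ! i, w ! Suc i) \<cdot>\<^bsub>W\<^esub> as ! i) [0..<length as]"

lemma hmap_simps [simp]: "length (hmap W f w as) = length as" "hmap W f w [] = []"
   "i < length as \<Longrightarrow> hmap W f w as ! i = on_homs f (w ! i, w ! Suc i) \<cdot>\<^bsub>W\<^esub> as ! i"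
  by (auto simp: hmap_def)

lemma hmap_Cons [simp]: "hmap W f (x # w) (a # as) = (on_homs f (x, w ! 0) \<cdot>\<^bsub>W\<^esub> a) # hmap W f w as"
  unfolding hmap_def length_Cons map_upt_Suc by simp

section \<open>Normal forms: elements of a free hom as paths of elements\<close>

context lexv
begin

text \<open>What the free construction asks of a graph, regardless of the constructor and of
  extensionality.\<close>

definition gr where "gr G \<longleftrightarrow> small elts (obs G) \<and> (\<forall>x\<in>obs G. \<forall>y\<in>obs G. homob G (x, y) \<in> Obj W)"

lemma gr_simps: assumes "gr G" shows "small elts (obs G)" "x \<in> obs G \<Longrightarrow> y \<in> obs G \<Longrightarrow> homob G (x, y) \<in> Obj W"
  using assms by (auto simp: gr_def)

lemma graph_gr [simp]: "graph elts W G \<Longrightarrow> gr G"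
  unfolding gr_def by (auto dest: graph_simps)

lemma forget_graph [simp]: assumes A: "enr A" shows "graph elts W (forget_ob A)"
proof -
  obtain O' h m j where "A = CatOb O' h m j" "small elts O'" "h \<in> O' \<times> O' \<rightarrow>\<^sub>E Obj W"
    using A unfolding enriched_category_def by blast
  then show ?thesis unfolding graph_def forget_ob_def by simp
qed

lemma pel_forget [simp]: "pel (forget_ob A) = pel A"
  by (auto simp: pel_def Paths_def intro!: ext)

lemma Paths_nth: "w \<in> Paths G x y \<Longrightarrow> i < length w \<Longrightarrow> w ! i \<in> obs G"
  unfolding Paths_def using nth_mem by blast

lemma Paths_small: assumes "gr G" shows "essentially_small elts (Paths G x y)"
proof -
  have "essentially_small elts (\<Union>n. paths G x y n)"
  proof -
    have "(\<Union>n. paths G x y n) = snd ` Sigma UNIV (paths G x y)" by force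
    moreover have "essentially_small elts (paths G x y n)" for n
      by (rule essentially_small_subset[OF essentially_small_lists[OF essentially_small[OF gr_simps(1)[OF assms]], of "Suc n"]])
        (auto simp: paths_def)
    ultimately show ?thesis using essentially_small_image[OF essentially_small_Sigma[OF essentially_small_nat]] by metis
  qed
  moreover have "Paths G x y \<subseteq> (\<Union>n. paths G x y n)"
  proof
    fix w assume w: "w \<in> Paths G x y"
    then have "w \<in> paths G x y (length w - 1)" by (simp add: paths_eq Paths_def)
    then show "w \<in> (\<Union>n. paths G x y n)" by blast
  qed
  ultimately show ?thesis by (rule essentially_small_subset)
qed

lemma step_Obj: "\<lbrakk>gr G; w \<in> Paths G x y; i < length w - 1\<rbrakk> \<Longrightarrow> step G w i \<in> Obj W"
  unfolding step_def using Paths_nth[of w G x y i] Paths_nth[of w G x y "Suc i"] gr_simps by auto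

lemma path_ob_simps [simp]:
  assumes "gr G" "w \<in> Paths G x y"
  shows "path_ob W G w \<in> Obj W"
    "i < length w - 1 \<Longrightarrow> path_proj W G w i \<in> Arr W"
    "i < length w - 1 \<Longrightarrow> Dom W (path_proj W G w i) = path_ob W G w"
    "i < length w - 1 \<Longrightarrow> Cod W (path_proj W G w i) = homob G (w ! i, w ! Suc i)"
  using nprod_simps[of "length w - 1" "step G w"] step_Obj[OF assms] unfolding path_ob_def path_proj_def by (auto simp: step_def)

text \<open>The definition nests a coproduct over paths of fixed length inside one over lengths.
  Flattened to a single coproduct over all paths, it can be met with decomposition and disjointness
  at once.\<close>

lemma free_coproduct:
  assumes G: "gr G"
  shows "is_coproduct W (Paths G x y) (path_ob W G) (free_hom W G x y) (free_inj W G)"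
proof -
  have 1: "is_coproduct W (paths G x y n) (path_ob W G) (Coprod W (paths G x y n) (path_ob W G)) (coproj W (paths G x y n) (path_ob W G))" for n
    by (rule Coprod_is) (use G in "auto simp: paths_eq intro!: essentially_small_subset[OF Paths_small[OF G, of x y]]")
  have 2: "is_coproduct W UNIV (\<lambda>n. Coprod W (paths G x y n) (path_ob W G)) (free_hom W G x y)
      (coproj W (UNIV :: nat set) (\<lambda>n. Coprod W (paths G x y n) (path_ob W G)))"
    unfolding free_hom_def by (rule Coprod_is[OF essentially_small_nat]) (rule coproduct_simps(1)[OF 1])
  have 3: "(\<Union>n\<in>UNIV. paths G x y n) = Paths G x y"
    by (auto simp: paths_eq Paths_def) (metis length_Suc_conv neq_Nil_conv)
  have "is_coproduct W (\<Union>n\<in>UNIV. paths G x y n) (path_ob W G) (free_hom W G x y)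
     (\<lambda>w. coproj W (UNIV :: nat set) (\<lambda>n. Coprod W (paths G x y n) (path_ob W G)) (length w - 1) \<cdot>
        coproj W (paths G x y (length w - 1)) (path_ob W G) w)"
    by (rule coproduct_nested[OF 2 1]) (auto simp: paths_eq)
  then show ?thesis
    unfolding 3 by (subst coproduct_cong[OF refl]) (auto simp: free_inj_def Paths_def Let_def)
qed

lemma free_hom_Obj [simp]: "gr G \<Longrightarrow> free_hom W G x y \<in> Obj W"
  using coproduct_simps(1)[OF free_coproduct] .

lemma free_inj_simps [simp]:
  assumes "gr G" "w \<in> Paths G x y"
  shows "free_inj W G w \<in> Arr W" "Dom W (free_inj W G w) = path_ob W G w" "Cod W (free_inj W G w) = free_hom W G x y"
  using coproduct_simps[OF free_coproduct[OF assms(1)]] assms by auto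

lemma pelD:
  assumes "pel G d x y w as"
  shows "d \<in> Obj W" "w \<in> Paths G x y" "length w = Suc (length as)" "x \<in> obs G" "y \<in> obs G" "w \<noteq> []" "hd w = x" "last w = y"
    "w ! 0 = x" "\<And>i. i \<le> length as \<Longrightarrow> w ! i \<in> obs G"
    "\<And>i. i < length as \<Longrightarrow> as ! i \<in> Arr W" "\<And>i. i < length as \<Longrightarrow> Dom W (as ! i) = d"
    "\<And>i. i < length as \<Longrightarrow> Cod W (as ! i) = homob G (w ! i, w ! Suc i)"
  using assms unfolding pel_def Paths_def by (auto simp: hd_conv_nth)

lemma pel_step: "pel G d x y w as \<Longrightarrow> i < length as \<Longrightarrow> Cod W (as ! i) = step G w i"
  by (simp add: pelD(13) step_def)

lemma ptup_simps [simp]: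
  assumes "pel G d x y w as"
  shows "ptup d as \<in> Arr W" "Dom W (ptup d as) = d" "Cod W (ptup d as) = path_ob W G w"
  using Cod_tuple[of d "length as" "\<lambda>i. as ! i" "step G w"] pelD[OF assms] pel_step[OF assms]
  unfolding ptup_def path_ob_def by auto

lemma pel_restrict: "\<lbrakk>pel G d x y w as; e \<in> Arr W; Cod W e = d\<rbrakk> \<Longrightarrow> pel G (Dom W e) x y w (map (\<lambda>a. a \<cdot> e) as)"
  unfolding pel_def by auto

lemma ptup_comp:
  assumes "pel G d x y w as" "e \<in> Arr W" "Cod W e = d"
  shows "ptup d as \<cdot> e = ptup (Dom W e) (map (\<lambda>a. a \<cdot> e) as)"
proof -
  have "ptup d as \<cdot> e = tuple W {..<length as} (Dom W e) (\<lambda>i. as ! i \<cdot> e)"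
    unfolding ptup_def by (rule tuple_comp) (use pelD[OF assms(1)] assms in auto)
  also have "\<dots> = ptup (Dom W e) (map (\<lambda>a. a \<cdot> e) as)"
    unfolding ptup_def length_map by (rule tuple_cong) simp
  finally show ?thesis .
qed

lemma proj_ptup: "pel G d x y w as \<Longrightarrow> i < length as \<Longrightarrow> path_proj W G w i \<cdot> ptup d as = as ! i"
  using proj_tuple[of d "length as" "\<lambda>i. as ! i" "step G w" i] pel_step[of G d x y w as]
  unfolding ptup_def path_proj_def by (simp add: pelD)

lemma ptup_inj: "\<lbrakk>pel G d x y w as; pel G d x y w bs; ptup d as = ptup d bs\<rbrakk> \<Longrightarrow> as = bs"
  using pelD(3)[of G d x y w as] pelD(3)[of G d x y w bs] proj_ptup[of G d x y w as] proj_ptup[of G d x y w bs]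
  by (intro nth_equalityI) auto

lemma ptup_surj:
  assumes G: "gr G" and w: "w \<in> Paths G x y" and u: "u \<in> Arr W" "Cod W u = path_ob W G w"
  obtains as where "pel G (Dom W u) x y w as" "u = ptup (Dom W u) as"
proof -
  let ?as = "map (\<lambda>i. path_proj W G w i \<cdot> u) [0..<length w - 1]"
  have "w \<noteq> []" using w by (simp add: Paths_def)
  then have p: "pel G (Dom W u) x y w ?as" using path_ob_simps[OF G w] u w unfolding pel_def by simp
  have "u = ptup (Dom W u) ?as"
  proof (rule tuple_ext[of _ _ "length w - 1" "step G w"])
    fix i assume i: "i < length w - 1"
    then show "proj W {..<length w - 1} (step G w) i \<cdot> u = proj W {..<length w - 1} (step G w) i \<cdot> ptup (Dom W u) ?as"
      using proj_ptup[OF p, of i] by (simp add: path_proj_def)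
  qed (use u ptup_simps[OF p] step_Obj[OF G w] in "auto simp: path_ob_def")
  then show ?thesis using that p by blast
qed

lemma fin_simps [simp]:
  assumes "gr G" "pel G d x y w as"
  shows "fin G d w as \<in> Arr W" "Dom W (fin G d w as) = d" "Cod W (fin G d w as) = free_hom W G x y"
  using pelD(2)[OF assms(2)] free_inj_simps[OF assms(1)] ptup_simps[OF assms(2)] unfolding fin_def by auto

lemma fin_comp:
  assumes "gr G" "pel G d x y w as" "e \<in> Arr W" "Cod W e = d"
  shows "fin G d w as \<cdot> e = fin G (Dom W e) w (map (\<lambda>a. a \<cdot> e) as)"
  using pelD(2)[OF assms(2)] free_inj_simps[OF assms(1)] ptup_simps[OF assms(2)] ptup_comp[OF assms(2-4)] assms(3,4) unfolding fin_def by simp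

text \<open>Coprojections of different paths are disjoint and each one is monic, so at a noninitial
  stage both the path and the elements on its edges can be read off; a tuple in turn determines its
  entries.\<close>

lemma fin_inj:
  assumes G: "gr G" and as: "pel G d x y w as" and bs: "pel G d x y v bs" and ni: "\<not> is_initial W d"
    and eq: "fin G d w as = fin G d v bs"
  shows "w = v" "as = bs"
proof -
  have "w = v \<and> ptup d as = ptup d bs"
    by (rule coproduct_disjoint[OF Paths_small[OF G] free_coproduct[OF G], of w x y v])
      (use pelD(2)[OF as] pelD(2)[OF bs] ptup_simps[OF as] ptup_simps[OF bs] ni eq in "auto simp: fin_def")
  then show "w = v" "as = bs" using ptup_inj as bs by auto
qed

text \<open>A predicate of \<open>e\<close>, to fit \<open>locally\<close>: restricted along
  \<open>e\<close>, the element \<open>u\<close> is given by a path.\<close>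

definition finl where
  "finl G x y u e \<longleftrightarrow> (\<exists>w as. pel G (Dom W e) x y w as \<and> u \<cdot> e = fin G (Dom W e) w as)"

lemma fin_decomp:
  assumes G: "gr G" and u: "u \<in> Arr W" "Cod W u = free_hom W G x y" "Dom W u = d"
  shows "locally d (finl G x y u)"
proof -
  have "locally d (\<lambda>e. \<exists>w t. w \<in> Paths G x y \<and> t \<in> hom W (Dom W e) (path_ob W G w) \<and> u \<cdot> e = free_inj W G w \<cdot> t)"
    using coproduct_decomp[OF Paths_small[OF G] free_coproduct[OF G] u(1,2)] u(3) by simp
  then show ?thesis
  proof (rule locally_weaken)
    fix e assume e: "e \<in> Arr W" "Cod W e = d" "\<exists>w t. w \<in> Paths G x y \<and> t \<in> hom W (Dom W e) (path_ob W G w) \<and> u \<cdot> e = free_inj W G w \<cdot> t"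
    then obtain w t where t: "w \<in> Paths G x y" "t \<in> Arr W" "Dom W t = Dom W e" "Cod W t = path_ob W G w" "u \<cdot> e = free_inj W G w \<cdot> t" by auto
    obtain as where "pel G (Dom W t) x y w as" "t = ptup (Dom W t) as" using ptup_surj[OF G t(1,2,4)] .
    then show "finl G x y u e" unfolding finl_def fin_def using t by (intro exI[of _ w] exI[of _ as]) simp
  qed
qed

lemma finl_stable:
  assumes "gr G" "u \<in> Arr W" "Cod W e = Dom W u" "e \<in> Arr W" "finl G x y u e" "f \<in> Arr W" "Cod W f = Dom W e"
  shows "finl G x y u (e \<cdot> f)"
proof -
  obtain w as where w: "pel G (Dom W e) x y w as" "u \<cdot> e = fin G (Dom W e) w as" using assms(5) by (auto simp: finl_def)
  have "u \<cdot> (e \<cdot> f) = fin G (Dom W f) w (map (\<lambda>a. a \<cdot> f) as)"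
    using fin_comp[OF assms(1) w(1) assms(6,7)] comp_eq[OF w(2), of f] assms by simp
  then show ?thesis using pel_restrict[OF w(1) assms(6,7)] assms unfolding finl_def by auto
qed

text \<open>A common refinement of two covers; both predicates have to survive restriction, as a
  leaf of one cover is cut further by the other.\<close>

lemma locally_conj:
  assumes "locally d P" "locally d Q"
    and P: "\<And>e f. \<lbrakk>e \<in> Arr W; Cod W e = d; P e; f \<in> Arr W; Cod W f = Dom W e\<rbrakk> \<Longrightarrow> P (e \<cdot> f)"
    and Q: "\<And>e f. \<lbrakk>e \<in> Arr W; Cod W e = d; Q e; f \<in> Arr W; Cod W f = Dom W e\<rbrakk> \<Longrightarrow> Q (e \<cdot> f)"
  shows "locally d (\<lambda>e. P e \<and> Q e)"
  using assms(1)
proof (rule locally_trans)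
  fix e assume e: "e \<in> Arr W" "Cod W e = d" "P e"
  have "locally (Dom W e) (\<lambda>f. Q (e \<cdot> f))" by (rule locally_restrict[OF assms(2) e(1,2)]) (use Q in auto)
  then show "locally (Dom W e) (\<lambda>f. P (e \<cdot> f) \<and> Q (e \<cdot> f))" by (rule locally_weaken) (use e P in auto)
qed

lemma fin_decomp2:
  assumes G: "gr G" and u: "u \<in> Arr W" "Cod W u = free_hom W G x y" "Dom W u = d"
    and v: "v \<in> Arr W" "Cod W v = free_hom W H x' y'" "Dom W v = d" and H: "gr H"
  shows "locally d (\<lambda>e. finl G x y u e \<and> finl H x' y' v e)"
  by (rule locally_conj[OF fin_decomp[OF G u] fin_decomp[OF H v]]) (use finl_stable[OF G] finl_stable[OF H] u v in auto)

lemma fin_decomp3: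
  assumes G: "gr G" and u: "u \<in> Arr W" "Cod W u = free_hom W G x y" "Dom W u = d"
    and v: "v \<in> Arr W" "Cod W v = free_hom W G x' y'" "Dom W v = d"
    and t: "t \<in> Arr W" "Cod W t = free_hom W G x'' y''" "Dom W t = d"
  shows "locally d (\<lambda>e. finl G x y u e \<and> finl G x' y' v e \<and> finl G x'' y'' t e)"
  by (rule locally_conj[OF fin_decomp[OF G u] fin_decomp2[OF G v t G]]) (use finl_stable[OF G] u v t in auto)

lemma fin_ext:
  assumes G: "gr G" and f: "f \<in> Arr W" "Dom W f = free_hom W G x y" and g: "g \<in> Arr W" "Dom W g = free_hom W G x y" and c: "Cod W f = Cod W g"
    and eq: "\<And>d w as. pel G d x y w as \<Longrightarrow> f \<cdot> fin G d w as = g \<cdot> fin G d w as"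
  shows "f = g"
proof (rule locally_eq)
  show "locally (free_hom W G x y) (\<lambda>e. f \<cdot> e = g \<cdot> e)"
  proof (rule locally_weaken)
    \<comment> \<open>The identity is the generic element of the free hom; a cover on which it
      becomes a path reduces the equation to path elements.\<close>
    show "locally (free_hom W G x y) (finl G x y (Ide W (free_hom W G x y)))" by (rule fin_decomp[OF G]) (use G in auto)
    fix e assume e: "e \<in> Arr W" "Cod W e = free_hom W G x y" "finl G x y (Ide W (free_hom W G x y)) e"
    then obtain w as where p: "pel G (Dom W e) x y w as" and "Ide W (free_hom W G x y) \<cdot> e = fin G (Dom W e) w as"
      by (auto simp: finl_def)
    then have "e = fin G (Dom W e) w as" using e by simp
    then show "f \<cdot> e = g \<cdot> e" using eq[OF p] by (simp only: flip: \<open>e = fin G (Dom W e) w as\<close>)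
  qed
qed (use f g c in auto)

section \<open>Concatenation of paths and composition in the free category\<close>

lemma Paths_append: "v \<in> Paths G x y \<Longrightarrow> w \<in> Paths G y z \<Longrightarrow> v @ tl w \<in> Paths G x z"
  unfolding Paths_def by (cases w) (auto simp: last_append)

text \<open>The end of \<open>v\<close> is the start of \<open>w\<close> and is listed once, hence
  \<open>tl w\<close> on vertices but plain appending on edges.\<close>

lemma pel_append:
  assumes v: "pel G d x y v as" and w: "pel G d y z w bs"
  shows "pel G d x z (v @ tl w) (as @ bs)"
proof -
  note V = pelD[OF v] and W = pelD[OF w]
  \<comment> \<open>At the joint \<open>i = length as\<close> the vertex is taken from
    \<open>v\<close>; \<open>lv\<close> says that \<open>w\<close> offers the same one.\<close>
  have nth: "(v @ tl w) ! i = (if i \<le> length as then v ! i else w ! (i - length as))" if "i \<le> length as + length bs" for i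
  proof (cases "i \<le> length as")
    case True
    then show ?thesis using V(3) by (simp add: nth_append)
  next
    case False
    then have "tl w ! (i - Suc (length as)) = w ! (i - length as)" using W(3) that by (cases w) (auto simp: nth_Cons')
    then show ?thesis using V(3) False by (simp add: nth_append)
  qed
  have lv: "v ! length as = w ! 0" using V(3,6,8) W(9) by (simp add: last_conv_nth)
  show ?thesis
    unfolding pel_def
  proof (intro conjI allI impI)
    show "d \<in> Obj W" by (rule V(1))
    show "v @ tl w \<in> Paths G x z" by (rule Paths_append[OF V(2) W(2)])
    show "length (v @ tl w) = Suc (length (as @ bs))" using V(3) W(3) by simp
    fix i assume i: "i < length (as @ bs)"
    show "(as @ bs) ! i \<in> hom W d (homob G ((v @ tl w) ! i, (v @ tl w) ! Suc i))"
    proof (cases "i < length as")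
      case True
      then show ?thesis using i nth[of i] nth[of "Suc i"] V(11-13)[of i] by (simp add: nth_append)
    next
      case False
      then have "(v @ tl w) ! i = w ! (i - length as)" "(v @ tl w) ! Suc i = w ! Suc (i - length as)"
        using nth[of i] nth[of "Suc i"] lv i by (auto simp: Suc_diff_le)
      then show ?thesis using i False W(11-13)[of "i - length as"] by (simp add: nth_append)
    qed
  qed
qed

text \<open>The vertex \<open>w ! k\<close> ends the first part and starts the second, so vertices
  are cut by \<open>take (Suc k)\<close> and \<open>drop k\<close>, edges by \<open>take k\<close>
  and \<open>drop k\<close>.\<close>

lemma pel_split:
  assumes w: "pel G d x z w cs" and k: "k \<le> length cs"
  shows "pel G d x (w ! k) (take (Suc k) w) (take k cs)" "pel G d (w ! k) z (drop k w) (drop k cs)"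
proof -
  note W = pelD[OF w]
  have "set w \<subseteq> obs G" using W(2) by (simp add: Paths_def)
  moreover have "last (take (Suc k) w) = w ! k" using k W(3) by (simp add: take_Suc_conv_app_nth)
  moreover have "hd (take (Suc k) w) = x" "hd (drop k w) = w ! k" "last (drop k w) = z" "drop k w \<noteq> []"
    using k W(3,6-8) by (auto simp: hd_take hd_drop_conv_nth)
  ultimately have "take (Suc k) w \<in> Paths G x (w ! k)" "drop k w \<in> Paths G (w ! k) z"
    using W(6) by (auto simp: Paths_def dest: in_set_takeD in_set_dropD)
  then show "pel G d x (w ! k) (take (Suc k) w) (take k cs)" "pel G d (w ! k) z (drop k w) (drop k cs)"
    using W k unfolding pel_def by auto
qed

lemma pel_Nil: "pel G d x y w [] \<longleftrightarrow> d \<in> Obj W \<and> x \<in> obs G \<and> x = y \<and> w = [x]"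
  unfolding pel_def Paths_def by (auto simp: length_Suc_conv)

lemma pel_Cons: "pel G d x y w (a # as) \<longleftrightarrow> (\<exists>v. w = x # v \<and> x \<in> obs G \<and> a \<in> hom W d (homob G (x, v ! 0)) \<and> pel G d (v ! 0) y v as)"
proof
  assume p: "pel G d x y w (a # as)"
  note P = pelD[OF p]
  obtain v where v: "w = x # v" using P(6,7) by (cases w) auto
  have "v \<noteq> []" using P(3) v by auto
  then have "v \<in> Paths G (v ! 0) y" using P(2) v by (auto simp: Paths_def hd_conv_nth)
  then have "pel G d (v ! 0) y v as" using P v P(11-13)[of "Suc _"] unfolding pel_def by auto
  then show "\<exists>v. w = x # v \<and> x \<in> obs G \<and> a \<in> hom W d (homob G (x, v ! 0)) \<and> pel G d (v ! 0) y v as"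
    using v P(4) P(11-13)[of 0] by auto
next
  assume "\<exists>v. w = x # v \<and> x \<in> obs G \<and> a \<in> hom W d (homob G (x, v ! 0)) \<and> pel G d (v ! 0) y v as"
  then obtain v where v: "w = x # v" "x \<in> obs G" "a \<in> hom W d (homob G (x, v ! 0))" "pel G d (v ! 0) y v as" by blast
  note P = pelD[OF v(4)]
  show "pel G d x y w (a # as)"
    unfolding pel_def
  proof (intro conjI allI impI)
    show "w \<in> Paths G x y" using v P(2,6) by (auto simp: Paths_def)
    fix i assume "i < length (a # as)"
    then show "(a # as) ! i \<in> hom W d (homob G (w ! i, w ! Suc i))" using v P(11-13) by (cases i) auto
  qed (use v P in auto)
qed

lemma pel_sing: "\<lbrakk>x \<in> obs G; y \<in> obs G; a \<in> Arr W; Dom W a = d; Cod W a = homob G (x, y)\<rbrakk> \<Longrightarrow> pel G d x y [x, y] [a]"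
  by (auto simp: pel_Cons pel_Nil)

text \<open>Distributivity of products over coproducts in local form: both components of a pair
  become paths on a common cover.\<close>

lemma fin_prod_ext:
  assumes G: "gr G" and f: "f \<in> Arr W" "Dom W f = prod2 W (free_hom W G y z) (free_hom W G x y)"
    and g: "g \<in> Arr W" "Dom W g = prod2 W (free_hom W G y z) (free_hom W G x y)" and c: "Cod W f = Cod W g"
    and eq: "\<And>d v as w bs. pel G d x y v as \<Longrightarrow> pel G d y z w bs \<Longrightarrow>
       f \<cdot> pair W (fin G d w bs) (fin G d v as) = g \<cdot> pair W (fin G d w bs) (fin G d v as)"
  shows "f = g"
proof (rule prod2_arr_ext)
  fix d b a assume d: "d \<in> Obj W" and b: "b \<in> hom W d (free_hom W G y z)" and a: "a \<in> hom W d (free_hom W G x y)"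
  show "f \<cdot> pair W b a = g \<cdot> pair W b a"
  proof (rule locally_eq)
    have "locally d (\<lambda>e. finl G y z b e \<and> finl G x y a e)" by (rule fin_decomp2[OF G]) (use a b G in auto)
    then show "locally d (\<lambda>e. (f \<cdot> pair W b a) \<cdot> e = (g \<cdot> pair W b a) \<cdot> e)"
    proof (rule locally_weaken)
      fix e assume e: "e \<in> Arr W" "Cod W e = d" "finl G y z b e \<and> finl G x y a e"
      then obtain w bs v as where "pel G (Dom W e) x y v as" "pel G (Dom W e) y z w bs" "b \<cdot> e = fin G (Dom W e) w bs" "a \<cdot> e = fin G (Dom W e) v as"
        by (auto simp: finl_def)
      then show "(f \<cdot> pair W b a) \<cdot> e = (g \<cdot> pair W b a) \<cdot> e" using eq a b f g e(1,2) by simp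
    qed
  qed (use a b f g c in auto)
qed (use G f g c in auto)

text \<open>On elements, the canonical isomorphism to the object of the concatenated path is
  concatenation of lists.\<close>

lemma concat_iso_pair:
  assumes G: "gr G" and v: "pel G d x y v as" and w: "pel G d y z w bs"
  shows "concat_iso W G w v \<cdot> pair W (ptup d bs) (ptup d as) = ptup d (as @ bs)"
proof -
  note V = pelD[OF v] and W = pelD[OF w]
  note [simp] = path_ob_simps[OF G V(2)] path_ob_simps[OF G W(2)] ptup_simps[OF v] ptup_simps[OF w]
  let ?d = "prod2 W (path_ob W G w) (path_ob W G v)"
  let ?f = "\<lambda>i. if i < length as then path_proj W G v i \<cdot> proj2 W (path_ob W G w) (path_ob W G v)
             else path_proj W G w (i - length as) \<cdot> proj1 W (path_ob W G w) (path_ob W G v)"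
  have "concat_iso W G w v = tuple W {..<length as + length bs} ?d ?f"
    unfolding concat_iso_def Let_def V(3) W(3) diff_Suc_1 ..
  moreover have "tuple W {..<length as + length bs} ?d ?f \<cdot> pair W (ptup d bs) (ptup d as) =
     tuple W {..<length as + length bs} (Dom W (pair W (ptup d bs) (ptup d as))) (\<lambda>i. ?f i \<cdot> pair W (ptup d bs) (ptup d as))"
    by (rule tuple_comp) (use V(3) W(3) in auto)
  moreover have "\<dots> = tuple W {..<length as + length bs} d (\<lambda>i. (as @ bs) ! i)"
  proof -
    have "Dom W (pair W (ptup d bs) (ptup d as)) = d" by simp
    then show ?thesis
      by (simp only:) (rule tuple_cong, use V(3) W(3) proj_ptup[OF v] proj_ptup[OF w] in \<open>auto simp: nth_append\<close>)
  qed
  ultimately show ?thesis unfolding ptup_def by simp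
qed

text \<open>Existence is an instance of \<open>locally_define\<close>: the value on a pair of path
  elements is prescribed, the paths are determined by the pair at noninitial stages, and every pair
  is locally of this form. The two claims are proved together because uniqueness of the composition
  arrow uses its value on path elements.\<close>

lemma
  assumes G: "gr G"
  shows free_mult_uni: "\<exists>!c. c \<in> hom W (prod2 W (free_hom W G y z) (free_hom W G x y)) (free_hom W G x z) \<and>
        (\<forall>k l. \<forall>v\<in>paths G x y k. \<forall>w\<in>paths G y z l.
           c \<cdot> prod2_arr W (free_inj W G w) (free_inj W G v) = free_inj W G (v @ tl w) \<cdot> concat_iso W G w v)"
    (is "\<exists>!c. ?P c")
  and free_mult_fin: "\<And>c d v as w bs. \<lbrakk>c \<in> hom W (prod2 W (free_hom W G y z) (free_hom W G x y)) (free_hom W G x z) \<and>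
        (\<forall>k l. \<forall>v\<in>paths G x y k. \<forall>w\<in>paths G y z l.
           c \<cdot> prod2_arr W (free_inj W G w) (free_inj W G v) = free_inj W G (v @ tl w) \<cdot> concat_iso W G w v);
      pel G d x y v as; pel G d y z w bs\<rbrakk> \<Longrightarrow>
      c \<cdot> pair W (fin G d w bs) (fin G d v as) = fin G d (v @ tl w) (as @ bs)"
proof -
  let ?X = "prod2 W (free_hom W G y z) (free_hom W G x y)" and ?Y = "free_hom W G x z"
  have concat: "concat_iso W G w v \<in> hom W (prod2 W (path_ob W G w) (path_ob W G v)) (path_ob W G (v @ tl w))"
    if v: "v \<in> Paths G x y" and w: "w \<in> Paths G y z" for v w
  proof -
    note [simp] = path_ob_simps[OF G v] path_ob_simps[OF G w]
    let ?d = "prod2 W (path_ob W G w) (path_ob W G v)"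
    obtain as where as: "pel G ?d x y v as" "proj2 W (path_ob W G w) (path_ob W G v) = ptup ?d as"
      using ptup_surj[OF G v, of "proj2 W (path_ob W G w) (path_ob W G v)"] by auto
    obtain bs where bs: "pel G ?d y z w bs" "proj1 W (path_ob W G w) (path_ob W G v) = ptup ?d bs"
      using ptup_surj[OF G w, of "proj1 W (path_ob W G w) (path_ob W G v)"] by auto
    have "concat_iso W G w v = tuple W {..<length as + length bs} ?d
       (\<lambda>i. if i < length as then path_proj W G v i \<cdot> proj2 W (path_ob W G w) (path_ob W G v)
             else path_proj W G w (i - length as) \<cdot> proj1 W (path_ob W G w) (path_ob W G v))"
      unfolding concat_iso_def Let_def pelD(3)[OF as(1)] pelD(3)[OF bs(1)] diff_Suc_1 ..
    also have "\<dots> = ptup ?d (as @ bs)"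
      unfolding ptup_def length_append
      by (rule tuple_cong) (use as bs proj_ptup[OF as(1)] proj_ptup[OF bs(1)] in "auto simp: nth_append")
    finally show ?thesis using ptup_simps[OF pel_append[OF as(1) bs(1)]] by simp
  qed
  show fin: "c \<cdot> pair W (fin G d w bs) (fin G d v as) = fin G d (v @ tl w) (as @ bs)"
    if c: "?P c" and v: "pel G d x y v as" and w: "pel G d y z w bs" for c d v as w bs
  proof -
    note [simp] = ptup_simps[OF v] ptup_simps[OF w] free_inj_simps[OF G pelD(2)[OF v]] free_inj_simps[OF G pelD(2)[OF w]]
      free_inj_simps[OF G Paths_append[OF pelD(2)[OF v] pelD(2)[OF w]]]
    have "v \<in> paths G x y (length as)" "w \<in> paths G y z (length bs)"
      using pelD(2,3)[OF v] pelD(2,3)[OF w] by (auto simp: paths_eq)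
    then have "c \<cdot> prod2_arr W (free_inj W G w) (free_inj W G v) = free_inj W G (v @ tl w) \<cdot> concat_iso W G w v"
      using c by blast
    from comp_eq[OF this, of "pair W (ptup d bs) (ptup d as)"]
    show ?thesis using c concat[OF pelD(2)[OF v] pelD(2)[OF w]] concat_iso_pair[OF G v w] by (simp add: fin_def)
  qed
  \<comment> \<open>The graph of concatenation, on those elements of the product that are pairs of
    path elements.\<close>
  define R where "R u t \<longleftrightarrow> (\<exists>v as w bs. pel G (Dom W u) x y v as \<and> pel G (Dom W u) y z w bs \<and>
     u = pair W (fin G (Dom W u) w bs) (fin G (Dom W u) v as) \<and> t = fin G (Dom W u) (v @ tl w) (as @ bs))" for u t
  have RI: "R (pair W (fin G d w bs) (fin G d v as)) (fin G d (v @ tl w) (as @ bs))" if v: "pel G d x y v as" and w: "pel G d y z w bs" for d v as w bs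
    unfolding R_def by (rule exI[of _ v], rule exI[of _ as], rule exI[of _ w], rule exI[of _ bs]) (use v w G in simp)
  obtain c where c: "c \<in> Arr W" "Dom W c = ?X" "Cod W c = ?Y" "\<And>u t. R u t \<Longrightarrow> c \<cdot> u = t"
  proof (rule locally_define[of ?X ?Y R])
    show "?X \<in> Obj W" "?Y \<in> Obj W" using G by auto
    fix u t assume R: "R u t"
    then obtain v as w bs where v: "pel G (Dom W u) x y v as" "pel G (Dom W u) y z w bs"
     and u: "u = pair W (fin G (Dom W u) w bs) (fin G (Dom W u) v as)" and t: "t = fin G (Dom W u) (v @ tl w) (as @ bs)"
      unfolding R_def by blast
    note a = pel_append[OF v]
    have uA: "u \<in> Arr W" by (subst u) (use G v in simp)
    have uC: "Cod W u = ?X" by (subst u) (use G v in simp)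
    show "u \<in> Arr W \<and> Cod W u = ?X \<and> t \<in> hom W (Dom W u) ?Y" using uA uC G a t by simp
    show "R (u \<cdot> e) (t \<cdot> e)" if e: "e \<in> Arr W" "Cod W e = Dom W u" for e
    proof -
      have "u \<cdot> e = pair W (fin G (Dom W e) w (map (\<lambda>a. a \<cdot> e) bs)) (fin G (Dom W e) v (map (\<lambda>a. a \<cdot> e) as))"
        by (subst u) (use G v e fin_comp[OF G v(1) e] fin_comp[OF G v(2) e] in simp)
      moreover have "t \<cdot> e = fin G (Dom W e) (v @ tl w) (map (\<lambda>a. a \<cdot> e) as @ map (\<lambda>a. a \<cdot> e) bs)"
        using fin_comp[OF G a e] t by simp
      ultimately show ?thesis using RI[OF pel_restrict[OF v(1) e] pel_restrict[OF v(2) e]] by simp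
    qed
    fix t' assume "R u t'" and ni: "\<not> is_initial W (Dom W u)"
    then obtain v' as' w' bs' where v': "pel G (Dom W u) x y v' as'" "pel G (Dom W u) y z w' bs'"
     and u': "u = pair W (fin G (Dom W u) w' bs') (fin G (Dom W u) v' as')" and t': "t' = fin G (Dom W u) (v' @ tl w') (as' @ bs')"
      unfolding R_def by blast
    have "pair W (fin G (Dom W u) w bs) (fin G (Dom W u) v as) = pair W (fin G (Dom W u) w' bs') (fin G (Dom W u) v' as')"
      using u u' by (rule trans[OF sym])
    then have "fin G (Dom W u) w bs = fin G (Dom W u) w' bs'" "fin G (Dom W u) v as = fin G (Dom W u) v' as'"
      using pair_eq_iff[of "fin G (Dom W u) w bs" "fin G (Dom W u) v as" "fin G (Dom W u) w' bs'" "fin G (Dom W u) v' as'"] G v v' by simp_all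
    then have "w = w'" "bs = bs'" "v = v'" "as = as'" using fin_inj[OF G v(2) v'(2) ni] fin_inj[OF G v(1) v'(1) ni] by auto
    then show "t = t'" using t t' by simp
  next
    fix u assume u: "u \<in> Arr W" "Cod W u = ?X"
    define b a where "b = proj1 W (free_hom W G y z) (free_hom W G x y) \<cdot> u" and "a = proj2 W (free_hom W G y z) (free_hom W G x y) \<cdot> u"
    have ba: "b \<in> hom W (Dom W u) (free_hom W G y z)" "a \<in> hom W (Dom W u) (free_hom W G x y)" "u = pair W b a"
      using u G pair_proj[of u "free_hom W G y z" "free_hom W G x y"] by (auto simp: a_def b_def)
    have "locally (Dom W u) (\<lambda>e. finl G y z b e \<and> finl G x y a e)" by (rule fin_decomp2[OF G]) (use ba(1,2) G in auto)
    then show "locally (Dom W u) (\<lambda>e. \<exists>t. R (u \<cdot> e) t)"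
    proof (rule locally_weaken)
      fix e assume e: "e \<in> Arr W" "Cod W e = Dom W u" "finl G y z b e \<and> finl G x y a e"
      then obtain w bs v as where v: "pel G (Dom W e) x y v as" "pel G (Dom W e) y z w bs" "b \<cdot> e = fin G (Dom W e) w bs" "a \<cdot> e = fin G (Dom W e) v as"
        by (auto simp: finl_def)
      have "u \<cdot> e = pair W (b \<cdot> e) (a \<cdot> e)" by (subst ba(3)) (use ba(1,2) e in simp)
      then show "\<exists>t. R (u \<cdot> e) t" using RI[OF v(1,2)] v by auto
    qed
  qed blast
  have Pc: "?P c"
  proof (intro conjI allI ballI)
    show "c \<in> hom W ?X ?Y" using c by simp
    fix k l v w assume "v \<in> paths G x y k" "w \<in> paths G y z l"
    then have vw: "v \<in> Paths G x y" "w \<in> Paths G y z" by (auto simp: paths_eq)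
    note [simp] = path_ob_simps[OF G vw(1)] path_ob_simps[OF G vw(2)] free_inj_simps[OF G vw(1)] free_inj_simps[OF G vw(2)]
      free_inj_simps[OF G Paths_append[OF vw]]
    let ?d = "prod2 W (path_ob W G w) (path_ob W G v)"
    obtain as where as: "pel G ?d x y v as" "proj2 W (path_ob W G w) (path_ob W G v) = ptup ?d as"
      using ptup_surj[OF G vw(1), of "proj2 W (path_ob W G w) (path_ob W G v)"] by auto
    obtain bs where bs: "pel G ?d y z w bs" "proj1 W (path_ob W G w) (path_ob W G v) = ptup ?d bs"
      using ptup_surj[OF G vw(2), of "proj1 W (path_ob W G w) (path_ob W G v)"] by auto
    \<comment> \<open>The projections of \<open>?d\<close> form the generic pair of elements along
      \<open>w\<close> and \<open>v\<close>, so the rule on elements yields the equation on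
      coprojections.\<close>
    have "prod2_arr W (free_inj W G w) (free_inj W G v) = pair W (fin G ?d w bs) (fin G ?d v as)"
      unfolding prod2_arr_def fin_def using as bs by simp
    moreover have "concat_iso W G w v \<cdot> pair W (ptup ?d bs) (ptup ?d as) = concat_iso W G w v"
      using concat[OF vw] as bs pair_proj[of "Ide W ?d" "path_ob W G w" "path_ob W G v"] by simp
    ultimately show "c \<cdot> prod2_arr W (free_inj W G w) (free_inj W G v) = free_inj W G (v @ tl w) \<cdot> concat_iso W G w v"
      using c(4)[OF RI[OF as(1) bs(1)]] concat_iso_pair[OF G as(1) bs(1)] by (simp add: fin_def)
  qed
  show "\<exists>!c. ?P c"
  proof (rule ex1I[of ?P, OF Pc])
    fix c' assume c': "?P c'"
    show "c' = c"
    proof (rule fin_prod_ext[OF G])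
      fix d v as w bs assume "pel G d x y v as" "pel G d y z w bs"
      then show "c' \<cdot> pair W (fin G d w bs) (fin G d v as) = c \<cdot> pair W (fin G d w bs) (fin G d v as)"
        using fin[OF c'] fin[OF Pc] by simp
    qed (use c c' in auto)
  qed
qed

lemma free_mult_simps [simp]:
  assumes G: "gr G"
  shows "free_mult W G x y z \<in> Arr W" "Dom W (free_mult W G x y z) = prod2 W (free_hom W G y z) (free_hom W G x y)"
    "Cod W (free_mult W G x y z) = free_hom W G x z"
  using theI'[OF free_mult_uni[OF G, where x=x and y=y and z=z]] unfolding free_mult_def by simp_all

lemma free_mult_pair:
  assumes G: "gr G" and "pel G d x y v as" "pel G d y z w bs"
  shows "free_mult W G x y z \<cdot> pair W (fin G d w bs) (fin G d v as) = fin G d (v @ tl w) (as @ bs)"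
  unfolding free_mult_def by (rule free_mult_fin[OF G theI'[OF free_mult_uni[OF G]] assms(2,3)])

lemma free_idt_bang:
  assumes G: "gr G" and x: "x \<in> obs G" and d: "d \<in> Obj W"
  shows "free_idt W G x \<in> hom W \<T> (free_hom W G x x)" "free_idt W G x \<cdot> bang W d = fin G d [x] []"
proof -
  \<comment> \<open>The definition of \<open>free_idt\<close> uses an empty tuple with a dummy
    family; this is the tuple of the empty list.\<close>
  have e: "tuple W ({} :: nat set) d' (\<lambda>_. undefined) = ptup d' []" for d'
    unfolding ptup_def list.size lessThan_0[symmetric] by (rule tuple_cong) simp
  have p: "pel G d' x x [x] []" if "d' \<in> Obj W" for d' using that x by (simp add: pel_Nil)
  have 1: "free_idt W G x = fin G \<T> [x] []" unfolding free_idt_def e fin_def ..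
  show "free_idt W G x \<in> hom W \<T> (free_hom W G x x)" unfolding 1 using fin_simps[OF G p[of \<T>]] by simp
  show "free_idt W G x \<cdot> bang W d = fin G d [x] []" unfolding 1 using fin_comp[OF G p[of \<T>], of "bang W d"] d by simp
qed

abbreviation "F \<equiv> free_ob W"

lemma free_ob_mk: "F G = mk_cat (obs G) (\<lambda>(x, y). free_hom W G x y) (\<lambda>(x, y, z). free_mult W G x y z) (free_idt W G)"
  by (simp add: free_ob_def mk_cat_def)

lemma free_ob_simps [simp]:
  "obs (F G) = obs G"
  "x \<in> obs G \<Longrightarrow> y \<in> obs G \<Longrightarrow> homob (F G) (x, y) = free_hom W G x y"
  by (auto simp: free_ob_mk)

lemma free_ecomp:
  assumes "gr G" "pel G d x y v as" "pel G d y z w bs"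
  shows "ecomp (F G) x y z (fin G d w bs) (fin G d v as) = fin G d (v @ tl w) (as @ bs)"
  using free_mult_pair[OF assms] pelD(4,5)[OF assms(2)] pelD(4,5)[OF assms(3)] unfolding ecomp_def free_ob_mk by simp

lemma free_eid:
  assumes "gr G" "x \<in> obs G" "d \<in> Obj W"
  shows "eid (F G) x d = fin G d [x] []"
  using free_idt_bang[OF assms] assms unfolding eid_def free_ob_mk by simp

lemma tl_append: "v \<noteq> [] \<Longrightarrow> (u @ tl v) @ tl w = u @ tl (v @ tl w)"
  by (cases v) auto

end

section \<open>The free enriched category\<close>

context lexv
begin

lemma locally_eqI:
  assumes "locally d P" "X \<in> Arr W" "Y \<in> Arr W" "Dom W X = d" "Dom W Y = d" "Cod W X = Cod W Y"
    "\<And>e. \<lbrakk>e \<in> Arr W; Cod W e = d; \<not> is_initial W (Dom W e); P e\<rbrakk> \<Longrightarrow> X \<cdot> e = Y \<cdot> e"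
  shows "X = Y"
  by (rule locally_eq[OF locally_mono[OF assms(1)]]) (use assms in auto)

text \<open>On a cover where all elements are paths, the laws are those of concatenation: one-vertex
  paths are neutral, and appending is associative by \<open>tl_append\<close>.\<close>

lemma free_enr [simp]: assumes G: "gr G" shows "enr (F G)"
  unfolding free_ob_mk
proof (rule enr_mk_cat)
  have mm: "(\<lambda>(x, y, z). free_mult W G x y z) (x, y, z) = free_mult W G x y z" for x y z by simp
  have hh: "(\<lambda>(x, y). free_hom W G x y) (x, y) = free_hom W G x y" for x y by simp
  show "small elts (obs G)" using gr_simps[OF G] by simp
  fix x assume x: "x \<in> obs G"
  show "free_idt W G x \<in> hom W \<T> ((\<lambda>(x, y). free_hom W G x y) (x, x))"
    using free_idt_bang(1)[OF G x terminal_Obj] by simp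
  fix y assume y: "y \<in> obs G"
  show "(\<lambda>(x, y). free_hom W G x y) (x, y) \<in> Obj W" using G by simp
  note id = free_idt_bang(2)[OF G]
  have jt: "free_idt W G x \<in> Arr W" "Dom W (free_idt W G x) = \<T>" "Cod W (free_idt W G x) = free_hom W G x x" if "x \<in> obs G" for x
    using free_idt_bang(1)[OF G that terminal_Obj] by auto
  fix d a assume d: "d \<in> Obj W" and "a \<in> hom W d ((\<lambda>(x, y). free_hom W G x y) (x, y))"
  then have a: "a \<in> Arr W" "Cod W a = free_hom W G x y" "Dom W a = d" by auto
  show "(\<lambda>(x, y, z). free_mult W G x y z) (x, y, y) \<cdot> pair W (free_idt W G y \<cdot> bang W d) a = a" unfolding mm
  proof (rule locally_eqI[OF fin_decomp[OF G a]])
    fix e assume e: "e \<in> Arr W" "Cod W e = d" "finl G x y a e"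
    then obtain w as where w: "pel G (Dom W e) x y w as" "a \<cdot> e = fin G (Dom W e) w as" by (auto simp: finl_def)
    have "pel G (Dom W e) y y [y] []" using y e by (simp add: pel_Nil)
    note m = free_mult_pair[OF G w(1) this]
    have "(free_mult W G x y y \<cdot> pair W (free_idt W G y \<cdot> bang W d) a) \<cdot> e =
       free_mult W G x y y \<cdot> pair W (free_idt W G y \<cdot> bang W (Dom W e)) (a \<cdot> e)"
      using e a d y G jt by simp
    then show "(free_mult W G x y y \<cdot> pair W (free_idt W G y \<cdot> bang W d) a) \<cdot> e = a \<cdot> e"
      using m e w y by (simp add: id)
  qed (use G d a jt y in simp_all)
  show "(\<lambda>(x, y, z). free_mult W G x y z) (x, x, y) \<cdot> pair W a (free_idt W G x \<cdot> bang W d) = a" unfolding mm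
  proof (rule locally_eqI[OF fin_decomp[OF G a]])
    fix e assume e: "e \<in> Arr W" "Cod W e = d" "finl G x y a e"
    then obtain w as where w: "pel G (Dom W e) x y w as" "a \<cdot> e = fin G (Dom W e) w as" by (auto simp: finl_def)
    have "pel G (Dom W e) x x [x] []" using x e by (simp add: pel_Nil)
    moreover have "[x] @ tl w = w" using pelD(6,7)[OF w(1)] by (cases w) auto
    moreover have "(free_mult W G x x y \<cdot> pair W a (free_idt W G x \<cdot> bang W d)) \<cdot> e =
       free_mult W G x x y \<cdot> pair W (a \<cdot> e) (free_idt W G x \<cdot> bang W (Dom W e))"
      using e a d x G jt by simp
    ultimately show "(free_mult W G x x y \<cdot> pair W a (free_idt W G x \<cdot> bang W d)) \<cdot> e = a \<cdot> e"
      using free_mult_pair[OF G _ w(1), of x "[x]" "[]"] e w x by (simp add: id)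
  qed (use G d a jt x in simp_all)
  fix z w b c assume zw: "z \<in> obs G" "w \<in> obs G" and "b \<in> hom W d ((\<lambda>(x, y). free_hom W G x y) (y, z))"
    "c \<in> hom W d ((\<lambda>(x, y). free_hom W G x y) (z, w))"
  then have bc: "b \<in> Arr W" "Cod W b = free_hom W G y z" "Dom W b = d" "c \<in> Arr W" "Cod W c = free_hom W G z w" "Dom W c = d" by auto
  show "(\<lambda>(x, y, z). free_mult W G x y z) (x, z, w) \<cdot> pair W c ((\<lambda>(x, y, z). free_mult W G x y z) (x, y, z) \<cdot> pair W b a) =
    (\<lambda>(x, y, z). free_mult W G x y z) (x, y, w) \<cdot> pair W ((\<lambda>(x, y, z). free_mult W G x y z) (y, z, w) \<cdot> pair W c b) a"
    unfolding mm
  proof (rule locally_eqI[OF fin_decomp3[OF G a bc]])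
    fix e assume e: "e \<in> Arr W" "Cod W e = d" "finl G x y a e \<and> finl G y z b e \<and> finl G z w c e"
    obtain u as where u: "pel G (Dom W e) x y u as" "a \<cdot> e = fin G (Dom W e) u as" using e by (auto simp: finl_def)
    obtain v bs where v: "pel G (Dom W e) y z v bs" "b \<cdot> e = fin G (Dom W e) v bs" using e by (auto simp: finl_def)
    obtain t cs where t: "pel G (Dom W e) z w t cs" "c \<cdot> e = fin G (Dom W e) t cs" using e by (auto simp: finl_def)
    note m = free_mult_pair[OF G u(1) v(1)] free_mult_pair[OF G v(1) t(1)]
      free_mult_pair[OF G pel_append[OF u(1) v(1)] t(1)] free_mult_pair[OF G u(1) pel_append[OF v(1) t(1)]]
    have tl: "(u @ tl v) @ tl t = u @ tl (v @ tl t)" using pelD(6)[OF v(1)] by (rule tl_append)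
    show "(free_mult W G x z w \<cdot> pair W c (free_mult W G x y z \<cdot> pair W b a)) \<cdot> e =
       (free_mult W G x y w \<cdot> pair W (free_mult W G y z w \<cdot> pair W c b) a) \<cdot> e"
      using e(1,2) a bc G m tl u(2) v(2) t(2) by (simp del: append_assoc add: append_assoc[of as bs cs])
  qed (use G a bc in simp_all)
qed (use G in auto)

subsection \<open>Composition along paths\<close>

text \<open>The composite of a path in an enriched category: the first edge \<open>a\<close>,
  followed by the composite of the rest. The end point needed by \<open>ecomp\<close> is recovered
  as \<open>last w\<close>.\<close>

fun pcomp where
  "pcomp A d (x # w) [] = eid A x d"
| "pcomp A d (x # w) (a # as) = ecomp A x (w ! 0) (last w) (pcomp A d w as) a"
| "pcomp A d [] as = undefined"

lemma pel_induct [consumes 1, case_names Nil Cons]: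
  assumes "pel G d x y w as"
    and "d \<in> Obj W \<Longrightarrow> y \<in> obs G \<Longrightarrow> P y [y] []"
    and "\<And>x v a as. \<lbrakk>x \<in> obs G; a \<in> Arr W; Dom W a = d; Cod W a = homob G (x, v ! 0);
      pel G d (v ! 0) y v as; P (v ! 0) v as\<rbrakk> \<Longrightarrow> P x (x # v) (a # as)"
  shows "P x w as"
  using assms(1)
proof (induction as arbitrary: x w)
  case Nil then show ?case using assms(2) by (auto simp: pel_Nil)
next
  case (Cons a as) then show ?case using assms(3) by (auto simp: pel_Cons)
qed

lemma pcomp_simps [simp]:
  assumes A: "enr A" and p: "pel A d x y w as"
  shows "pcomp A d w as \<in> Arr W" "Dom W (pcomp A d w as) = d" "Cod W (pcomp A d w as) = homob A (x, y)"
proof -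
  have "pcomp A d w as \<in> Arr W \<and> Dom W (pcomp A d w as) = d \<and> Cod W (pcomp A d w as) = homob A (x, y)"
    using p
  proof (induction rule: pel_induct)
    case Nil then show ?case using A by simp
  next
    case (Cons x v a as) then show ?case using A pelD(4,5,8)[OF Cons(5)] by simp
  qed
  then show "pcomp A d w as \<in> Arr W" "Dom W (pcomp A d w as) = d" "Cod W (pcomp A d w as) = homob A (x, y)" by auto
qed

lemma pcomp_restrict:
  assumes A: "enr A" and p: "pel A d x y w as" and e: "e \<in> Arr W" "Cod W e = d"
  shows "pcomp A d w as \<cdot> e = pcomp A (Dom W e) w (map (\<lambda>a. a \<cdot> e) as)"
  using p
proof (induction rule: pel_induct)
  case Nil then show ?case using A e by simp
next
  case (Cons x v a as) then show ?case using A e pelD(4,5,8)[OF Cons(5)] pcomp_simps[OF A Cons(5)] by simp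
qed

text \<open>The general associative law, by induction on the first path; the empty path is handled
  by the unit law.\<close>

lemma pcomp_append:
  assumes A: "enr A" and v: "pel A d x y v as" and w: "pel A d y z w bs"
  shows "pcomp A d (v @ tl w) (as @ bs) = ecomp A x y z (pcomp A d w bs) (pcomp A d v as)"
  using v
proof (induction rule: pel_induct)
  case Nil
  have "[y] @ tl w = w" using pelD(6,7)[OF w] by (cases w) auto
  then show ?case using ecomp_eid(2)[OF A pelD(4,5)[OF w] pcomp_simps[OF A w]] by simp
next
  case (Cons x v a as)
  note V = pelD[OF Cons(5)]
  have "(v @ tl w) ! 0 = v ! 0" using V(6) by (cases v) auto
  moreover have "last (v @ tl w) = z" using pelD(8)[OF pel_append[OF Cons(5) w]] .
  ultimately show ?case
    using Cons V ecomp_assoc[OF A Cons(1) V(4,5), of z a "pcomp A d v as" "pcomp A d w bs"] pelD(4,5)[OF w]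
      pcomp_simps[OF A w] pcomp_simps[OF A Cons(5)] by simp
qed

lemma hmap_pel:
  assumes f: "gmor W f" and s: "obs (src f) = obs G" "homob (src f) = homob G" and p: "pel G d x y w as"
  shows "pel (tgt f) d (on_obs f x) (on_obs f y) (map (on_obs f) w) (hmap W f w as)"
proof -
  note P = pelD[OF p]
  have "set w \<subseteq> obs G" using P(2) by (simp add: Paths_def)
  then have "on_obs f ` set w \<subseteq> obs (tgt f)" using gmor_simps(1)[OF f] s by auto
  then show ?thesis
    unfolding pel_def using P s gmor_simps(2-)[OF f] by (auto simp: Paths_def hd_map last_map)
qed

lemma hmap_restrict:
  assumes f: "gmor W f" and s: "obs (src f) = obs G" "homob (src f) = homob G" and p: "pel G d x y w as" and e: "e \<in> Arr W" "Cod W e = d"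
  shows "map (\<lambda>a. a \<cdot> e) (hmap W f w as) = hmap W f w (map (\<lambda>a. a \<cdot> e) as)"
  by (rule nth_equalityI) (use pelD[OF p] s gmor_simps(2-)[OF f] e in auto)

lemma hmap_comp:
  assumes f: "gmor W f" "gmor W g" "obs (src g) = obs (tgt f)" "homob (src g) = homob (tgt f)" and s: "obs (src f) = obs G" "homob (src f) = homob G"
    and p: "pel G d x y w as"
  shows "hmap W g (map (on_obs f) w) (hmap W f w as) = hmap W (mor_comp W g f) w as"
  by (rule nth_equalityI) (use pelD[OF p] s f(3,4) gmor_simps(1)[OF f(1)] gmor_simps(2-)[OF f(1)] gmor_simps(2-)[OF f(2)] in auto)

lemma hmap_id:
  assumes p: "pel G d x y w as" shows "map (on_obs (mor_id W G)) w = w" "hmap W (mor_id W G) w as = as"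
proof -
  note P = pelD[OF p]
  have "set w \<subseteq> obs G" using P(2) by (simp add: Paths_def)
  then show "map (on_obs (mor_id W G)) w = w" by (intro map_idI) auto
  show "hmap W (mor_id W G) w as = as" by (rule nth_equalityI) (use P in auto)
qed

lemma pcomp_functor:
  assumes h: "emor h" and A: "enr (src h)" "enr (tgt h)" and p: "pel (src h) d x y w as"
  shows "on_homs h (x, y) \<cdot> pcomp (src h) d w as = pcomp (tgt h) d (map (on_obs h) w) (hmap W h w as)"
  using p
proof (induction rule: pel_induct)
  case Nil then show ?case using emor_id[OF h, of y d] by simp
next
  case (Cons x v a as)
  note V = pelD[OF Cons(5)]
  have "map (on_obs h) v ! 0 = on_obs h (v ! 0)" "last (map (on_obs h) v) = on_obs h y"
    using V(6,8) by (auto simp: nth_Cons' last_map)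
  then show ?case
    using Cons V emor_comp[OF h, of x "v ! 0" y a "pcomp (src h) d v as"] pcomp_simps[OF A(1) Cons(5)] by simp
qed

subsection \<open>The universal property\<close>

abbreviation "\<eta>\<^sub>F \<equiv> free_unit W"

lemma free_unit_mk: "\<eta>\<^sub>F G = mk_mor G (forget_ob (F G)) (\<lambda>x. x)
    (\<lambda>(x, y). free_inj W G [x, y] \<cdot> tuple W {..<1 :: nat} (homob G (x, y)) (\<lambda>i. Ide W (homob G (x, y))))"
  unfolding free_unit_def mk_mor_def ..

lemma free_unit_simps [simp]:
  "src (\<eta>\<^sub>F G) = G" "tgt (\<eta>\<^sub>F G) = forget_ob (F G)" "x \<in> obs G \<Longrightarrow> on_obs (\<eta>\<^sub>F G) x = x"
  by (auto simp: free_unit_mk)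

lemma free_unit_fin:
  assumes G: "gr G" and xy: "x \<in> obs G" "y \<in> obs G"
  shows "on_homs (\<eta>\<^sub>F G) (x, y) = fin G (homob G (x, y)) [x, y] [Ide W (homob G (x, y))]"
    "a \<in> Arr W \<Longrightarrow> Cod W a = homob G (x, y) \<Longrightarrow> on_homs (\<eta>\<^sub>F G) (x, y) \<cdot> a = fin G (Dom W a) [x, y] [a]"
proof -
  have "tuple W {..<1 :: nat} (homob G (x, y)) (\<lambda>i. Ide W (homob G (x, y))) = ptup (homob G (x, y)) [Ide W (homob G (x, y))]"
    unfolding ptup_def by simp (rule tuple_cong, simp)
  then show 1: "on_homs (\<eta>\<^sub>F G) (x, y) = fin G (homob G (x, y)) [x, y] [Ide W (homob G (x, y))]"
    using xy unfolding free_unit_mk fin_def by simp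
  have p: "pel G (homob G (x, y)) x y [x, y] [Ide W (homob G (x, y))]"
    by (rule pel_sing) (use G xy gr_simps in auto)
  show "a \<in> Arr W \<Longrightarrow> Cod W a = homob G (x, y) \<Longrightarrow> on_homs (\<eta>\<^sub>F G) (x, y) \<cdot> a = fin G (Dom W a) [x, y] [a]"
    unfolding 1 using fin_comp[OF G p, of a] by simp
qed

lemma free_unit_gmor [simp]: assumes G: "gr G" shows "gmor W (\<eta>\<^sub>F G)"
  unfolding free_unit_mk
proof (rule gmor_mk)
  fix x y assume xy: "x \<in> obs G" "y \<in> obs G"
  have p: "pel G (homob G (x, y)) x y [x, y] [Ide W (homob G (x, y))]"
    by (rule pel_sing) (use G xy gr_simps in auto)
  have "on_homs (\<eta>\<^sub>F G) (x, y) \<in> hom W (homob G (x, y)) (homob (forget_ob (F G)) (x, y))"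
    unfolding free_unit_fin(1)[OF G xy] using fin_simps[OF G p] xy by simp
  then show "(\<lambda>(x, y). free_inj W G [x, y] \<cdot> tuple W {..<1 :: nat} (homob G (x, y)) (\<lambda>i. Ide W (homob G (x, y)))) (x, y)
     \<in> hom W (homob G (x, y)) (homob (forget_ob (F G)) (x, y))"
    using xy unfolding free_unit_mk by simp
qed simp

lemma map_free_unit: "w \<in> Paths G x y \<Longrightarrow> map (on_obs (\<eta>\<^sub>F G)) w = w"
  by (rule map_idI) (auto simp: Paths_def)

text \<open>The free category is generated by its edges: prepending an edge to a path is composition
  with a one-edge path. Uniqueness of extensions rests on this.\<close>

lemma pcomp_free_unit:
  assumes G: "gr G" and p: "pel G d x y w as"
  shows "pcomp (F G) d w (hmap W (\<eta>\<^sub>F G) w as) = fin G d w as"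
  using p
proof (induction rule: pel_induct)
  case Nil then show ?case using free_eid[OF G] by simp
next
  case (Cons x v a as)
  note V = pelD[OF Cons(5)]
  have v: "[x, v ! 0] @ tl v = x # v" using V(6) by (cases v) auto
  have s: "pel G d x (v ! 0) [x, v ! 0] [a]" by (rule pel_sing) (use Cons V in auto)
  show ?case using Cons V free_unit_fin(2)[OF G Cons(1) V(4), of a] free_ecomp[OF G s Cons(5)] v by simp
qed

text \<open>A path is sent to the composite in \<open>A\<close> of the images of its edges. This
  prescription defines an arrow by \<open>locally_define\<close>, and it respects composition by
  \<open>pcomp_append\<close>, used on a common cover of the two factors.\<close>

lemma free_ext_ex:
  assumes G: "graph elts W G" and A: "enr A" and f: "gmor W f" "src f = G" "tgt f = forget_ob A"
  obtains h where "emor h" "src h = F G" "tgt h = A" "\<And>x. x \<in> obs G \<Longrightarrow> on_obs h x = on_obs f x"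
    "\<And>d x y w as. pel G d x y w as \<Longrightarrow> on_homs h (x, y) \<cdot> fin G d w as = pcomp A d (map (on_obs f) w) (hmap W f w as)"
proof -
  have gG [simp]: "gr G" using G by simp
  have fo: "on_obs f x \<in> obs A" if "x \<in> obs G" for x using gmor_simps(1)[OF f(1), of x] f that by simp
  have fp: "pel A d (on_obs f x) (on_obs f y) (map (on_obs f) w) (hmap W f w as)" if "pel G d x y w as" for d x y w as
    using hmap_pel[OF f(1) _ _ that] f by simp
  have fr: "map (\<lambda>a. a \<cdot> e) (hmap W f w as) = hmap W f w (map (\<lambda>a. a \<cdot> e) as)" if "pel G d x y w as" "e \<in> Arr W" "Cod W e = d" for d x y w as e
    by (rule hmap_restrict[OF f(1) _ _ that]) (use f in auto)
  have "\<exists>t. t \<in> hom W (free_hom W G x y) (homob A (on_obs f x, on_obs f y)) \<and>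
    (\<forall>d w as. pel G d x y w as \<longrightarrow> t \<cdot> fin G d w as = pcomp A d (map (on_obs f) w) (hmap W f w as))" if xy: "x \<in> obs G" "y \<in> obs G" for x y
  proof -
    define R where "R u t \<longleftrightarrow> (\<exists>w as. pel G (Dom W u) x y w as \<and> u = fin G (Dom W u) w as \<and>
       t = pcomp A (Dom W u) (map (on_obs f) w) (hmap W f w as))" for u t
    have RI: "R (fin G d w as) (pcomp A d (map (on_obs f) w) (hmap W f w as))" if "pel G d x y w as" for d w as
      unfolding R_def by (rule exI[of _ w], rule exI[of _ as]) (use that fin_simps[OF gG that] in simp)
    obtain t where t: "t \<in> Arr W" "Dom W t = free_hom W G x y" "Cod W t = homob A (on_obs f x, on_obs f y)" "\<And>u v. R u v \<Longrightarrow> t \<cdot> u = v"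
    proof (rule locally_define[of "free_hom W G x y" "homob A (on_obs f x, on_obs f y)" R])
      show "free_hom W G x y \<in> Obj W" "homob A (on_obs f x, on_obs f y) \<in> Obj W" using fo xy A by auto
      fix u t assume "R u t"
      then obtain w as where w: "pel G (Dom W u) x y w as" and u: "u = fin G (Dom W u) w as" and
         t: "t = pcomp A (Dom W u) (map (on_obs f) w) (hmap W f w as)" unfolding R_def by blast
      have u1: "u \<in> Arr W" by (subst u) (use fin_simps[OF gG w] in simp)
      have u2: "Cod W u = free_hom W G x y" by (subst u) (use fin_simps[OF gG w] in simp)
      show "u \<in> Arr W \<and> Cod W u = free_hom W G x y \<and> t \<in> hom W (Dom W u) (homob A (on_obs f x, on_obs f y))"
        using u1 u2 t pcomp_simps[OF A fp[OF w]] by simp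
      show "R (u \<cdot> e) (t \<cdot> e)" if e: "e \<in> Arr W" "Cod W e = Dom W u" for e
      proof -
        have "u \<cdot> e = fin G (Dom W e) w (map (\<lambda>a. a \<cdot> e) as)" by (subst u) (rule fin_comp[OF gG w e])
        moreover have "t \<cdot> e = pcomp A (Dom W e) (map (on_obs f) w) (hmap W f w (map (\<lambda>a. a \<cdot> e) as))"
          unfolding t using pcomp_restrict[OF A fp[OF w] e] fr[OF w e] by simp
        ultimately show ?thesis using RI[OF pel_restrict[OF w e]] by simp
      qed
      fix t' assume "R u t'" and ni: "\<not> is_initial W (Dom W u)"
      then obtain w' as' where w': "pel G (Dom W u) x y w' as'" and u': "u = fin G (Dom W u) w' as'" and
         t': "t' = pcomp A (Dom W u) (map (on_obs f) w') (hmap W f w' as')" unfolding R_def by blast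
      have "fin G (Dom W u) w as = fin G (Dom W u) w' as'" using u u' by (rule trans[OF sym])
      then show "t = t'" using fin_inj[OF gG w w' ni] t t' by simp
    next
      fix u assume u: "u \<in> Arr W" "Cod W u = free_hom W G x y"
      show "locally (Dom W u) (\<lambda>e. \<exists>t. R (u \<cdot> e) t)"
      proof (rule locally_weaken[OF fin_decomp[OF gG u refl]])
        fix e assume "finl G x y u e"
        then show "\<exists>t. R (u \<cdot> e) t" using RI unfolding finl_def by metis
      qed
    qed blast
    then show ?thesis using RI by (intro exI[of _ t]) auto
  qed
  then obtain \<tau> where \<tau>0: "\<And>x y. x \<in> obs G \<Longrightarrow> y \<in> obs G \<Longrightarrow> \<tau> x y \<in> hom W (free_hom W G x y) (homob A (on_obs f x, on_obs f y)) \<and>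
    (\<forall>d w as. pel G d x y w as \<longrightarrow> \<tau> x y \<cdot> fin G d w as = pcomp A d (map (on_obs f) w) (hmap W f w as))" by metis
  have \<tau>: "\<tau> x y \<in> Arr W" "Dom W (\<tau> x y) = free_hom W G x y" "Cod W (\<tau> x y) = homob A (on_obs f x, on_obs f y)"
    if "x \<in> obs G" "y \<in> obs G" for x y using \<tau>0[OF that] by auto
  have \<tau>4: "\<tau> x y \<cdot> fin G d w as = pcomp A d (map (on_obs f) w) (hmap W f w as)" if "pel G d x y w as" for d x y w as
    using \<tau>0[OF pelD(4,5)[OF that]] that by blast
  let ?h = "mk_mor (F G) A (on_obs f) (\<lambda>(x, y). \<tau> x y)"
  have g: "gmor W ?h" by (rule gmor_mk) (use fo \<tau>(1-3) in auto)
  have "emor ?h" unfolding emor_def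
  proof (intro conjI ballI impI g)
    fix x d assume "x \<in> obs (src ?h)" and d: "d \<in> Obj W"
    then have x: "x \<in> obs G" by simp
    have p: "pel G d x x [x] []" using x d by (simp add: pel_Nil)
    show "on_homs ?h (x, x) \<cdot> eid (src ?h) x d = eid (tgt ?h) (on_obs ?h x) d"
      using free_eid[OF gG x d] \<tau>4[OF p] x by simp
  next
    fix x y z a b assume "x \<in> obs (src ?h)" "y \<in> obs (src ?h)" "z \<in> obs (src ?h)" and ab: "a \<in> Arr W" "b \<in> Arr W" "Dom W b = Dom W a"
       "Cod W a = homob (src ?h) (x, y)" "Cod W b = homob (src ?h) (y, z)"
    then have xyz: "x \<in> obs G" "y \<in> obs G" "z \<in> obs G" by simp_all
    have a: "a \<in> Arr W" "Cod W a = free_hom W G x y" "Dom W a = Dom W a" and b: "b \<in> Arr W" "Cod W b = free_hom W G y z" "Dom W b = Dom W a"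
      using ab xyz by simp_all
    note [simp] = xyz fo[OF xyz(1)] fo[OF xyz(2)] fo[OF xyz(3)] \<tau>(1-3) A
    have "\<tau> x z \<cdot> ecomp (F G) x y z b a = ecomp A (on_obs f x) (on_obs f y) (on_obs f z) (\<tau> y z \<cdot> b) (\<tau> x y \<cdot> a)"
    proof (rule locally_eqI[OF fin_decomp2[OF gG a b gG]])
      fix e assume e: "e \<in> Arr W" "Cod W e = Dom W a" "finl G x y a e \<and> finl G y z b e"
      obtain v as where v: "pel G (Dom W e) x y v as" "a \<cdot> e = fin G (Dom W e) v as" using e by (auto simp: finl_def)
      obtain w bs where w: "pel G (Dom W e) y z w bs" "b \<cdot> e = fin G (Dom W e) w bs" using e by (auto simp: finl_def)
      \<comment> \<open>The edges of the concatenated path keep their end points, because at the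
        joint both vertex lists supply the same vertex.\<close>
      have "hmap W f (v @ tl w) (as @ bs) = hmap W f v as @ hmap W f w bs"
      proof (rule nth_equalityI)
        fix i assume i: "i < length (hmap W f (v @ tl w) (as @ bs))"
        note V = pelD[OF v(1)] and W' = pelD[OF w(1)]
        have "v ! length as = w ! 0" using V(3,6,8) W'(9) by (simp add: last_conv_nth)
        moreover have "w \<noteq> []" by (rule W'(6))
        ultimately have "(v @ tl w) ! j = (if j \<le> length as then v ! j else w ! (j - length as))" if "j \<le> length as + length bs" for j
          using V(3) that by (cases w) (auto simp: nth_append nth_Cons')
        then show "hmap W f (v @ tl w) (as @ bs) ! i = (hmap W f v as @ hmap W f w bs) ! i"
          using i \<open>v ! length as = w ! 0\<close> by (auto simp: nth_append Suc_diff_le not_less not_less_eq_eq less_Suc_eq_le)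
      qed simp
      then show "(\<tau> x z \<cdot> ecomp (F G) x y z b a) \<cdot> e = ecomp A (on_obs f x) (on_obs f y) (on_obs f z) (\<tau> y z \<cdot> b) (\<tau> x y \<cdot> a) \<cdot> e"
        using e(1,2) ab v(2) w(2) free_ecomp[OF gG v(1) w(1)] \<tau>4[OF v(1)] \<tau>4[OF w(1)] \<tau>4[OF pel_append[OF v(1) w(1)]]
          pcomp_append[OF A fp[OF v(1)] fp[OF w(1)]] by (simp add: map_tl)
    qed (use ab in simp_all)
    then show "on_homs ?h (x, z) \<cdot> ecomp (src ?h) x y z b a =
       ecomp (tgt ?h) (on_obs ?h x) (on_obs ?h y) (on_obs ?h z) (on_homs ?h (y, z) \<cdot> b) (on_homs ?h (x, y) \<cdot> a)" by simp
  qed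
  then show ?thesis
  proof (rule that)
    fix d x y w as assume p: "pel G d x y w as"
    show "on_homs ?h (x, y) \<cdot> fin G d w as = pcomp A d (map (on_obs f) w) (hmap W f w as)"
      using \<tau>4[OF p] pelD(4,5)[OF p] by simp
  qed simp_all
qed

text \<open>A functor commutes with composition along paths, and a path element is the composite of
  its edges, on which the functor is given by \<open>f\<close>.\<close>

lemma free_fin_unique:
  assumes G: "graph elts W G" and h: "emor h" "src h = F G" "enr (tgt h)" and f: "mor_comp W (far forget h) (\<eta>\<^sub>F G) = f"
  shows "\<And>x. x \<in> obs G \<Longrightarrow> on_obs f x = on_obs h x"
    "\<And>d x y w as. pel G d x y w as \<Longrightarrow> on_homs h (x, y) \<cdot> fin G d w as = pcomp (tgt h) d (map (on_obs f) w) (hmap W f w as)"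
proof -
  have gG [simp]: "gr G" using G by simp
  show o: "on_obs f x = on_obs h x" if "x \<in> obs G" for x unfolding f[symmetric] using that by simp
  fix d x y w as assume p: "pel G d x y w as"
  have gh: "gmor W h" using h(1) by (rule emor_gmor)
  have q: "pel (F G) d x y w (hmap W (\<eta>\<^sub>F G) w as)"
    using hmap_pel[OF free_unit_gmor[OF gG] _ _ p] map_free_unit[OF pelD(2)[OF p]] pelD(4,5)[OF p] by simp
  have "on_homs h (x, y) \<cdot> fin G d w as = pcomp (tgt h) d (map (on_obs h) w) (hmap W h w (hmap W (\<eta>\<^sub>F G) w as))"
    using pcomp_functor[OF h(1) _ h(3), of d x y w "hmap W (\<eta>\<^sub>F G) w as"] q h(2) pcomp_free_unit[OF gG p] by simp
  moreover have "map (on_obs h) w = map (on_obs f) w" using o pelD(2)[OF p] by (auto simp: Paths_def)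
  moreover have "hmap W h w (hmap W (\<eta>\<^sub>F G) w as) = hmap W (mor_comp W (far forget h) (\<eta>\<^sub>F G)) w as"
    using hmap_comp[OF free_unit_gmor[OF gG] gmor_forget[OF gh] _ _ _ _ p] map_free_unit[OF pelD(2)[OF p]] h(2) by (simp add: hmap_def)
  ultimately show "on_homs h (x, y) \<cdot> fin G d w as = pcomp (tgt h) d (map (on_obs f) w) (hmap W f w as)" using f by simp
qed

lemma free_unique:
  assumes G: "graph elts W G" and h: "emor h" "src h = F G" "enr (tgt h)" and h': "emor h'" "src h' = F G" "tgt h' = tgt h"
    and eq: "mor_comp W (far forget h) (\<eta>\<^sub>F G) = mor_comp W (far forget h') (\<eta>\<^sub>F G)"
  shows "h = h'"
proof (rule gmor_eqI[OF emor_gmor[OF h(1)] emor_gmor[OF h'(1)]])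
  have gG [simp]: "gr G" using G by simp
  have e': "enr (tgt h')" using h h' by simp
  note u = free_fin_unique[OF G h eq] free_fin_unique[OF G h'(1,2) e' refl]
  fix x assume x: "x \<in> obs (src h')"
  then show o: "on_obs h x = on_obs h' x" using u(1)[of x] u(3)[of x] h' by simp
  fix y assume y: "y \<in> obs (src h')"
  have o': "on_obs h y = on_obs h' y" using u(1)[of y] u(3)[of y] h' y by simp
  have xy: "x \<in> obs G" "y \<in> obs G" using x y h' by auto
  note [simp] = gmor_simps(2-)[OF emor_gmor[OF h(1)]] gmor_simps(2-)[OF emor_gmor[OF h'(1)]]
  show "on_homs h (x, y) = on_homs h' (x, y)"
    by (rule fin_ext[OF gG, of _ x y]) (use xy h h' o o' u in auto)
qed (use h h' in auto)

text \<open>Existence and uniqueness of the extension make the definite description denote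
  it.\<close>

lemma free_ext:
  assumes G: "graph elts W G" and A: "enr A" and f: "gmor W f" "src f = G" "tgt f = forget_ob A"
  shows "emor (free_ext elts W G A f)" "src (free_ext elts W G A f) = F G" "tgt (free_ext elts W G A f) = A"
    "mor_comp W (far forget (free_ext elts W G A f)) (\<eta>\<^sub>F G) = f"
proof -
  have gG [simp]: "gr G" using G by simp
  obtain h where h: "emor h" "src h = F G" "tgt h = A" "\<And>x. x \<in> obs G \<Longrightarrow> on_obs h x = on_obs f x"
    and hf: "\<And>d x y w as. pel G d x y w as \<Longrightarrow> on_homs h (x, y) \<cdot> fin G d w as = pcomp A d (map (on_obs f) w) (hmap W f w as)"
    by (rule free_ext_ex[OF G A f]) blast
  have fo: "on_obs f x \<in> obs A" if "x \<in> obs G" for x using gmor_simps(1)[OF f(1), of x] f that by simp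
  have hc: "mor_comp W (far forget h) (\<eta>\<^sub>F G) = f"
  proof (rule gmor_eqI[OF _ f(1)])
    show "gmor W (mor_comp W (far forget h) (\<eta>\<^sub>F G))" using gmor_comp[OF free_unit_gmor[OF gG] gmor_forget[OF emor_gmor[OF h(1)]]] h by simp
    fix x y assume "x \<in> obs (src f)" "y \<in> obs (src f)"
    then have xy: "x \<in> obs G" "y \<in> obs G" using f by auto
    have p: "pel G (homob G (x, y)) x y [x, y] [Ide W (homob G (x, y))]"
      by (rule pel_sing) (use xy gr_simps[OF gG] in auto)
    show "on_homs (mor_comp W (far forget h) (\<eta>\<^sub>F G)) (x, y) = on_homs f (x, y)"
      using hf[OF p] free_unit_fin(1)[OF gG xy] xy gmor_simps(2-)[OF f(1), of x y] f A fo gr_simps[OF gG] by simp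
  qed (use h f in auto)
  have "\<exists>!h. h \<in> hom CAT (F G) A \<and> far forget h \<cdot>\<^bsub>GPH\<^esub> \<eta>\<^sub>F G = f"
  proof (rule ex1I[of _ h])
    show "h \<in> hom CAT (F G) A \<and> far forget h \<cdot>\<^bsub>GPH\<^esub> \<eta>\<^sub>F G = f" using h hc A by (simp add: Cat_Arr)
    fix h' assume h': "h' \<in> hom CAT (F G) A \<and> far forget h' \<cdot>\<^bsub>GPH\<^esub> \<eta>\<^sub>F G = f"
    show "h' = h" by (rule free_unique[OF G]) (use h h' hc A in "auto simp: Cat_Arr")
  qed
  from theI'[OF this] show "emor (free_ext elts W G A f)" "src (free_ext elts W G A f) = F G" "tgt (free_ext elts W G A f) = A"
    "mor_comp W (far forget (free_ext elts W G A f)) (\<eta>\<^sub>F G) = f"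
    unfolding free_ext_def[symmetric] by (auto simp: Cat_Arr)
qed

section \<open>The free category adjunction, computed on path elements\<close>

lemma forget_mor_id: assumes A: "enr A" shows "far forget (mor_id W A) = mor_id W (forget_ob A)"
  by (rule gmor_eqI[of W]) (use gmor_id_graph[OF forget_graph[OF A]] gmor_forget[OF emor_gmor[OF emor_mor_id[OF A]]] in auto)

lemma forget_functor: "is_functor CAT GPH forget"
  unfolding is_functor_def
proof (intro conjI ballI impI CC.is_cat cat.is_cat[OF Gph_cat])
  fix A assume "A \<in> Obj CAT"
  then have A: "enr A" by simp
  then show "far forget (Ide CAT A) = Ide GPH (fob forget A)"
    by (simp add: forget_mor_id)
next
  fix f g assume *: "f \<in> Arr CAT" "g \<in> Arr CAT" "Dom CAT g = Cod CAT f"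
  then have g: "gmor W f" "gmor W g" "src g = tgt f" by (auto simp: Cat_Arr emor_gmor)
  show "far forget (g \<cdot>\<^bsub>CAT\<^esub> f) = far forget g \<cdot>\<^bsub>GPH\<^esub> far forget f"
    by (rule gmor_eqI[of W]) (use g in auto)
qed (auto simp: Cat_Arr Gph_Arr emor_gmor)

abbreviation "adjF \<equiv> free_adj elts W"

lemma adjF_simps [simp]: "fob (ladj adjF) = F" "radj adjF = forget" "unit adjF = \<eta>\<^sub>F"
  "far (ladj adjF) f = free_ext elts W (src f) (F (tgt f)) (mor_comp W (\<eta>\<^sub>F (tgt f)) f)"
  "counit adjF A = free_ext elts W (forget_ob A) A (mor_id W (forget_ob A))"
  by (auto simp: free_adj_def)

text \<open>The unit is the universal arrow; \<open>free_unique\<close> and \<open>free_ext\<close>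
  supply uniqueness and existence of transposes.\<close>

lemma free_adj_is_adjunction: "is_adjunction GPH CAT adjF"
proof (rule adjunction_universal)
  show "cat GPH" by (rule Gph_cat)
  show "is_functor CAT GPH (radj adjF)" using forget_functor by simp
  fix G assume "G \<in> Obj GPH"
  then have G: "graph elts W G" by simp
  show "fob (ladj adjF) G \<in> Obj CAT" using G by simp
  show "unit adjF G \<in> hom GPH G (fob (radj adjF) (fob (ladj adjF) G))" using G by (simp add: Gph_Arr)
  fix h h' assume *: "h \<in> Arr CAT" "h' \<in> Arr CAT" "Dom CAT h = fob (ladj adjF) G" "Dom CAT h' = fob (ladj adjF) G"
    "Cod CAT h = Cod CAT h'" "far (radj adjF) h \<cdot>\<^bsub>GPH\<^esub> unit adjF G = far (radj adjF) h' \<cdot>\<^bsub>GPH\<^esub> unit adjF G"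
  show "h = h'"
  proof (rule free_unique[OF G])
    show "emor h" "enr (tgt h)" "emor h'" using *(1,2) by (auto simp: Cat_Arr)
    show "src h = F G" "src h' = F G" "tgt h' = tgt h" using *(3-5) by simp_all
    show "mor_comp W (far forget h) (\<eta>\<^sub>F G) = mor_comp W (far forget h') (\<eta>\<^sub>F G)" using *(6) by simp
  qed
next
  fix f assume "f \<in> Arr GPH"
  then have f: "graph elts W (src f)" "graph elts W (tgt f)" "gmor W f" by (auto simp: Gph_Arr)
  have "gmor W (mor_comp W (\<eta>\<^sub>F (tgt f)) f)" using f by simp
  note e = free_ext[OF f(1) _ this, of "F (tgt f)"]
  show "far (ladj adjF) f \<in> hom CAT (fob (ladj adjF) (Dom GPH f)) (fob (ladj adjF) (Cod GPH f))"
    using e f by (simp add: Cat_Arr)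
  show "far (radj adjF) (far (ladj adjF) f) \<cdot>\<^bsub>GPH\<^esub> unit adjF (Dom GPH f) = unit adjF (Cod GPH f) \<cdot>\<^bsub>GPH\<^esub> f"
    using e f by simp
next
  fix A assume "A \<in> Obj CAT"
  then have A: "enr A" by simp
  note e = free_ext[OF forget_graph[OF A] A, OF gmor_id_graph[OF forget_graph[OF A]], simplified]
  show "counit adjF A \<in> hom CAT (fob (ladj adjF) (fob (radj adjF) A)) A"
    using e A by (simp add: Cat_Arr)
  show "far (radj adjF) (counit adjF A) \<cdot>\<^bsub>GPH\<^esub> unit adjF (fob (radj adjF) A) = Ide GPH (fob (radj adjF) A)"
    using e A by simp
qed

text \<open>\<open>F f\<close> extends \<open>\<eta>\<^sub>F (tgt f)\<close> after \<open>f\<close>,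
  so a path goes to the composite of one-edge paths on the images of its edges, and that composite
  is the image path.\<close>

lemma free_map_fin:
  assumes f: "graph elts W (src f)" "graph elts W (tgt f)" "gmor W f" and p: "pel (src f) d x y w as"
  shows "on_homs (far (ladj adjF) f) (x, y) \<cdot> fin (src f) d w as = fin (tgt f) d (map (on_obs f) w) (hmap W f w as)"
proof -
  have "gmor W (mor_comp W (\<eta>\<^sub>F (tgt f)) f)" using f by simp
  note e = free_ext[OF f(1) _ this, of "F (tgt f)"]
  have q: "pel (tgt f) d (on_obs f x) (on_obs f y) (map (on_obs f) w) (hmap W f w as)" by (rule hmap_pel[OF f(3) _ _ p]) auto
  have "on_homs (far (ladj adjF) f) (x, y) \<cdot> fin (src f) d w as =
     pcomp (F (tgt f)) d (map (on_obs (mor_comp W (\<eta>\<^sub>F (tgt f)) f)) w) (hmap W (mor_comp W (\<eta>\<^sub>F (tgt f)) f) w as)"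
    using free_fin_unique(2)[OF f(1) e(1) _ _ e(4) p] e f by simp
  also have "map (on_obs (mor_comp W (\<eta>\<^sub>F (tgt f)) f)) w = map (on_obs f) w"
    using pelD(2)[OF p] gmor_simps(1)[OF f(3)] by (auto simp: Paths_def subset_iff)
  also have "hmap W (mor_comp W (\<eta>\<^sub>F (tgt f)) f) w as = hmap W (\<eta>\<^sub>F (tgt f)) (map (on_obs f) w) (hmap W f w as)"
    by (rule hmap_comp[symmetric, OF f(3) _ _ _ _ _ p]) (use f in auto)
  finally show ?thesis using pcomp_free_unit[OF graph_gr[OF f(2)] q] by simp
qed

lemma free_map_obs:
  assumes f: "graph elts W (src f)" "graph elts W (tgt f)" "gmor W f" and x: "x \<in> obs (src f)"
  shows "on_obs (far (ladj adjF) f) x = on_obs f x"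
proof -
  have "gmor W (mor_comp W (\<eta>\<^sub>F (tgt f)) f)" using f by simp
  note e = free_ext[OF f(1) _ this, of "F (tgt f)"]
  show ?thesis using free_fin_unique(1)[OF f(1) e(1) _ _ e(4) x] e f x gmor_simps(1)[OF f(3) x] by simp
qed

text \<open>The counit extends the identity of the underlying graph, so a path is sent to its own
  composite.\<close>

lemma free_counit_fin:
  assumes A: "enr A" and p: "pel A d x y w as"
  shows "on_homs (counit adjF A) (x, y) \<cdot> fin (forget_ob A) d w as = pcomp A d w as"
proof -
  note e = free_ext[OF forget_graph[OF A] A, OF gmor_id_graph[OF forget_graph[OF A]], simplified]
  have p': "pel (forget_ob A) d x y w as" using p by simp
  show ?thesis using free_fin_unique(2)[OF forget_graph[OF A] e(1) _ _ e(4) p'] e A hmap_id[OF p'] by simp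
qed

lemma free_counit_obs:
  assumes A: "enr A" and x: "x \<in> obs A"
  shows "on_obs (counit adjF A) x = x"
proof -
  note e = free_ext[OF forget_graph[OF A] A, OF gmor_id_graph[OF forget_graph[OF A]], simplified]
  show ?thesis using free_fin_unique(1)[OF forget_graph[OF A] e(1) _ _ e(4), of x] e A x by simp
qed

end

section \<open>Cartesianness of the free category adjunction\<close>

context lexv
begin

abbreviation "Fm \<equiv> far (ladj adjF)"

text \<open>Gathers what is used of \<open>F\<close> on arrows. Afterwards
  \<open>adjF_simps(4,5)\<close> leave the simpset, and \<open>F f\<close> is handled through this
  list instead of its definite description.\<close>

lemma free_map:
  assumes f: "f \<in> Arr GPH"
  shows "graph elts W (src f)" "graph elts W (tgt f)" "gmor W f" "gr (src f)" "gr (tgt f)"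
    "emor (Fm f)" "gmor W (Fm f)" "src (Fm f) = F (src f)" "tgt (Fm f) = F (tgt f)"
    "\<And>x. x \<in> obs (src f) \<Longrightarrow> on_obs (Fm f) x = on_obs f x"
    "\<And>x. x \<in> obs (src f) \<Longrightarrow> on_obs f x \<in> obs (tgt f)"
    "\<And>x y. x \<in> obs (src f) \<Longrightarrow> y \<in> obs (src f) \<Longrightarrow> on_homs (Fm f) (x, y) \<in> Arr W"
    "\<And>x y. x \<in> obs (src f) \<Longrightarrow> y \<in> obs (src f) \<Longrightarrow> Dom W (on_homs (Fm f) (x, y)) = free_hom W (src f) x y"
    "\<And>x y. x \<in> obs (src f) \<Longrightarrow> y \<in> obs (src f) \<Longrightarrow> Cod W (on_homs (Fm f) (x, y)) = free_hom W (tgt f) (on_obs f x) (on_obs f y)"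
    "\<And>d x y w as. pel (src f) d x y w as \<Longrightarrow>
       on_homs (Fm f) (x, y) \<cdot> fin (src f) d w as = fin (tgt f) d (map (on_obs f) w) (hmap W f w as)"
    "\<And>d x y w as. pel (src f) d x y w as \<Longrightarrow> pel (tgt f) d (on_obs f x) (on_obs f y) (map (on_obs f) w) (hmap W f w as)"
proof -
  show f': "graph elts W (src f)" "graph elts W (tgt f)" "gmor W f" using f by (auto simp: Gph_Arr)
  then show "gr (src f)" "gr (tgt f)" by auto
  have "gmor W (mor_comp W (\<eta>\<^sub>F (tgt f)) f)" using f' by simp
  note e = free_ext[OF f'(1) _ this, of "F (tgt f)"]
  show em: "emor (Fm f)" and st: "src (Fm f) = F (src f)" "tgt (Fm f) = F (tgt f)" using e f' by auto
  then show gm: "gmor W (Fm f)" by (simp only: emor_gmor)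
  show o: "on_obs (Fm f) x = on_obs f x" if "x \<in> obs (src f)" for x by (rule free_map_obs[OF f' that])
  show o': "on_obs f x \<in> obs (tgt f)" if "x \<in> obs (src f)" for x by (rule gmor_simps(1)[OF f'(3) that])
  fix x y assume xy: "x \<in> obs (src f)" "y \<in> obs (src f)"
  show "on_homs (Fm f) (x, y) \<in> Arr W" "Dom W (on_homs (Fm f) (x, y)) = free_hom W (src f) x y"
    "Cod W (on_homs (Fm f) (x, y)) = free_hom W (tgt f) (on_obs f x) (on_obs f y)"
    using gmor_simps(2-)[OF gm, of x y] st xy o o' by (simp_all del: adjF_simps)
next
  fix d x y w as assume p: "pel (src f) d x y w as"
  have f': "graph elts W (src f)" "graph elts W (tgt f)" "gmor W f" using f by (auto simp: Gph_Arr)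
  show "on_homs (Fm f) (x, y) \<cdot> fin (src f) d w as = fin (tgt f) d (map (on_obs f) w) (hmap W f w as)"
    by (rule free_map_fin[OF f' p])
  show "pel (tgt f) d (on_obs f x) (on_obs f y) (map (on_obs f) w) (hmap W f w as)"
    by (rule hmap_pel[OF f'(3) refl refl p])
qed

declare adjF_simps(4,5) [simp del]

text \<open>\<open>F f\<close> keeps the number of edges. A path whose image is a single edge is
  therefore a single edge itself, and this edge is the required lift.\<close>

lemma free_unit_cpb:
  assumes f: "f \<in> Arr GPH"
  shows "cpb W (far forget (Fm f)) (\<eta>\<^sub>F (tgt f)) (\<eta>\<^sub>F (src f)) f"
proof -
  note fm = free_map[OF f]
  note [simp] = fm(1-14)
  define G H where "G = src f" and "H = tgt f"
  have GH [simp]: "src f = G" "tgt f = H" by (auto simp: G_def H_def)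
  note [simp] = fm(1-14)[unfolded GH]
  have eta: "on_homs (\<eta>\<^sub>F G) (x, y) \<in> Arr W" "Dom W (on_homs (\<eta>\<^sub>F G) (x, y)) = homob G (x, y)" "Cod W (on_homs (\<eta>\<^sub>F G) (x, y)) = free_hom W G x y"
    if "x \<in> obs G" "y \<in> obs G" for x y using gmor_simps(2-)[OF free_unit_gmor, of G x y] that by auto
  have etaH: "on_homs (\<eta>\<^sub>F H) (x, y) \<in> Arr W" "Dom W (on_homs (\<eta>\<^sub>F H) (x, y)) = homob H (x, y)" "Cod W (on_homs (\<eta>\<^sub>F H) (x, y)) = free_hom W H x y"
    if "x \<in> obs H" "y \<in> obs H" for x y using gmor_simps(2-)[OF free_unit_gmor, of H x y] that by auto
  have pb: "is_pullback W (on_homs (Fm f) (x, y)) (on_homs (\<eta>\<^sub>F H) (on_obs f x, on_obs f y)) (on_homs (\<eta>\<^sub>F G) (x, y)) (on_homs f (x, y))"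
    if xy: "x \<in> obs G" "y \<in> obs G" for x y
  proof (rule locally_pullbackI)
    note [simp] = eta[OF xy] etaH xy
    show "on_homs (Fm f) (x, y) \<cdot> on_homs (\<eta>\<^sub>F G) (x, y) = on_homs (\<eta>\<^sub>F H) (on_obs f x, on_obs f y) \<cdot> on_homs f (x, y)"
    proof -
      have p: "pel G (homob G (x, y)) x y [x, y] [Ide W (homob G (x, y))]" by (rule pel_sing) (use xy gr_simps[of G] in auto)
      show ?thesis using fm(15)[unfolded GH, OF p] free_unit_fin(1)[of G x y] free_unit_fin(2)[of H "on_obs f x" "on_obs f y" "on_homs f (x, y)"]
        by simp
    qed
    fix d a b assume a: "a \<in> Arr W" "Dom W a = d" "Cod W a = Dom W (on_homs (Fm f) (x, y))"
      and b: "b \<in> Arr W" "Dom W b = d" "Cod W b = Dom W (on_homs (\<eta>\<^sub>F H) (on_obs f x, on_obs f y))"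
      and eq: "on_homs (Fm f) (x, y) \<cdot> a = on_homs (\<eta>\<^sub>F H) (on_obs f x, on_obs f y) \<cdot> b"
    have a': "a \<in> Arr W" "Cod W a = free_hom W G x y" "Dom W a = d" using a by auto
    have b': "Cod W b = homob H (on_obs f x, on_obs f y)" using b by simp
    from fin_decomp[OF _ a', of] have "locally d (finl G x y a)" by simp
    then show "locally d (\<lambda>e. \<exists>h. h \<in> hom W (Dom W e) (Dom W (on_homs f (x, y))) \<and> on_homs (\<eta>\<^sub>F G) (x, y) \<cdot> h = a \<cdot> e \<and> on_homs f (x, y) \<cdot> h = b \<cdot> e)"
    proof (rule locally_mono)
      fix e assume e: "e \<in> Arr W" "Cod W e = d" "\<not> is_initial W (Dom W e)" "finl G x y a e"
      obtain w as where w: "pel G (Dom W e) x y w as" "a \<cdot> e = fin G (Dom W e) w as" using e by (auto simp: finl_def)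
      have bp: "pel H (Dom W e) (on_obs f x) (on_obs f y) [on_obs f x, on_obs f y] [b \<cdot> e]" by (rule pel_sing) (use b b' e in auto)
      have "fin H (Dom W e) (map (on_obs f) w) (hmap W f w as) = on_homs (Fm f) (x, y) \<cdot> a \<cdot> e"
        using fm(15)[unfolded GH, OF w(1)] w(2) by simp
      also have "\<dots> = fin H (Dom W e) [on_obs f x, on_obs f y] [b \<cdot> e]"
        using comp_eq[OF eq, of e] a' b b' e free_unit_fin(2)[of H "on_obs f x" "on_obs f y" "b \<cdot> e"] by simp
      finally have "map (on_obs f) w = [on_obs f x, on_obs f y]" "hmap W f w as = [b \<cdot> e]"
        using fin_inj[OF _ fm(16)[unfolded GH, OF w(1)] bp e(3)] by auto
      then obtain a1 where a1: "as = [a1]" using hmap_simps(1)[of W f w as] by (cases as) auto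
      obtain w' where w': "w = x # w'" "a1 \<in> hom W (Dom W e) (homob G (x, w' ! 0))" "pel G (Dom W e) (w' ! 0) y w' []"
        using w(1) unfolding a1 pel_Cons by blast
      then have w: "w = [x, y]" "a \<cdot> e = fin G (Dom W e) [x, y] [a1]" using w a1 by (auto simp: pel_Nil)
      have "on_homs f (x, y) \<cdot> a1 = b \<cdot> e" using \<open>hmap W f w as = [b \<cdot> e]\<close> unfolding a1 w by (simp add: hmap_def)
      then show "\<exists>h. h \<in> hom W (Dom W e) (Dom W (on_homs f (x, y))) \<and> on_homs (\<eta>\<^sub>F G) (x, y) \<cdot> h = a \<cdot> e \<and> on_homs f (x, y) \<cdot> h = b \<cdot> e"
        using w' w free_unit_fin(2)[of G x y a1] by (intro exI[of _ a1]) auto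
    qed
  next
    note [simp] = eta[OF xy] etaH xy
    fix d h h' assume h: "h \<in> Arr W" "h' \<in> Arr W" "Dom W h = d" "Dom W h' = d" "Cod W h = Dom W (on_homs f (x, y))" "Cod W h' = Dom W (on_homs f (x, y))"
      "\<not> is_initial W d" "on_homs (\<eta>\<^sub>F G) (x, y) \<cdot> h = on_homs (\<eta>\<^sub>F G) (x, y) \<cdot> h'"
    have p: "pel G d x y [x, y] [h]" by (rule pel_sing) (use h(1-6) in auto)
    have p': "pel G d x y [x, y] [h']" by (rule pel_sing) (use h(1-6) in auto)
    have "fin G d [x, y] [h] = fin G d [x, y] [h']" using h free_unit_fin(2)[of G x y h] free_unit_fin(2)[of G x y h'] by simp
    from fin_inj(2)[OF _ p p' h(7) this] have "h = h'" by simp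
    then show "locally d (\<lambda>e. h \<cdot> e = h' \<cdot> e)" using h by (auto intro: here)
  qed (use eta[OF xy] etaH xy in auto)
  show ?thesis
    unfolding cpb_def
  proof (intro conjI ballI impI)
    fix z z' assume "z \<in> obs (src f)" "z' \<in> obs (src f)"
    then show "is_pullback W (on_homs (far forget (Fm f)) (on_obs (\<eta>\<^sub>F (src f)) z, on_obs (\<eta>\<^sub>F (src f)) z'))
        (on_homs (\<eta>\<^sub>F (tgt f)) (on_obs f z, on_obs f z')) (on_homs (\<eta>\<^sub>F (src f)) (z, z')) (on_homs f (z, z'))"
      using pb by simp
  next
    fix x y assume xy: "x \<in> obs (src (far forget (Fm f)))" "y \<in> obs (src (\<eta>\<^sub>F (tgt f)))" "on_obs (far forget (Fm f)) x = on_obs (\<eta>\<^sub>F (tgt f)) y"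
    then have "x \<in> obs G" "y = on_obs f x" by simp_all
    then show "\<exists>!z. z \<in> obs (src f) \<and> on_obs (\<eta>\<^sub>F (src f)) z = x \<and> on_obs f z = y"
      by (intro ex1I[of _ x]) (simp, metis free_unit_simps(3) GH(1))
  qed simp_all
qed

text \<open>Paths in \<open>G\<close> and \<open>H\<close> with the same image in \<open>K\<close>
  have equal length and match vertex by vertex and edge by edge. The pullback of graphs then
  supplies the vertices \<open>z i\<close> and the edges \<open>c i\<close> of a unique path above
  both.\<close>

lemma free_map_cpb:
  assumes f: "f \<in> Arr GPH" and g: "g \<in> Arr GPH" and p: "p \<in> Arr GPH" and q: "q \<in> Arr GPH"
    and pb: "cpb W f g p q"
  shows "cpb W (Fm f) (Fm g) (Fm p) (Fm q)"
proof -
  note fm = free_map[OF f] and gm = free_map[OF g] and pm = free_map[OF p] and qm = free_map[OF q]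
  define G H P K where "G = src f" and "H = src g" and "P = src q" and "K = tgt g"
  have st [simp]: "src f = G" "src g = H" "src q = P" "src p = P" "tgt f = K" "tgt g = K" "tgt p = G" "tgt q = H"
    using pb by (auto simp: cpb_def G_def H_def P_def K_def)
  note [simp] = fm(1-14)[unfolded st] gm(1-14)[unfolded st] pm(1-14)[unfolded st] qm(1-14)[unfolded st]
  note Ff = fm(15,16)[unfolded st] and Fg = gm(15,16)[unfolded st] and Fp = pm(15,16)[unfolded st] and Fq = qm(15,16)[unfolded st]
  have oe: "on_obs f (on_obs p z) = on_obs g (on_obs q z)" if "z \<in> obs P" for z using pb that by (auto simp: cpb_def)
  have ex1: "\<exists>!z. z \<in> obs P \<and> on_obs p z = x \<and> on_obs q z = y" if "x \<in> obs G" "y \<in> obs H" "on_obs f x = on_obs g y" for x y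
    using pb that by (auto simp: cpb_def)
  have uniq: "z = z'" if "z \<in> obs P" "z' \<in> obs P" "on_obs p z = on_obs p z'" "on_obs q z = on_obs q z'" for z z'
  proof -
    have "\<exists>!u. u \<in> obs P \<and> on_obs p u = on_obs p z \<and> on_obs q u = on_obs q z" using ex1 oe that by simp
    then show ?thesis by (rule ex1_unique) (use that in auto)
  qed
  have pbh: "is_pullback W (on_homs f (on_obs p z, on_obs p z')) (on_homs g (on_obs q z, on_obs q z')) (on_homs p (z, z')) (on_homs q (z, z'))"
    if "z \<in> obs P" "z' \<in> obs P" for z z' using pb that by (auto simp: cpb_def)
  have main: "is_pullback W (on_homs (Fm f) (on_obs p x, on_obs p y)) (on_homs (Fm g) (on_obs q x, on_obs q y)) (on_homs (Fm p) (x, y)) (on_homs (Fm q) (x, y))"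
    if xy: "x \<in> obs P" "y \<in> obs P" for x y
  proof (rule locally_pullbackI)
    note [simp] = xy oe
    \<comment> \<open>Commutativity on path elements: the two image paths agree in their vertices by
      \<open>oe\<close> and in each edge by the hom square of the given pullback.\<close>
    have fin_eq: "on_homs (Fm f) (on_obs p x, on_obs p y) \<cdot> on_homs (Fm p) (x, y) \<cdot> fin P d w as = on_homs (Fm g) (on_obs q x, on_obs q y) \<cdot> on_homs (Fm q) (x, y) \<cdot> fin P d w as"
      if w: "pel P d x y w as" for d w as
    proof -
      have "set w \<subseteq> obs P" using pelD(2)[OF w] by (simp add: Paths_def)
      then have "map (on_obs f) (map (on_obs p) w) = map (on_obs g) (map (on_obs q) w)" by auto
      moreover have "hmap W f (map (on_obs p) w) (hmap W p w as) = hmap W g (map (on_obs q) w) (hmap W q w as)"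
      proof (rule nth_equalityI)
        fix i assume "i < length (hmap W f (map (on_obs p) w) (hmap W p w as))"
        then have i: "i < length as" by simp
        note w' = pelD(3,10-13)[OF w]
        have "on_homs f (on_obs p (w ! i), on_obs p (w ! Suc i)) \<cdot> on_homs p (w ! i, w ! Suc i) = on_homs g (on_obs q (w ! i), on_obs q (w ! Suc i)) \<cdot> on_homs q (w ! i, w ! Suc i)"
          using pullback_simps(9)[OF pbh, of "w ! i" "w ! Suc i"] w' i by simp
        from comp_eq[OF this, of "as ! i"]
        have "on_homs f (on_obs p (w ! i), on_obs p (w ! Suc i)) \<cdot> on_homs p (w ! i, w ! Suc i) \<cdot> as ! i = on_homs g (on_obs q (w ! i), on_obs q (w ! Suc i)) \<cdot> on_homs q (w ! i, w ! Suc i) \<cdot> as ! i"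
          using w' i by simp
        then show "hmap W f (map (on_obs p) w) (hmap W p w as) ! i = hmap W g (map (on_obs q) w) (hmap W q w as) ! i"
          using i w' by simp
      qed simp
      ultimately show ?thesis using Fp[OF w] Fq[OF w] Ff[OF Fp(2)[OF w]] Fg[OF Fq(2)[OF w]] by (simp del: map_map)
    qed
    show "on_homs (Fm f) (on_obs p x, on_obs p y) \<cdot> on_homs (Fm p) (x, y) = on_homs (Fm g) (on_obs q x, on_obs q y) \<cdot> on_homs (Fm q) (x, y)"
      by (rule fin_ext[of P _ x y]) (use fin_eq fin_simps[of P] in auto)
  next
    note [simp] = xy oe
    fix d a b assume a: "a \<in> Arr W" "Dom W a = d" "Cod W a = Dom W (on_homs (Fm f) (on_obs p x, on_obs p y))"
      and b: "b \<in> Arr W" "Dom W b = d" "Cod W b = Dom W (on_homs (Fm g) (on_obs q x, on_obs q y))"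
      and eq: "on_homs (Fm f) (on_obs p x, on_obs p y) \<cdot> a = on_homs (Fm g) (on_obs q x, on_obs q y) \<cdot> b"
    have a': "a \<in> Arr W" "Cod W a = free_hom W G (on_obs p x) (on_obs p y)" "Dom W a = d"
      and b': "b \<in> Arr W" "Cod W b = free_hom W H (on_obs q x) (on_obs q y)" "Dom W b = d" using a b by auto
    have "locally d (\<lambda>e. finl G (on_obs p x) (on_obs p y) a e \<and> finl H (on_obs q x) (on_obs q y) b e)"
      by (rule fin_decomp2) (use a' b' in auto)
    then show "locally d (\<lambda>e. \<exists>h. h \<in> hom W (Dom W e) (Dom W (on_homs (Fm q) (x, y))) \<and> on_homs (Fm p) (x, y) \<cdot> h = a \<cdot> e \<and> on_homs (Fm q) (x, y) \<cdot> h = b \<cdot> e)"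
    proof (rule locally_mono)
      fix e assume e: "e \<in> Arr W" "Cod W e = d" "\<not> is_initial W (Dom W e)" "finl G (on_obs p x) (on_obs p y) a e \<and> finl H (on_obs q x) (on_obs q y) b e"
      obtain w as where w: "pel G (Dom W e) (on_obs p x) (on_obs p y) w as" "a \<cdot> e = fin G (Dom W e) w as" using e by (auto simp: finl_def)
      obtain v bs where v: "pel H (Dom W e) (on_obs q x) (on_obs q y) v bs" "b \<cdot> e = fin H (Dom W e) v bs" using e by (auto simp: finl_def)
      note w' = pelD[OF w(1)] and v' = pelD[OF v(1)]
      have "fin K (Dom W e) (map (on_obs f) w) (hmap W f w as) = fin K (Dom W e) (map (on_obs g) v) (hmap W g v bs)"
        using comp_eq[OF eq, of e] a' b' e(1,2) Ff(1)[OF w(1)] Fg(1)[OF v(1)] w(2) v(2) by simp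
      then have mm: "map (on_obs f) w = map (on_obs g) v" and hm: "hmap W f w as = hmap W g v bs"
        using fin_inj[OF _ Ff(2)[OF w(1)] _ e(3)] Fg(2)[OF v(1)] by auto
      have len: "length as = length bs" using arg_cong[OF mm, of length] w'(3) v'(3) by simp
      have wv: "on_obs f (w ! i) = on_obs g (v ! i)" if "i \<le> length as" for i
        using arg_cong[OF mm, of "\<lambda>l. l ! i"] that w'(3) v'(3) len by simp
      have hab: "on_homs f (w ! i, w ! Suc i) \<cdot> as ! i = on_homs g (v ! i, v ! Suc i) \<cdot> bs ! i" if "i < length as" for i
        using arg_cong[OF hm, of "\<lambda>l. l ! i"] that len by simp
      have "\<exists>z. z \<in> obs P \<and> on_obs p z = w ! i \<and> on_obs q z = v ! i" if "i \<le> length as" for i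
        using ex1[of "w ! i" "v ! i"] wv w'(10) v'(10) len that by auto
      then obtain z where z: "\<And>i. i \<le> length as \<Longrightarrow> z i \<in> obs P" "\<And>i. i \<le> length as \<Longrightarrow> on_obs p (z i) = w ! i" "\<And>i. i \<le> length as \<Longrightarrow> on_obs q (z i) = v ! i"
        by metis
      have "\<exists>c. c \<in> hom W (Dom W e) (homob P (z i, z (Suc i))) \<and> on_homs p (z i, z (Suc i)) \<cdot> c = as ! i \<and> on_homs q (z i, z (Suc i)) \<cdot> c = bs ! i"
        if i: "i < length as" for i
        by (rule pullback_lift[OF pbh, of "z i" "z (Suc i)" "as ! i" "bs ! i" "Dom W e"])
          (use z i w' v' len hab in auto)
      then obtain c where c: "\<And>i. i < length as \<Longrightarrow> c i \<in> hom W (Dom W e) (homob P (z i, z (Suc i)))"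
        "\<And>i. i < length as \<Longrightarrow> on_homs p (z i, z (Suc i)) \<cdot> c i = as ! i" "\<And>i. i < length as \<Longrightarrow> on_homs q (z i, z (Suc i)) \<cdot> c i = bs ! i"
        by metis
      let ?z = "map z [0..<Suc (length as)]" and ?c = "map c [0..<length as]"
      have nz: "?z ! i = z i" if "i \<le> length as" for i using that nth_map[of i "[0..<Suc (length as)]" z] by (simp del: upt_Suc)
      \<comment> \<open>An object of the pullback is determined by its two projections, so the
        lifted path starts and ends where it should.\<close>
      have "z 0 = x" by (rule uniq) (use z[of 0] w'(9) v'(9) in auto)
      moreover have "z (length as) = y"
        by (rule uniq) (use z[of "length as"] w'(3,6,8) v'(3,6,8) len in "auto simp: last_conv_nth")
      ultimately have zc: "pel P (Dom W e) x y ?z ?c"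
        unfolding pel_def Paths_def using z(1) c(1) nz e(1)
        by (auto simp: hd_map hd_upt last_map nth_append less_Suc_eq simp del: upt_Suc)
      have "map (on_obs p) ?z = w" by (rule nth_equalityI) (use w' z nz in "auto simp del: upt_Suc")
      moreover have "map (on_obs q) ?z = v" by (rule nth_equalityI) (use v' z nz len in "auto simp del: upt_Suc")
      moreover have "hmap W p ?z ?c = as" by (rule nth_equalityI) (use c nz in "auto simp del: upt_Suc")
      moreover have "hmap W q ?z ?c = bs" by (rule nth_equalityI) (use c nz len in "auto simp del: upt_Suc")
      ultimately have "on_homs (Fm p) (x, y) \<cdot> fin P (Dom W e) ?z ?c = a \<cdot> e" "on_homs (Fm q) (x, y) \<cdot> fin P (Dom W e) ?z ?c = b \<cdot> e"
        using Fp(1)[OF zc] Fq(1)[OF zc] w(2) v(2) by (simp_all del: upt_Suc)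
      then show "\<exists>h. h \<in> hom W (Dom W e) (Dom W (on_homs (Fm q) (x, y))) \<and> on_homs (Fm p) (x, y) \<cdot> h = a \<cdot> e \<and> on_homs (Fm q) (x, y) \<cdot> h = b \<cdot> e"
        using fin_simps[OF _ zc] by (intro exI[of _ "fin P (Dom W e) ?z ?c"]) (simp del: upt_Suc)
    qed
  next
    note [simp] = xy oe
    fix d h h' assume h: "h \<in> Arr W" "h' \<in> Arr W" "Dom W h = d" "Dom W h' = d" "Cod W h = Dom W (on_homs (Fm q) (x, y))" "Cod W h' = Dom W (on_homs (Fm q) (x, y))"
      and eqp: "on_homs (Fm p) (x, y) \<cdot> h = on_homs (Fm p) (x, y) \<cdot> h'" and eqq: "on_homs (Fm q) (x, y) \<cdot> h = on_homs (Fm q) (x, y) \<cdot> h'"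
    have "locally d (\<lambda>e. finl P x y h e \<and> finl P x y h' e)" by (rule fin_decomp2) (use h in auto)
    then show "locally d (\<lambda>e. h \<cdot> e = h' \<cdot> e)"
    proof (rule locally_mono)
      fix e assume e: "e \<in> Arr W" "Cod W e = d" "\<not> is_initial W (Dom W e)" "finl P x y h e \<and> finl P x y h' e"
      obtain w as where w: "pel P (Dom W e) x y w as" "h \<cdot> e = fin P (Dom W e) w as" using e by (auto simp: finl_def)
      obtain v bs where v: "pel P (Dom W e) x y v bs" "h' \<cdot> e = fin P (Dom W e) v bs" using e by (auto simp: finl_def)
      note w' = pelD[OF w(1)] and v' = pelD[OF v(1)]
      have "fin G (Dom W e) (map (on_obs p) w) (hmap W p w as) = fin G (Dom W e) (map (on_obs p) v) (hmap W p v bs)"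
        using comp_eq[OF eqp, of e] h e(1,2) Fp(1)[OF w(1)] Fp(1)[OF v(1)] w(2) v(2) by simp
      then have mp: "map (on_obs p) w = map (on_obs p) v" "hmap W p w as = hmap W p v bs"
        using fin_inj[OF _ Fp(2)[OF w(1)] Fp(2)[OF v(1)] e(3)] by auto
      have "fin H (Dom W e) (map (on_obs q) w) (hmap W q w as) = fin H (Dom W e) (map (on_obs q) v) (hmap W q v bs)"
        using comp_eq[OF eqq, of e] h e(1,2) Fq(1)[OF w(1)] Fq(1)[OF v(1)] w(2) v(2) by simp
      then have mq: "map (on_obs q) w = map (on_obs q) v" "hmap W q w as = hmap W q v bs"
        using fin_inj[OF _ Fq(2)[OF w(1)] Fq(2)[OF v(1)] e(3)] by auto
      have len: "length as = length bs" using arg_cong[OF mp(1), of length] w'(3) v'(3) by simp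
      have wv: "w = v"
      proof (rule nth_equalityI)
        fix i assume "i < length w"
        then have i: "i \<le> length as" using w'(3) by simp
        show "w ! i = v ! i"
          by (rule uniq) (use arg_cong[OF mp(1), of "\<lambda>l. l ! i"] arg_cong[OF mq(1), of "\<lambda>l. l ! i"] w' v' i len in auto)
      qed (use w' v' len in simp)
      have "as = bs"
      proof (rule nth_equalityI[OF len])
        fix i assume i: "i < length as"
        show "as ! i = bs ! i"
          by (rule cpb_hom_ext[OF pb, of "w ! i" "w ! Suc i"])
            (use arg_cong[OF mp(2), of "\<lambda>l. l ! i"] arg_cong[OF mq(2), of "\<lambda>l. l ! i"] w' v' i len wv in auto)
      qed
      then show "h \<cdot> e = h' \<cdot> e" using w(2) v(2) wv by simp
    qed
  qed (use xy oe in auto)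
  show ?thesis
    unfolding cpb_def
  proof (intro conjI ballI impI)
    fix x y assume "x \<in> obs (src (Fm f))" "y \<in> obs (src (Fm g))" "on_obs (Fm f) x = on_obs (Fm g) y"
    then have "\<exists>!z. z \<in> obs P \<and> on_obs p z = x \<and> on_obs q z = y" using ex1 by simp
    moreover have "(z \<in> obs P \<and> on_obs p z = x \<and> on_obs q z = y) = (z \<in> obs (src (Fm q)) \<and> on_obs (Fm p) z = x \<and> on_obs (Fm q) z = y)" for z
      by auto
    ultimately show "\<exists>!z. z \<in> obs (src (Fm q)) \<and> on_obs (Fm p) z = x \<and> on_obs (Fm q) z = y" by simp
  qed (use oe main in auto)
qed

text \<open>
  The unique lifting of binary factorizations along \<open>Fm g\<close>, iterated along a path, makes the naturality
  square of the counit at \<open>Fm g\<close> a pullback.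
\<close>

lemma free_factor_ex:
  assumes g: "g \<in> Arr GPH" and xy: "x \<in> obs (src g)" "y \<in> obs (src g)" "z \<in> obs (tgt g)"
    and u: "u \<in> Arr W" "Dom W u = d" "Cod W u = free_hom W (src g) x y"
    and b: "b \<in> Arr W" "Dom W b = d" "Cod W b = free_hom W (tgt g) (on_obs g x) z"
    and c: "c \<in> Arr W" "Dom W c = d" "Cod W c = free_hom W (tgt g) z (on_obs g y)"
    and eq: "on_homs (Fm g) (x, y) \<cdot> u = ecomp (F (tgt g)) (on_obs g x) z (on_obs g y) c b"
  shows "locally d (\<lambda>e. \<exists>x' v t. x' \<in> obs (src g) \<and> on_obs g x' = z \<and>
     v \<in> hom W (Dom W e) (free_hom W (src g) x x') \<and> t \<in> hom W (Dom W e) (free_hom W (src g) x' y) \<and>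
     on_homs (Fm g) (x, x') \<cdot> v = b \<cdot> e \<and> on_homs (Fm g) (x', y) \<cdot> t = c \<cdot> e \<and> ecomp (F (src g)) x x' y t v = u \<cdot> e)"
proof -
  note gm = free_map[OF g]
  define G H where "G = src g" and "H = tgt g"
  have st [simp]: "src g = G" "tgt g = H" by (auto simp: G_def H_def)
  note [simp] = gm(1-14)[unfolded st] xy[unfolded st]
  note Fg = gm(15,16)[unfolded st]
  have u': "u \<in> Arr W" "Cod W u = free_hom W G x y" "Dom W u = d" using u by auto
  have bc': "b \<in> Arr W" "Cod W b = free_hom W H (on_obs g x) z" "Dom W b = d" "c \<in> Arr W" "Cod W c = free_hom W H z (on_obs g y)" "Dom W c = d"
    using b c by auto
  have "locally d (\<lambda>e. finl G x y u e \<and> finl H (on_obs g x) z b e \<and> finl H z (on_obs g y) c e)"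
    by (rule locally_conj[OF fin_decomp[OF _ u'] fin_decomp2[OF _ bc']]) (use finl_stable[of G] finl_stable[of H] u' bc' in auto)
  then show ?thesis
  proof (rule locally_mono)
    fix e assume e: "e \<in> Arr W" "Cod W e = d" "\<not> is_initial W (Dom W e)" "finl G x y u e \<and> finl H (on_obs g x) z b e \<and> finl H z (on_obs g y) c e"
    obtain w as where w: "pel G (Dom W e) x y w as" "u \<cdot> e = fin G (Dom W e) w as" using e by (auto simp: finl_def)
    obtain v bs where v: "pel H (Dom W e) (on_obs g x) z v bs" "b \<cdot> e = fin H (Dom W e) v bs" using e by (auto simp: finl_def)
    obtain t cs where t: "pel H (Dom W e) z (on_obs g y) t cs" "c \<cdot> e = fin H (Dom W e) t cs" using e by (auto simp: finl_def)
    have "fin H (Dom W e) (map (on_obs g) w) (hmap W g w as) = fin H (Dom W e) (v @ tl t) (bs @ cs)"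
      using comp_eq[OF eq, of e] u' bc' e(1,2) Fg(1)[OF w(1)] w(2) v(2) t(2) free_ecomp[OF _ v(1) t(1)] by simp
    then have mm: "map (on_obs g) w = v @ tl t" "hmap W g w as = bs @ cs"
      using fin_inj[OF _ Fg(2)[OF w(1)] pel_append[OF v(1) t(1)] e(3)] by auto
    \<comment> \<open>The place at which the path above has to be cut: \<open>F g\<close> keeps the
      number of edges, so the factors below dictate it.\<close>
    define k where "k = length bs"
    have k: "k \<le> length as" using arg_cong[OF mm(2), of length] by (simp add: k_def)
    have vl: "length v = Suc k" "length t = Suc (length cs)" using pelD(3)[OF v(1)] pelD(3)[OF t(1)] by (auto simp: k_def)
    note s = pel_split[OF w(1) k]
    have wl: "length w = Suc (length as)" using pelD(3)[OF w(1)] .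
    have v_eq: "map (on_obs g) (take (Suc k) w) = v" using arg_cong[OF mm(1), of "take (Suc k)"] vl by (simp add: take_map)
    have lv: "on_obs g (w ! k) = z"
      using arg_cong[OF v_eq, of "\<lambda>l. l ! k"] wl k pelD(6,8)[OF v(1)] vl by (simp add: last_conv_nth)
    \<comment> \<open>\<open>drop k\<close> contains the joint vertex, which \<open>tl t\<close>
      omits; it is put back by \<open>lv\<close>.\<close>
    have t_eq: "map (on_obs g) (drop k w) = t"
    proof -
      have "drop k w = w ! k # drop (Suc k) w" using wl k by (simp add: Cons_nth_drop_Suc)
      moreover have "map (on_obs g) (drop (Suc k) w) = tl t" using arg_cong[OF mm(1), of "drop (Suc k)"] vl by (simp add: drop_map)
      moreover have "t = z # tl t" using pelD(6,7)[OF t(1)] by (cases t) auto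
      ultimately show ?thesis using lv by simp
    qed
    have b_eq: "hmap W g (take (Suc k) w) (take k as) = bs"
    proof (rule nth_equalityI)
      fix i assume "i < length (hmap W g (take (Suc k) w) (take k as))"
      then have "i < k" by simp
      then show "hmap W g (take (Suc k) w) (take k as) ! i = bs ! i"
        using arg_cong[OF mm(2), of "\<lambda>l. l ! i"] k by (simp add: k_def nth_append)
    qed (use k in "simp add: k_def")
    have c_eq: "hmap W g (drop k w) (drop k as) = cs"
    proof (rule nth_equalityI)
      show len: "length (hmap W g (drop k w) (drop k as)) = length cs" using arg_cong[OF mm(2), of length] by (simp add: k_def)
      fix i assume "i < length (hmap W g (drop k w) (drop k as))"
      then have "k + i < length as" by simp
      then show "hmap W g (drop k w) (drop k as) ! i = cs ! i"
        using arg_cong[OF mm(2), of "\<lambda>l. l ! (k + i)"] wl by (simp add: k_def nth_append)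
    qed
    have "take (Suc k) w @ tl (drop k w) = w" by (simp add: tl_drop drop_Suc[symmetric] flip: drop_Suc)
    then have u_eq: "ecomp (F G) x (w ! k) y (fin G (Dom W e) (drop k w) (drop k as)) (fin G (Dom W e) (take (Suc k) w) (take k as)) = u \<cdot> e"
      using free_ecomp[OF _ s] w(2) by simp
    show "\<exists>x' v t. x' \<in> obs (src g) \<and> on_obs g x' = z \<and>
     v \<in> hom W (Dom W e) (free_hom W (src g) x x') \<and> t \<in> hom W (Dom W e) (free_hom W (src g) x' y) \<and>
     on_homs (Fm g) (x, x') \<cdot> v = b \<cdot> e \<and> on_homs (Fm g) (x', y) \<cdot> t = c \<cdot> e \<and> ecomp (F (src g)) x x' y t v = u \<cdot> e"
      using pelD(5)[OF s(1)] lv Fg(1)[OF s(1)] Fg(1)[OF s(2)] fin_simps[OF _ s(1)] fin_simps[OF _ s(2)] u_eq v_eq t_eq b_eq c_eq v(2) t(2)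
      by (intro exI[of _ "w ! k"] exI[of _ "fin G (Dom W e) (take (Suc k) w) (take k as)"] exI[of _ "fin G (Dom W e) (drop k w) (drop k as)"]) simp
  qed
qed

text \<open>The elements \<open>v\<close> and \<open>v'\<close> have the same image, so locally they
  are paths of equal length; two cuts of one path at the same place coincide.\<close>

lemma free_factor_unique:
  assumes g: "g \<in> Arr GPH" and xy: "x \<in> obs (src g)" "y \<in> obs (src g)" "z \<in> obs (src g)" "z' \<in> obs (src g)" "on_obs g z = on_obs g z'"
    and ni: "\<not> is_initial W d"
    and v: "v \<in> Arr W" "Dom W v = d" "Cod W v = free_hom W (src g) x z" "v' \<in> Arr W" "Dom W v' = d" "Cod W v' = free_hom W (src g) x z'"
    and t: "t \<in> Arr W" "Dom W t = d" "Cod W t = free_hom W (src g) z y" "t' \<in> Arr W" "Dom W t' = d" "Cod W t' = free_hom W (src g) z' y"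
    and eqv: "on_homs (Fm g) (x, z) \<cdot> v = on_homs (Fm g) (x, z') \<cdot> v'"
    and eq: "ecomp (F (src g)) x z y t v = ecomp (F (src g)) x z' y t' v'"
  shows "z = z' \<and> v = v' \<and> t = t'"
proof -
  note gm = free_map[OF g]
  define G H where "G = src g" and "H = tgt g"
  have st [simp]: "src g = G" "tgt g = H" by (auto simp: G_def H_def)
  note [simp] = gm(1-14)[unfolded st] xy[unfolded st]
  note Fg = gm(15,16)[unfolded st]
  note [simp] = v[unfolded st] t[unfolded st]
  have l1: "locally d (\<lambda>e. finl G x z v e \<and> finl G x z' v' e)" by (rule fin_decomp2) auto
  have l2: "locally d (\<lambda>e. finl G z y t e \<and> finl G z' y t' e)" by (rule fin_decomp2) auto
  have "locally d (\<lambda>e. (finl G x z v e \<and> finl G x z' v' e) \<and> (finl G z y t e \<and> finl G z' y t' e))"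
    by (rule locally_conj[OF l1 l2]) (use finl_stable[of G] in auto)
  then have L: "locally d (\<lambda>e. z = z' \<and> v \<cdot> e = v' \<cdot> e \<and> t \<cdot> e = t' \<cdot> e)"
  proof (rule locally_mono)
    fix e assume e: "e \<in> Arr W" "Cod W e = d" "\<not> is_initial W (Dom W e)" "(finl G x z v e \<and> finl G x z' v' e) \<and> (finl G z y t e \<and> finl G z' y t' e)"
    obtain p as where p: "pel G (Dom W e) x z p as" "v \<cdot> e = fin G (Dom W e) p as" using e by (auto simp: finl_def)
    obtain p' as' where p': "pel G (Dom W e) x z' p' as'" "v' \<cdot> e = fin G (Dom W e) p' as'" using e by (auto simp: finl_def)
    obtain q bs where q: "pel G (Dom W e) z y q bs" "t \<cdot> e = fin G (Dom W e) q bs" using e by (auto simp: finl_def)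
    obtain q' bs' where q': "pel G (Dom W e) z' y q' bs'" "t' \<cdot> e = fin G (Dom W e) q' bs'" using e by (auto simp: finl_def)
    have "fin G (Dom W e) (p @ tl q) (as @ bs) = fin G (Dom W e) (p' @ tl q') (as' @ bs')"
      using arg_cong[OF eq, of "\<lambda>f. f \<cdot> e"] e(1,2) p(2) p'(2) q(2) q'(2) free_ecomp[OF _ p(1) q(1)] free_ecomp[OF _ p'(1) q'(1)] by simp
    then have pq: "p @ tl q = p' @ tl q'" "as @ bs = as' @ bs'"
      using fin_inj[OF _ pel_append[OF p(1) q(1)] pel_append[OF p'(1) q'(1)] e(3)] by auto
    have "fin H (Dom W e) (map (on_obs g) p) (hmap W g p as) = fin H (Dom W e) (map (on_obs g) p') (hmap W g p' as')"
      using comp_eq[OF eqv, of e] e(1,2) p(2) p'(2) Fg(1)[OF p(1)] Fg(1)[OF p'(1)] by simp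
    then have "hmap W g p as = hmap W g p' as'"
      using fin_inj(2)[OF _ Fg(2)[OF p(1)] _ e(3), of "map (on_obs g) p'"] Fg(2)[OF p'(1)] by simp
    \<comment> \<open>Equal lengths fix where the common concatenation is cut, so both halves
      agree.\<close>
    then have "length as = length as'" using hmap_simps(1) by metis
    moreover have "length p = length p'" using calculation pelD(3)[OF p(1)] pelD(3)[OF p'(1)] by simp
    ultimately have *: "p = p'" "tl q = tl q'" "as = as'" "bs = bs'" using pq by auto
    then have z: "z = z'" using pelD(8)[OF p(1)] pelD(8)[OF p'(1)] by simp
    then have "q = q'" using *(2) pelD(6,7)[OF q(1)] pelD(6,7)[OF q'(1)] by (cases q; cases q') auto
    then show "z = z' \<and> v \<cdot> e = v' \<cdot> e \<and> t \<cdot> e = t' \<cdot> e" using * z p p' q q' by simp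
  qed
  \<comment> \<open>The equation does not mention the stage, which is noninitial, so it may be read
    off on one piece of the cover.\<close>
  have z: "z = z'" by (rule locally_const[OF L _ ni]) auto
  have "v = v'" by (rule locally_eqI[OF L]) (use z v t in auto)
  moreover have "t = t'" by (rule locally_eqI[OF L]) (use z v t in auto)
  ultimately show ?thesis using z by simp
qed

end

section \<open>The counit square at a free arrow\<close>

context lexv
begin

lemma pel_set: "pel G d x y w as \<Longrightarrow> a \<in> set as \<Longrightarrow> a \<in> Arr W \<and> Dom W a = d"
  using pelD(11,12) by (metis in_set_conv_nth)

lemma free_counit:
  assumes A: "enr A"
  shows "emor (counit adjF A)" "gmor W (counit adjF A)" "src (counit adjF A) = F (forget_ob A)" "tgt (counit adjF A) = A"
    "\<And>x. x \<in> obs A \<Longrightarrow> on_obs (counit adjF A) x = x"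
    "\<And>x y. x \<in> obs A \<Longrightarrow> y \<in> obs A \<Longrightarrow> on_homs (counit adjF A) (x, y) \<in> Arr W"
    "\<And>x y. x \<in> obs A \<Longrightarrow> y \<in> obs A \<Longrightarrow> Dom W (on_homs (counit adjF A) (x, y)) = free_hom W (forget_ob A) x y"
    "\<And>x y. x \<in> obs A \<Longrightarrow> y \<in> obs A \<Longrightarrow> Cod W (on_homs (counit adjF A) (x, y)) = homob A (x, y)"
proof -
  note e = free_ext[OF forget_graph[OF A] A, OF gmor_id_graph[OF forget_graph[OF A]], simplified]
  show em: "emor (counit adjF A)" and st: "src (counit adjF A) = F (forget_ob A)" "tgt (counit adjF A) = A"
    using e by (simp_all add: adjF_simps)
  then show gm: "gmor W (counit adjF A)" by (simp only: emor_gmor)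
  show o: "on_obs (counit adjF A) x = x" if "x \<in> obs A" for x by (rule free_counit_obs[OF A that])
  fix x y assume xy: "x \<in> obs A" "y \<in> obs A"
  have g: "gr (forget_ob A)" using forget_graph[OF A] by simp
  show "on_homs (counit adjF A) (x, y) \<in> Arr W" "Dom W (on_homs (counit adjF A) (x, y)) = free_hom W (forget_ob A) x y"
    "Cod W (on_homs (counit adjF A) (x, y)) = homob A (x, y)"
    using gmor_simps(2-)[OF gm, of x y] st xy o g by simp_all
qed

text \<open>Induction on the number of factors. \<open>free_factor_ex\<close> splits off the first
  factor, and the induction hypothesis lifts the rest, on a finer cover each time; this is why the
  stage \<open>d\<close> varies in the induction. In the base case an element over an identity is
  itself an identity, because it has no edges.\<close>

lemma counit_lift_ex:
  assumes g: "g \<in> Arr GPH"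
    and p: "pel (F (tgt g)) d (on_obs g x) (on_obs g y) v vs" and xy: "x \<in> obs (src g)" "y \<in> obs (src g)"
    and u: "u \<in> Arr W" "Dom W u = d" "Cod W u = free_hom W (src g) x y"
    and eq: "on_homs (Fm g) (x, y) \<cdot> u = pcomp (F (tgt g)) d v vs"
  shows "locally d (\<lambda>e. \<exists>w us. pel (F (src g)) (Dom W e) x y w us \<and> map (on_obs g) w = v \<and>
     hmap W (Fm g) w us = map (\<lambda>a. a \<cdot> e) vs \<and> pcomp (F (src g)) (Dom W e) w us = u \<cdot> e)"
  using p xy u eq
proof (induction "length vs" arbitrary: d x v vs u)
  note gm = free_map[OF g]
  define G H where "G = src g" and "H = tgt g"
  have st [simp]: "src g = G" "tgt g = H" by (auto simp: G_def H_def)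
  note [simp] = gm(1-14)[unfolded st]
  note Fg = gm(15,16)[unfolded st]
  {
    case 0
    then have vs: "vs = []" by simp
    note N = 0(2-)[unfolded st vs]
    have v: "v = [on_obs g x]" "d \<in> Obj W" using N(1) by (auto simp: pel_Nil)
    have "locally d (finl G x y u)" by (rule fin_decomp) (use N in auto)
    then show ?case
      unfolding st vs
    proof (rule locally_mono)
      fix e assume e: "e \<in> Arr W" "Cod W e = d" "\<not> is_initial W (Dom W e)" "finl G x y u e"
      obtain w as where w: "pel G (Dom W e) x y w as" "u \<cdot> e = fin G (Dom W e) w as" using e by (auto simp: finl_def)
      have q: "pel H d (on_obs g x) (on_obs g y) [on_obs g x] []" using N(1) v by (auto simp: pel_Nil)
      then have q': "pel H (Dom W e) (on_obs g x) (on_obs g y) [on_obs g x] []" using e by (auto simp: pel_Nil)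
      have "on_homs (Fm g) (x, y) \<cdot> u = fin H d [on_obs g x] []" using N(7) v N(2) free_eid[of H "on_obs g x" d] by simp
      from comp_eq[OF this, of e] have "fin H (Dom W e) (map (on_obs g) w) (hmap W g w as) = fin H (Dom W e) [on_obs g x] []"
        using Fg(1)[OF w(1)] w(2) e N(2-6) fin_comp[OF _ q e(1,2)] fin_simps[OF _ q] by simp
      from fin_inj(2)[OF _ Fg(2)[OF w(1)] q' e(3) this] have "as = []" using hmap_simps(1)[of W g w as] by simp
      then have as: "as = []" "w = [x]" "x = y" using w(1) by (auto simp: pel_Nil)
      then show "\<exists>w us. pel (F G) (Dom W e) x y w us \<and> map (on_obs g) w = v \<and>
         hmap W (Fm g) w us = map (\<lambda>a. a \<cdot> e) [] \<and> pcomp (F G) (Dom W e) w us = u \<cdot> e"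
        using v w(2) free_eid[of G x "Dom W e"] N(2) e by (intro exI[of _ "[x]"] exI[of _ "[]"]) (simp add: pel_Nil hmap_def)
    qed
  next
    case (Suc n vs0 d x v u)
    obtain a vs where vs0: "vs0 = a # vs" using Suc(2) by (cases vs0) auto
    note N = Suc(3-)[unfolded st vs0]
    have n: "n = length (map (\<lambda>a. a \<cdot> e) vs)" for e using Suc(2) vs0 by simp
    obtain v' where v0: "v = on_obs g x # v'" "a \<in> hom W d (homob (F H) (on_obs g x, v' ! 0))" "pel (F H) d (v' ! 0) (on_obs g y) v' vs"
      using N(1) unfolding pel_Cons by blast
    then have v: "v = on_obs g x # v'" "a \<in> Arr W" "Dom W a = d" "Cod W a = free_hom W H (on_obs g x) (v' ! 0)"
        "pel (F H) d (v' ! 0) (on_obs g y) v' vs"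
      using N(2) pelD(4)[OF v0(3)] by auto
    note V = pelD[OF v(5)]
    have c: "pcomp (F H) d v' vs \<in> Arr W" "Dom W (pcomp (F H) d v' vs) = d" "Cod W (pcomp (F H) d v' vs) = free_hom W H (v' ! 0) (on_obs g y)"
      using pcomp_simps[OF _ v(5)] V(4) N(3) by auto
    have z: "v' ! 0 \<in> obs H" using V(4) by simp
    have "on_homs (Fm g) (x, y) \<cdot> u = ecomp (F H) (on_obs g x) (v' ! 0) (on_obs g y) (pcomp (F H) d v' vs) a"
      using N(7) v V(8) by simp
    \<comment> \<open>The composite along \<open>v\<close> is read as a binary one, with first
      factor \<open>a\<close> and the composite of all remaining factors as second.\<close>
    note L = free_factor_ex[OF g, unfolded st, OF N(2,3) z N(4-6) v(2-4) c this]
    show ?case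
      unfolding st vs0
    proof (rule locally_trans[OF L])
      fix e assume e: "e \<in> Arr W" "Cod W e = d"
        and "\<exists>x' b t. x' \<in> obs G \<and> on_obs g x' = v' ! 0 \<and>
           b \<in> hom W (Dom W e) (free_hom W G x x') \<and> t \<in> hom W (Dom W e) (free_hom W G x' y) \<and>
           on_homs (Fm g) (x, x') \<cdot> b = a \<cdot> e \<and> on_homs (Fm g) (x', y) \<cdot> t = pcomp (F H) d v' vs \<cdot> e \<and> ecomp (F G) x x' y t b = u \<cdot> e"
      then obtain x' b t where x': "x' \<in> obs G" "on_obs g x' = v' ! 0" and b: "b \<in> Arr W" "Dom W b = Dom W e" "Cod W b = free_hom W G x x'"
        and t: "t \<in> Arr W" "Dom W t = Dom W e" "Cod W t = free_hom W G x' y"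
        and eqs: "on_homs (Fm g) (x, x') \<cdot> b = a \<cdot> e" "on_homs (Fm g) (x', y) \<cdot> t = pcomp (F H) d v' vs \<cdot> e" "ecomp (F G) x x' y t b = u \<cdot> e"
        by auto
      have p': "pel (F H) (Dom W e) (on_obs g x') (on_obs g y) v' (map (\<lambda>a. a \<cdot> e) vs)"
        using pel_restrict[OF v(5) e] x' by simp
      have "on_homs (Fm g) (x', y) \<cdot> t = pcomp (F H) (Dom W e) v' (map (\<lambda>a. a \<cdot> e) vs)"
        unfolding eqs(2) by (rule pcomp_restrict[OF _ v(5) e]) simp
      note IH = Suc(1)[unfolded st, OF n p' x'(1) N(3) t this]
      show "locally (Dom W e) (\<lambda>k. \<exists>w us. pel (F G) (Dom W (e \<cdot> k)) x y w us \<and> map (on_obs g) w = v \<and>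
         hmap W (Fm g) w us = map (\<lambda>a. a \<cdot> (e \<cdot> k)) (a # vs) \<and> pcomp (F G) (Dom W (e \<cdot> k)) w us = u \<cdot> (e \<cdot> k))"
      proof (rule locally_mono[OF IH])
        fix k assume k: "k \<in> Arr W" "Cod W k = Dom W e"
          and "\<exists>w us. pel (F G) (Dom W k) x' y w us \<and> map (on_obs g) w = v' \<and>
            hmap W (Fm g) w us = map (\<lambda>a. a \<cdot> k) (map (\<lambda>a. a \<cdot> e) vs) \<and> pcomp (F G) (Dom W k) w us = t \<cdot> k"
        then obtain w us where w: "pel (F G) (Dom W k) x' y w us" "map (on_obs g) w = v'"
          "hmap W (Fm g) w us = map (\<lambda>a. a \<cdot> k) (map (\<lambda>a. a \<cdot> e) vs)" "pcomp (F G) (Dom W k) w us = t \<cdot> k" by auto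
        note P = pelD[OF w(1)]
        have w0: "w ! 0 = x'" using P(6,7) by (simp add: hd_conv_nth)
        have p: "pel (F G) (Dom W k) x y (x # w) (b \<cdot> k # us)"
          unfolding pel_Cons using w(1) w0 b k N(2) e x' by simp
        have "pcomp (F G) (Dom W k) (x # w) (b \<cdot> k # us) = ecomp (F G) x x' y t b \<cdot> k"
          using w(4) w0 P(8) b t k N(2,3) x' by simp
        also have "\<dots> = u \<cdot> (e \<cdot> k)" unfolding eqs(3) using e k N by simp
        finally have pc: "pcomp (F G) (Dom W k) (x # w) (b \<cdot> k # us) = u \<cdot> (e \<cdot> k)" .
        have "on_homs (Fm g) (x, x') \<cdot> (b \<cdot> k) = a \<cdot> (e \<cdot> k)"
          using comp_eq[OF eqs(1), of k] b k N(2) x' e v(2-4) by simp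
        moreover have "a \<cdot> e \<cdot> k = a \<cdot> (e \<cdot> k)" if "a \<in> set vs" for a
          using that e k pel_set[OF v(5)] by simp
        ultimately have "hmap W (Fm g) (x # w) (b \<cdot> k # us) = map (\<lambda>a. a \<cdot> (e \<cdot> k)) (a # vs)"
          unfolding hmap_Cons using w0 w(3) e k pel_set[OF v(5)] by simp
        then show "\<exists>w us. pel (F G) (Dom W (e \<cdot> k)) x y w us \<and> map (on_obs g) w = v \<and>
         hmap W (Fm g) w us = map (\<lambda>a. a \<cdot> (e \<cdot> k)) (a # vs) \<and> pcomp (F G) (Dom W (e \<cdot> k)) w us = u \<cdot> (e \<cdot> k)"
          using p pc w(2) v(1) e k by (intro exI[of _ "x # w"] exI[of _ "b \<cdot> k # us"]) simp
      qed
    qed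
  }
qed

text \<open>Induction along \<open>us\<close>: \<open>free_factor_unique\<close> identifies the
  first factors, the vertices between, and the composites of the rest, to which the hypothesis
  applies.\<close>

lemma counit_lift_unique:
  assumes g: "g \<in> Arr GPH" and ni: "\<not> is_initial W d"
    and p: "pel (F (src g)) d x y w us" "pel (F (src g)) d x y w' us'"
    and eq: "map (on_obs g) w = map (on_obs g) w'" "hmap W (Fm g) w us = hmap W (Fm g) w' us'"
      "pcomp (F (src g)) d w us = pcomp (F (src g)) d w' us'"
  shows "w = w' \<and> us = us'"
  using p eq
proof (induction us arbitrary: x w w' us')
  note gm = free_map[OF g]
  define G H where "G = src g" and "H = tgt g"
  have st [simp]: "src g = G" "tgt g = H" by (auto simp: G_def H_def)
  note [simp] = gm(1-14)[unfolded st]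
  {
    case Nil
    have "us' = []" using arg_cong[OF Nil(4), of length] by simp
    then show ?case using Nil(1,2) by (simp add: pel_Nil)
  next
    case (Cons a us)
    note N = Cons(2-)[unfolded st]
    obtain a' vs' where us': "us' = a' # vs'" using arg_cong[OF N(4), of length] by (cases us') auto
    obtain v where v: "w = x # v" "x \<in> obs G" "a \<in> Arr W" "Dom W a = d" "Cod W a = homob (F G) (x, v ! 0)" "pel (F G) d (v ! 0) y v us"
      using N(1) unfolding pel_Cons by auto
    obtain v' where v': "w' = x # v'" "a' \<in> Arr W" "Dom W a' = d" "Cod W a' = homob (F G) (x, v' ! 0)" "pel (F G) d (v' ! 0) y v' vs'"
      using N(2) unfolding us' pel_Cons by auto
    note V = pelD[OF v(6)] and V' = pelD[OF v'(5)]
    have ty: "v ! 0 \<in> obs G" "y \<in> obs G" "v' ! 0 \<in> obs G" using V(4,5) V'(4) by auto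
    have tya: "Cod W a = free_hom W G x (v ! 0)" "Cod W a' = free_hom W G x (v' ! 0)" using v(2,5) v'(4) ty by auto
    have pc: "pcomp (F G) d v us \<in> Arr W" "Dom W (pcomp (F G) d v us) = d" "Cod W (pcomp (F G) d v us) = free_hom W G (v ! 0) y"
      using pcomp_simps[OF _ v(6)] ty by auto
    have pc': "pcomp (F G) d v' vs' \<in> Arr W" "Dom W (pcomp (F G) d v' vs') = d" "Cod W (pcomp (F G) d v' vs') = free_hom W G (v' ! 0) y"
      using pcomp_simps[OF _ v'(5)] ty by auto
    have mv: "map (on_obs g) v = map (on_obs g) v'" using N(3) v v' by simp
    then have oz: "on_obs g (v ! 0) = on_obs g (v' ! 0)"
      using V(6) V'(6) by (metis hd_conv_nth list.map_sel(1) map_is_Nil_conv)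
    have hm: "on_homs (Fm g) (x, v ! 0) \<cdot> a = on_homs (Fm g) (x, v' ! 0) \<cdot> a'" "hmap W (Fm g) v us = hmap W (Fm g) v' vs'"
      using N(4) unfolding us' v(1) v'(1) hmap_Cons by auto
    have ec: "ecomp (F G) x (v ! 0) y (pcomp (F G) d v us) a = ecomp (F G) x (v' ! 0) y (pcomp (F G) d v' vs') a'"
      using N(5) V(8) V'(8) unfolding us' v(1) v'(1) by simp
    note U = free_factor_unique[OF g, unfolded st, OF v(2) ty(2) ty(1,3) oz ni v(3,4) tya(1) v'(2,3) tya(2) pc pc' hm(1) ec]
    have "pel (F G) d (v ! 0) y v' vs'" using v'(5) U by simp
    from Cons(1)[unfolded st, OF v(6) this mv hm(2)] U show ?case using v(1) v'(1) us' by simp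
  }
qed

text \<open>Locally an element of a hom of \<open>F (forget_ob (F H))\<close> is a path of elements
  of \<open>F H\<close>, and the counit composes it. Given an element of \<open>F G\<close> over
  that composite, the factorization lifts to \<open>F G\<close> uniquely, and the lifted path is the
  element sought.\<close>

lemma free_counit_pullback:
  assumes g: "g \<in> Arr GPH"
  shows "is_pullback CAT (Fm g) (counit adjF (F (tgt g))) (counit adjF (F (src g))) (Fm (far forget (Fm g)))"
proof -
  note gm = free_map[OF g]
  define G H where "G = src g" and "H = tgt g"
  have st [simp]: "src g = G" "tgt g = H" by (auto simp: G_def H_def)
  note [simp] = gm(1-14)[unfolded st]
  note Fg = gm(15,16)[unfolded st]
  have enr: "enr (F G)" "enr (F H)" by simp_all
  have k: "far forget (Fm g) \<in> Arr GPH" by (simp add: Gph_Arr)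
  define K where "K = Fm (far forget (Fm g))"
  note km = free_map[OF k]
  have kst [simp]: "src (far forget (Fm g)) = forget_ob (F G)" "tgt (far forget (Fm g)) = forget_ob (F H)" by simp_all
  note km' [simp] = km(1-14)[unfolded kst forget_ob_simps, folded K_def]
  note Fk = km(15,16)[unfolded kst, folded K_def]
  note eG = free_counit[OF enr(1)] and eH = free_counit[OF enr(2)]
  note [simp] = eG eH
  have hk: "hmap W (far forget (Fm g)) w us = hmap W (Fm g) w us" for w us by (simp add: hmap_def)
  note Fk' = Fk[unfolded forget_simps hk]
  have mo: "map (on_obs (Fm g)) w = map (on_obs g) w" if "pel (F G) d x y w us" for d x y w us
    using pelD(2)[OF that] by (auto simp: Paths_def)
  have FK: "on_homs K (x, y) \<cdot> fin (forget_ob (F G)) d w us = fin (forget_ob (F H)) d (map (on_obs g) w) (hmap W (Fm g) w us)"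
    "pel (F H) d (on_obs g x) (on_obs g y) (map (on_obs g) w) (hmap W (Fm g) w us)" if "pel (F G) d x y w us" for d x y w us
    using Fk'[of d x y w us] that mo[OF that] pelD(4,5)[OF that] by simp_all
  have main: "is_pullback W (on_homs (Fm g) (x, y)) (on_homs (counit adjF (F H)) (on_obs g x, on_obs g y)) (on_homs (counit adjF (F G)) (x, y)) (on_homs K (x, y))"
    if xy: "x \<in> obs G" "y \<in> obs G" for x y
  proof (rule locally_pullbackI)
    note [simp] = xy
    note cG = free_counit_fin[OF enr(1)] and cH = free_counit_fin[OF enr(2)]
    show "on_homs (Fm g) (x, y) \<cdot> on_homs (counit adjF (F G)) (x, y) = on_homs (counit adjF (F H)) (on_obs g x, on_obs g y) \<cdot> on_homs K (x, y)"
    proof (rule fin_ext)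
      fix d w us assume "pel (forget_ob (F G)) d x y w us"
      then have p: "pel (F G) d x y w us" by simp
      then have p': "pel (forget_ob (F G)) d x y w us" by simp
      have "(on_homs (Fm g) (x, y) \<cdot> on_homs (counit adjF (F G)) (x, y)) \<cdot> fin (forget_ob (F G)) d w us = on_homs (Fm g) (x, y) \<cdot> pcomp (F G) d w us"
        using cG[OF p] fin_simps[OF _ p'] by simp
      also have "\<dots> = pcomp (F H) d (map (on_obs g) w) (hmap W (Fm g) w us)"
        using pcomp_functor[of "Fm g" d x y w us] p mo[OF p] by simp
      also have "\<dots> = (on_homs (counit adjF (F H)) (on_obs g x, on_obs g y) \<cdot> on_homs K (x, y)) \<cdot> fin (forget_ob (F G)) d w us"
        using cH[OF FK(2)[OF p]] FK(1)[OF p] fin_simps[OF _ p'] by simp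
      finally show "(on_homs (Fm g) (x, y) \<cdot> on_homs (counit adjF (F G)) (x, y)) \<cdot> fin (forget_ob (F G)) d w us =
        (on_homs (counit adjF (F H)) (on_obs g x, on_obs g y) \<cdot> on_homs K (x, y)) \<cdot> fin (forget_ob (F G)) d w us" .
    qed simp_all
    fix d a b assume "a \<in> Arr W" "b \<in> Arr W" "Dom W a = d" "Dom W b = d" "Cod W a = Dom W (on_homs (Fm g) (x, y))"
      "Cod W b = Dom W (on_homs (counit adjF (F H)) (on_obs g x, on_obs g y))"
      and eq: "on_homs (Fm g) (x, y) \<cdot> a = on_homs (counit adjF (F H)) (on_obs g x, on_obs g y) \<cdot> b"
    then have a: "a \<in> Arr W" "Dom W a = d" "Cod W a = free_hom W G x y"
      and b: "b \<in> Arr W" "Cod W b = free_hom W (forget_ob (F H)) (on_obs g x) (on_obs g y)" "Dom W b = d" by simp_all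
    have "locally d (finl (forget_ob (F H)) (on_obs g x) (on_obs g y) b)" by (rule fin_decomp[OF _ b]) simp
    then show "locally d (\<lambda>e. \<exists>h. h \<in> hom W (Dom W e) (Dom W (on_homs K (x, y))) \<and>
        on_homs (counit adjF (F G)) (x, y) \<cdot> h = a \<cdot> e \<and> on_homs K (x, y) \<cdot> h = b \<cdot> e)"
    proof (rule locally_trans)
      fix e assume e: "e \<in> Arr W" "Cod W e = d" "finl (forget_ob (F H)) (on_obs g x) (on_obs g y) b e"
      then obtain v vs where v: "pel (F H) (Dom W e) (on_obs g x) (on_obs g y) v vs" "b \<cdot> e = fin (forget_ob (F H)) (Dom W e) v vs"
        by (auto simp: finl_def)
      have "on_homs (Fm g) (x, y) \<cdot> (a \<cdot> e) = pcomp (F H) (Dom W e) v vs"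
        using comp_eq[OF eq, of e] a b e(1,2) v(2) cH[OF v(1)] by simp
      note L = counit_lift_ex[OF g, unfolded st, OF v(1) xy _ _ _ this]
      have "locally (Dom W e) (\<lambda>k. \<exists>w us. pel (F G) (Dom W k) x y w us \<and> map (on_obs g) w = v \<and>
          hmap W (Fm g) w us = map (\<lambda>a. a \<cdot> k) vs \<and> pcomp (F G) (Dom W k) w us = (a \<cdot> e) \<cdot> k)"
        by (rule L) (use a e(1,2) in simp_all)
      then show "locally (Dom W e) (\<lambda>k. \<exists>h. h \<in> hom W (Dom W (e \<cdot> k)) (Dom W (on_homs K (x, y))) \<and>
        on_homs (counit adjF (F G)) (x, y) \<cdot> h = a \<cdot> (e \<cdot> k) \<and> on_homs K (x, y) \<cdot> h = b \<cdot> (e \<cdot> k))"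
      proof (rule locally_mono)
        fix k assume k: "k \<in> Arr W" "Cod W k = Dom W e"
          and "\<exists>w us. pel (F G) (Dom W k) x y w us \<and> map (on_obs g) w = v \<and>
          hmap W (Fm g) w us = map (\<lambda>a. a \<cdot> k) vs \<and> pcomp (F G) (Dom W k) w us = (a \<cdot> e) \<cdot> k"
        then obtain w us where w: "pel (F G) (Dom W k) x y w us" "map (on_obs g) w = v"
          "hmap W (Fm g) w us = map (\<lambda>a. a \<cdot> k) vs" "pcomp (F G) (Dom W k) w us = (a \<cdot> e) \<cdot> k" by auto
        have w': "pel (forget_ob (F G)) (Dom W k) x y w us" using w by simp
        have v': "pel (forget_ob (F H)) (Dom W e) (on_obs g x) (on_obs g y) v vs" using v by simp
        have "on_homs K (x, y) \<cdot> fin (forget_ob (F G)) (Dom W k) w us = (b \<cdot> e) \<cdot> k"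
          unfolding v(2) FK(1)[OF w(1)] w(2,3) using fin_comp[OF _ v' k] by simp
        then show "\<exists>h. h \<in> hom W (Dom W (e \<cdot> k)) (Dom W (on_homs K (x, y))) \<and>
          on_homs (counit adjF (F G)) (x, y) \<cdot> h = a \<cdot> (e \<cdot> k) \<and> on_homs K (x, y) \<cdot> h = b \<cdot> (e \<cdot> k)"
          using cG[OF w(1)] w(4) fin_simps[OF _ w'] a b e(1,2) k
          by (intro exI[of _ "fin (forget_ob (F G)) (Dom W k) w us"]) simp
      qed
    qed
  next
    note [simp] = xy
    note cG = free_counit_fin[OF enr(1)]
    fix d h h' assume "h \<in> Arr W" "h' \<in> Arr W" "Dom W h = d" "Dom W h' = d" "Cod W h = Dom W (on_homs K (x, y))" "Cod W h' = Dom W (on_homs K (x, y))"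
      and e1: "on_homs (counit adjF (F G)) (x, y) \<cdot> h = on_homs (counit adjF (F G)) (x, y) \<cdot> h'"
      and e2: "on_homs K (x, y) \<cdot> h = on_homs K (x, y) \<cdot> h'"
    then have h: "h \<in> Arr W" "Cod W h = free_hom W (forget_ob (F G)) x y" "Dom W h = d"
      "h' \<in> Arr W" "Cod W h' = free_hom W (forget_ob (F G)) x y" "Dom W h' = d" by simp_all
    have "locally d (\<lambda>e. finl (forget_ob (F G)) x y h e \<and> finl (forget_ob (F G)) x y h' e)"
      by (rule fin_decomp2[OF _ h]) simp_all
    then show "locally d (\<lambda>e. h \<cdot> e = h' \<cdot> e)"
    proof (rule locally_mono)
      fix e assume e: "e \<in> Arr W" "Cod W e = d" "\<not> is_initial W (Dom W e)" "finl (forget_ob (F G)) x y h e \<and> finl (forget_ob (F G)) x y h' e"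
      obtain w us where w: "pel (F G) (Dom W e) x y w us" "h \<cdot> e = fin (forget_ob (F G)) (Dom W e) w us" using e by (auto simp: finl_def)
      obtain w' us' where w': "pel (F G) (Dom W e) x y w' us'" "h' \<cdot> e = fin (forget_ob (F G)) (Dom W e) w' us'" using e by (auto simp: finl_def)
      have "fin (forget_ob (F H)) (Dom W e) (map (on_obs g) w) (hmap W (Fm g) w us) = fin (forget_ob (F H)) (Dom W e) (map (on_obs g) w') (hmap W (Fm g) w' us')"
        using comp_eq[OF e2, of e] h e(1,2) w(2) w'(2) FK(1)[OF w(1)] FK(1)[OF w'(1)] by simp
      then have "map (on_obs g) w = map (on_obs g) w'" "hmap W (Fm g) w us = hmap W (Fm g) w' us'"
        using fin_inj[of "forget_ob (F H)" "Dom W e" "on_obs g x" "on_obs g y"] FK(2)[OF w(1)] FK(2)[OF w'(1)] e(3) by simp_all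
      moreover have "pcomp (F G) (Dom W e) w us = pcomp (F G) (Dom W e) w' us'"
        using comp_eq[OF e1, of e] h e(1,2) w(2) w'(2) cG[OF w(1)] cG[OF w'(1)] by simp
      ultimately have "w = w' \<and> us = us'"
        by (rule counit_lift_unique[OF g e(3), unfolded st, OF w(1) w'(1)])
      then show "h \<cdot> e = h' \<cdot> e" using w(2) w'(2) by simp
    qed
  qed (use xy in simp_all)
  have "cpb W (Fm g) (counit adjF (F H)) (counit adjF (F G)) K"
    unfolding cpb_def
  proof (intro conjI ballI impI)
    fix z z' assume "z \<in> obs (src K)" "z' \<in> obs (src K)"
    then have "z \<in> obs G" "z' \<in> obs G" by simp_all
    then show "is_pullback W (on_homs (Fm g) (on_obs (counit adjF (F G)) z, on_obs (counit adjF (F G)) z'))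
        (on_homs (counit adjF (F H)) (on_obs K z, on_obs K z')) (on_homs (counit adjF (F G)) (z, z')) (on_homs K (z, z'))"
      using main by simp
  next
    fix x y assume xy: "x \<in> obs (src (Fm g))" "y \<in> obs (src (counit adjF (F H)))" "on_obs (Fm g) x = on_obs (counit adjF (F H)) y"
    then have "x \<in> obs G" "y = on_obs g x" by simp_all
    then show "\<exists>!z. z \<in> obs (src K) \<and> on_obs (counit adjF (F G)) z = x \<and> on_obs K z = y"
      by (intro ex1I[of _ x]) auto
  qed (simp_all)
  then have "is_pullback CAT (Fm g) (counit adjF (F H)) (counit adjF (F G)) K"
    by (rule cpb_Cat_pullback) (use enr in "simp_all add: Cat_Arr")
  then show ?thesis by (simp add: K_def)
qed

end

section \<open>Arrows cartesian for a copointed endofunctor\<close>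

text \<open>Models the endofunctor \<open>L R\<close> of the adjunction one level below, together
  with its counit.\<close>

locale copointed = lextensive elts C
  for elts :: "'u \<Rightarrow> 'u set" and C :: "('o, 'm) category" (structure) +
  fixes K :: "('o, 'm, 'o, 'm) cfunctor" and \<epsilon> :: "'o \<Rightarrow> 'm"
  assumes copoint: "nat_trans C C K id_functor \<epsilon>"
    and preserves_pb: "preserves_pullbacks C C K"
    and preserves_small_coproduct: "small elts I \<Longrightarrow> is_coproduct C I X s \<iota> \<Longrightarrow>
      is_coproduct C I (\<lambda>i. fob K (X i)) (fob K s) (\<lambda>i. far K (\<iota> i))"
begin

lemma K_functor: "is_functor C C K"
  using copoint by (simp add: nat_trans_def)

lemmas K_simps [simp] = functor_simps[OF K_functor]
lemmas eps_simps [simp] = nat_trans_simps[OF copoint, simplified]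

lemma eps_nat: "f \<in> Arr C \<Longrightarrow> f \<cdot> \<epsilon> (Dom C f) = \<epsilon> (Cod C f) \<cdot> far K f"
  using nat_trans_nat[OF copoint, of f] by simp

lemma preserves_coproduct:
  assumes "essentially_small elts I" and s: "is_coproduct C I X s \<iota>"
  shows "is_coproduct C I (\<lambda>i. fob K (X i)) (fob K s) (\<lambda>i. far K (\<iota> i))"
proof -
  obtain \<sigma> where \<sigma>: "inj_on \<sigma> I" "small elts (\<sigma> ` I)" using assms by (auto simp: essentially_small_def)
  have "is_coproduct C (\<sigma> ` I) (\<lambda>j. X (inv_into I \<sigma> j)) s (\<lambda>j. \<iota> (inv_into I \<sigma> j))"
    by (rule iffD2[OF coproduct_reindex_inv[OF \<sigma>(1)] s])
  from preserves_small_coproduct[OF \<sigma>(2) this] show ?thesis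
    by (rule iffD1[OF coproduct_reindex_inv[OF \<sigma>(1), of C "\<lambda>i. fob K (X i)" "fob K s" "\<lambda>i. far K (\<iota> i)"]])
qed

text \<open>The arrows at which \<epsilon> is cartesian; \<epsilon> as a whole is not assumed to be
  so.\<close>

definition cart :: "'m \<Rightarrow> bool" where
  "cart f \<longleftrightarrow> is_pullback C f (\<epsilon> (Cod C f)) (\<epsilon> (Dom C f)) (far K f)"

lemma cart_Arr: "cart f \<Longrightarrow> f \<in> Arr C"
  unfolding cart_def by (drule pullback_simps(1))

text \<open>The counit square at \<open>f\<close> is pasted with the image of the given pullback
  under \<open>K\<close>. By naturality the resulting rectangle is also the given pullback pasted
  with the square at \<open>q\<close>, and the former is cancelled.\<close>

lemma cart_pullback:
  assumes f: "cart f" and pb: "is_pullback C f g p q"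
  shows "cart q"
proof -
  note s [simp] = pullback_simps[OF pb]
  have "is_pullback C (far K f) (far K g) (far K p) (far K q)" using pb preserves_pb by (auto simp: preserves_pullbacks_def)
  from pullback_paste[OF f[unfolded cart_def] this]
  have "is_pullback C f (\<epsilon> (Cod C f) \<cdot> far K g) (\<epsilon> (Dom C f) \<cdot> far K p) (far K q)" .
  moreover have "\<epsilon> (Cod C f) \<cdot> far K g = g \<cdot> \<epsilon> (Cod C q)" "\<epsilon> (Dom C f) \<cdot> far K p = p \<cdot> \<epsilon> (Dom C q)"
    using eps_nat[of g] eps_nat[of p] by simp_all
  ultimately have "is_pullback C f (g \<cdot> \<epsilon> (Cod C q)) (p \<cdot> \<epsilon> (Dom C q)) (far K q)" by simp
  from pullback_cancel[OF pb this] show ?thesis unfolding cart_def using eps_nat[of q] by simp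
qed

lemma cart_comp:
  assumes f: "cart f" and g: "cart g" and c: "Cod C g = Dom C f"
  shows "cart (f \<cdot> g)"
proof -
  note [simp] = cart_Arr[OF f] cart_Arr[OF g] c
  have "is_pullback C (\<epsilon> (Cod C f)) f (far K f) (\<epsilon> (Dom C f))" using f unfolding cart_def by (rule pullback_swap)
  moreover have "is_pullback C (\<epsilon> (Dom C f)) g (far K g) (\<epsilon> (Dom C g))" using g unfolding cart_def c by (rule pullback_swap)
  ultimately have "is_pullback C (\<epsilon> (Cod C f)) (f \<cdot> g) (far K f \<cdot> far K g) (\<epsilon> (Dom C g))" by (rule pullback_paste)
  then show ?thesis unfolding cart_def using pullback_swap by simp
qed

lemma cart_Ide: assumes "a \<in> Obj C" shows "cart (Ide C a)"
  unfolding cart_def by (rule pullbackI) (use assms in auto)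

text \<open>Locally an element of \<open>s\<close> lies in some \<open>X i\<close> and an element of
  \<open>fob K t\<close> in some \<open>fob K (Y j)\<close>. Their common image in \<open>t\<close>
  forces \<open>\<phi> i = j\<close> by disjointness, and the square at \<open>p i\<close> supplies
  the lift. The index map \<phi> is arbitrary because several paths can have the same image.\<close>

lemma cart_coproduct:
  assumes I: "essentially_small elts I" and J: "essentially_small elts J"
    and s: "is_coproduct C I X s \<iota>" and t: "is_coproduct C J Y t \<kappa>"
    and \<phi>: "\<And>i. i \<in> I \<Longrightarrow> \<phi> i \<in> J" and p: "\<And>i. i \<in> I \<Longrightarrow> p i \<in> hom C (X i) (Y (\<phi> i))" "\<And>i. i \<in> I \<Longrightarrow> cart (p i)"
    and u: "u \<in> hom C s t" "\<And>i. i \<in> I \<Longrightarrow> u \<cdot> \<iota> i = \<kappa> (\<phi> i) \<cdot> p i"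
  shows "cart u"
  unfolding cart_def
proof (rule locally_pullbackI)
  note Ks = preserves_coproduct[OF I s] and Kt = preserves_coproduct[OF J t]
  note [simp] = coproduct_simps[OF s] coproduct_simps[OF t] \<phi>
  have u' [simp]: "u \<in> Arr C" "Dom C u = s" "Cod C u = t" using u by auto
  have p' [simp]: "p i \<in> Arr C" "Dom C (p i) = X i" "Cod C (p i) = Y (\<phi> i)" if "i \<in> I" for i using p(1)[OF that] by auto
  have X [simp]: "X i \<in> Obj C" if "i \<in> I" for i using coproduct_simps(3)[OF s that] by (metis that coproduct_simps(2)[OF s] Dom_Obj)
  have ei: "\<epsilon> s \<cdot> far K (\<iota> i) = \<iota> i \<cdot> \<epsilon> (X i)" if "i \<in> I" for i using eps_nat[of "\<iota> i"] that by simp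
  have ej: "\<epsilon> t \<cdot> far K (\<kappa> j) = \<kappa> j \<cdot> \<epsilon> (Y j)" if "j \<in> J" for j using eps_nat[of "\<kappa> j"] that by simp
  have Ku: "far K u \<cdot> far K (\<iota> i) = far K (\<kappa> (\<phi> i)) \<cdot> far K (p i)" if "i \<in> I" for i
    using arg_cong[OF u(2)[OF that], of "far K"] that by simp
  show "u \<cdot> \<epsilon> (Dom C u) = \<epsilon> (Cod C u) \<cdot> far K u" using eps_nat[of u] by simp
  {
    fix d a b assume a: "a \<in> Arr C" "Dom C a = d" "Cod C a = Dom C u" and b: "b \<in> Arr C" "Dom C b = d" "Cod C b = Dom C (\<epsilon> (Cod C u))"
      and eq: "u \<cdot> a = \<epsilon> (Cod C u) \<cdot> b"
    have a': "Cod C a = s" and b': "Cod C b = fob K t" using a b by auto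
    show "locally d (\<lambda>e. \<exists>h. h \<in> hom C (Dom C e) (Dom C (far K u)) \<and> \<epsilon> (Dom C u) \<cdot> h = a \<cdot> e \<and> far K u \<cdot> h = b \<cdot> e)"
    proof (rule locally_trans[OF coproduct_decomp[OF I s a(1) a', unfolded a(2)]])
      fix e assume e: "e \<in> Arr C" "Cod C e = d" and "\<exists>i x. i \<in> I \<and> x \<in> hom C (Dom C e) (X i) \<and> a \<cdot> e = \<iota> i \<cdot> x"
      then obtain i x where i: "i \<in> I" and x: "x \<in> Arr C" "Dom C x = Dom C e" "Cod C x = X i" "a \<cdot> e = \<iota> i \<cdot> x" by auto
      have be: "b \<cdot> e \<in> Arr C" "Cod C (b \<cdot> e) = fob K t" using b b' e by auto
      have D: "Dom C (b \<cdot> e) = Dom C e" using b e by simp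
      show "locally (Dom C e) (\<lambda>k. \<exists>h. h \<in> hom C (Dom C (e \<cdot> k)) (Dom C (far K u)) \<and> \<epsilon> (Dom C u) \<cdot> h = a \<cdot> (e \<cdot> k) \<and> far K u \<cdot> h = b \<cdot> (e \<cdot> k))"
      proof (rule locally_mono[OF coproduct_decomp[OF J Kt be, unfolded D]])
        fix k assume k: "k \<in> Arr C" "Cod C k = Dom C e" "\<not> is_initial C (Dom C k)"
          and "\<exists>j y. j \<in> J \<and> y \<in> hom C (Dom C k) (fob K (Y j)) \<and> (b \<cdot> e) \<cdot> k = far K (\<kappa> j) \<cdot> y"
        then obtain j y where j: "j \<in> J" and y: "y \<in> Arr C" "Dom C y = Dom C k" "Cod C y = fob K (Y j)" "(b \<cdot> e) \<cdot> k = far K (\<kappa> j) \<cdot> y" by auto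
        have [simp]: "Y j \<in> Obj C" using j by (metis coproduct_simps(2,3)[OF t] Dom_Obj)
        \<comment> \<open>The common image in \<open>t\<close>, computed through the summand
          \<open>\<phi> i\<close> on one side and through \<open>j\<close> on the other.\<close>
        have "\<kappa> (\<phi> i) \<cdot> (p i \<cdot> (x \<cdot> k)) = u \<cdot> \<iota> i \<cdot> x \<cdot> k" using comp_eq[OF u(2)[OF i], of "x \<cdot> k"] i x k by simp
        also have "\<dots> = u \<cdot> a \<cdot> e \<cdot> k" using comp_eq[OF x(4), of k] i x k a a' e by simp
        also have "\<dots> = \<epsilon> t \<cdot> b \<cdot> e \<cdot> k" using comp_eq[OF eq, of "e \<cdot> k"] a a' b b' e k by simp
        also have "\<dots> = \<epsilon> t \<cdot> far K (\<kappa> j) \<cdot> y" using y(4) b b' e k by simp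
        also have "\<dots> = \<kappa> j \<cdot> (\<epsilon> (Y j) \<cdot> y)" using comp_eq[OF ej[OF j], of y] y j by simp
        finally have "\<kappa> (\<phi> i) \<cdot> (p i \<cdot> (x \<cdot> k)) = \<kappa> j \<cdot> (\<epsilon> (Y j) \<cdot> y)" .
        from coproduct_disjoint[OF J t _ j _ _ _ _ _ _ this] have ij: "\<phi> i = j" and px: "p i \<cdot> (x \<cdot> k) = \<epsilon> (Y j) \<cdot> y"
          using i x k y by auto
        obtain h where h: "h \<in> Arr C" "Dom C h = Dom C k" "Cod C h = fob K (X i)" "\<epsilon> (X i) \<cdot> h = x \<cdot> k" "far K (p i) \<cdot> h = y"
          using pullback_lift[OF p(2)[OF i, unfolded cart_def], of "x \<cdot> k" y] px ij i x k y by auto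
        have "\<epsilon> s \<cdot> far K (\<iota> i) \<cdot> h = a \<cdot> e \<cdot> k"
          using comp_eq[OF ei[OF i], of h] h i x k comp_eq[OF x(4), of k] a a' e by simp
        moreover have "far K u \<cdot> far K (\<iota> i) \<cdot> h = b \<cdot> e \<cdot> k"
          using comp_eq[OF Ku[OF i], of h] h i j y(4) b b' e k ij by simp
        ultimately show "\<exists>h. h \<in> hom C (Dom C (e \<cdot> k)) (Dom C (far K u)) \<and> \<epsilon> (Dom C u) \<cdot> h = a \<cdot> (e \<cdot> k) \<and> far K u \<cdot> h = b \<cdot> (e \<cdot> k)"
          using h i a b e k by (intro exI[of _ "far K (\<iota> i) \<cdot> h"]) simp
      qed
    qed
  next
    fix d h h' assume h: "h \<in> Arr C" "h' \<in> Arr C" "Dom C h = d" "Dom C h' = d" "Cod C h = Dom C (far K u)" "Cod C h' = Dom C (far K u)"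
      and e1: "\<epsilon> (Dom C u) \<cdot> h = \<epsilon> (Dom C u) \<cdot> h'" and e2: "far K u \<cdot> h = far K u \<cdot> h'"
    have h': "Cod C h = fob K s" "Cod C h' = fob K s" using h by auto
    show "locally d (\<lambda>e. h \<cdot> e = h' \<cdot> e)"
    proof (rule locally_trans[OF coproduct_decomp[OF I Ks h(1) h'(1), unfolded h(3)]])
      fix e assume e: "e \<in> Arr C" "Cod C e = d" and "\<exists>i x. i \<in> I \<and> x \<in> hom C (Dom C e) (fob K (X i)) \<and> h \<cdot> e = far K (\<iota> i) \<cdot> x"
      then obtain i x where i: "i \<in> I" and x: "x \<in> Arr C" "Dom C x = Dom C e" "Cod C x = fob K (X i)" "h \<cdot> e = far K (\<iota> i) \<cdot> x" by auto
      have he: "h' \<cdot> e \<in> Arr C" "Cod C (h' \<cdot> e) = fob K s" using h h' e by auto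
      have D: "Dom C (h' \<cdot> e) = Dom C e" using h e by simp
      show "locally (Dom C e) (\<lambda>k. h \<cdot> (e \<cdot> k) = h' \<cdot> (e \<cdot> k))"
      proof (rule locally_mono[OF coproduct_decomp[OF I Ks he, unfolded D]])
        fix k assume k: "k \<in> Arr C" "Cod C k = Dom C e" "\<not> is_initial C (Dom C k)"
          and "\<exists>j y. j \<in> I \<and> y \<in> hom C (Dom C k) (fob K (X j)) \<and> (h' \<cdot> e) \<cdot> k = far K (\<iota> j) \<cdot> y"
        then obtain j y where j: "j \<in> I" and y: "y \<in> Arr C" "Dom C y = Dom C k" "Cod C y = fob K (X j)" "(h' \<cdot> e) \<cdot> k = far K (\<iota> j) \<cdot> y" by auto
        have hx: "h \<cdot> e \<cdot> k = far K (\<iota> i) \<cdot> (x \<cdot> k)" using comp_eq[OF x(4), of k] h h' e k i x by simp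
        have hy: "h' \<cdot> e \<cdot> k = far K (\<iota> j) \<cdot> y" using y(4) h h' e k by simp
        have "\<iota> i \<cdot> (\<epsilon> (X i) \<cdot> (x \<cdot> k)) = \<epsilon> s \<cdot> far K (\<iota> i) \<cdot> (x \<cdot> k)" using comp_eq[OF ei[OF i], of "x \<cdot> k"] i x k by simp
        also have "\<dots> = \<epsilon> s \<cdot> h' \<cdot> e \<cdot> k" using comp_eq[OF e1, of "e \<cdot> k"] hx h h' e k by simp
        also have "\<dots> = \<iota> j \<cdot> (\<epsilon> (X j) \<cdot> y)" unfolding hy using comp_eq[OF ei[OF j], of y] j y by simp
        finally have "\<iota> i \<cdot> (\<epsilon> (X i) \<cdot> (x \<cdot> k)) = \<iota> j \<cdot> (\<epsilon> (X j) \<cdot> y)" .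
        \<comment> \<open>The images under \<epsilon> in \<open>s\<close> show that both elements
          lie in the same summand; only then can the square at \<open>p i\<close> compare
          them.\<close>
        from coproduct_disjoint[OF I s i j _ _ _ _ _ _ this] have ij: "j = i" and xy: "\<epsilon> (X i) \<cdot> (x \<cdot> k) = \<epsilon> (X i) \<cdot> y"
          using i j x k y by auto
        have "far K (\<kappa> (\<phi> i)) \<cdot> (far K (p i) \<cdot> (x \<cdot> k)) = far K u \<cdot> far K (\<iota> i) \<cdot> (x \<cdot> k)"
          using comp_eq[OF Ku[OF i], of "x \<cdot> k"] i x k by simp
        also have "\<dots> = far K u \<cdot> far K (\<iota> i) \<cdot> y" using comp_eq[OF e2, of "e \<cdot> k"] hx hy ij h h' e k by simp
        also have "\<dots> = far K (\<kappa> (\<phi> i)) \<cdot> (far K (p i) \<cdot> y)" using comp_eq[OF Ku[OF i], of y] i ij y by simp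
        finally have "far K (\<kappa> (\<phi> i)) \<cdot> (far K (p i) \<cdot> (x \<cdot> k)) = far K (\<kappa> (\<phi> i)) \<cdot> (far K (p i) \<cdot> y)" .
        from coproduct_disjoint[OF J Kt _ _ _ _ _ _ _ _ this] have pxy: "far K (p i) \<cdot> (x \<cdot> k) = far K (p i) \<cdot> y"
          using i x k y ij by auto
        have "x \<cdot> k = y"
          by (rule pullback_ext[OF p(2)[OF i, unfolded cart_def]]) (use xy pxy i ij x k y in auto)
        then show "h \<cdot> (e \<cdot> k) = h' \<cdot> (e \<cdot> k)" using hx hy ij by simp
      qed
    qed
  }
qed (use u in auto)

text \<open>One factor is changed at a time. \<open>Z m\<close> has the first \<open>m\<close>
  factors replaced; \<open>r m\<close> changes factor \<open>m\<close> and is a pullback of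
  \<open>f m\<close> along a projection, so \<open>cart\<close> passes to it; \<open>q m\<close> is
  the composite of the first \<open>m\<close> of these steps.\<close>

lemma cart_nprod:
  assumes X: "\<And>i. i < n \<Longrightarrow> X i \<in> Obj C" and Y: "\<And>i. i < n \<Longrightarrow> Y i \<in> Obj C"
    and f: "\<And>i. i < n \<Longrightarrow> f i \<in> hom C (X i) (Y i)" "\<And>i. i < n \<Longrightarrow> cart (f i)"
  shows "cart (tuple C {..<n :: nat} (Prod C {..<n} X) (\<lambda>i. f i \<cdot> proj C {..<n} X i))"
proof -
  define Z where "Z m = (\<lambda>i. if i < m then Y i else X i)" for m :: nat
  define q where "q m = tuple C {..<n} (Prod C {..<n} X) (\<lambda>i. if i < m then f i \<cdot> proj C {..<n} X i else proj C {..<n} X i)" for m :: nat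
  define r where "r m = tuple C {..<n} (Prod C {..<n} (Z m)) (\<lambda>i. if i = m then f i \<cdot> proj C {..<n} (Z m) i else proj C {..<n} (Z m) i)" for m :: nat
  have Z [simp]: "Z m i \<in> Obj C" if "i < n" for m i using that X Y by (simp add: Z_def)
  have Zm: "Z m m = X m" "Z (Suc m) m = Y m" for m by (auto simp: Z_def)
  have Zi: "i \<noteq> m \<Longrightarrow> Z (Suc m) i = Z m i" for i m by (auto simp: Z_def less_Suc_eq)
  have Z0: "Z 0 = X" by (auto simp: Z_def)
  have f' [simp]: "f i \<in> Arr C" "Dom C (f i) = X i" "Cod C (f i) = Y i" if "i < n" for i using f(1)[OF that] by auto
  note PX [simp] = nprod_simps[of n X, OF X]
  note PZ [simp] = nprod_simps[of n "Z m" for m, OF Z]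
  have q: "q m \<in> Arr C" "Dom C (q m) = Prod C {..<n} X" "Cod C (q m) = Prod C {..<n} (Z m)"
    "\<And>i. i < n \<Longrightarrow> proj C {..<n} (Z m) i \<cdot> q m = (if i < m then f i \<cdot> proj C {..<n} X i else proj C {..<n} X i)" for m
    unfolding q_def
    using tuple_is[of "Prod C {..<n} X" n "\<lambda>i. if i < m then f i \<cdot> proj C {..<n} X i else proj C {..<n} X i" "Z m"]
    by (auto simp: Z_def)
  have r: "r m \<in> Arr C" "Dom C (r m) = Prod C {..<n} (Z m)" "Cod C (r m) = Prod C {..<n} (Z (Suc m))"
    "\<And>i. i < n \<Longrightarrow> proj C {..<n} (Z (Suc m)) i \<cdot> r m = (if i = m then f i \<cdot> proj C {..<n} (Z m) i else proj C {..<n} (Z m) i)" if "m < n" for m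
    unfolding r_def
    using tuple_is[of "Prod C {..<n} (Z m)" n "\<lambda>i. if i = m then f i \<cdot> proj C {..<n} (Z m) i else proj C {..<n} (Z m) i" "Z (Suc m)"] that
    by (auto simp: Zm Zi)
  have rc: "cart (r m)" if m: "m < n" for m
  proof (rule cart_pullback[OF f(2)[OF m]])
    note [simp] = r(1-3)[OF m] m Zm
    show "is_pullback C (f m) (proj C {..<n} (Z (Suc m)) m) (proj C {..<n} (Z m) m) (r m)"
    proof (rule pullbackI)
      show "f m \<cdot> proj C {..<n} (Z m) m = proj C {..<n} (Z (Suc m)) m \<cdot> r m" using r(4)[OF m m] by simp
      fix d a b assume ab: "a \<in> Arr C" "b \<in> Arr C" "Dom C a = d" "Dom C b = d" "Cod C a = Dom C (f m)" "Cod C b = Dom C (proj C {..<n} (Z (Suc m)) m)"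
        and eq: "f m \<cdot> a = proj C {..<n} (Z (Suc m)) m \<cdot> b"
      define h where "h = tuple C {..<n} d (\<lambda>i. if i = m then a else proj C {..<n} (Z (Suc m)) i \<cdot> b)"
      have h: "h \<in> hom C d (Prod C {..<n} (Z m)) \<and> (\<forall>i\<in>{..<n}. proj C {..<n} (Z m) i \<cdot> h = (if i = m then a else proj C {..<n} (Z (Suc m)) i \<cdot> b))"
        unfolding h_def by (rule tuple_is) (use ab Zi in auto)
      have "r m \<cdot> h = b"
      proof (rule tuple_ext)
        fix i assume i: "i < n"
        have "proj C {..<n} (Z (Suc m)) i \<cdot> (r m \<cdot> h) = (if i = m then f i \<cdot> proj C {..<n} (Z m) i else proj C {..<n} (Z m) i) \<cdot> h"
          using comp_eq[OF r(4)[OF m i], of h] h i by simp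
        also have "\<dots> = proj C {..<n} (Z (Suc m)) i \<cdot> b" using h i eq by auto
        finally show "proj C {..<n} (Z (Suc m)) i \<cdot> (r m \<cdot> h) = proj C {..<n} (Z (Suc m)) i \<cdot> b" .
      qed (use h ab in auto)
      then show "\<exists>h. h \<in> hom C d (Dom C (r m)) \<and> proj C {..<n} (Z m) m \<cdot> h = a \<and> r m \<cdot> h = b" using h by auto
    next
      fix d h h' assume h: "h \<in> Arr C" "h' \<in> Arr C" "Dom C h = d" "Dom C h' = d" "Cod C h = Dom C (r m)" "Cod C h' = Dom C (r m)"
        and e1: "proj C {..<n} (Z m) m \<cdot> h = proj C {..<n} (Z m) m \<cdot> h'" and e2: "r m \<cdot> h = r m \<cdot> h'"
      show "h = h'"
      proof (rule tuple_ext)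
        fix i assume i: "i < n"
        show "proj C {..<n} (Z m) i \<cdot> h = proj C {..<n} (Z m) i \<cdot> h'"
        proof (cases "i = m")
          case False
          then have "proj C {..<n} (Z m) i \<cdot> g = proj C {..<n} (Z (Suc m)) i \<cdot> (r m \<cdot> g)" if "g \<in> Arr C" "Cod C g = Prod C {..<n} (Z m)" for g
            using comp_eq[OF r(4)[OF m i], of g] that i by simp
          then show ?thesis using h e2 by simp
        qed (use e1 in simp)
      qed (use h in auto)
    qed (use Zm in auto)
  qed
  have "cart (q m)" if "m \<le> n" for m
    using that
  proof (induction m)
    case 0
    have "q 0 = Ide C (Prod C {..<n} X)" by (rule tuple_ext[of _ _ n X]) (use q(1-3)[of 0] q(4)[of _ 0] X in "simp_all add: Z0")
    then show ?case using cart_Ide by simp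
  next
    case (Suc m)
    then have m: "m < n" by simp
    have "q (Suc m) = r m \<cdot> q m"
    proof (rule tuple_ext)
      fix i assume i: "i < n"
      have "proj C {..<n} (Z (Suc m)) i \<cdot> (r m \<cdot> q m) = (if i = m then f i \<cdot> proj C {..<n} (Z m) i else proj C {..<n} (Z m) i) \<cdot> q m"
        using comp_eq[OF r(4)[OF m i], of "q m"] q(1-3)[of m] r(1-3)[OF m] i by simp
      also have "\<dots> = (if i < Suc m then f i \<cdot> proj C {..<n} X i else proj C {..<n} X i)"
        using q(4)[OF i, of m] comp_eq[OF q(4)[OF i, of m]] q(1-3)[of m] i by (auto simp: Zm)
      finally show "proj C {..<n} (Z (Suc m)) i \<cdot> q (Suc m) = proj C {..<n} (Z (Suc m)) i \<cdot> (r m \<cdot> q m)"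
        using q(4)[OF i, of "Suc m"] by simp
    qed (use q(1-3)[of m] q(1-3)[of "Suc m"] r(1-3)[OF m] in auto)
    then show ?case using cart_comp[OF rc[OF m] Suc(1)] m q(1-3)[of m] r(1-3)[OF m] by simp
  qed
  moreover have "q n = tuple C {..<n} (Prod C {..<n} X) (\<lambda>i. f i \<cdot> proj C {..<n} X i)" unfolding q_def by (rule tuple_cong) simp
  ultimately show ?thesis by (metis order_refl)
qed

end

section \<open>Passage of pullback counit squares to the homs of a free functor\<close>

locale copointed_lexv = lexv elts W + copointed elts W K \<epsilon>
  for elts :: "'u \<Rightarrow> 'u set" and W :: "('u, 'o, 'm) vcat" (structure) and K \<epsilon>
begin

text \<open>On homs, \<open>F g\<close> is the coproduct over paths \<open>w\<close> of the arrows
  \<open>p w\<close>, each a product of hom arrows of \<open>g\<close>; the map of indices sends a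
  path to its image.\<close>

lemma cart_free_map:
  assumes g: "g \<in> Arr GPH" and c: "\<And>x y. x \<in> obs (src g) \<Longrightarrow> y \<in> obs (src g) \<Longrightarrow> cart (on_homs g (x, y))"
    and xy: "x \<in> obs (src g)" "y \<in> obs (src g)"
  shows "cart (on_homs (Fm g) (x, y))"
proof -
  note gm = free_map[OF g]
  define G H where "G = src g" and "H = tgt g"
  have st [simp]: "src g = G" "tgt g = H" by (auto simp: G_def H_def)
  note [simp] = gm(1-14)[unfolded st] xy[unfolded st]
  note Fg = gm(15,16)[unfolded st]
  define p where "p w = tuple W {..<length w - 1} (path_ob W G w) (\<lambda>i. on_homs g (w ! i, w ! Suc i) \<cdot> path_proj W G w i)" for w
  have path: "map (on_obs g) w \<in> Paths H (on_obs g x) (on_obs g y)" if w: "w \<in> Paths G x y" for w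
    using w by (auto simp: Paths_def hd_map last_map)
  have gh: "on_homs g (w ! i, w ! Suc i) \<in> Arr W" "Dom W (on_homs g (w ! i, w ! Suc i)) = step G w i"
    "Cod W (on_homs g (w ! i, w ! Suc i)) = step H (map (on_obs g) w) i" "cart (on_homs g (w ! i, w ! Suc i))"
    if w: "w \<in> Paths G x y" and i: "i < length w - 1" for w i
    using gmor_simps(2-)[OF gm(3), of "w ! i" "w ! Suc i"] c[of "w ! i" "w ! Suc i"] Paths_nth[OF w, of i] Paths_nth[OF w, of "Suc i"] i
    by (auto simp: step_def)
  have ph: "p w \<in> hom W (path_ob W G w) (path_ob W H (map (on_obs g) w))" if w: "w \<in> Paths G x y" for w
    unfolding p_def path_ob_def[of W H] length_map
    by (rule conjunct1[OF tuple_is]) (use path_ob_simps[OF _ w] gh[OF w] in "auto simp: step_def")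
  have pc: "cart (p w)" if w: "w \<in> Paths G x y" for w
    unfolding p_def path_ob_def path_proj_def
    by (rule cart_nprod[of _ _ "step H (map (on_obs g) w)"])
      (use gh[OF w] step_Obj[OF _ w] step_Obj[OF _ path[OF w]] in auto)
  have eq: "on_homs (Fm g) (x, y) \<cdot> free_inj W G w = free_inj W H (map (on_obs g) w) \<cdot> p w" if w: "w \<in> Paths G x y" for w
  proof -
    let ?d = "path_ob W G w"
    have d: "?d \<in> Obj W" using path_ob_simps(1)[OF _ w] by simp
    \<comment> \<open>The identity of \<open>path_ob W G w\<close> written as a tuple has the
      projections as entries, so the rule for path elements computes \<open>F g\<close> on the
      coprojection at \<open>w\<close>.\<close>
    obtain as where "pel G (Dom W (Ide W ?d)) x y w as" "Ide W ?d = ptup (Dom W (Ide W ?d)) as"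
      by (rule ptup_surj[OF _ w, of "Ide W ?d"]) (use d in auto)
    then have as: "pel G ?d x y w as" "ptup ?d as = Ide W ?d" using d by auto
    have l: "length as = length w - 1" using pelD(3)[OF as(1)] by simp
    have "as ! i = path_proj W G w i" if "i < length as" for i
      using proj_ptup[OF as(1) that] as(2) path_ob_simps(1)[OF _ w] path_ob_simps(2-)[OF _ w, of i] that l by simp
    then have "ptup ?d (hmap W g w as) = p w"
      unfolding ptup_def p_def hmap_simps l[symmetric] by (intro tuple_cong) simp
    then show ?thesis using Fg(1)[OF as(1)] as(2) free_inj_simps[OF _ w] unfolding fin_def by simp
  qed
  show ?thesis
    by (rule cart_coproduct[OF Paths_small Paths_small free_coproduct free_coproduct, where \<phi> = "map (on_obs g)" and p = p, of G H])
      (use path ph pc eq in simp_all)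
qed

end

section \<open>The base category\<close>

lemma equivalence_surj:
  assumes F: "is_equivalence C D F" and d: "d \<in> Obj D"
  obtains c h k where "c \<in> Obj C" "h \<in> hom D (fob F c) d" "k \<in> hom D d (fob F c)"
    "k \<cdot>\<^bsub>D\<^esub> h = Ide D (fob F c)" "h \<cdot>\<^bsub>D\<^esub> k = Ide D d"
proof -
  obtain G \<beta> where G: "is_functor D C G" and \<beta>: "nat_iso D D (comp_functor F G) id_functor \<beta>"
    using F unfolding is_equivalence_def by blast
  have "is_iso D (\<beta> d)" and t: "\<beta> d \<in> Arr D" "Dom D (\<beta> d) = fob F (fob G d)" "Cod D (\<beta> d) = d"
    using \<beta> d nat_trans_simps[of D D "comp_functor F G" id_functor \<beta> d] by (auto simp: nat_iso_def)
  then obtain k where "k \<in> hom D d (fob F (fob G d))" "k \<cdot>\<^bsub>D\<^esub> \<beta> d = Ide D (fob F (fob G d))" "\<beta> d \<cdot>\<^bsub>D\<^esub> k = Ide D d"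
    unfolding is_iso_def by auto
  then show ?thesis using that[of "fob G d" "\<beta> d" k] t functor_simps(1)[OF G d] by simp
qed

text \<open>The preimage is \<open>far G m\<close> conjugated by \<alpha>. Then
  \<open>far F t\<close> and \<open>m\<close> have the same image under \<open>G\<close>, and
  naturality of \<beta> turns this into equality.\<close>

lemma equivalence_full:
  fixes C (structure)
  assumes F: "is_equivalence C D F" and a: "a \<in> Obj C" and b: "b \<in> Obj C" and m: "m \<in> hom D (fob F a) (fob F b)"
  obtains t where "t \<in> hom C a b" "far F t = m"
proof -
  obtain G \<alpha> \<beta> where G: "is_functor D C G" and \<alpha>: "nat_iso C C id_functor (comp_functor G F) \<alpha>"
    and \<beta>: "nat_iso D D (comp_functor F G) id_functor \<beta>" and FF: "is_functor C D F"
    using F unfolding is_equivalence_def by blast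
  have an: "nat_trans C C id_functor (comp_functor G F) \<alpha>" and bn: "nat_trans D D (comp_functor F G) id_functor \<beta>"
    using \<alpha> \<beta> by (auto simp: nat_iso_def)
  interpret C: cat C by (rule functor_cat(1)[OF FF])
  interpret D: cat D by (rule functor_cat(2)[OF FF])
  note [simp] = functor_simps[OF FF] functor_simps[OF G] nat_trans_simps[OF an, simplified] nat_trans_simps[OF bn, simplified] a b
  have m' [simp]: "m \<in> Arr D" "Dom D m = fob F a" "Cod D m = fob F b" using m by auto
  have iso: "is_iso C (\<alpha> a)" "is_iso C (\<alpha> b)" "is_iso D (\<beta> (fob F a))"
    using \<alpha> \<beta> by (auto simp: nat_iso_def)
  obtain i where i: "i \<in> Arr C" "Dom C i = fob G (fob F b)" "Cod C i = b" "i \<cdot> \<alpha> b = Ide C b" "\<alpha> b \<cdot> i = Ide C (fob G (fob F b))"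
    using iso(2) unfolding is_iso_def by auto
  obtain j where j: "j \<in> Arr C" "Dom C j = fob G (fob F a)" "Cod C j = a" "j \<cdot> \<alpha> a = Ide C a" "\<alpha> a \<cdot> j = Ide C (fob G (fob F a))"
    using iso(1) unfolding is_iso_def by auto
  define t where "t = i \<cdot> far G m \<cdot> \<alpha> a"
  have t: "t \<in> Arr C" "Dom C t = a" "Cod C t = b" using i by (auto simp: t_def)
  have "far G (far F t) \<cdot> \<alpha> a = \<alpha> b \<cdot> t" using nat_trans_nat[OF an t(1)] t by simp
  also have "\<dots> = far G m \<cdot> \<alpha> a" unfolding t_def using C.comp_eq[OF i(5), of "far G m \<cdot> \<alpha> a"] i by simp
  finally have eq: "far G (far F t) \<cdot> \<alpha> a = far G m \<cdot> \<alpha> a" .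
  have "(far G (far F t) \<cdot> \<alpha> a) \<cdot> j = (far G m \<cdot> \<alpha> a) \<cdot> j" by (simp only: eq)
  then have GG: "far G (far F t) = far G m" using t j by simp
  have "far F t \<cdot>\<^bsub>D\<^esub> \<beta> (fob F a) = m \<cdot>\<^bsub>D\<^esub> \<beta> (fob F a)"
    using nat_trans_nat[OF bn, of "far F t"] nat_trans_nat[OF bn, of m] t GG by simp
  moreover obtain k where k: "k \<in> Arr D" "Dom D k = fob F a" "Cod D k = fob F (fob G (fob F a))" "\<beta> (fob F a) \<cdot>\<^bsub>D\<^esub> k = Ide D (fob F a)"
    using iso(3) unfolding is_iso_def by auto
  ultimately have "(far F t \<cdot>\<^bsub>D\<^esub> \<beta> (fob F a)) \<cdot>\<^bsub>D\<^esub> k = (m \<cdot>\<^bsub>D\<^esub> \<beta> (fob F a)) \<cdot>\<^bsub>D\<^esub> k" by simp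
  then have "far F t = m" using t k by simp
  then show ?thesis using that t by simp
qed

lemma slice_simps [simp]:
  "f \<in> Obj (slice C X) \<longleftrightarrow> f \<in> Arr C \<and> Cod C f = X"
  "(f, h, g) \<in> Arr (slice C X) \<longleftrightarrow> f \<in> Arr C \<and> Cod C f = X \<and> g \<in> Arr C \<and> Cod C g = X \<and> h \<in> hom C (Dom C f) (Dom C g) \<and> g \<cdot>\<^bsub>C\<^esub> h = f"
  "Dom (slice C X) (f, h, g) = f" "Cod (slice C X) (f, h, g) = g" "Ide (slice C X) f = (f, Ide C (Dom C f), f)"
  "Cmp (slice C X) (f', k, g') (f, h, g) = (f, k \<cdot>\<^bsub>C\<^esub> h, g')"
  by (auto simp: slice_def)

section \<open>Decomposition and disjointness from the equivalence of slices\<close>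

context cat
begin

lemma cotuple_is:
  assumes s: "is_coproduct C I (\<lambda>i. Dom C (f i)) s \<iota>" and c: "c \<in> Obj C" and f: "\<And>i. i \<in> I \<Longrightarrow> f i \<in> Arr C" "\<And>i. i \<in> I \<Longrightarrow> Cod C (f i) = c"
  shows "cotuple C I c f \<in> Arr C" "Dom C (cotuple C I c f) = Coprod C I (\<lambda>i. Dom C (f i))" "Cod C (cotuple C I c f) = c"
    "\<And>i. i \<in> I \<Longrightarrow> cotuple C I c f \<cdot> coproj C I (\<lambda>i. Dom C (f i)) i = f i"
proof -
  have "\<exists>!h. h \<in> hom C (Coprod C I (\<lambda>i. Dom C (f i))) c \<and> (\<forall>i\<in>I. h \<cdot> coproj C I (\<lambda>i. Dom C (f i)) i = f i)"
    using Coprod_is_coproduct[OF s] c f unfolding is_coproduct_def by simp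
  from theI'[OF this] show "cotuple C I c f \<in> Arr C" "Dom C (cotuple C I c f) = Coprod C I (\<lambda>i. Dom C (f i))" "Cod C (cotuple C I c f) = c"
    "\<And>i. i \<in> I \<Longrightarrow> cotuple C I c f \<cdot> coproj C I (\<lambda>i. Dom C (f i)) i = f i"
    unfolding cotuple_def by auto
qed

lemma coprod_arr_is:
  assumes s: "is_coproduct C I D s \<iota>" and t: "is_coproduct C I X t \<kappa>"
    and f: "\<And>i. i \<in> I \<Longrightarrow> f i \<in> hom C (D i) (X i)"
  shows "coprod_arr C I f \<in> hom C (Coprod C I D) (Coprod C I X)"
    "\<And>i. i \<in> I \<Longrightarrow> coprod_arr C I f \<cdot> coproj C I D i = coproj C I X i \<cdot> f i"
proof -
  have f' [simp]: "f i \<in> Arr C" "Dom C (f i) = D i" "Cod C (f i) = X i" if "i \<in> I" for i using f[OF that] by auto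
  have X: "Coprod C I (\<lambda>i. Cod C (f i)) = Coprod C I X" "coproj C I (\<lambda>i. Cod C (f i)) = coproj C I X"
    using Coprod_cong[of I "\<lambda>i. Cod C (f i)" X C] by auto
  note T [simp] = coproduct_simps[OF Coprod_is_coproduct[OF t]]
  let ?g = "\<lambda>i. coproj C I X i \<cdot> f i"
  have D: "Coprod C I (\<lambda>i. Dom C (?g i)) = Coprod C I D" "coproj C I (\<lambda>i. Dom C (?g i)) = coproj C I D"
    using Coprod_cong[of I "\<lambda>i. Dom C (?g i)" D C] by auto
  have "is_coproduct C I (\<lambda>i. Dom C (?g i)) s \<iota>" by (rule iffD1[OF coproduct_cong s]) auto
  note c = cotuple_is[OF this, of "Coprod C I X", unfolded D]
  show "coprod_arr C I f \<in> hom C (Coprod C I D) (Coprod C I X)" unfolding coprod_arr_def X using c by simp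
  show "\<And>i. i \<in> I \<Longrightarrow> coprod_arr C I f \<cdot> coproj C I D i = coproj C I X i \<cdot> f i" unfolding coprod_arr_def X using c by simp
qed

text \<open>Essential surjectivity at the object \<open>u\<close> of the slice: \<open>u\<close> is
  isomorphic to a coproduct of arrows \<open>a i\<close>, and the isomorphism \<open>h2\<close>
  carries the coprojections to the domain of \<open>u\<close>.\<close>

lemma extensive_decomp:
  assumes E: "extensive elts C" and I: "small elts I" and X: "\<And>i. i \<in> I \<Longrightarrow> X i \<in> Obj C" and u: "u \<in> Arr C" "Cod C u = Coprod C I X"
  obtains D e a where "is_coproduct C I D (Dom C u) e" "\<And>i. i \<in> I \<Longrightarrow> a i \<in> hom C (D i) (X i)"
    "\<And>i. i \<in> I \<Longrightarrow> u \<cdot> e i = coproj C I X i \<cdot> a i"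
proof -
  have ex: "\<exists>s \<iota>. is_coproduct C I Y s \<iota>" if "\<And>i. i \<in> I \<Longrightarrow> Y i \<in> Obj C" for Y
    using E I that unfolding extensive_def by auto
  have eq: "is_equivalence (prod_category I (\<lambda>i. slice C (X i))) (slice C (Coprod C I X)) (coprod_functor C I)"
    using E I X unfolding extensive_def by auto
  have "u \<in> Obj (slice C (Coprod C I X))" using u by simp
  from equivalence_surj[OF eq this] obtain a h k where a: "a \<in> Obj (prod_category I (\<lambda>i. slice C (X i)))"
    and h: "h \<in> hom (slice C (Coprod C I X)) (fob (coprod_functor C I) a) u"
    and k: "k \<in> hom (slice C (Coprod C I X)) u (fob (coprod_functor C I) a)"
    and kh: "k \<cdot>\<^bsub>slice C (Coprod C I X)\<^esub> h = Ide (slice C (Coprod C I X)) (fob (coprod_functor C I) a)"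
    and hk: "h \<cdot>\<^bsub>slice C (Coprod C I X)\<^esub> k = Ide (slice C (Coprod C I X)) u" by blast
  have a': "a i \<in> Arr C" "Cod C (a i) = X i" if "i \<in> I" for i using a that by (auto simp: prod_category_def)
  define D where "D i = Dom C (a i)" for i
  have D: "D i \<in> Obj C" if "i \<in> I" for i using a' that by (simp add: D_def)
  obtain s \<iota> where "is_coproduct C I D s \<iota>" using ex[of D, OF D] by blast
  note s = this Coprod_is_coproduct[OF this]
  obtain t \<kappa> where t: "is_coproduct C I X t \<kappa>" using ex[of X, OF X] by blast
  have ai: "a i \<in> hom C (D i) (X i)" if "i \<in> I" for i using a' that by (simp add: D_def)
  note ca = coprod_arr_is[OF s(1) t ai]
  have F: "fob (coprod_functor C I) a = coprod_arr C I a" by (simp add: coprod_functor_def)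
  obtain h1 h2 h3 where h': "h = (h1, h2, h3)" by (cases h) auto
  obtain k1 k2 k3 where k': "k = (k1, k2, k3)" by (cases k) auto
  have hh: "h2 \<in> hom C (Coprod C I D) (Dom C u)" "u \<cdot> h2 = coprod_arr C I a" using h ca unfolding h' F by auto
  have kk: "k2 \<in> hom C (Dom C u) (Coprod C I D)" using k ca unfolding k' F by auto
  have "k2 \<cdot> h2 = Ide C (Coprod C I D)" "h2 \<cdot> k2 = Ide C (Dom C u)" using kh hk ca unfolding h' k' F by auto
  then have c: "is_coproduct C I D (Dom C u) (\<lambda>i. h2 \<cdot> coproj C I D i)" by (rule coproduct_iso[OF s(2) hh(1) kk])
  have "u \<cdot> (h2 \<cdot> coproj C I D i) = coproj C I X i \<cdot> a i" if i: "i \<in> I" for i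
    using comp_eq[OF hh(2), of "coproj C I D i"] ca(2)[OF _ i] u hh(1) coproduct_simps[OF s(2)] i by simp
  then show ?thesis using that[OF c ai] by blast
qed

text \<open>The decomposition for the empty family. The given initial object may differ from the
  chosen empty coproduct, so \<open>u\<close> is composed with the comparison arrow.\<close>

lemma extensive_initial:
  assumes E: "extensive elts C" and sm: "small elts {}" and u: "u \<in> Arr C" "is_initial C (Cod C u)"
  shows "is_initial C (Dom C u)"
proof -
  define X where "X = (\<lambda>i :: 'a. Cod C u)"
  have c: "is_coproduct C {} X (Cod C u) undefined" using u by (simp add: initial_empty_coproduct)
  obtain k l where k: "k \<in> hom C (Cod C u) (Coprod C {} X)" using coproduct_unique[OF c Coprod_is_coproduct[OF c]] by blast
  show ?thesis
  proof (rule extensive_decomp[OF E sm, of X "k \<cdot> u"])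
    fix D e assume "is_coproduct C {} D (Dom C (k \<cdot> u)) e"
    then show "is_initial C (Dom C u)" using k u by (simp add: initial_empty_coproduct)
  qed (use k u in auto)
qed

text \<open>\<open>A\<close> is \<open>a\<close> at \<open>i\<close> and an arrow from an initial
  object elsewhere; \<open>B\<close> is \<open>b\<close> at \<open>j\<close> likewise. Up to
  isomorphism their coproducts are the two sides of \<open>eq\<close>, so there is an arrow
  \<open>m\<close> between them in the slice, and fullness splits it into arrows \<open>r k\<close>.
  If \<open>i\<close> and \<open>j\<close> differ, \<open>r i\<close> ends in an initial object,
  contradicting \<open>ni\<close>; otherwise \<open>r i\<close> is an identity and
  \<open>B i \<cdot> r i = a\<close> gives \<open>b = a\<close>.\<close>

lemma extensive_disjoint:
  assumes E: "extensive elts C" and I: "small elts I" and sm: "small elts {}" and X: "\<And>i. i \<in> I \<Longrightarrow> X i \<in> Obj C"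
    and i: "i \<in> I" and j: "j \<in> I" and ab: "a \<in> Arr C" "b \<in> Arr C" "Dom C b = Dom C a" "Cod C a = X i" "Cod C b = X j"
    and ni: "\<not> is_initial C (Dom C a)" and eq: "coproj C I X i \<cdot> a = coproj C I X j \<cdot> b"
  shows "i = j \<and> a = b"
proof -
  let ?d = "Dom C a"
  have ex: "\<exists>s \<iota>. is_coproduct C J Y s \<iota>" if "small elts J" "\<And>i. i \<in> J \<Longrightarrow> Y i \<in> Obj C" for J Y
    using E that unfolding extensive_def by auto
  obtain z \<zeta> where "is_coproduct C {} X z \<zeta>" using ex[OF sm, of X] by auto
  then have z: "is_initial C z" by (simp add: initial_empty_coproduct)
  define zz where "zz c = (SOME u. u \<in> hom C z c)" for c
  have zz: "zz c \<in> Arr C" "Dom C (zz c) = z" "Cod C (zz c) = c" if "c \<in> Obj C" for c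
    using someI_ex[OF initial_hom[OF z that]] by (auto simp: zz_def)
  have zO: "z \<in> Obj C" using z by (rule initial_Obj)
  define A where "A = (\<lambda>k\<in>I. if k = i then a else zz (X k))"
  define B where "B = (\<lambda>k\<in>I. if k = j then b else zz (X k))"
  define DA where "DA k = (if k = i then ?d else z)" for k
  define DB where "DB k = (if k = j then ?d else z)" for k
  have A: "A k \<in> hom C (DA k) (X k)" and B: "B k \<in> hom C (DB k) (X k)" if "k \<in> I" for k
    using that ab zz X by (auto simp: A_def B_def DA_def DB_def)
  have D: "DA k \<in> Obj C" "DB k \<in> Obj C" for k using ab zO by (auto simp: DA_def DB_def)
  obtain sa \<iota>a sb \<iota>b t \<kappa> where "is_coproduct C I DA sa \<iota>a" "is_coproduct C I DB sb \<iota>b" "is_coproduct C I X t \<kappa>"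
    using ex[OF I, of DA] ex[OF I, of DB] ex[OF I, of X] D X by meson
  note s = this Coprod_is_coproduct[OF this(1)] Coprod_is_coproduct[OF this(2)] Coprod_is_coproduct[OF this(3)]
  note sA [simp] = coproduct_simps[OF s(4)] and sB [simp] = coproduct_simps[OF s(5)] and sX [simp] = coproduct_simps[OF s(6)]
  note cA = coprod_arr_is[OF s(1,3) A] and cB = coprod_arr_is[OF s(2,3) B]
  \<comment> \<open>The summand \<open>i\<close> goes to the summand \<open>j\<close> by its
    coprojection; the other summands are initial and offer one choice.\<close>
  have "\<exists>m. m \<in> Arr C \<and> Dom C m = Coprod C I DA \<and> Cod C m = Coprod C I DB \<and>
     (\<forall>k\<in>I. m \<cdot> coproj C I DA k = (if k = i then coproj C I DB j else zz (Coprod C I DB)))"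
  proof (rule coproduct_copair[OF s(4), of "Coprod C I DB" "\<lambda>k. if k = i then coproj C I DB j else zz (Coprod C I DB)"])
    show "(if k = i then coproj C I DB j else zz (Coprod C I DB)) \<in> hom C (DA k) (Coprod C I DB)" if "k \<in> I" for k
      using zz sB j by (auto simp: DA_def DB_def)
  qed auto
  then obtain m where m: "m \<in> Arr C" "Dom C m = Coprod C I DA" "Cod C m = Coprod C I DB"
    "\<And>k. k \<in> I \<Longrightarrow> m \<cdot> coproj C I DA k = (if k = i then coproj C I DB j else zz (Coprod C I DB))" by blast
  have FB: "coprod_arr C I B \<cdot> m = coprod_arr C I A"
  proof (rule coproduct_ext[OF s(4)])
    fix k assume k: "k \<in> I"
    show "(coprod_arr C I B \<cdot> m) \<cdot> coproj C I DA k = coprod_arr C I A \<cdot> coproj C I DA k"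
    proof (cases "k = i")
      case True
      have "A i = a" "B j = b" using i j by (auto simp: A_def B_def)
      then show ?thesis using True m cA(1) cA(2)[OF _ i] cB(1) cB(2)[OF _ j] i j eq by simp
    next
      case False
      then have dz: "DA k = z" by (simp add: DA_def)
      show ?thesis by (rule initial_unique[OF z]) (use dz m(1-3) cA(1) cB(1) k in auto)
    qed
  qed (use m cA cB in auto)
  let ?P = "prod_category I (\<lambda>i. slice C (X i))"
  have equiv: "is_equivalence ?P (slice C (Coprod C I X)) (coprod_functor C I)"
    using E I X unfolding extensive_def by auto
  have "A \<in> Obj ?P" "B \<in> Obj ?P" using A B by (auto simp: prod_category_def A_def B_def)
  moreover have "(coprod_arr C I A, m, coprod_arr C I B) \<in> hom (slice C (Coprod C I X)) (fob (coprod_functor C I) A) (fob (coprod_functor C I) B)"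
    using FB m cA(1) cB(1) by (simp add: coprod_functor_def)
  ultimately obtain t where t: "t \<in> hom ?P A B" "far (coprod_functor C I) t = (coprod_arr C I A, m, coprod_arr C I B)"
    by (rule equivalence_full[OF equiv])
  define r where "r k = fst (snd (t k))" for k
  have r: "r k \<in> hom C (DA k) (DB k) \<and> B k \<cdot> r k = A k" if "k \<in> I" for k
  proof -
    have tk: "t k \<in> Arr (slice C (X k))" "Dom (slice C (X k)) (t k) = A k" "Cod (slice C (X k)) (t k) = B k"
      using t(1) that by (auto simp: prod_category_def dest!: fun_cong[of _ _ k])
    obtain t1 t2 t3 where "t k = (t1, t2, t3)" by (cases "t k") auto
    then show ?thesis using tk A[OF that] B[OF that] by (simp add: r_def)
  qed
  have ri: "r i \<in> hom C ?d (DB i)" "B i \<cdot> r i = a" using r[OF i] i by (auto simp: DA_def A_def)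
  have ij: "i = j"
  proof (rule ccontr)
    assume "i \<noteq> j"
    then have "r i \<in> hom C ?d z" using ri by (simp add: DB_def)
    then show False using extensive_initial[OF E sm, of "r i"] z ni by simp
  qed
  have "(\<lambda>k. fst (snd (t k))) = r" by (auto simp: r_def)
  then have "coprod_arr C I r = m" using t(2) by (simp add: coprod_functor_def)
  then have "m \<cdot> coproj C I DA i = coproj C I DB i \<cdot> r i"
    using coprod_arr_is(2)[OF s(1,2), of r i] r i by simp
  then have mono: "coproj C I DB i \<cdot> r i = coproj C I DB i" using m(4)[OF i] ij by simp
  \<comment> \<open>A retraction of the coprojection at \<open>i\<close>, used to cancel it in
    \<open>mono\<close>.\<close>
  obtain l where l: "l \<in> Arr C" "Dom C l = Coprod C I DB" "Cod C l = ?d" "\<And>k. k \<in> I \<Longrightarrow> l \<cdot> coproj C I DB k = (if k = i then Ide C ?d else zz ?d)"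
    by (rule coproduct_copair[OF s(5), of ?d "\<lambda>k. if k = i then Ide C ?d else zz ?d"]) (use zz ab ij in "auto simp: DB_def")
  have ri': "r i \<in> Arr C" "Dom C (r i) = ?d" "Cod C (r i) = ?d" using ri ij by (auto simp: DB_def)
  have "l \<cdot> (coproj C I DB i \<cdot> r i) = Ide C ?d \<cdot> r i" by (rule comp_eq) (use l i ri' ij in "auto simp: DB_def")
  then have "r i = Ide C ?d" unfolding mono using l(4)[OF i] ri' by simp
  moreover have "B i = b" using i ij by (simp add: B_def)
  ultimately show ?thesis using ri(2) ij ab by simp
qed

section \<open>Terminal objects and pullbacks from finite limits\<close>

lemma finite_limits_terminal:
  assumes "has_finite_limits C"
  shows "\<exists>t. is_terminal C t"
proof -
  let ?J = "\<lparr>Obj = {}, Arr = {}, Dom = id, Cod = id, Ide = id, Cmp = \<lambda>g f. f\<rparr> :: (nat, nat) category"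
  let ?D = "undefined :: (nat, nat, 'o, 'm) cfunctor"
  have "is_functor ?J C ?D" using is_cat by (auto simp: is_functor_def is_category_def)
  then obtain l \<pi> where "is_limit ?J C ?D l \<pi>" using assms unfolding has_finite_limits_def by fastforce
  then have "is_terminal C l" unfolding is_limit_def is_cone_def is_terminal_def by simp
  then show ?thesis by blast
qed

text \<open>Arrows 0, 1 and 2 are the identities, 3 goes from 0 to 2 and 4 from 1 to 2. In a
  composite one factor is always an identity, so composition just selects the other.\<close>

definition cospan :: "(nat, nat) category" where
  "cospan = \<lparr>Obj = {0, 1, 2}, Arr = {0, 1, 2, 3, 4}, Dom = \<lambda>n. if n = 3 then 0 else if n = 4 then 1 else n,
     Cod = \<lambda>n. if n \<ge> 3 then 2 else n, Ide = id, Cmp = \<lambda>g f. if g \<le> 2 then f else g\<rparr>"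

lemma finite_limits_pullback:
  assumes lim: "has_finite_limits C" and f: "f \<in> Arr C" "g \<in> Arr C" "Cod C f = Cod C g"
  shows "\<exists>p q. is_pullback C f g p q"
proof -
  let ?D = "\<lparr>fob = \<lambda>n. if n = 0 then Dom C f else if n = 1 then Dom C g else Cod C g,
    far = \<lambda>n. if n = 0 then Ide C (Dom C f) else if n = 1 then Ide C (Dom C g) else if n = 2 then Ide C (Cod C g) else if n = 3 then f else g\<rparr>
    :: (nat, nat, 'o, 'm) cfunctor"
  have J: "is_category cospan" unfolding is_category_def cospan_def hom_def by auto
  have F: "is_functor cospan C ?D" unfolding is_functor_def using J is_cat f by (auto simp: cospan_def)
  have "finite (Obj cospan) \<and> finite (Arr cospan)" by (simp add: cospan_def)
  then obtain l \<pi> where l: "is_limit cospan C ?D l \<pi>" using lim F unfolding has_finite_limits_def by blast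
  \<comment> \<open>The component at the vertex 2 is forced by the other two, which makes a cone the
    same as a commutative square.\<close>
  have cone: "is_cone cospan C ?D c \<gamma> \<longleftrightarrow> \<gamma> 0 \<in> hom C c (Dom C f) \<and> \<gamma> 1 \<in> hom C c (Dom C g) \<and> f \<cdot> \<gamma> 0 = \<gamma> 2 \<and> g \<cdot> \<gamma> 1 = \<gamma> 2" for c \<gamma>
  proof
    assume "is_cone cospan C ?D c \<gamma>"
    then show "\<gamma> 0 \<in> hom C c (Dom C f) \<and> \<gamma> 1 \<in> hom C c (Dom C g) \<and> f \<cdot> \<gamma> 0 = \<gamma> 2 \<and> g \<cdot> \<gamma> 1 = \<gamma> 2"
      unfolding is_cone_def using f by (auto simp: cospan_def)
  next
    assume R: "\<gamma> 0 \<in> hom C c (Dom C f) \<and> \<gamma> 1 \<in> hom C c (Dom C g) \<and> f \<cdot> \<gamma> 0 = \<gamma> 2 \<and> g \<cdot> \<gamma> 1 = \<gamma> 2"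
    then have "\<gamma> 1 \<in> hom C c (Dom C g)" by blast
    then have "g \<cdot> \<gamma> 1 \<in> hom C c (Cod C g)" using f by auto
    then have "\<gamma> 2 \<in> hom C c (Cod C g)" using R by metis
    then show "is_cone cospan C ?D c \<gamma>" unfolding is_cone_def using R f by (auto simp: cospan_def)
  qed
  have \<pi>: "\<pi> 0 \<in> hom C l (Dom C f)" "\<pi> 1 \<in> hom C l (Dom C g)" "f \<cdot> \<pi> 0 = \<pi> 2" "g \<cdot> \<pi> 1 = \<pi> 2"
    using l unfolding is_limit_def cone by auto
  have uni: "\<exists>!h. h \<in> hom C c l \<and> (\<forall>j\<in>{0, 1, 2}. \<pi> j \<cdot> h = \<gamma> j)"
    if "\<gamma> 0 \<in> hom C c (Dom C f)" "\<gamma> 1 \<in> hom C c (Dom C g)" "f \<cdot> \<gamma> 0 = \<gamma> 2" "g \<cdot> \<gamma> 1 = \<gamma> 2" for c \<gamma>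
  proof -
    have "is_cone cospan C ?D c \<gamma>" unfolding cone using that by simp
    then have "\<exists>!h. h \<in> hom C c l \<and> (\<forall>j\<in>Obj cospan. \<pi> j \<cdot> h = \<gamma> j)" using l unfolding is_limit_def by blast
    moreover have "Obj cospan = {0, 1, 2}" by (simp add: cospan_def)
    ultimately show ?thesis by (simp only:)
  qed
  have "is_pullback C f g (\<pi> 0) (\<pi> 1)"
    unfolding is_pullback_def
  proof (intro conjI allI ballI impI)
    fix c a b assume ab: "a \<in> hom C c (Dom C f)" "b \<in> hom C c (Dom C g)" "f \<cdot> a = g \<cdot> b"
    define \<gamma> where "\<gamma> = (\<lambda>n :: nat. if n = 0 then a else if n = 1 then b else g \<cdot> b)"
    have \<gamma>: "\<gamma> 0 = a" "\<gamma> 1 = b" "\<gamma> 2 = g \<cdot> b" by (auto simp: \<gamma>_def)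
    have "\<exists>!h. h \<in> hom C c l \<and> (\<forall>j\<in>{0, 1, 2}. \<pi> j \<cdot> h = \<gamma> j)"
      by (rule uni) (use ab \<gamma> in auto)
    moreover have "h \<in> hom C c l \<and> (\<forall>j\<in>{0, 1, 2}. \<pi> j \<cdot> h = \<gamma> j) \<longleftrightarrow> h \<in> hom C c (Dom C (\<pi> 0)) \<and> \<pi> 0 \<cdot> h = a \<and> \<pi> 1 \<cdot> h = b" for h
    proof -
      have "\<pi> 2 \<cdot> h = g \<cdot> b" if "h \<in> hom C c l" "\<pi> 1 \<cdot> h = b"
        using comp_eq[OF \<pi>(4), of h] that f \<pi>(2) by simp
      moreover have "Dom C (\<pi> 0) = l" using \<pi>(1) by simp
      ultimately show ?thesis unfolding \<gamma>_def by auto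
    qed
    ultimately show "\<exists>!h. h \<in> hom C c (Dom C (\<pi> 0)) \<and> \<pi> 0 \<cdot> h = a \<and> \<pi> 1 \<cdot> h = b" by simp
  qed (use f \<pi> in auto)
  then show ?thesis by blast
qed

end

lemma extensive_lextensive:
  assumes U: "grothendieck_universe elts" and E: "extensive elts V" and L: "has_finite_limits V"
  shows "lextensive elts V"
proof -
  interpret universe elts by (rule universe.intro[OF U])
  interpret V: cat V using E by (simp add: extensive_def cat_def)
  obtain t where "is_terminal V t" using V.finite_limits_terminal[OF L] by blast
  then have "fp_cat V" by (rule V.fp_catI) (use V.finite_limits_pullback[OF L] in auto)
  then show ?thesis
  proof (intro lextensive.intro universe_axioms lextensive_axioms.intro)
    fix I :: "'a set" and X assume I: "small elts I" and X: "\<And>i. i \<in> I \<Longrightarrow> X i \<in> Obj V"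
    have "\<exists>s \<iota>. is_coproduct V I X s \<iota>" using E I X unfolding extensive_def by auto
    then obtain s \<iota> where s: "is_coproduct V I X s \<iota>" by blast
    show "\<exists>s \<iota>. extensive_coproduct V I X s \<iota>"
      unfolding extensive_coproduct_def
    proof (intro exI[of _ "Coprod V I X"] exI[of _ "coproj V I X"] conjI[OF Coprod_is_coproduct[OF s]] conjI allI impI ballI)
      fix u assume "u \<in> Arr V" "Cod V u = Coprod V I X"
      then show "\<exists>D e a. is_coproduct V I D (Dom V u) e \<and> (\<forall>i\<in>I. a i \<in> hom V (D i) (X i) \<and> u \<cdot>\<^bsub>V\<^esub> e i = coproj V I X i \<cdot>\<^bsub>V\<^esub> a i)"
        using V.extensive_decomp[OF E I, of X u, OF X] by metis
    next
      fix i j a b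
      assume *: "i \<in> I" "j \<in> I" "a \<in> Arr V" "b \<in> Arr V" "Dom V b = Dom V a" "Cod V a = X i" "Cod V b = X j"
        "\<not> is_initial V (Dom V a)" "coproj V I X i \<cdot>\<^bsub>V\<^esub> a = coproj V I X j \<cdot>\<^bsub>V\<^esub> b"
      have "i = j \<and> a = b" by (rule V.extensive_disjoint[OF E I small_empty, of X, OF X]) (use * in auto)
      then show "i = j" "a = b" by auto
    qed
  qed
qed

section \<open>The copy of the base category in the common type of iterated categories\<close>

lemma base_simps [simp]:
  "BaseOb a \<in> Obj (base V) \<longleftrightarrow> a \<in> Obj V" "BaseAr f \<in> Arr (base V) \<longleftrightarrow> f \<in> Arr V"
  "Dom (base V) (BaseAr f) = BaseOb (Dom V f)" "Cod (base V) (BaseAr f) = BaseOb (Cod V f)"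
  "Ide (base V) (BaseOb a) = BaseAr (Ide V a)" "BaseAr g \<cdot>\<^bsub>base V\<^esub> BaseAr f = BaseAr (g \<cdot>\<^bsub>V\<^esub> f)"
  by (auto simp: base_def)

lemma base_Obj: "a \<in> Obj (base V) \<longleftrightarrow> (\<exists>a'. a = BaseOb a' \<and> a' \<in> Obj V)"
  and base_Arr: "f \<in> Arr (base V) \<longleftrightarrow> (\<exists>f'. f = BaseAr f' \<and> f' \<in> Arr V)"
  by (auto simp: base_def)

text \<open>\<open>base V\<close> is \<open>V\<close> renamed by the constructors
  \<open>BaseOb\<close> and \<open>BaseAr\<close>, which are injective; all universal properties are
  transported along them.\<close>

lemma base_lextensive:
  fixes elts :: "'u \<Rightarrow> 'u set" and V :: "('o, 'm) category" (structure)
  assumes V: "lextensive elts V" and pbV: "\<And>f g. \<lbrakk>f \<in> Arr V; g \<in> Arr V; Cod V f = Cod V g\<rbrakk> \<Longrightarrow> \<exists>p q. is_pullback V f g p q"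
  shows "lextensive elts (base V :: ('u, 'o, 'm) vcat)"
    "\<And>f g :: ('u, 'o, 'm) ar. \<lbrakk>f \<in> Arr (base V); g \<in> Arr (base V); Cod (base V) f = Cod (base V) g\<rbrakk> \<Longrightarrow> \<exists>p q. is_pullback (base V) f g p q"
proof -
  let ?B = "base V :: ('u, 'o, 'm) vcat"
  interpret V: lextensive elts V by fact
  have "is_category ?B"
    unfolding is_category_def by (auto simp: base_Obj base_Arr)
  then interpret B: cat "?B" by unfold_locales
  have homE: "h \<in> hom ?B (BaseOb a) (BaseOb b) \<longleftrightarrow> (\<exists>h'. h = BaseAr h' \<and> h' \<in> hom V a b)" for h :: "('u, 'o, 'm) ar" and a b
    by (auto simp: base_Arr)
  have cop: "is_coproduct ?B I (\<lambda>i. BaseOb (X i) :: ('u, 'o, 'm) ob) (BaseOb s) (\<lambda>i. BaseAr (\<iota> i))"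
    if s: "is_coproduct V I X s \<iota>" for I :: "'u set" and X s \<iota>
    unfolding is_coproduct_def
  proof (intro conjI ballI allI impI)
    note [simp] = V.coproduct_simps[OF s]
    show "BaseOb s \<in> Obj ?B" by simp
    show "BaseAr (\<iota> i) \<in> hom ?B (BaseOb (X i)) (BaseOb s)" if "i \<in> I" for i using that by simp
    fix c f assume "c \<in> Obj ?B" and f: "\<forall>i\<in>I. f i \<in> hom ?B (BaseOb (X i)) c"
    then obtain c' where c: "c = BaseOb c'" "c' \<in> Obj V" by (auto simp: base_Obj)
    have f': "f i = BaseAr (un_ar (f i)) \<and> un_ar (f i) \<in> hom V (X i) c'" if "i \<in> I" for i
    proof -
      have "f i \<in> hom ?B (BaseOb (X i)) (BaseOb c')" using f that c by blast
      then obtain h where "f i = BaseAr h" "h \<in> hom V (X i) c'" using iffD1[OF homE] by blast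
      then show ?thesis by simp
    qed
    obtain h where h: "h \<in> Arr V" "Dom V h = s" "Cod V h = c'" "\<And>i. i \<in> I \<Longrightarrow> h \<cdot> \<iota> i = un_ar (f i)"
      by (rule V.coproduct_copair[OF s c(2), of "\<lambda>i. un_ar (f i)"]) (use f' in auto)
    show "\<exists>!h. h \<in> hom ?B (BaseOb s) c \<and> (\<forall>i\<in>I. h \<cdot>\<^bsub>?B\<^esub> BaseAr (\<iota> i) = f i)"
    proof (rule ex1I[of _ "BaseAr h"])
      show "BaseAr h \<in> hom ?B (BaseOb s) c \<and> (\<forall>i\<in>I. BaseAr h \<cdot>\<^bsub>?B\<^esub> BaseAr (\<iota> i) = f i)"
        using h f' c by auto
      fix k assume k: "k \<in> hom ?B (BaseOb s) c \<and> (\<forall>i\<in>I. k \<cdot>\<^bsub>?B\<^esub> BaseAr (\<iota> i) = f i)"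
      then obtain k' where k': "k = BaseAr k'" "k' \<in> hom V s c'" using iffD1[OF homE, of k s c'] unfolding c by blast
      have ki: "k' \<cdot> \<iota> i = h \<cdot> \<iota> i" if "i \<in> I" for i
      proof -
        have "BaseAr (k' \<cdot> \<iota> i) = f i" using k k' that by auto
        then show ?thesis using h(4)[OF that] by (metis ar.sel(1))
      qed
      have "k' = h" by (rule V.coproduct_ext[OF s]) (use k' h ki in auto)
      then show "k = BaseAr h" using k' by simp
    qed
  qed
  \<comment> \<open>Contraposed: a noninitial stage of \<open>base V\<close> comes from a noninitial
    one of \<open>V\<close>, as disjointness in \<open>V\<close> demands.\<close>
  have ini: "is_initial ?B (BaseOb z :: ('u, 'o, 'm) ob)" if "is_initial V z" for z
    using cop[of "{}" undefined z undefined] that by (simp add: V.initial_empty_coproduct B.initial_empty_coproduct)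
  show pbB: "\<exists>p q. is_pullback ?B f g p q" if c: "f \<in> Arr ?B" "g \<in> Arr ?B" "Cod ?B f = Cod ?B g" for f g
  proof -
    obtain f' g' where fg: "f = BaseAr f'" "f' \<in> Arr V" "g = BaseAr g'" "g' \<in> Arr V" "Cod V f' = Cod V g'" using c by (auto simp: base_Arr)
    obtain p q where pq: "is_pullback V f' g' p q" using pbV fg by blast
    note [simp] = V.pullback_simps[OF pq]
    have "is_pullback ?B (BaseAr f' :: ('u, 'o, 'm) ar) (BaseAr g') (BaseAr p) (BaseAr q)"
    proof (rule B.pullbackI)
      show "BaseAr f' \<cdot>\<^bsub>?B\<^esub> BaseAr p = BaseAr g' \<cdot>\<^bsub>?B\<^esub> BaseAr q" using V.pullback_simps(9)[OF pq] by simp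
      fix d a b assume ab: "a \<in> Arr ?B" "b \<in> Arr ?B" "Dom ?B a = d" "Dom ?B b = d"
        "Cod ?B a = Dom ?B (BaseAr f')" "Cod ?B b = Dom ?B (BaseAr g')" "BaseAr f' \<cdot>\<^bsub>?B\<^esub> a = BaseAr g' \<cdot>\<^bsub>?B\<^esub> b"
      then obtain a' b' where ab': "a = BaseAr a'" "a' \<in> Arr V" "b = BaseAr b'" "b' \<in> Arr V" by (auto simp: base_Arr)
      obtain h where "h \<in> Arr V" "Dom V h = Dom V a'" "Cod V h = Dom V p" "p \<cdot> h = a'" "q \<cdot> h = b'"
        by (rule V.pullback_lift[OF pq, of a' b' "Dom V a'"]) (use ab ab' in auto)
      then show "\<exists>h. h \<in> hom ?B d (Dom ?B (BaseAr q)) \<and> BaseAr p \<cdot>\<^bsub>?B\<^esub> h = a \<and> BaseAr q \<cdot>\<^bsub>?B\<^esub> h = b"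
        using ab ab' by (intro exI[of _ "BaseAr h"]) auto
    next
      fix d h h' assume h: "h \<in> Arr ?B" "h' \<in> Arr ?B" "Dom ?B h = d" "Dom ?B h' = d"
        "Cod ?B h = Dom ?B (BaseAr q)" "Cod ?B h' = Dom ?B (BaseAr q)"
        "BaseAr p \<cdot>\<^bsub>?B\<^esub> h = BaseAr p \<cdot>\<^bsub>?B\<^esub> h'" "BaseAr q \<cdot>\<^bsub>?B\<^esub> h = BaseAr q \<cdot>\<^bsub>?B\<^esub> h'"
      then obtain k k' where k: "h = BaseAr k" "k \<in> Arr V" "h' = BaseAr k'" "k' \<in> Arr V" by (auto simp: base_Arr)
      have "k = k'" by (rule V.pullback_ext[OF pq, of _ _ "Dom V k"]) (use h k in auto)
      then show "h = h'" using k by simp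
    qed simp_all
    then show ?thesis using fg by blast
  qed
  obtain t where t: "is_terminal V t" using V.terminal_ex by blast
  have "is_terminal ?B (BaseOb t :: ('u, 'o, 'm) ob)"
    unfolding is_terminal_def
  proof (intro conjI ballI)
    show "BaseOb t \<in> Obj ?B" using t by (simp add: is_terminal_def)
    fix c assume "c \<in> Obj ?B"
    then obtain c' where c: "c = BaseOb c'" "c' \<in> Obj V" by (auto simp: base_Obj)
    then have "\<exists>!h. h \<in> hom V c' t" using t by (simp add: is_terminal_def)
    then show "\<exists>!h. h \<in> hom ?B c (BaseOb t)" unfolding c(1) using homE by metis
  qed
  then have "fp_cat ?B" by (rule B.fp_catI) (use pbB in auto)
  then show "lextensive elts ?B"
  proof (intro lextensive.intro V.universe_axioms lextensive_axioms.intro)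
    fix I :: "'u set" and X :: "'u \<Rightarrow> ('u, 'o, 'm) ob" assume I: "small elts I" and XO: "\<And>i. i \<in> I \<Longrightarrow> X i \<in> Obj ?B"
    have X: "X i = BaseOb (un_ob (X i))" "un_ob (X i) \<in> Obj V" if "i \<in> I" for i
      using XO[OF that] by (auto simp: base_Obj)
    obtain s \<iota> where s: "is_coproduct V I (\<lambda>i. un_ob (X i)) s \<iota>" using V.small_coproduct_ex[OF I, of "\<lambda>i. un_ob (X i)"] X by blast
    have bs: "is_coproduct ?B I X (BaseOb s) (\<lambda>i. BaseAr (\<iota> i))"
      by (rule iffD1[OF coproduct_cong cop[OF s]]) (use X in auto)
    show "\<exists>s \<iota>. extensive_coproduct ?B I X s \<iota>"
      unfolding extensive_coproduct_def
    proof (intro exI[of _ "BaseOb s"] exI[of _ "\<lambda>i. BaseAr (\<iota> i)"] conjI[OF bs] conjI allI impI ballI)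
      fix u assume "u \<in> Arr ?B" "Cod ?B u = BaseOb s"
      then obtain u' where u: "u = BaseAr u'" "u' \<in> Arr V" "Cod V u' = s" by (auto simp: base_Arr)
      obtain D e a where D: "is_coproduct V I D (Dom V u') e" "\<forall>i\<in>I. a i \<in> hom V (D i) (un_ob (X i)) \<and> u' \<cdot> e i = \<iota> i \<cdot> a i"
        using V.small_decomp[OF I s u(2,3)] by blast
      have "is_coproduct ?B I (\<lambda>i. BaseOb (D i)) (Dom ?B u) (\<lambda>i. BaseAr (e i))" using cop[OF D(1)] u by simp
      moreover have "BaseAr (a i) \<in> hom ?B (BaseOb (D i)) (X i) \<and> u \<cdot>\<^bsub>?B\<^esub> BaseAr (e i) = BaseAr (\<iota> i) \<cdot>\<^bsub>?B\<^esub> BaseAr (a i)" if "i \<in> I" for i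
        using D(2) u X[OF that] that by auto
      ultimately show "\<exists>D e a. is_coproduct ?B I D (Dom ?B u) e \<and>
          (\<forall>i\<in>I. a i \<in> hom ?B (D i) (X i) \<and> u \<cdot>\<^bsub>?B\<^esub> e i = BaseAr (\<iota> i) \<cdot>\<^bsub>?B\<^esub> a i)"
        by (intro exI[of _ "\<lambda>i. BaseOb (D i)"] exI[of _ "\<lambda>i. BaseAr (e i)"] exI[of _ "\<lambda>i. BaseAr (a i)"] conjI ballI) auto
    next
      fix i j a b
      assume *: "i \<in> I" "j \<in> I" "a \<in> Arr ?B" "b \<in> Arr ?B" "Dom ?B b = Dom ?B a" "Cod ?B a = X i" "Cod ?B b = X j"
        "\<not> is_initial ?B (Dom ?B a)" "BaseAr (\<iota> i) \<cdot>\<^bsub>?B\<^esub> a = BaseAr (\<iota> j) \<cdot>\<^bsub>?B\<^esub> b"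
      then obtain a' b' where ab: "a = BaseAr a'" "a' \<in> Arr V" "b = BaseAr b'" "b' \<in> Arr V" by (auto simp: base_Arr)
      have "i = j \<and> a' = b'"
        by (rule V.small_disjoint[OF I s *(1,2)]) (use * ab X[OF *(1)] X[OF *(2)] ini in "auto dest: arg_cong[of _ _ un_ob]")
      then show "i = j" "a = b" using ab by auto
    qed
  qed
qed

section \<open>Iterated free enriched categories\<close>

text \<open>\<open>Gph_nat\<close> is the identity on objects, so only the hom squares have content.
  They are asked for at the homs of a single \<open>k\<close>, since the counit is cartesian at
  certain arrows only.\<close>

lemma Gph_nat_cpb:
  assumes n: "nat_trans A B H K \<alpha>" and k: "k \<in> Arr (Gph elts A)"
    and sq: "\<And>x y. x \<in> obs (src k) \<Longrightarrow> y \<in> obs (src k) \<Longrightarrow>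
      is_pullback B (far K (on_homs k (x, y))) (\<alpha> (homob (tgt k) (on_obs k x, on_obs k y))) (\<alpha> (homob (src k) (x, y))) (far H (on_homs k (x, y)))"
  shows "cpb B (far (Gph_fun K) k) (Gph_nat H K \<alpha> (tgt k)) (Gph_nat H K \<alpha> (src k)) (far (Gph_fun H) k)"
proof -
  have HK: "is_functor A B H" "is_functor A B K" using n by (auto simp: nat_trans_def)
  have g: "graph elts A (src k)" "graph elts A (tgt k)" "gmor A k" using k by (auto simp: Gph_Arr)
  note [simp] = Gph_fun_gmor[OF HK(1) g(3)] Gph_fun_gmor[OF HK(2) g(3)] gmor_obs[OF g(3) refl]
  have [simp]: "gmor B (Gph_nat H K \<alpha> (src k))" "gmor B (Gph_nat H K \<alpha> (tgt k))"
    by (rule Gph_nat_gmor, use nat_trans_simps[OF n] graph_simps(2)[OF g(1)] in simp)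
      (rule Gph_nat_gmor, use nat_trans_simps[OF n] graph_simps(2)[OF g(2)] in simp)
  show ?thesis
    unfolding cpb_def
  proof (intro conjI ballI impI)
    fix x y assume "x \<in> obs (src (far (Gph_fun K) k))" "y \<in> obs (src (Gph_nat H K \<alpha> (tgt k)))"
      "on_obs (far (Gph_fun K) k) x = on_obs (Gph_nat H K \<alpha> (tgt k)) y"
    then have xy: "x \<in> obs (src k)" "y = on_obs k x" by simp_all
    show "\<exists>!z. z \<in> obs (src (far (Gph_fun H) k)) \<and> on_obs (Gph_nat H K \<alpha> (src k)) z = x \<and> on_obs (far (Gph_fun H) k) z = y"
    proof (rule ex1I[of _ x])
      show "x \<in> obs (src (far (Gph_fun H) k)) \<and> on_obs (Gph_nat H K \<alpha> (src k)) x = x \<and> on_obs (far (Gph_fun H) k) x = y"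
        using xy by simp
      fix z assume "z \<in> obs (src (far (Gph_fun H) k)) \<and> on_obs (Gph_nat H K \<alpha> (src k)) z = x \<and> on_obs (far (Gph_fun H) k) z = y"
      then show "z = x" by clarsimp
    qed
  next
    fix z z' assume "z \<in> obs (src (far (Gph_fun H) k))" "z' \<in> obs (src (far (Gph_fun H) k))"
    then have "z \<in> obs (src k)" "z' \<in> obs (src k)" by simp_all
    then show "is_pullback B (on_homs (far (Gph_fun K) k) (on_obs (Gph_nat H K \<alpha> (src k)) z, on_obs (Gph_nat H K \<alpha> (src k)) z'))
        (on_homs (Gph_nat H K \<alpha> (tgt k)) (on_obs (far (Gph_fun H) k) z, on_obs (far (Gph_fun H) k) z'))
        (on_homs (Gph_nat H K \<alpha> (src k)) (z, z')) (on_homs (far (Gph_fun H) k) (z, z'))"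
      using sq by simp
  qed auto
qed

lemma Gph_fun_id: assumes "f \<in> Arr (Gph elts A)" shows "far (Gph_fun id_functor) f = f"
proof -
  have f: "graph elts A (src f)" "graph elts A (tgt f)" "gmor A f" using assms by (auto simp: Gph_Arr)
  show ?thesis
  proof (rule gmor_eqI[OF _ f(3)])
    show "gmor A (far (Gph_fun id_functor) f)"
      using f unfolding gmor_def graph_map_def by (auto simp: Gph_fun_def PiE_iff)
  qed (use f in "auto simp: Gph_ob_id[OF f(1)] Gph_ob_id[OF f(2)]")
qed

lemma Gph_fun_comp: "far (Gph_fun (comp_functor K H)) f = far (Gph_fun K) (far (Gph_fun H) f)"
  by (auto simp: Gph_fun_def intro!: ext)

lemma (in vcat) cpb_pullback:
  assumes pb: "cpb C f g p q" and ar: "f \<in> Arr (Gph elts C)" "q \<in> Arr (Gph elts C)"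
  shows "is_pullback (Gph elts C) f g p q"
  by (rule cpb_Gph_pullback[OF pb]) (use pb ar in "auto simp: Gph_Arr cpb_def")

context lexv
begin

lemma lexv_Cat: "lexv elts CAT"
  by (intro lexv.intro Cat_lextensive vcat.intro CC.cat_axioms)

lemma free_map_pullback:
  assumes pb: "cpb W f g p q" and ar: "f \<in> Arr GPH" "g \<in> Arr GPH" "p \<in> Arr GPH" "q \<in> Arr GPH"
  shows "is_pullback CAT (Fm f) (Fm g) (Fm p) (Fm q)"
proof -
  have C: "Fm h \<in> Arr CAT" if "h \<in> Arr GPH" for h
    using functor_simps(2)[OF adj.L_functor[OF adj.intro[OF free_adj_is_adjunction]] that] .
  show ?thesis by (rule cpb_Cat_pullback[OF free_map_cpb[OF ar pb]]) (use C ar in auto)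
qed

end

text \<open>The induction hypothesis. \<open>counit_pb\<close> concerns arrows of the form
  \<open>far L f\<close> only. \<open>R_coproduct\<close> makes \<open>L R\<close> preserve small
  coproducts, for the closure of such arrows under coproducts. The graph side \<open>A\<close>
  carries pullbacks, the category side \<open>W\<close> extensivity.\<close>

locale cartesian_adjunction = adj A W a for elts :: "'u \<Rightarrow> 'u set" and A W :: "('u, 'o, 'm) vcat" and a +
  assumes pb_cat_A: "pb_cat elts A" and lexv_W: "lexv elts W"
    and L_pb: "preserves_pullbacks A W L"
    and unit_pb: "f \<in> Arr A \<Longrightarrow> is_pullback A (far R (far L f)) (\<eta> (Cod A f)) (\<eta> (Dom A f)) f"
    and R_coproduct: "small elts (I :: 'u set) \<Longrightarrow> is_coproduct W I X s \<iota> \<Longrightarrow>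
      is_coproduct A I (\<lambda>i. fob R (X i)) (fob R s) (\<lambda>i. far R (\<iota> i))"
    and counit_pb: "f \<in> Arr A \<Longrightarrow>
      is_pullback W (far L f) (\<epsilon> (fob L (Cod A f))) (\<epsilon> (fob L (Dom A f))) (far L (far R (far L f)))"
begin

text \<open>\<open>L\<close> preserves coproducts as a left adjoint and \<open>R\<close> preserves
  pullbacks as a right adjoint; the two remaining preservation properties are part of the
  locale.\<close>

lemma copointed: "copointed_lexv elts W (comp_functor L R) \<epsilon>"
proof -
  interpret W: lexv elts W by (rule lexv_W)
  show ?thesis
  proof (intro copointed_lexv.intro copointed.intro lexv_W W.lextensive_axioms copointed_axioms.intro counit_nat)
    show "preserves_pullbacks W W (comp_functor L R)"
      using L_pb radj_preserves_pullbacks unfolding preserves_pullbacks_def by simp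
    fix I :: "'u set" and X s \<iota> assume "small elts I" "is_coproduct W I X s \<iota>"
    from ladj_preserves_coproducts[OF R_coproduct[OF this]]
    show "is_coproduct W I (\<lambda>i. fob (comp_functor L R) (X i)) (fob (comp_functor L R) s) (\<lambda>i. far (comp_functor L R) (\<iota> i))"
      by simp
  qed
qed

text \<open>Unit and counit squares of the composite adjunction are pasted from squares of
  \<open>Gph_adj a\<close> and of \<open>free_adj elts W\<close>.\<close>

lemma cartesian_adjunction_Suc:
  "cartesian_adjunction elts (Gph elts A) (Cat elts W) (comp_adj (Gph elts A) (Cat elts W) (Gph_adj a) (free_adj elts W))"
proof -
  interpret A: pb_cat elts A by (rule pb_cat_A)
  interpret W: lexv elts W by (rule lexv_W)
  interpret K: copointed_lexv elts W "comp_functor L R" \<epsilon> by (rule copointed)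
  interpret GA: cat "Gph elts A" by (rule A.Gph_cat)
  interpret GW: cat "Gph elts W" by (rule W.Gph_cat)
  let ?F = "ladj (free_adj elts W)"
  let ?Fm = "far (ladj (free_adj elts W))"
  let ?b = "comp_adj (Gph elts A) (Cat elts W) (Gph_adj a) (free_adj elts W)"
  have b: "is_adjunction (Gph elts A) (Cat elts W) ?b"
    by (rule comp_adj_is_adjunction[OF Gph_adj_is_adjunction[OF adj] W.free_adj_is_adjunction])
  have Ff: "is_functor (Gph elts W) (Cat elts W) ?F"
    using W.free_adj_is_adjunction by (simp add: is_adjunction_def)
  note GL = Gph_fun_is_functor[OF L_functor, of elts] and GR = Gph_fun_is_functor[OF R_functor, of elts]
  have bs: "ladj ?b = comp_functor ?F (Gph_fun L)" "radj ?b = comp_functor (Gph_fun R) forget"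
    "unit ?b G = far (Gph_fun R) (free_unit W (Gph_ob L G)) \<cdot>\<^bsub>Gph elts A\<^esub> Gph_nat id_functor (comp_functor R L) \<eta> G"
    "counit ?b C = counit (free_adj elts W) C \<cdot>\<^bsub>Cat elts W\<^esub> ?Fm (Gph_nat (comp_functor L R) id_functor \<epsilon> (forget_ob C))" for G C
    by (simp_all add: comp_adj_def Gph_adj_def W.adjF_simps(1-3))
  show ?thesis
  proof (intro cartesian_adjunction.intro adj.intro b cartesian_adjunction_axioms.intro A.Gph_pb_cat W.lexv_Cat)
    show "preserves_pullbacks (Gph elts A) (Cat elts W) (ladj ?b)"
      unfolding preserves_pullbacks_def A.Gph_pullback_iff bs
      using W.free_map_pullback[OF cpb_Gph_fun[OF L_functor L_pb]] functor_simps(2)[OF GL] by auto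
  next
    fix f assume f: "f \<in> Arr (Gph elts A)"
    let ?g = "far (Gph_fun L) f"
    have g: "?g \<in> Arr (Gph elts W)" using functor_simps(2)[OF GL f] .
    \<comment> \<open>The outer part of the composite unit is the image of \<open>free_unit\<close>
      under \<open>Gph_fun R\<close>, and \<open>R\<close> preserves the pullback squares of
      \<open>free_unit\<close>.\<close>
    have "is_pullback (Gph elts A) (far (Gph_fun R) (far forget (?Fm ?g))) (far (Gph_fun R) (free_unit W (tgt ?g)))
        (far (Gph_fun R) (free_unit W (src ?g))) (far (Gph_fun R) ?g)"
      by (rule A.cpb_pullback[OF cpb_Gph_fun[OF R_functor radj_preserves_pullbacks W.free_unit_cpb[OF g]]])
        (intro functor_simps(2)[OF GR] functor_simps(2)[OF W.forget_functor] functor_simps(2)[OF Ff] g)+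
    moreover have "is_pullback (Gph elts A) (far (Gph_fun R) ?g) (Gph_nat id_functor (comp_functor R L) \<eta> (tgt f))
        (Gph_nat id_functor (comp_functor R L) \<eta> (src f)) f"
    proof (rule A.cpb_pullback[OF _ functor_simps(2)[OF GR g] f])
      have f': "graph elts A (src f)" "graph elts A (tgt f)" "gmor A f" using f by (auto simp: Gph_Arr)
      have "cpb A (far (Gph_fun (comp_functor R L)) f) (Gph_nat id_functor (comp_functor R L) \<eta> (tgt f))
        (Gph_nat id_functor (comp_functor R L) \<eta> (src f)) (far (Gph_fun id_functor) f)"
      proof (rule Gph_nat_cpb[OF unit_nat f])
        fix x y assume "x \<in> obs (src f)" "y \<in> obs (src f)"
        then show "is_pullback A (far (comp_functor R L) (on_homs f (x, y))) (\<eta> (homob (tgt f) (on_obs f x, on_obs f y)))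
          (\<eta> (homob (src f) (x, y))) (far id_functor (on_homs f (x, y)))"
          using unit_pb[of "on_homs f (x, y)"] gmor_simps(2-)[OF f'(3), of x y] by simp
      qed
      then show "cpb A (far (Gph_fun R) ?g) (Gph_nat id_functor (comp_functor R L) \<eta> (tgt f)) (Gph_nat id_functor (comp_functor R L) \<eta> (src f)) f"
        unfolding Gph_fun_comp Gph_fun_id[OF f] .
    qed
    ultimately show "is_pullback (Gph elts A) (far (radj ?b) (far (ladj ?b) f)) (unit ?b (Cod (Gph elts A) f)) (unit ?b (Dom (Gph elts A) f)) f"
      unfolding bs using GA.pullback_paste by simp
  next
    fix I :: "'u set" and X s \<iota> assume I: "small elts I" and s: "is_coproduct (Cat elts W) I X s \<iota>"
    have X: "\<And>i. i \<in> I \<Longrightarrow> W.enr (X i)" using W.CC.coproduct_simps(5)[OF s] by simp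
    obtain S \<kappa> c where gc: "gcop W I X S \<kappa> c" and S: "W.enr S" and \<kappa>: "\<And>i. i \<in> I \<Longrightarrow> \<kappa> i \<in> Arr (Cat elts W)"
      by (rule W.gcop_ex[OF I, of X]) (use X in auto)
    note Sc = W.gcop_Cat[OF gc S \<kappa>]
    have Rf: "is_functor (Cat elts W) (Gph elts A) (radj ?b)" using b by (simp add: is_adjunction_def)
    \<comment> \<open>On the explicit disjoint union \<open>radj ?b\<close> changes homs only. Those
      between different summands stay initial because \<open>R\<close> preserves the empty
      coproduct.\<close>
    have "is_coproduct (Gph elts A) I (\<lambda>i. fob (radj ?b) (X i)) (fob (radj ?b) S) (\<lambda>i. far (radj ?b) (\<kappa> i))"
    proof (rule A.gcop_Gph[of I _ _ _ c])
      have "is_initial A (fob R z)" if "is_initial W z" for z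
        using R_coproduct[OF A.small_empty, of undefined z undefined] that
        by (simp add: D.initial_empty_coproduct C.initial_empty_coproduct)
      note init = this
      note gs = W.gcop_simps[OF gc]
      note [simp] = gs(1-6,8,9) gmor_obs[OF gs(1) gs(3)]
      have ho: "homob (X i) (x, y) \<in> Obj W" if "i \<in> I" "x \<in> obs (X i)" "y \<in> obs (X i)" for i x y
        using X that by simp
      have "bij_betw (on_obs (\<kappa> i)) (obs (X i)) {p \<in> obs S. c p = i}" if "i \<in> I" for i
        using gc that unfolding gcop_def by blast
      then show "gcop A I (\<lambda>i. fob (radj ?b) (X i)) (fob (radj ?b) S) (\<lambda>i. far (radj ?b) (\<kappa> i)) c"
        unfolding gcop_def bs using init gs(7,10) ho by (auto simp: Gph_fun_gmor[OF R_functor] gmor_forget)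
      show "graph elts A (fob (radj ?b) (X i))" if "i \<in> I" for i
        using functor_simps(1)[OF Rf, of "X i"] X[OF that] by simp
      show "graph elts A (fob (radj ?b) S)" using functor_simps(1)[OF Rf, of S] S by simp
    qed
    from preserves_coproduct_transfer[OF Rf Sc s this]
    show "is_coproduct (Gph elts A) I (\<lambda>i. fob (radj ?b) (X i)) (fob (radj ?b) s) (\<lambda>i. far (radj ?b) (\<iota> i))" .
  next
    fix f assume f: "f \<in> Arr (Gph elts A)"
    let ?g = "far (Gph_fun L) f"
    have g: "?g \<in> Arr (Gph elts W)" using functor_simps(2)[OF GL f] .
    show "is_pullback (Cat elts W) (far (ladj ?b) f) (counit ?b (fob (ladj ?b) (Cod (Gph elts A) f)))
       (counit ?b (fob (ladj ?b) (Dom (Gph elts A) f))) (far (ladj ?b) (far (radj ?b) (far (ladj ?b) f)))"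
    proof -
      have f': "graph elts A (src f)" "graph elts A (tgt f)" "gmor A f" using f by (auto simp: Gph_Arr)
      note gm = W.free_map[OF g]
      let ?k = "far forget (?Fm ?g)"
      have k: "?k \<in> Arr (Gph elts W)" using functor_simps(2)[OF W.forget_functor functor_simps(2)[OF Ff g]] .
      have "cpb W (far (Gph_fun id_functor) ?k) (Gph_nat (comp_functor L R) id_functor \<epsilon> (tgt ?k))
        (Gph_nat (comp_functor L R) id_functor \<epsilon> (src ?k)) (far (Gph_fun (comp_functor L R)) ?k)"
      proof (rule Gph_nat_cpb[OF counit_nat k])
        fix x y assume "x \<in> obs (src ?k)" "y \<in> obs (src ?k)"
        then have xy: "x \<in> obs (src ?g)" "y \<in> obs (src ?g)" using gm(8) by simp_all
        \<comment> \<open>Here the hypothesis on the lower adjunction enters: the homs of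
          \<open>?g\<close> are arrows \<open>far L\<close> of homs of \<open>f\<close>, so their
          counit squares are pullbacks, and \<open>cart_free_map\<close> passes this on to the homs
          of \<open>?Fm ?g\<close>.\<close>
        have "K.cart (on_homs (?Fm ?g) (x, y))"
        proof (rule K.cart_free_map[OF g _ xy])
          fix x y assume "x \<in> obs (src ?g)" "y \<in> obs (src ?g)"
          then have "x \<in> obs (src f)" "y \<in> obs (src f)" by simp_all
          then show "K.cart (on_homs ?g (x, y))"
            unfolding K.cart_def using counit_pb[of "on_homs f (x, y)"] gmor_simps(2-)[OF f'(3), of x y] by simp
        qed
        then show "is_pullback W (far id_functor (on_homs ?k (x, y))) (\<epsilon> (homob (tgt ?k) (on_obs ?k x, on_obs ?k y)))
          (\<epsilon> (homob (src ?k) (x, y))) (far (comp_functor L R) (on_homs ?k (x, y)))"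
          unfolding K.cart_def using xy gm(8-14) by simp
      qed
      then have c: "cpb W ?k (Gph_nat (comp_functor L R) id_functor \<epsilon> (tgt ?k)) (Gph_nat (comp_functor L R) id_functor \<epsilon> (src ?k))
          (far (Gph_fun L) (far (Gph_fun R) ?k))"
        unfolding Gph_fun_id[OF k] Gph_fun_comp .
      \<comment> \<open>\<open>F\<close> preserves the pullback \<open>c\<close> of graphs; the
        result is then pasted with the counit square of the free category adjunction at
        \<open>?Fm ?g\<close>.\<close>
      have "is_pullback (Cat elts W) (?Fm ?k) (?Fm (Gph_nat (comp_functor L R) id_functor \<epsilon> (tgt ?k)))
          (?Fm (Gph_nat (comp_functor L R) id_functor \<epsilon> (src ?k))) (?Fm (far (Gph_fun L) (far (Gph_fun R) ?k)))"
        using W.free_map_pullback[OF c] GW.pullback_simps(1-4)[OF W.cpb_pullback[OF c k functor_simps(2)[OF GL functor_simps(2)[OF GR k]]]] by blast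
      from W.CC.pullback_paste[OF W.free_counit_pullback[OF g] this]
      show ?thesis unfolding bs using gm(8,9) by simp
    qed
  qed
qed

text \<open>The multiplication at \<open>c\<close> is \<open>R\<close> applied to the counit at
  \<open>fob L c\<close>, so its naturality squares are images under \<open>R\<close> of counit
  squares at arrows \<open>far L f\<close>.\<close>

lemma generated_monad_cartesian: "cartesian_monad A (generated_monad a)"
  unfolding cartesian_monad_def
proof (intro conjI)
  interpret A: pb_cat elts A by (rule pb_cat_A)
  show "has_pullbacks A" using A.pullback_ex C.is_cat by (auto simp: has_pullbacks_def)
  show m: "is_monad A (generated_monad a)" by (rule generated_monad_is_monad)
  show "preserves_pullbacks A A (mfun (generated_monad a))"
    using L_pb radj_preserves_pullbacks unfolding preserves_pullbacks_def generated_monad_def by simp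
  show "cartesian_nat_trans A A id_functor (mfun (generated_monad a)) (munit (generated_monad a))"
    using m unit_pb unfolding cartesian_nat_trans_def is_monad_def by (simp add: generated_monad_def)
  have "is_pullback A (far R (far L f)) (far R (\<epsilon> (fob L (Cod A f)))) (far R (\<epsilon> (fob L (Dom A f)))) (far R (far L (far R (far L f))))"
    if "f \<in> Arr A" for f
    using counit_pb[OF that] radj_preserves_pullbacks unfolding preserves_pullbacks_def by blast
  then show "cartesian_nat_trans A A (comp_functor (mfun (generated_monad a)) (mfun (generated_monad a))) (mfun (generated_monad a))
     (mmult (generated_monad a))"
    using m unfolding cartesian_nat_trans_def is_monad_def by (simp add: generated_monad_def)
qed

end

text \<open>The start of the induction, where all components of unit and counit are
  identities.\<close>

lemma cartesian_adjunction_id: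
  assumes "lexv elts W" "pb_cat elts W" shows "cartesian_adjunction elts W W (id_adj W)"
proof -
  interpret W: lexv elts W by fact
  have id: "is_pullback W f (Ide W (Cod W f)) (Ide W (Dom W f)) f" if "f \<in> Arr W" for f
    by (rule W.pullbackI) (use that in auto)
  show ?thesis
    by (intro cartesian_adjunction.intro adj.intro cartesian_adjunction_axioms.intro id_adj_is_adjunction W.cat_axioms assms)
      (use id in "auto simp: id_adj_def preserves_pullbacks_def")
qed

theorem theorem7p12:
  fixes elts :: "'u \<Rightarrow> 'u set"
    and V :: "('o, 'm) category"
    and n :: nat
  assumes "grothendieck_universe elts"
    and "extensive elts V"
    and "has_finite_limits V"
  shows "cartesian_monad (Gph_iter elts V n) (free_monad elts V n)"
proof -
  interpret V: cat V using assms(2) by (simp add: extensive_def cat_def)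
  note e = extensive_lextensive[OF assms] and pb = V.finite_limits_pullback[OF assms(3)]
  have b: "lextensive elts (base V :: ('u, 'o, 'm) vcat)" by (rule base_lextensive(1)[OF e pb])
  then have c: "cat (base V :: ('u, 'o, 'm) vcat)" unfolding lextensive_def fp_cat_def by blast
  have "lexv elts (base V :: ('u, 'o, 'm) vcat)" by (intro lexv.intro vcat.intro b c)
  moreover have "pb_cat elts (base V :: ('u, 'o, 'm) vcat)"
    by (intro pb_cat.intro universe.intro vcat.intro pb_cat_axioms.intro assms(1) c) (rule base_lextensive(2)[OF e pb])
  \<comment> \<open>The recursion of \<open>free_adj_iter\<close> is literally the passage of
    \<open>cartesian_adjunction_Suc\<close>, so the induction is on the number of levels.\<close>
  ultimately have "cartesian_adjunction elts (Gph_iter elts V n) (Cat_iter elts V n) (free_adj_iter elts V n)"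
    by (induction n) (auto intro: cartesian_adjunction_id dest: cartesian_adjunction.cartesian_adjunction_Suc)
  then show ?thesis
    unfolding free_monad_def by (rule cartesian_adjunction.generated_monad_cartesian)
qed

end
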